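(* For any ring $R$ the canonical functor $\mathbf C^{\mathrm b}(R\text{-}\mathrm{proj})\to\mathbf K^{\mathrm b}(R\text{-}\mathrm{proj})$ induces, for every Picard category $\mathcal P$, a functor $$\det\big(\mathbf K^{\mathrm b}(R\text{-}\mathrm{proj}),\mathcal P\big)\longrightarrow\det\big((\mathbf C^{\mathrm b}(R\text{-}\mathrm{proj}),\mathrm{qis}),\mathcal P\big)$$ and therefore a homomorphism $$K_1\big(\mathbf C^{\mathrm b}(R\text{-}\mathrm{proj}),\mathrm{qis}\big)\longrightarrow K_1\big(\mathbf K^{\mathrm b}(R\text{-}\mathrm{proj})\big).$$ This homomorphism is always surjective. If $R=k[\varepsilon]/(\varepsilon^2)$ for a field $k$, then this homomorphism is not injective.
   Context: Rings are associative with unit; modules are left modules; complexes are cochain complexes. $R\text{-}\mathrm{proj}$ is the category of finitely generated projective $R$-modules; $\mathbf C^{\mathrm b}(R\text{-}\mathrm{proj})$ is the exact category of bounded complexes in $R\text{-}\mathrm{proj}$, $\mathrm{qis}$ its class of quasi-isomorphisms, and $\mathbf K^{\mathrm b}(R\text{-}\mathrm{proj})$ the triangulated bounded homotopy category; $T=[1]$; a triangle is distinguished if isomorphic to some $A\xrightarrow{a}B\to\mathrm{cone}(a)\to A[1]$ with second map the canonical inclusion and third map the negative of the canonical projection. Quasi-isomorphisms in $\mathbf C^{\mathrm b}(R\text{-}\mathrm{proj})$ become isomorphisms in $\mathbf K^{\mathrm b}(R\text{-}\mathrm{proj})$, so a short exact sequence $\Delta:0\to A\xrightarrow{a}B\xrightarrow{b}C\to0$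 in $\mathbf C^{\mathrm b}(R\text{-}\mathrm{proj})$ yields a distinguished triangle $\widehat\Delta:A\xrightarrow{a}B\xrightarrow{b}C\xrightarrow{c}TA$ with $c$ given by $C\xleftarrow{\sim}\mathrm{cone}(a)\to TA$ (canonical quasi-isomorphism, negative of the canonical projection). Picard categories. A Picard category is a nonempty category $\mathcal P$ in which every morphism is an isomorphism, with a bifunctor $\otimes$ and natural associativity and commutativity constraints $\varphi_{X,Y,Z}:X\otimes(Y\otimes Z)\to(X\otimes Y)\otimes Z$, $\psi_{X,Y}:X\otimes Y\to Y\otimes X$ satisfying the pentagon and hexagon axioms and $\psi_{Y,X}\psi_{X,Y}=\mathrm{id}$, and such that $X\otimes -$ is an autoequivalence for every object $X$ (no unit object is fixed). A monoidal functor $(M,c)$ is a functor $M$ with natural isomorphisms $c_{X,Y}:M(X\otimes Y)\to M(X)\otimes M(Y)$ compatible with $\varphi$ and $\psi$; with natural transformations compatible with $c$ these form a category $\mathrm{Hom}^\otimes(\mathcal P,\mathcal P')$. $\pi_0(\mathcal P)$ is the group of isomorphism classes of objects under $\otimes$, and $\pi_1(\mathcal P)=\mathrm{Aut}(X)$ for any object $X$ (canonically identified for different $X,Y$ through $\mathrm{Aut}(X\otimes Y)$). Determinant functors on exact categories. For an exact category $\mathcal E$ and a class $w$ of morphisms containing all isomorphisms and closed under composition, let $\mathcal E_w$ be the subcategory with all objects and with morphisms in $w$. A determinant functor $f=(f_1,f_2):(\mathcal E,w)\to\mathcal P$ is a functor $f_1:\mathcal E_w\to\mathcal P$ and, for each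 short exact sequence $\Delta:0\to A\to B\to C\to0$, a morphism $f_2(\Delta):f_1(B)\to f_1(A)\otimes f_1(C)$, such that: (naturality) $f_2$ is compatible with morphisms of short exact sequences all of whose components lie in $w$; (associativity) for admissible monomorphisms $A\to B\to C$ with associated sequences $\Delta_{h1}:0\to A\to B\to C'\to0$, $\Delta_{h2}:0\to A\to C\to B'\to0$, $\Delta_{v1}:0\to B\to C\to A'\to0$, $\Delta_{v2}:0\to C'\to B'\to A'\to0$ one has $\varphi(\mathrm{id}\otimes f_2(\Delta_{v2}))f_2(\Delta_{h2})=(f_2(\Delta_{h1})\otimes\mathrm{id})f_2(\Delta_{v1})$; (commutativity) for $\Delta_1:0\to A\to A\oplus B\to B\to0$, $\Delta_2:0\to B\to A\oplus B\to A\to0$ one has $\psi f_2(\Delta_1)=f_2(\Delta_2)$. Determinant functors on triangulated categories. A determinant functor $g=(g_1,g_2):\mathcal T\to\mathcal P$ is a functor $g_1:\mathcal T_{\mathrm{iso}}\to\mathcal P$ (on the subcategory of isomorphisms) together with $g_2(\Delta):g_1(B)\to g_1(A)\otimes g_1(C)$ for each distinguished triangle $\Delta:A\to B\to C\to TA$, with: naturality for isomorphisms of distinguished triangles; the same associativity identity for every octahedral diagram (octahedron of the octahedral axiom) with distinguished triangles $\Delta_{h1}:A\to B\to C'\to TA$, $\Delta_{h2}:A\to C\to B'\to TA$, $\Delta_{v1}:B\to C\to A'\to TB$, $\Delta_{v2}:C'\to B'\to A'\to TC'$; commutativity for the split triangles $A\to A\oplus B\to B\xrightarrow{0}TA$,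 $B\to A\oplus B\to A\xrightarrow{0}TB$. In both cases morphisms are natural transformations of first components compatible with the second components, giving categories $\det((\mathcal E,w),\mathcal P)$, $\det(\mathcal T,\mathcal P)$. A determinant functor $f$ to $\mathcal V$ is universal if $M\mapsto M\circ f$ is an equivalence $\mathrm{Hom}^\otimes(\mathcal V,\mathcal P)\to\det(-,\mathcal P)$ for every Picard category $\mathcal P$. Universal determinant functors exist here, and $K_i:=\pi_i(\mathcal V)$ for $i=0,1$. Induced maps. The induced functor on determinant functors sends $g=(g_1,g_2)$ to the pair consisting of the composite of $g_1$ with the canonical functor and of $\Delta\mapsto g_2(\widehat\Delta)$. If $f:(\mathbf C^{\mathrm b}(R\text{-}\mathrm{proj}),\mathrm{qis})\to\mathcal V$ and $g:\mathbf K^{\mathrm b}(R\text{-}\mathrm{proj})\to\mathcal W$ are universal, the homomorphism on $K_1$ is $\pi_1(M)$, where $M:\mathcal V\to\mathcal W$ is a monoidal functor (unique up to isomorphism) such that $M\circ f$ is isomorphic to the determinant functor induced by $g$. *)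

theory Defs
  imports "HOL-Algebra.Module" "HOL-Algebra.QuotRing" "HOL-Algebra.Polynomials"
begin

no_notation var (\<open>X\<index>\<close>)

section \<open>Categories, functors, natural transformations\<close>

record ('o, 'a) cat =
  Obj :: "'o set"
  Arr :: "'a set"
  Dom :: "'a \<Rightarrow> 'o"
  Cod :: "'a \<Rightarrow> 'o"
  Ident :: "'o \<Rightarrow> 'a"
  Comp :: "'a \<Rightarrow> 'a \<Rightarrow> 'a"  (infixr \<open>\<bullet>\<index>\<close> 70)

definition Hom :: "('o, 'a, 'x) cat_scheme \<Rightarrow> 'o \<Rightarrow> 'o \<Rightarrow> 'a set" where
  "Hom C X Y = {f \<in> Arr C. Dom C f = X \<and> Cod C f = Y}"

locale category =
  fixes C (structure)
  assumes Dom_closed: "f \<in> Arr C \<Longrightarrow> Dom C f \<in> Obj C"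
    and Cod_closed: "f \<in> Arr C \<Longrightarrow> Cod C f \<in> Obj C"
    and Ident_closed: "X \<in> Obj C \<Longrightarrow> Ident C X \<in> Hom C X X"
    and Comp_closed: "\<lbrakk>f \<in> Hom C X Y; g \<in> Hom C Y Z\<rbrakk> \<Longrightarrow> g \<bullet> f \<in> Hom C X Z"
    and Comp_assoc: "\<lbrakk>f \<in> Hom C W X; g \<in> Hom C X Y; h \<in> Hom C Y Z\<rbrakk>
      \<Longrightarrow> h \<bullet> (g \<bullet> f) = (h \<bullet> g) \<bullet> f"
    and Ident_left: "f \<in> Hom C X Y \<Longrightarrow> Ident C Y \<bullet> f = f"
    and Ident_right: "f \<in> Hom C X Y \<Longrightarrow> f \<bullet> Ident C X = f"

definition inverse_arrows :: "('o, 'a, 'x) cat_scheme \<Rightarrow> 'a \<Rightarrow> 'a \<Rightarrow> bool" where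
  "inverse_arrows C f g \<longleftrightarrow> f \<in> Arr C \<and> g \<in> Hom C (Cod C f) (Dom C f) \<and>
     g \<bullet>\<^bsub>C\<^esub> f = Ident C (Dom C f) \<and> f \<bullet>\<^bsub>C\<^esub> g = Ident C (Cod C f)"

definition iso_arrows :: "('o, 'a, 'x) cat_scheme \<Rightarrow> 'a set" where
  "iso_arrows C = {f. \<exists>g. inverse_arrows C f g}"

definition isomorphic :: "('o, 'a, 'x) cat_scheme \<Rightarrow> 'o \<Rightarrow> 'o \<Rightarrow> bool" where
  "isomorphic C X Y \<longleftrightarrow> Hom C X Y \<inter> iso_arrows C \<noteq> {}"

definition wide_subcat :: "('o, 'a, 'x) cat_scheme \<Rightarrow> 'a set \<Rightarrow> ('o, 'a) cat" where
  "wide_subcat C W = \<lparr>Obj = Obj C, Arr = W, Dom = Dom C, Cod = Cod C, Ident = Ident C, Comp = Comp C\<rparr>"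

record ('o, 'a, 'p, 'b) func =
  FO :: "'o \<Rightarrow> 'p"
  FA :: "'a \<Rightarrow> 'b"

definition is_functor ::
  "('o, 'a, 'x) cat_scheme \<Rightarrow> ('p, 'b, 'y) cat_scheme \<Rightarrow> ('o, 'a, 'p, 'b, 'z) func_scheme \<Rightarrow> bool" where
  "is_functor C D F \<longleftrightarrow> category C \<and> category D \<and>
     (\<forall>X\<in>Obj C. FO F X \<in> Obj D) \<and>
     (\<forall>f\<in>Arr C. FA F f \<in> Hom D (FO F (Dom C f)) (FO F (Cod C f))) \<and>
     (\<forall>X\<in>Obj C. FA F (Ident C X) = Ident D (FO F X)) \<and>
     (\<forall>f\<in>Arr C. \<forall>g\<in>Arr C. Dom C g = Cod C f \<longrightarrow> FA F (g \<bullet>\<^bsub>C\<^esub> f) = FA F g \<bullet>\<^bsub>D\<^esub> FA F f)"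

definition id_func :: "('o, 'a, 'o, 'a) func" where
  "id_func = \<lparr>FO = (\<lambda>X. X), FA = (\<lambda>f. f)\<rparr>"

definition comp_func ::
  "('p, 'b, 'q, 'c, 'y) func_scheme \<Rightarrow> ('o, 'a, 'p, 'b, 'z) func_scheme \<Rightarrow> ('o, 'a, 'q, 'c) func" where
  "comp_func G F = \<lparr>FO = FO G \<circ> FO F, FA = FA G \<circ> FA F\<rparr>"

text \<open>Components are required to be \<^const>\<open>undefined\<close> off the objects, so that equality of
  natural transformations is equality of functions.\<close>

definition is_nat ::
  "('o, 'a, 'x) cat_scheme \<Rightarrow> ('p, 'b, 'y) cat_scheme \<Rightarrow> ('o, 'a, 'p, 'b, 'z) func_scheme \<Rightarrow>
   ('o, 'a, 'p, 'b, 'w) func_scheme \<Rightarrow> ('o \<Rightarrow> 'b) \<Rightarrow> bool" where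
  "is_nat C D F G \<alpha> \<longleftrightarrow> \<alpha> \<in> extensional (Obj C) \<and>
     (\<forall>X\<in>Obj C. \<alpha> X \<in> Hom D (FO F X) (FO G X)) \<and>
     (\<forall>f\<in>Arr C. \<alpha> (Cod C f) \<bullet>\<^bsub>D\<^esub> FA F f = FA G f \<bullet>\<^bsub>D\<^esub> \<alpha> (Dom C f))"

definition is_nat_iso ::
  "('o, 'a, 'x) cat_scheme \<Rightarrow> ('p, 'b, 'y) cat_scheme \<Rightarrow> ('o, 'a, 'p, 'b, 'z) func_scheme \<Rightarrow>
   ('o, 'a, 'p, 'b, 'w) func_scheme \<Rightarrow> ('o \<Rightarrow> 'b) \<Rightarrow> bool" where
  "is_nat_iso C D F G \<alpha> \<longleftrightarrow> is_nat C D F G \<alpha> \<and> (\<forall>X\<in>Obj C. \<alpha> X \<in> iso_arrows D)"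

definition is_equivalence ::
  "('o, 'a, 'x) cat_scheme \<Rightarrow> ('p, 'b, 'y) cat_scheme \<Rightarrow> ('o, 'a, 'p, 'b, 'z) func_scheme \<Rightarrow> bool" where
  "is_equivalence C D F \<longleftrightarrow> is_functor C D F \<and>
     (\<exists>(G :: ('p, 'b, 'o, 'a) func) \<alpha> \<beta>. is_functor D C G \<and>
        is_nat_iso C C id_func (comp_func G F) \<alpha> \<and> is_nat_iso D D (comp_func F G) id_func \<beta>)"

text \<open>The category with objects a given set \<open>S\<close> of functors (possibly carrying extra structure)
  and with morphisms the natural transformations satisfying \<open>ok\<close>. Members of \<open>S\<close> that agree on
  the objects and arrows of \<open>C\<close> but differ elsewhere are distinct but isomorphic objects.\<close>

definition nat_cat ::
  "('o, 'a, 'x) cat_scheme \<Rightarrow> ('p, 'b, 'y) cat_scheme \<Rightarrow> ('o, 'a, 'p, 'b, 'z) func_scheme set \<Rightarrow>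
   (('o, 'a, 'p, 'b, 'z) func_scheme \<Rightarrow> ('o \<Rightarrow> 'b) \<Rightarrow> ('o, 'a, 'p, 'b, 'z) func_scheme \<Rightarrow> bool) \<Rightarrow>
   (('o, 'a, 'p, 'b, 'z) func_scheme,
    ('o, 'a, 'p, 'b, 'z) func_scheme \<times> ('o \<Rightarrow> 'b) \<times> ('o, 'a, 'p, 'b, 'z) func_scheme) cat" where
  "nat_cat C D S ok =
     \<lparr>Obj = S,
      Arr = {(F, \<alpha>, G). F \<in> S \<and> G \<in> S \<and> is_nat C D F G \<alpha> \<and> ok F \<alpha> G},
      Dom = (\<lambda>(F, \<alpha>, G). F),
      Cod = (\<lambda>(F, \<alpha>, G). G),
      Ident = (\<lambda>F. (F, \<lambda>X\<in>Obj C. Ident D (FO F X), F)),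
      Comp = (\<lambda>(G, \<beta>, H) (F, \<alpha>, G'). (F, \<lambda>X\<in>Obj C. \<beta> X \<bullet>\<^bsub>D\<^esub> \<alpha> X, H))\<rparr>"


section \<open>Picard categories\<close>

record ('o, 'a) picard = "('o, 'a) cat" +
  TenO :: "'o \<Rightarrow> 'o \<Rightarrow> 'o"  (infixr \<open>\<otimes>\<^sub>o\<index>\<close> 75)
  TenA :: "'a \<Rightarrow> 'a \<Rightarrow> 'a"  (infixr \<open>\<otimes>\<^sub>a\<index>\<close> 75)
  Phi :: "'o \<Rightarrow> 'o \<Rightarrow> 'o \<Rightarrow> 'a"  (\<open>\<phi>\<index>\<close>)
  Psi :: "'o \<Rightarrow> 'o \<Rightarrow> 'a"  (\<open>\<psi>\<index>\<close>)

locale picard_category = category P for P (structure) +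
  assumes nonempty: "Obj P \<noteq> {}"
    and groupoid: "Arr P \<subseteq> iso_arrows P"
    and TenO_closed: "\<lbrakk>X \<in> Obj P; Y \<in> Obj P\<rbrakk> \<Longrightarrow> X \<otimes>\<^sub>o Y \<in> Obj P"
    and TenA_closed: "\<lbrakk>f \<in> Hom P X X'; g \<in> Hom P Y Y'\<rbrakk> \<Longrightarrow> f \<otimes>\<^sub>a g \<in> Hom P (X \<otimes>\<^sub>o Y) (X' \<otimes>\<^sub>o Y')"
    and Ten_Ident: "\<lbrakk>X \<in> Obj P; Y \<in> Obj P\<rbrakk> \<Longrightarrow> Ident P X \<otimes>\<^sub>a Ident P Y = Ident P (X \<otimes>\<^sub>o Y)"
    and Ten_Comp: "\<lbrakk>f \<in> Hom P X X'; f' \<in> Hom P X' X''; g \<in> Hom P Y Y'; g' \<in> Hom P Y' Y''\<rbrakk>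
      \<Longrightarrow> (f' \<bullet> f) \<otimes>\<^sub>a (g' \<bullet> g) = (f' \<otimes>\<^sub>a g') \<bullet> (f \<otimes>\<^sub>a g)"
    and Phi_closed: "\<lbrakk>X \<in> Obj P; Y \<in> Obj P; Z \<in> Obj P\<rbrakk>
      \<Longrightarrow> \<phi> X Y Z \<in> Hom P (X \<otimes>\<^sub>o (Y \<otimes>\<^sub>o Z)) ((X \<otimes>\<^sub>o Y) \<otimes>\<^sub>o Z)"
    and Phi_natural: "\<lbrakk>f \<in> Hom P X X'; g \<in> Hom P Y Y'; h \<in> Hom P Z Z'\<rbrakk>
      \<Longrightarrow> \<phi> X' Y' Z' \<bullet> (f \<otimes>\<^sub>a (g \<otimes>\<^sub>a h)) = ((f \<otimes>\<^sub>a g) \<otimes>\<^sub>a h) \<bullet> \<phi> X Y Z"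
    and Psi_closed: "\<lbrakk>X \<in> Obj P; Y \<in> Obj P\<rbrakk> \<Longrightarrow> \<psi> X Y \<in> Hom P (X \<otimes>\<^sub>o Y) (Y \<otimes>\<^sub>o X)"
    and Psi_natural: "\<lbrakk>f \<in> Hom P X X'; g \<in> Hom P Y Y'\<rbrakk>
      \<Longrightarrow> \<psi> X' Y' \<bullet> (f \<otimes>\<^sub>a g) = (g \<otimes>\<^sub>a f) \<bullet> \<psi> X Y"
    and Psi_symmetry: "\<lbrakk>X \<in> Obj P; Y \<in> Obj P\<rbrakk> \<Longrightarrow> \<psi> Y X \<bullet> \<psi> X Y = Ident P (X \<otimes>\<^sub>o Y)"
    and pentagon: "\<lbrakk>W \<in> Obj P; X \<in> Obj P; Y \<in> Obj P; Z \<in> Obj P\<rbrakk>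
      \<Longrightarrow> \<phi> (W \<otimes>\<^sub>o X) Y Z \<bullet> \<phi> W X (Y \<otimes>\<^sub>o Z) =
          (\<phi> W X Y \<otimes>\<^sub>a Ident P Z) \<bullet> \<phi> W (X \<otimes>\<^sub>o Y) Z \<bullet> (Ident P W \<otimes>\<^sub>a \<phi> X Y Z)"
    and hexagon: "\<lbrakk>X \<in> Obj P; Y \<in> Obj P; Z \<in> Obj P\<rbrakk>
      \<Longrightarrow> \<phi> Z X Y \<bullet> \<psi> (X \<otimes>\<^sub>o Y) Z \<bullet> \<phi> X Y Z =
          (\<psi> X Z \<otimes>\<^sub>a Ident P Y) \<bullet> \<phi> X Z Y \<bullet> (Ident P X \<otimes>\<^sub>a \<psi> Y Z)"
    and autoequivalence: "X \<in> Obj P \<Longrightarrow>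
      is_equivalence P P \<lparr>FO = (\<lambda>Y. X \<otimes>\<^sub>o Y), FA = (\<lambda>f. Ident P X \<otimes>\<^sub>a f)\<rparr>"

record ('o, 'a, 'p, 'b) mon_func = "('o, 'a, 'p, 'b) func" +
  MC :: "'o \<Rightarrow> 'o \<Rightarrow> 'b"

definition monoidal_functor ::
  "('o, 'a, 'x) picard_scheme \<Rightarrow> ('p, 'b, 'y) picard_scheme \<Rightarrow> ('o, 'a, 'p, 'b) mon_func \<Rightarrow> bool" where
  "monoidal_functor P Q M \<longleftrightarrow> is_functor P Q M \<and>
     (\<forall>X\<in>Obj P. \<forall>Y\<in>Obj P.
        MC M X Y \<in> Hom Q (FO M (X \<otimes>\<^sub>o\<^bsub>P\<^esub> Y)) (FO M X \<otimes>\<^sub>o\<^bsub>Q\<^esub> FO M Y) \<inter> iso_arrows Q) \<and>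
     (\<forall>f\<in>Arr P. \<forall>g\<in>Arr P.
        MC M (Cod P f) (Cod P g) \<bullet>\<^bsub>Q\<^esub> FA M (f \<otimes>\<^sub>a\<^bsub>P\<^esub> g) =
        (FA M f \<otimes>\<^sub>a\<^bsub>Q\<^esub> FA M g) \<bullet>\<^bsub>Q\<^esub> MC M (Dom P f) (Dom P g)) \<and>
     (\<forall>X\<in>Obj P. \<forall>Y\<in>Obj P. \<forall>Z\<in>Obj P.
        \<phi>\<^bsub>Q\<^esub> (FO M X) (FO M Y) (FO M Z) \<bullet>\<^bsub>Q\<^esub>
          (Ident Q (FO M X) \<otimes>\<^sub>a\<^bsub>Q\<^esub> MC M Y Z) \<bullet>\<^bsub>Q\<^esub> MC M X (Y \<otimes>\<^sub>o\<^bsub>P\<^esub> Z) =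
        (MC M X Y \<otimes>\<^sub>a\<^bsub>Q\<^esub> Ident Q (FO M Z)) \<bullet>\<^bsub>Q\<^esub>
          MC M (X \<otimes>\<^sub>o\<^bsub>P\<^esub> Y) Z \<bullet>\<^bsub>Q\<^esub> FA M (\<phi>\<^bsub>P\<^esub> X Y Z)) \<and>
     (\<forall>X\<in>Obj P. \<forall>Y\<in>Obj P.
        \<psi>\<^bsub>Q\<^esub> (FO M X) (FO M Y) \<bullet>\<^bsub>Q\<^esub> MC M X Y = MC M Y X \<bullet>\<^bsub>Q\<^esub> FA M (\<psi>\<^bsub>P\<^esub> X Y))"

definition monoidal_trans ::
  "('o, 'a, 'x) picard_scheme \<Rightarrow> ('p, 'b, 'y) picard_scheme \<Rightarrow>
   ('o, 'a, 'p, 'b) mon_func \<Rightarrow> ('o \<Rightarrow> 'b) \<Rightarrow> ('o, 'a, 'p, 'b) mon_func \<Rightarrow> bool" where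
  "monoidal_trans P Q M \<alpha> N \<longleftrightarrow> (\<forall>X\<in>Obj P. \<forall>Y\<in>Obj P.
     (\<alpha> X \<otimes>\<^sub>a\<^bsub>Q\<^esub> \<alpha> Y) \<bullet>\<^bsub>Q\<^esub> MC M X Y = MC N X Y \<bullet>\<^bsub>Q\<^esub> \<alpha> (X \<otimes>\<^sub>o\<^bsub>P\<^esub> Y))"

definition Hom_ten where
  "Hom_ten P Q = nat_cat P Q {M. monoidal_functor P Q M} (monoidal_trans P Q)"

text \<open>An element of \<open>\<pi>\<^sub>1(P)\<close> is given by one automorphism of each object, the automorphisms of
  \<open>X\<close> and \<open>Y\<close> corresponding to each other under the canonical isomorphisms
  \<open>Aut X \<rightarrow> Aut (X \<otimes> Y) \<leftarrow> Aut Y\<close>. Evaluation at any object identifies the group with the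
  automorphism group of that object.\<close>

definition pi1 :: "('o, 'a, 'x) picard_scheme \<Rightarrow> ('o \<Rightarrow> 'a) monoid" where
  "pi1 P =
     \<lparr>carrier = {a \<in> extensional (Obj P). (\<forall>X\<in>Obj P. a X \<in> Hom P X X \<inter> iso_arrows P) \<and>
        (\<forall>X\<in>Obj P. \<forall>Y\<in>Obj P. a X \<otimes>\<^sub>a\<^bsub>P\<^esub> Ident P Y = Ident P X \<otimes>\<^sub>a\<^bsub>P\<^esub> a Y)},
      mult = (\<lambda>a b. \<lambda>X\<in>Obj P. a X \<bullet>\<^bsub>P\<^esub> b X),
      one = (\<lambda>X\<in>Obj P. Ident P X)\<rparr>"

definition pi1_map ::
  "('o, 'a, 'x) picard_scheme \<Rightarrow> ('p, 'b, 'y) picard_scheme \<Rightarrow> ('o, 'a, 'p, 'b) mon_func \<Rightarrow>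
   ('o \<Rightarrow> 'a) \<Rightarrow> ('p \<Rightarrow> 'b)" where
  "pi1_map P Q M = (\<lambda>a\<in>carrier (pi1 P).
     THE b. b \<in> carrier (pi1 Q) \<and> (\<forall>X\<in>Obj P. b (FO M X) = FA M (a X)))"


section \<open>Additive, exact and triangulated structure\<close>

record ('o, 'a) add_cat = "('o, 'a) cat" +
  ZeroA :: "'o \<Rightarrow> 'o \<Rightarrow> 'a"
  AddA :: "'a \<Rightarrow> 'a \<Rightarrow> 'a"
  NegA :: "'a \<Rightarrow> 'a"

record ('o, 'a) exact_cat = "('o, 'a) add_cat" +
  Ses :: "('a \<times> 'a) set"

record ('o, 'a) tri_cat = "('o, 'a) add_cat" +
  ShO :: "'o \<Rightarrow> 'o"
  ShA :: "'a \<Rightarrow> 'a"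
  Tri :: "('a \<times> 'a \<times> 'a) set"

definition zero_object :: "('o, 'a, 'x) add_cat_scheme \<Rightarrow> 'o \<Rightarrow> bool" where
  "zero_object C X \<longleftrightarrow> X \<in> Obj C \<and> Ident C X = ZeroA C X X"

text \<open>Direct sums are described by biproduct diagrams
  (injections \<open>i\<close>, \<open>j\<close>, projections \<open>p\<close>, \<open>q\<close>).\<close>

definition biproduct ::
  "('o, 'a, 'x) add_cat_scheme \<Rightarrow> 'o \<Rightarrow> 'o \<Rightarrow> 'o \<Rightarrow> 'a \<Rightarrow> 'a \<Rightarrow> 'a \<Rightarrow> 'a \<Rightarrow> bool" where
  "biproduct C X Y S i j p q \<longleftrightarrow> X \<in> Obj C \<and> Y \<in> Obj C \<and> S \<in> Obj C \<and>
     i \<in> Hom C X S \<and> j \<in> Hom C Y S \<and> p \<in> Hom C S X \<and> q \<in> Hom C S Y \<and>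
     p \<bullet>\<^bsub>C\<^esub> i = Ident C X \<and> q \<bullet>\<^bsub>C\<^esub> j = Ident C Y \<and>
     p \<bullet>\<^bsub>C\<^esub> j = ZeroA C Y X \<and> q \<bullet>\<^bsub>C\<^esub> i = ZeroA C X Y \<and>
     AddA C (i \<bullet>\<^bsub>C\<^esub> p) (j \<bullet>\<^bsub>C\<^esub> q) = Ident C S"

definition triangle :: "('o, 'a, 'x) tri_cat_scheme \<Rightarrow> 'a \<times> 'a \<times> 'a \<Rightarrow> bool" where
  "triangle T = (\<lambda>(u, v, w). u \<in> Arr T \<and> v \<in> Arr T \<and> w \<in> Arr T \<and>
     Cod T u = Dom T v \<and> Cod T v = Dom T w \<and> Cod T w = ShO T (Dom T u))"

definition triangle_iso ::
  "('o, 'a, 'x) tri_cat_scheme \<Rightarrow> 'a \<times> 'a \<times> 'a \<Rightarrow> 'a \<times> 'a \<times> 'a \<Rightarrow> 'a \<Rightarrow> 'a \<Rightarrow> 'a \<Rightarrow> bool" where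
  "triangle_iso T = (\<lambda>(u, v, w) (u', v', w') \<alpha> \<beta> \<gamma>.
     triangle T (u, v, w) \<and> triangle T (u', v', w') \<and>
     \<alpha> \<in> Hom T (Dom T u) (Dom T u') \<inter> iso_arrows T \<and>
     \<beta> \<in> Hom T (Cod T u) (Cod T u') \<inter> iso_arrows T \<and>
     \<gamma> \<in> Hom T (Cod T v) (Cod T v') \<inter> iso_arrows T \<and>
     \<beta> \<bullet>\<^bsub>T\<^esub> u = u' \<bullet>\<^bsub>T\<^esub> \<alpha> \<and> \<gamma> \<bullet>\<^bsub>T\<^esub> v = v' \<bullet>\<^bsub>T\<^esub> \<beta> \<and> ShA T \<alpha> \<bullet>\<^bsub>T\<^esub> w = w' \<bullet>\<^bsub>T\<^esub> \<gamma>)"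


section \<open>Determinant functors\<close>

text \<open>The type variable \<open>'d\<close> is the type of short exact sequences (pairs of arrows) or of
  distinguished triangles (triples of arrows). Values outside the relevant arrows, sequences and
  triangles are irrelevant.\<close>

record ('o, 'a, 'p, 'b, 'd) det_func = "('o, 'a, 'p, 'b) func" +
  DS :: "'d \<Rightarrow> 'b"

definition det_exact ::
  "('o, 'a, 'x) exact_cat_scheme \<Rightarrow> 'a set \<Rightarrow> ('p, 'b, 'y) picard_scheme \<Rightarrow>
   ('o, 'a, 'p, 'b, 'a \<times> 'a) det_func \<Rightarrow> bool" where
  "det_exact E w P f \<longleftrightarrow> is_functor (wide_subcat E w) P f \<and>
     (\<forall>(a, b)\<in>Ses E.
        DS f (a, b) \<in> Hom P (FO f (Cod E a)) (FO f (Dom E a) \<otimes>\<^sub>o\<^bsub>P\<^esub> FO f (Cod E b))) \<and>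
     (\<forall>(a, b)\<in>Ses E. \<forall>(a', b')\<in>Ses E. \<forall>\<alpha>\<in>w. \<forall>\<beta>\<in>w. \<forall>\<gamma>\<in>w.
        \<alpha> \<in> Hom E (Dom E a) (Dom E a') \<and> \<beta> \<in> Hom E (Cod E a) (Cod E a') \<and>
        \<gamma> \<in> Hom E (Cod E b) (Cod E b') \<and> \<beta> \<bullet>\<^bsub>E\<^esub> a = a' \<bullet>\<^bsub>E\<^esub> \<alpha> \<and> \<gamma> \<bullet>\<^bsub>E\<^esub> b = b' \<bullet>\<^bsub>E\<^esub> \<beta> \<longrightarrow>
        (FA f \<alpha> \<otimes>\<^sub>a\<^bsub>P\<^esub> FA f \<gamma>) \<bullet>\<^bsub>P\<^esub> DS f (a, b) = DS f (a', b') \<bullet>\<^bsub>P\<^esub> FA f \<beta>) \<and>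
     (\<forall>a b p q r s t.
        (a, p) \<in> Ses E \<and> (b \<bullet>\<^bsub>E\<^esub> a, q) \<in> Ses E \<and> (b, r) \<in> Ses E \<and> (s, t) \<in> Ses E \<and>
        Dom E b = Cod E a \<and> Dom E s = Cod E p \<and> Cod E s = Cod E q \<and> Cod E t = Cod E r \<and>
        s \<bullet>\<^bsub>E\<^esub> p = q \<bullet>\<^bsub>E\<^esub> b \<and> t \<bullet>\<^bsub>E\<^esub> q = r \<longrightarrow>
        \<phi>\<^bsub>P\<^esub> (FO f (Dom E a)) (FO f (Cod E p)) (FO f (Cod E r)) \<bullet>\<^bsub>P\<^esub>
          (Ident P (FO f (Dom E a)) \<otimes>\<^sub>a\<^bsub>P\<^esub> DS f (s, t)) \<bullet>\<^bsub>P\<^esub> DS f (b \<bullet>\<^bsub>E\<^esub> a, q) =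
        (DS f (a, p) \<otimes>\<^sub>a\<^bsub>P\<^esub> Ident P (FO f (Cod E r))) \<bullet>\<^bsub>P\<^esub> DS f (b, r)) \<and>
     (\<forall>A B S i j p q. biproduct E A B S i j p q \<longrightarrow>
        \<psi>\<^bsub>P\<^esub> (FO f A) (FO f B) \<bullet>\<^bsub>P\<^esub> DS f (i, q) = DS f (j, p))"

definition octahedron ::
  "('o, 'a, 'x) tri_cat_scheme \<Rightarrow> 'a \<times> 'a \<times> 'a \<Rightarrow> 'a \<times> 'a \<times> 'a \<Rightarrow> 'a \<times> 'a \<times> 'a \<Rightarrow>
   'a \<times> 'a \<times> 'a \<Rightarrow> bool" where
  "octahedron T = (\<lambda>(a, p, p') (ba, q, q') (b, r, r') (s, t, t').
     (a, p, p') \<in> Tri T \<and> (ba, q, q') \<in> Tri T \<and> (b, r, r') \<in> Tri T \<and> (s, t, t') \<in> Tri T \<and>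
     Dom T b = Cod T a \<and> Dom T s = Cod T p \<and> Cod T s = Cod T q \<and> Cod T t = Cod T r \<and>
     ba = b \<bullet>\<^bsub>T\<^esub> a \<and> q' \<bullet>\<^bsub>T\<^esub> s = p' \<and> t \<bullet>\<^bsub>T\<^esub> q = r \<and> t' = ShA T p \<bullet>\<^bsub>T\<^esub> r' \<and>
     s \<bullet>\<^bsub>T\<^esub> p = q \<bullet>\<^bsub>T\<^esub> b \<and> r' \<bullet>\<^bsub>T\<^esub> t = ShA T a \<bullet>\<^bsub>T\<^esub> q')"

definition det_tri ::
  "('o, 'a, 'x) tri_cat_scheme \<Rightarrow> ('p, 'b, 'y) picard_scheme \<Rightarrow>
   ('o, 'a, 'p, 'b, 'a \<times> 'a \<times> 'a) det_func \<Rightarrow> bool" where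
  "det_tri T P g \<longleftrightarrow> is_functor (wide_subcat T (iso_arrows T)) P g \<and>
     (\<forall>(u, v, w)\<in>Tri T.
        DS g (u, v, w) \<in> Hom P (FO g (Cod T u)) (FO g (Dom T u) \<otimes>\<^sub>o\<^bsub>P\<^esub> FO g (Cod T v))) \<and>
     (\<forall>(u, v, w)\<in>Tri T. \<forall>(u', v', w')\<in>Tri T. \<forall>\<alpha> \<beta> \<gamma>.
        triangle_iso T (u, v, w) (u', v', w') \<alpha> \<beta> \<gamma> \<longrightarrow>
        (FA g \<alpha> \<otimes>\<^sub>a\<^bsub>P\<^esub> FA g \<gamma>) \<bullet>\<^bsub>P\<^esub> DS g (u, v, w) = DS g (u', v', w') \<bullet>\<^bsub>P\<^esub> FA g \<beta>) \<and>
     (\<forall>a p p' q q' b r r' s t t'.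
        octahedron T (a, p, p') (b \<bullet>\<^bsub>T\<^esub> a, q, q') (b, r, r') (s, t, t') \<longrightarrow>
        \<phi>\<^bsub>P\<^esub> (FO g (Dom T a)) (FO g (Cod T p)) (FO g (Cod T r)) \<bullet>\<^bsub>P\<^esub>
          (Ident P (FO g (Dom T a)) \<otimes>\<^sub>a\<^bsub>P\<^esub> DS g (s, t, t')) \<bullet>\<^bsub>P\<^esub> DS g (b \<bullet>\<^bsub>T\<^esub> a, q, q') =
        (DS g (a, p, p') \<otimes>\<^sub>a\<^bsub>P\<^esub> Ident P (FO g (Cod T r))) \<bullet>\<^bsub>P\<^esub> DS g (b, r, r')) \<and>
     (\<forall>A B S i j p q. biproduct T A B S i j p q \<longrightarrow>
        \<psi>\<^bsub>P\<^esub> (FO g A) (FO g B) \<bullet>\<^bsub>P\<^esub> DS g (i, q, ZeroA T B (ShO T A)) = DS g (j, p, ZeroA T A (ShO T B)))"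

definition det_exact_trans where
  "det_exact_trans E P f \<alpha> f' \<longleftrightarrow> (\<forall>(a, b)\<in>Ses E.
     (\<alpha> (Dom E a) \<otimes>\<^sub>a\<^bsub>P\<^esub> \<alpha> (Cod E b)) \<bullet>\<^bsub>P\<^esub> DS f (a, b) = DS f' (a, b) \<bullet>\<^bsub>P\<^esub> \<alpha> (Cod E a))"

definition det_tri_trans where
  "det_tri_trans T P g \<alpha> g' \<longleftrightarrow> (\<forall>(u, v, w)\<in>Tri T.
     (\<alpha> (Dom T u) \<otimes>\<^sub>a\<^bsub>P\<^esub> \<alpha> (Cod T v)) \<bullet>\<^bsub>P\<^esub> DS g (u, v, w) = DS g' (u, v, w) \<bullet>\<^bsub>P\<^esub> \<alpha> (Cod T u))"

definition det_exact_cat where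
  "det_exact_cat E w P = nat_cat (wide_subcat E w) P {f. det_exact E w P f} (det_exact_trans E P)"

definition det_tri_cat where
  "det_tri_cat T P = nat_cat (wide_subcat T (iso_arrows T)) P {g. det_tri T P g} (det_tri_trans T P)"

definition postcomp_exact ::
  "('o, 'a, 'x) exact_cat_scheme \<Rightarrow> ('q, 'c, 'y) picard_scheme \<Rightarrow> ('p, 'b, 'q, 'c) mon_func \<Rightarrow>
   ('o, 'a, 'p, 'b, 'a \<times> 'a) det_func \<Rightarrow> ('o, 'a, 'q, 'c, 'a \<times> 'a) det_func" where
  "postcomp_exact E Q M f = \<lparr>FO = FO M \<circ> FO f, FA = FA M \<circ> FA f,
     DS = (\<lambda>(a, b). MC M (FO f (Dom E a)) (FO f (Cod E b)) \<bullet>\<^bsub>Q\<^esub> FA M (DS f (a, b)))\<rparr>"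

definition postcomp_tri ::
  "('o, 'a, 'x) tri_cat_scheme \<Rightarrow> ('q, 'c, 'y) picard_scheme \<Rightarrow> ('p, 'b, 'q, 'c) mon_func \<Rightarrow>
   ('o, 'a, 'p, 'b, 'a \<times> 'a \<times> 'a) det_func \<Rightarrow> ('o, 'a, 'q, 'c, 'a \<times> 'a \<times> 'a) det_func" where
  "postcomp_tri T Q M g = \<lparr>FO = FO M \<circ> FO g, FA = FA M \<circ> FA g,
     DS = (\<lambda>(u, v, w). MC M (FO g (Dom T u)) (FO g (Cod T v)) \<bullet>\<^bsub>Q\<^esub> FA M (DS g (u, v, w)))\<rparr>"

definition whisker where
  "whisker S h f = (\<lambda>(M, \<alpha>, N). (h M, \<lambda>X\<in>S. \<alpha> (FO f X), h N))"

text \<open>Universality is tested against the Picard categories whose objects and arrows are elements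
  of the type \<open>'u\<close> in which the target \<open>V\<close> lives, so \<open>'u\<close> acts as a universe.\<close>

definition universal_det_exact ::
  "('o, 'a, 'x) exact_cat_scheme \<Rightarrow> 'a set \<Rightarrow> ('u, 'u) picard \<Rightarrow>
   ('o, 'a, 'u, 'u, 'a \<times> 'a) det_func \<Rightarrow> bool" where
  "universal_det_exact E w V f \<longleftrightarrow> picard_category V \<and> det_exact E w V f \<and>
     (\<forall>P :: ('u, 'u) picard. picard_category P \<longrightarrow>
        is_equivalence (Hom_ten V P) (det_exact_cat E w P)
          \<lparr>FO = (\<lambda>M. postcomp_exact E P M f), FA = whisker (Obj E) (\<lambda>M. postcomp_exact E P M f) f\<rparr>)"

definition universal_det_tri ::
  "('o, 'a, 'x) tri_cat_scheme \<Rightarrow> ('u, 'u) picard \<Rightarrow>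
   ('o, 'a, 'u, 'u, 'a \<times> 'a \<times> 'a) det_func \<Rightarrow> bool" where
  "universal_det_tri T V g \<longleftrightarrow> picard_category V \<and> det_tri T V g \<and>
     (\<forall>P :: ('u, 'u) picard. picard_category P \<longrightarrow>
        is_equivalence (Hom_ten V P) (det_tri_cat T P)
          \<lparr>FO = (\<lambda>M. postcomp_tri T P M g), FA = whisker (Obj T) (\<lambda>M. postcomp_tri T P M g) g\<rparr>)"


section \<open>Bounded complexes and the homotopy category\<close>

record ('o, 'a) cpx =
  cob :: "int \<Rightarrow> 'o"
  cdif :: "int \<Rightarrow> 'a"

definition bounded_cpx :: "('o, 'a, 'x) add_cat_scheme \<Rightarrow> ('o, 'a) cpx \<Rightarrow> bool" where
  "bounded_cpx A X \<longleftrightarrow>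
     (\<forall>n. cob X n \<in> Obj A \<and> cdif X n \<in> Hom A (cob X n) (cob X (n + 1)) \<and>
        cdif X (n + 1) \<bullet>\<^bsub>A\<^esub> cdif X n = ZeroA A (cob X n) (cob X (n + 2))) \<and>
     finite {n. \<not> zero_object A (cob X n)}"

definition chain_map ::
  "('o, 'a, 'x) add_cat_scheme \<Rightarrow> ('o, 'a) cpx \<Rightarrow> ('o, 'a) cpx \<Rightarrow> (int \<Rightarrow> 'a) \<Rightarrow> bool" where
  "chain_map A X Y f \<longleftrightarrow> (\<forall>n. f n \<in> Hom A (cob X n) (cob Y n) \<and>
     cdif Y n \<bullet>\<^bsub>A\<^esub> f n = f (n + 1) \<bullet>\<^bsub>A\<^esub> cdif X n)"

type_synonym ('o, 'a) cmap = "('o, 'a) cpx \<times> (int \<Rightarrow> 'a) \<times> ('o, 'a) cpx"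

definition Cb :: "('o, 'a, 'x) exact_cat_scheme \<Rightarrow> (('o, 'a) cpx, ('o, 'a) cmap) exact_cat" where
  "Cb E =
     \<lparr>Obj = {X. bounded_cpx E X},
      Arr = {(X, f, Y). bounded_cpx E X \<and> bounded_cpx E Y \<and> chain_map E X Y f},
      Dom = (\<lambda>(X, f, Y). X),
      Cod = (\<lambda>(X, f, Y). Y),
      Ident = (\<lambda>X. (X, \<lambda>n. Ident E (cob X n), X)),
      Comp = (\<lambda>(Y, g, Z) (X, f, Y'). (X, \<lambda>n. g n \<bullet>\<^bsub>E\<^esub> f n, Z)),
      ZeroA = (\<lambda>X Y. (X, \<lambda>n. ZeroA E (cob X n) (cob Y n), Y)),
      AddA = (\<lambda>(X, f, Y) (X', g, Y'). (X, \<lambda>n. AddA E (f n) (g n), Y)),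
      NegA = (\<lambda>(X, f, Y). (X, \<lambda>n. NegA E (f n), Y)),
      Ses = {((A, a, B), (B', b, C)). bounded_cpx E A \<and> bounded_cpx E B \<and> bounded_cpx E C \<and> B' = B \<and>
         chain_map E A B a \<and> chain_map E B C b \<and> (\<forall>n. (a n, b n) \<in> Ses E)}\<rparr>"

definition homotopic ::
  "('o, 'a, 'x) add_cat_scheme \<Rightarrow> ('o, 'a) cpx \<Rightarrow> ('o, 'a) cpx \<Rightarrow> (int \<Rightarrow> 'a) \<Rightarrow> (int \<Rightarrow> 'a) \<Rightarrow> bool" where
  "homotopic A X Y f g \<longleftrightarrow> (\<exists>h. \<forall>n. h n \<in> Hom A (cob X n) (cob Y (n - 1)) \<and>
     f n = AddA A (g n) (AddA A (cdif Y (n - 1) \<bullet>\<^bsub>A\<^esub> h n) (h (n + 1) \<bullet>\<^bsub>A\<^esub> cdif X n)))"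

definition homotopy_class ::
  "('o, 'a, 'x) add_cat_scheme \<Rightarrow> ('o, 'a) cpx \<Rightarrow> ('o, 'a) cpx \<Rightarrow> (int \<Rightarrow> 'a) \<Rightarrow> (int \<Rightarrow> 'a) set" where
  "homotopy_class A X Y f = {g. chain_map A X Y g \<and> homotopic A X Y f g}"

type_synonym ('o, 'a) hmap = "('o, 'a) cpx \<times> (int \<Rightarrow> 'a) set \<times> ('o, 'a) cpx"

definition to_Kb :: "('o, 'a, 'x) add_cat_scheme \<Rightarrow> ('o, 'a) cmap \<Rightarrow> ('o, 'a) hmap" where
  "to_Kb A = (\<lambda>(X, f, Y). (X, homotopy_class A X Y f, Y))"

definition shift_cpx :: "('o, 'a, 'x) add_cat_scheme \<Rightarrow> ('o, 'a) cpx \<Rightarrow> ('o, 'a) cpx" where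
  "shift_cpx A X = \<lparr>cob = (\<lambda>n. cob X (n + 1)), cdif = (\<lambda>n. NegA A (cdif X (n + 1)))\<rparr>"

text \<open>Operations on homotopy classes are induced from representatives; each union below is over
  one and the same class. The distinguished triangles are added in \<open>Kb\<close>.\<close>

definition Kb_pre :: "('o, 'a, 'x) add_cat_scheme \<Rightarrow> (('o, 'a) cpx, ('o, 'a) hmap) tri_cat" where
  "Kb_pre A =
     \<lparr>Obj = {X. bounded_cpx A X},
      Arr = {(X, homotopy_class A X Y f, Y) | X f Y.
         bounded_cpx A X \<and> bounded_cpx A Y \<and> chain_map A X Y f},
      Dom = (\<lambda>(X, F, Y). X),
      Cod = (\<lambda>(X, F, Y). Y),
      Ident = (\<lambda>X. (X, homotopy_class A X X (\<lambda>n. Ident A (cob X n)), X)),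
      Comp = (\<lambda>(Y, G, Z) (X, F, Y').
         (X, \<Union>g\<in>G. \<Union>f\<in>F. homotopy_class A X Z (\<lambda>n. g n \<bullet>\<^bsub>A\<^esub> f n), Z)),
      ZeroA = (\<lambda>X Y. (X, homotopy_class A X Y (\<lambda>n. ZeroA A (cob X n) (cob Y n)), Y)),
      AddA = (\<lambda>(X, F, Y) (X', G, Y').
         (X, \<Union>f\<in>F. \<Union>g\<in>G. homotopy_class A X Y (\<lambda>n. AddA A (f n) (g n)), Y)),
      NegA = (\<lambda>(X, F, Y). (X, \<Union>f\<in>F. homotopy_class A X Y (\<lambda>n. NegA A (f n)), Y)),
      ShO = shift_cpx A,
      ShA = (\<lambda>(X, F, Y). (shift_cpx A X, (\<lambda>f n. f (n + 1)) ` F, shift_cpx A Y)),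
      Tri = {}\<rparr>"

text \<open>\<open>Q\<close> is the mapping cone of the chain map \<open>f : X \<rightarrow> Y\<close>: degree \<open>n\<close> is
  \<open>X\<^sup>n\<^sup>+\<^sup>1 \<oplus> Y\<^sup>n\<close> with injections \<open>i n\<close>, \<open>j n\<close> and projections \<open>p n\<close>, \<open>q n\<close>, and the differential is
  \<open>(x, y) \<mapsto> (- d x, f x + d y)\<close>.\<close>

definition is_cone ::
  "('o, 'a, 'x) add_cat_scheme \<Rightarrow> ('o, 'a) cmap \<Rightarrow> ('o, 'a) cpx \<Rightarrow>
   (int \<Rightarrow> 'a) \<Rightarrow> (int \<Rightarrow> 'a) \<Rightarrow> (int \<Rightarrow> 'a) \<Rightarrow> (int \<Rightarrow> 'a) \<Rightarrow> bool" where
  "is_cone A = (\<lambda>(X, f, Y) Q i j p q. bounded_cpx A Q \<and>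
     (\<forall>n. biproduct A (cob X (n + 1)) (cob Y n) (cob Q n) (i n) (j n) (p n) (q n) \<and>
        cdif Q n =
          AddA A (i (n + 1) \<bullet>\<^bsub>A\<^esub> NegA A (cdif X (n + 1)) \<bullet>\<^bsub>A\<^esub> p n)
            (AddA A (j (n + 1) \<bullet>\<^bsub>A\<^esub> f (n + 1) \<bullet>\<^bsub>A\<^esub> p n) (j (n + 1) \<bullet>\<^bsub>A\<^esub> cdif Y n \<bullet>\<^bsub>A\<^esub> q n))))"

definition cone_triangle ::
  "('o, 'a, 'x) add_cat_scheme \<Rightarrow> ('o, 'a) cmap \<Rightarrow> ('o, 'a) cpx \<Rightarrow> (int \<Rightarrow> 'a) \<Rightarrow> (int \<Rightarrow> 'a) \<Rightarrow>
   ('o, 'a) hmap \<times> ('o, 'a) hmap \<times> ('o, 'a) hmap" where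
  "cone_triangle A = (\<lambda>(X, f, Y) Q j p.
     (to_Kb A (X, f, Y), to_Kb A (Y, j, Q), to_Kb A (Q, \<lambda>n. NegA A (p n), shift_cpx A X)))"

definition Kb :: "('o, 'a, 'x) add_cat_scheme \<Rightarrow> (('o, 'a) cpx, ('o, 'a) hmap) tri_cat" where
  "Kb A = (Kb_pre A) \<lparr>Tri := {\<Delta>. \<exists>X f Y Q i j p q \<alpha> \<beta> \<gamma>.
     bounded_cpx A X \<and> bounded_cpx A Y \<and> chain_map A X Y f \<and> is_cone A (X, f, Y) Q i j p q \<and>
     triangle_iso (Kb_pre A) \<Delta> (cone_triangle A (X, f, Y) Q j p) \<alpha> \<beta> \<gamma>}\<rparr>"

text \<open>The third map of the triangle of a short exact sequence \<open>A \<rightarrow> B \<rightarrow> C\<close>: the inverse of the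
  canonical map from the cone of \<open>a\<close> to \<open>C\<close>, given by \<open>(x, y) \<mapsto> b y\<close>, followed by the negative
  of the canonical projection.\<close>

definition connecting :: "('o, 'a, 'x) exact_cat_scheme \<Rightarrow> ('o, 'a) cmap \<times> ('o, 'a) cmap \<Rightarrow> ('o, 'a) hmap" where
  "connecting E = (\<lambda>((A, a, B), (B', b, C)). THE c. \<exists>Q i j p q k.
     is_cone E (A, a, B) Q i j p q \<and>
     inverse_arrows (Kb E) (to_Kb E (Q, \<lambda>n. b n \<bullet>\<^bsub>E\<^esub> q n, C)) k \<and>
     c = to_Kb E (Q, \<lambda>n. NegA E (p n), shift_cpx E A) \<bullet>\<^bsub>Kb E\<^esub> k)"

definition ses_triangle ::
  "('o, 'a, 'x) exact_cat_scheme \<Rightarrow> ('o, 'a) cmap \<times> ('o, 'a) cmap \<Rightarrow>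
   ('o, 'a) hmap \<times> ('o, 'a) hmap \<times> ('o, 'a) hmap" where
  "ses_triangle E = (\<lambda>(a, b). (to_Kb E a, to_Kb E b, connecting E (a, b)))"

definition induced_det ::
  "('o, 'a, 'x) exact_cat_scheme \<Rightarrow>
   (('o, 'a) cpx, ('o, 'a) hmap, 'p, 'b, ('o, 'a) hmap \<times> ('o, 'a) hmap \<times> ('o, 'a) hmap) det_func \<Rightarrow>
   (('o, 'a) cpx, ('o, 'a) cmap, 'p, 'b, ('o, 'a) cmap \<times> ('o, 'a) cmap) det_func" where
  "induced_det E g = \<lparr>FO = FO g, FA = FA g \<circ> to_Kb E, DS = DS g \<circ> ses_triangle E\<rparr>"

definition induced_func where
  "induced_func E = \<lparr>FO = induced_det E, FA = (\<lambda>(g, \<alpha>, g'). (induced_det E g, \<alpha>, induced_det E g'))\<rparr>"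


section \<open>Finitely generated projective modules\<close>

locale left_module = R?: ring R + M?: abelian_group M
  for R :: "('r, 'x) ring_scheme" and M :: "('r, 'm) module" (structure) +
  assumes smult_closed: "\<lbrakk>r \<in> carrier R; x \<in> carrier M\<rbrakk> \<Longrightarrow> r \<odot> x \<in> carrier M"
    and smult_l_distr: "\<lbrakk>r \<in> carrier R; s \<in> carrier R; x \<in> carrier M\<rbrakk>
      \<Longrightarrow> (r \<oplus>\<^bsub>R\<^esub> s) \<odot> x = r \<odot> x \<oplus> s \<odot> x"
    and smult_r_distr: "\<lbrakk>r \<in> carrier R; x \<in> carrier M; y \<in> carrier M\<rbrakk>
      \<Longrightarrow> r \<odot> (x \<oplus> y) = r \<odot> x \<oplus> r \<odot> y"
    and smult_assoc: "\<lbrakk>r \<in> carrier R; s \<in> carrier R; x \<in> carrier M\<rbrakk>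
      \<Longrightarrow> (r \<otimes>\<^bsub>R\<^esub> s) \<odot> x = r \<odot> (s \<odot> x)"
    and smult_one: "x \<in> carrier M \<Longrightarrow> \<one>\<^bsub>R\<^esub> \<odot> x = x"

definition mod_hom :: "('r, 'x) ring_scheme \<Rightarrow> ('r, 'm) module \<Rightarrow> ('r, 'm) module \<Rightarrow> ('m \<Rightarrow> 'm) set" where
  "mod_hom R M N = {f \<in> carrier M \<rightarrow>\<^sub>E carrier N.
     (\<forall>x\<in>carrier M. \<forall>y\<in>carrier M. f (x \<oplus>\<^bsub>M\<^esub> y) = f x \<oplus>\<^bsub>N\<^esub> f y) \<and>
     (\<forall>r\<in>carrier R. \<forall>x\<in>carrier M. f (r \<odot>\<^bsub>M\<^esub> x) = r \<odot>\<^bsub>N\<^esub> f x)}"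

definition finitely_generated :: "('r, 'x) ring_scheme \<Rightarrow> ('r, 'm) module \<Rightarrow> bool" where
  "finitely_generated R M \<longleftrightarrow> (\<exists>S. finite S \<and> S \<subseteq> carrier M \<and>
     (\<forall>N. submodule N R M \<and> S \<subseteq> N \<longrightarrow> N = carrier M))"

text \<open>The lifting property is tested against modules with elements in the same type \<open>'m\<close>. For
  finitely generated \<open>M\<close> this is the usual notion as soon as \<open>'m\<close> has room for the modules
  \<open>R\<^sup>n\<close>.\<close>

definition projective :: "('r, 'x) ring_scheme \<Rightarrow> ('r, 'm) module \<Rightarrow> bool" where
  "projective R M \<longleftrightarrow> (\<forall>(N :: ('r, 'm) module) (N' :: ('r, 'm) module).
     left_module R N \<and> left_module R N' \<longrightarrow>
     (\<forall>e\<in>mod_hom R N N'. \<forall>h\<in>mod_hom R M N'. e ` carrier N = carrier N' \<longrightarrow>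
        (\<exists>l\<in>mod_hom R M N. compose (carrier M) e l = h)))"

type_synonym ('r, 'm) mmap = "('r, 'm) module \<times> ('m \<Rightarrow> 'm) \<times> ('r, 'm) module"

definition fgp :: "('r, 'x) ring_scheme \<Rightarrow> ('r, 'm) module \<Rightarrow> bool" where
  "fgp R M \<longleftrightarrow> left_module R M \<and> finitely_generated R M \<and> projective R M"

definition Rproj :: "('r, 'x) ring_scheme \<Rightarrow> (('r, 'm) module, ('r, 'm) mmap) exact_cat" where
  "Rproj R =
     \<lparr>Obj = {M. fgp R M},
      Arr = {(M, f, N). fgp R M \<and> fgp R N \<and> f \<in> mod_hom R M N},
      Dom = (\<lambda>(M, f, N). M),
      Cod = (\<lambda>(M, f, N). N),
      Ident = (\<lambda>M. (M, \<lambda>x\<in>carrier M. x, M)),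
      Comp = (\<lambda>(N, g, L) (M, f, N'). (M, compose (carrier M) g f, L)),
      ZeroA = (\<lambda>M N. (M, \<lambda>x\<in>carrier M. \<zero>\<^bsub>N\<^esub>, N)),
      AddA = (\<lambda>(M, f, N) (M', g, N'). (M, \<lambda>x\<in>carrier M. f x \<oplus>\<^bsub>N\<^esub> g x, N)),
      NegA = (\<lambda>(M, f, N). (M, \<lambda>x\<in>carrier M. \<ominus>\<^bsub>N\<^esub> f x, N)),
      Ses = {((L, a, M), (M', b, N)). fgp R L \<and> fgp R M \<and> fgp R N \<and> M' = M \<and>
         a \<in> mod_hom R L M \<and> b \<in> mod_hom R M N \<and> inj_on a (carrier L) \<and>
         a ` carrier L = {x \<in> carrier M. b x = \<zero>\<^bsub>N\<^esub>} \<and> b ` carrier M = carrier N}\<rparr>"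

definition fun_of :: "('r, 'm) mmap \<Rightarrow> 'm \<Rightarrow> 'm" where
  "fun_of = (\<lambda>(M, f, N). f)"

definition cycles :: "(('r, 'm) module, ('r, 'm) mmap) cpx \<Rightarrow> int \<Rightarrow> 'm set" where
  "cycles X n = {x \<in> carrier (cob X n). fun_of (cdif X n) x = \<zero>\<^bsub>cob X (n + 1)\<^esub>}"

definition boundaries :: "(('r, 'm) module, ('r, 'm) mmap) cpx \<Rightarrow> int \<Rightarrow> 'm set" where
  "boundaries X n = fun_of (cdif X (n - 1)) ` carrier (cob X (n - 1))"

definition cohomology :: "(('r, 'm) module, ('r, 'm) mmap) cpx \<Rightarrow> int \<Rightarrow> 'm set monoid" where
  "cohomology X n = (add_monoid (cob X n)) \<lparr>carrier := cycles X n\<rparr> Mod boundaries X n"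

definition cohomology_map ::
  "(('r, 'm) module, ('r, 'm) mmap) cmap \<Rightarrow> int \<Rightarrow> 'm set \<Rightarrow> 'm set" where
  "cohomology_map = (\<lambda>(X, f, Y) n c. \<Union>x\<in>c. boundaries Y n +>\<^bsub>cob Y n\<^esub> fun_of (f n) x)"

definition qis :: "('r, 'x) ring_scheme \<Rightarrow> (('r, 'm) module, ('r, 'm) mmap) cmap set" where
  "qis R = {s \<in> Arr (Cb (Rproj R)). \<forall>n.
     bij_betw (cohomology_map s n)
       (carrier (cohomology (Dom (Cb (Rproj R)) s) n)) (carrier (cohomology (Cod (Cb (Rproj R)) s) n))}"

definition dual_numbers :: "('k, 'x) ring_scheme \<Rightarrow> 'k list set ring" where
  "dual_numbers k = (let A = (carrier k)[X]\<^bsub>k\<^esub> in A Quot (PIdl\<^bsub>A\<^esub> (var k [^]\<^bsub>A\<^esub> (2::nat))))"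


section \<open>The comparison map on K1\<close>

text \<open>\<open>M\<close> induces the homomorphism on \<open>K\<^sub>1\<close>, for universal determinant functors \<open>f\<close> to \<open>V\<close> and
  \<open>g\<close> to \<open>W\<close>.\<close>

definition comparison where
  "comparison R V f W g M \<longleftrightarrow> monoidal_functor V W M \<and>
     isomorphic (det_exact_cat (Cb (Rproj R)) (qis R) W)
       (postcomp_exact (Cb (Rproj R)) W M f) (induced_det (Rproj R) g)"

end

theory Submission
 imports Defs
begin

text \<open>
 \<^bold>\<open>The induced functor.\<close> All short exact sequences of finitely generated projective modules split, so
 a short exact sequence of bounded complexes is a degreewise splitting together with a connecting
 map \<open>t d s\<close>, which determines its triangle in the homotopy category. Quasi-isomorphisms between
 such complexes are homotopy equivalences because their cones are acyclic, hence contractible. The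
 axioms of a determinant functor pass from triangles to sequences because morphisms of sequences
 give morphisms of triangles (\<open>ses_triangle_natural\<close>), three nested sequences give an octahedron
 (\<open>ses_octahedron\<close>), and direct sums give split triangles. All these identities between graded maps
 are computed inside one associative ring, so that they become ring arithmetic.

 \<^bold>\<open>Surjectivity.\<close> Every isomorphism of the homotopy category lifts to a quasi-isomorphism, and every
 distinguished triangle is isomorphic to the triangle of a short exact sequence (\<open>Tri_ses\<close>). Let
 \<open>M : V \<rightarrow> W\<close> be the comparison functor and \<open>I\<close> the Picard category with the objects of \<open>V\<close> whose
 arrows are the images under \<open>M\<close>. All values of the universal functor \<open>g\<close> then come, up to the
 isomorphism of \<open>M f\<close> with the functor induced by \<open>g\<close>, from arrows of \<open>I\<close>; since \<open>I \<rightarrow> W\<close> is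
 faithful, this defines a determinant functor with values in \<open>I\<close> (locale \<open>det_lift\<close>). Universality
 of \<open>W\<close> turns it into a monoidal functor \<open>J : W \<rightarrow> I\<close>, and the composite \<open>W \<rightarrow> I \<rightarrow> W\<close> is isomorphic to
 the identity, again by universality. Hence every automorphism in \<open>W\<close> is conjugate to one in the
 image of \<open>M\<close>, which gives surjectivity on \<open>\<pi>\<^sub>1\<close>.

 \<^bold>\<open>Failure of injectivity.\<close> The automorphism \<open>1 + \<epsilon>\<close> of \<open>R\<close>, seen as a complex in degree \<open>0\<close>,
 becomes trivial in the homotopy category: in the triangle \<open>R \<rightarrow> R \<rightarrow> cone(\<epsilon>)\<close> the triple
 \<open>(1 + \<epsilon>, 1, 1)\<close> is an automorphism, since \<open>\<epsilon> (1 + \<epsilon>) = \<epsilon>\<close> and the third map satisfies \<open>\<epsilon> w = 0\<close> up to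
 homotopy; naturality then forces \<open>g (1 + \<epsilon>) = 1\<close> (\<open>det_tri_unipotent\<close>). It is not trivial for
 complexes. To see this one needs a determinant functor that detects it. With the derivation \<open>D\<close> of
 \<open>k[\<epsilon>]\<close> given by \<open>D (a + b \<epsilon>) = b \<epsilon>\<close>, one would like to use the logarithmic derivative \<open>D (det F) / det F\<close>.
 For an isomorphism of modules this is \<open>tr (F\<^sup>-\<^sup>1 D F)\<close>, where \<open>D F\<close> is taken entrywise with respect
 to dual bases. The pairing \<open>tr (a D f)\<close> is a Hochschild cocycle (\<open>lam_cocycle\<close>), and for a
 quasi-isomorphism it can be corrected by the homotopies belonging to a homotopy inverse; the result
 \<open>T F\<close> is additive under composition (\<open>T_comp\<close>) and independent of the homotopy inverse (\<open>tor_unique\<close>).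
 On short exact sequences \<open>T\<close> is additive up to the explicit correction \<open>\<delta>\<close> of the sequence
 (\<open>T_natural\<close>), which does not depend on the splitting (below, the
 letters \<open>rh\<close>, \<open>dl\<close>, \<open>al\<close> and so on stand for \<open>\<rho>\<close>, \<open>\<delta>\<close>, \<open>\<alpha>\<close>). Thus \<open>T\<close> and \<open>\<delta>\<close> form a determinant
 functor \<open>dlog\<close> on complexes with values in a Picard category with one object, and
 \<open>T (1 + \<epsilon>) = D \<epsilon> = \<epsilon>\<close> is not zero.\<close>

text \<open>Composition, tensor products and ring operations, with the structure as an explicit argument.\<close>

abbreviation (input) comp_in ("_ o[_] _" [71, 0, 70] 70) where "g o[C] f == Comp C g f"
abbreviation (input) tenA_in ("_ *a[_] _" [76, 0, 75] 75) where "f *a[P] g == TenA P f g"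
abbreviation (input) tenO_in ("_ *o[_] _" [76, 0, 75] 75) where "X *o[P] Y == TenO P X Y"
abbreviation (input) zero_in ("0[_]") where "0[R] == zero R"
abbreviation (input) one_in ("1[_]") where "1[R] == one R"
abbreviation (input) add_in ("_ +[_] _" [65, 0, 66] 65) where "x +[R] y == add R x y"
abbreviation (input) mult_in ("_ *[_] _" [70, 0, 71] 70) where "x *[R] y == mult R x y"
abbreviation (input) minus_in ("-[_] _" [0, 81] 80) where "-[R] x == a_inv R x"
abbreviation (input) smult_in ("_ \<odot>[_] _" [70, 0, 71] 70) where "r \<odot>[M] x == smult M r x"

notation Comp (infixr "oo\<index>" 70) and TenO (infixr "#o\<index>" 75) and TenA (infixr "#a\<index>" 75)
lemmas alg = algebra_simps and ma = mult.assoc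

section \<open>Categories and equivalences\<close>

context category
begin

lemma Arr_in_Hom: "f:Arr C ==> f:Hom C (Dom C f) (Cod C f)"
 by (simp add: Hom_def)

lemma id_arr [simp]: "X:Obj C ==> Ident C X:Arr C"
 and dom_id [simp]: "X:Obj C ==> Dom C (Ident C X) = X"
 and cod_id [simp]: "X:Obj C ==> Cod C (Ident C X) = X"
 using Ident_closed[of X] by (auto simp: Hom_def)

lemma comp_arr [simp]: "[|f:Arr C; g:Arr C; Dom C g = Cod C f|] ==> g oo f:Arr C"
 and dom_comp [simp]: "[|f:Arr C; g:Arr C; Dom C g = Cod C f|] ==> Dom C (g oo f) = Dom C f"
 and cod_comp [simp]: "[|f:Arr C; g:Arr C; Dom C g = Cod C f|] ==> Cod C (g oo f) = Cod C g"
 using Comp_closed[of f "Dom C f" "Cod C f" g "Cod C g"] by (auto simp: Hom_def)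

lemma assoc: "[|f:Arr C; g:Arr C; h:Arr C; Dom C g = Cod C f; Dom C h = Cod C g|]
  ==> (h oo g) oo f = h oo (g oo f)"
 using Comp_assoc[of f "Dom C f" "Cod C f" g "Cod C g" h "Cod C h"] by (auto simp: Hom_def)

lemma id_left [simp]: "[|f:Arr C; Cod C f = Y|] ==> Ident C Y oo f = f"
 and id_right [simp]: "[|f:Arr C; Dom C f = X|] ==> f oo Ident C X = f"
 using Ident_left[of f "Dom C f" "Cod C f"] Ident_right[of f "Dom C f" "Cod C f"]
 by (auto simp: Hom_def)

declare Dom_closed [simp] Cod_closed [simp]

lemma iso_cancel_left:
 assumes "h:iso_arrows C" "f:Arr C" "g:Arr C" "Cod C f = Dom C h" "Cod C g = Dom C h"
  "h oo f = h oo g"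
 shows "f = g"
proof -
 obtain k where k: "h:Arr C" "k:Arr C" "Dom C k = Cod C h" "Cod C k = Dom C h"
   "k oo h = Ident C (Dom C h)"
  using assms(1) by (auto simp: iso_arrows_def inverse_arrows_def Hom_def)
 have "(k oo h) oo f = (k oo h) oo g" using assms k(1-4) by (simp add: assoc)
 then show ?thesis using k(1-4) assms(2-5) unfolding k(5) by simp
qed

lemma iso_cancel_right:
 assumes "h:iso_arrows C" "f:Arr C" "g:Arr C" "Dom C f = Cod C h" "Dom C g = Cod C h"
  "f oo h = g oo h"
 shows "f = g"
proof -
 obtain k where k: "h:Arr C" "k:Arr C" "Dom C k = Cod C h" "Cod C k = Dom C h"
   "h oo k = Ident C (Cod C h)"
  using assms(1) by (auto simp: iso_arrows_def inverse_arrows_def Hom_def)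
 have "f oo (h oo k) = g oo (h oo k)" using assms k by (metis assoc)
 then show ?thesis using k assms by simp
qed

end

lemma functorD:
 assumes "is_functor C D F"
 shows "category C" "category D" "X:Obj C ==> FO F X:Obj D"
  "f:Arr C ==> FA F f:Arr D" "f:Arr C ==> Dom D (FA F f) = FO F (Dom C f)"
  "f:Arr C ==> Cod D (FA F f) = FO F (Cod C f)"
  "X:Obj C ==> FA F (Ident C X) = Ident D (FO F X)"
  "[|f:Arr C; g:Arr C; Dom C g = Cod C f|] ==> FA F (g o[C] f) = FA F g o[D] FA F f"
 using assms by (auto simp: is_functor_def Hom_def)

lemma natD:
 assumes "is_nat C D F G al"
 shows "X:Obj C ==> al X:Arr D" "X:Obj C ==> Dom D (al X) = FO F X"
  "X:Obj C ==> Cod D (al X) = FO G X"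
  "f:Arr C ==> al (Cod C f) o[D] FA F f = FA G f o[D] al (Dom C f)"
  "al:extensional (Obj C)"
 using assms by (auto simp: is_nat_def Hom_def)

lemma equivalence_faithful:
 fixes C :: "('o, 'a, 'x) cat_scheme" and D :: "('p, 'b, 'y) cat_scheme"
 assumes "is_equivalence C D F" "f:Hom C X Y" "g:Hom C X Y" "FA F f = FA F g"
 shows "f = g"
proof -
 obtain G :: "('p, 'b, 'o, 'a) func" and al be where F: "is_functor C D F" and G: "is_functor D C G"
  and al: "is_nat C C id_func (comp_func G F) al" "ALL X:Obj C. al X:iso_arrows C"
  using assms(1) unfolding is_equivalence_def is_nat_iso_def by blast
 interpret C: category C by (rule functorD[OF F])
 have f: "f:Arr C" "Dom C f = X" "Cod C f = Y" "g:Arr C" "Dom C g = X" "Cod C g = Y"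
  using assms by (auto simp: Hom_def)
 have "al Y o[C] f = al Y o[C] g"
  using natD(4)[OF al(1) f(1)] natD(4)[OF al(1) f(4)] assms(4) f
  by (simp add: id_func_def comp_func_def)
 moreover have "Y:Obj C" using f by auto
 ultimately show ?thesis
  using C.iso_cancel_left[of "al Y" f g] al(2) f natD(2)[OF al(1), of Y] by (simp add: id_func_def)
qed

text \<open>The preimage of \<open>t\<close> is \<open>G t\<close> conjugated by the unit; naturality of
 the counit shows that it is mapped to \<open>t\<close>.\<close>

lemma equivalence_full:
 fixes C :: "('o, 'a, 'x) cat_scheme" and D :: "('p, 'b, 'y) cat_scheme"
 assumes "is_equivalence C D F" "X:Obj C" "Y:Obj C" "t:Hom D (FO F X) (FO F Y)"
 shows "EX f:Hom C X Y. FA F f = t"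
proof -
 obtain G :: "('p, 'b, 'o, 'a) func" and al be where F: "is_functor C D F" and G: "is_functor D C G"
  and al: "is_nat C C id_func (comp_func G F) al" "ALL X:Obj C. al X:iso_arrows C"
  and be: "is_nat D D (comp_func F G) id_func be" "ALL X:Obj D. be X:iso_arrows D"
  using assms(1) unfolding is_equivalence_def is_nat_iso_def by blast
 interpret C: category C by (rule functorD[OF F])
 interpret D: category D by (rule functorD[OF F])
 note a = natD[OF al(1), unfolded id_func_def comp_func_def, simplified]
 note b = natD[OF be(1), unfolded id_func_def comp_func_def, simplified]
 have t: "t:Arr D" "Dom D t = FO F X" "Cod D t = FO F Y" using assms(4) by (auto simp: Hom_def)
 obtain k where k: "k:Arr C" "Dom C k = FO G (FO F Y)" "Cod C k = Y"
   "al Y o[C] k = Ident C (FO G (FO F Y))"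
  using al(2) assms(3) a(1-3)[of Y] by (auto simp: iso_arrows_def inverse_arrows_def Hom_def)
 define f where "f = k o[C] FA G t o[C] al X"
 have Gt: "FA G t:Arr C" "Dom C (FA G t) = FO G (FO F X)" "Cod C (FA G t) = FO G (FO F Y)"
  using functorD[OF G] t by auto
 have f: "f:Arr C" "Dom C f = X" "Cod C f = Y" using k Gt a assms by (auto simp: f_def)
 have "FA G (FA F f) o[C] al X = al Y o[C] f" using a(4)[OF f(1)] f by simp
 also have "... = FA G t o[C] al X"
  using a assms Gt k by (simp add: f_def C.assoc[symmetric])
 finally have "FA G (FA F f) = FA G t"
  using C.iso_cancel_right[of "al X" "FA G (FA F f)" "FA G t"] al(2) a assms Gt f functorD[OF F] functorD[OF G]
  by simp
 moreover have "FA F f:Arr D" "Dom D (FA F f) = FO F X" "Cod D (FA F f) = FO F Y"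
  using functorD[OF F] f by auto
 ultimately have "FA F f o[D] be (FO F X) = t o[D] be (FO F X)"
  using b(4)[of "FA F f"] b(4)[of t] t by simp
 then have "FA F f = t"
  using D.iso_cancel_right[of "be (FO F X)" "FA F f" t] be(2) b assms t functorD[OF F] f
  by simp
 then show ?thesis using f by (auto simp: Hom_def)
qed

lemma equivalence_eso:
 fixes C :: "('o, 'a, 'x) cat_scheme" and D :: "('p, 'b, 'y) cat_scheme"
 assumes "is_equivalence C D F" "Y:Obj D"
 shows "EX X:Obj C. isomorphic D (FO F X) Y"
proof -
 obtain G :: "('p, 'b, 'o, 'a) func" and al be where F: "is_functor C D F" and G: "is_functor D C G"
  and be: "is_nat D D (comp_func F G) id_func be" "ALL X:Obj D. be X:iso_arrows D"
  using assms(1) unfolding is_equivalence_def is_nat_iso_def by blast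
 show ?thesis
  using natD(1-3)[OF be(1) assms(2)] be(2) assms(2) functorD[OF G]
  by (intro bexI[of _ "FO G Y"]) (auto simp: isomorphic_def id_func_def comp_func_def Hom_def)
qed

lemma equivalenceI:
 fixes F :: "('o, 'a, 'p, 'b, 'z) func_scheme"
 assumes F: "is_functor C D F"
  and faithful: "!!X Y f g. f:Hom C X Y ==> g:Hom C X Y ==> FA F f = FA F g ==> f = g"
  and full: "!!X Y t. X:Obj C ==> Y:Obj C ==> t:Hom D (FO F X) (FO F Y)
   ==> EX f:Hom C X Y. FA F f = t"
  and eso: "!!Y. Y:Obj D ==> EX X:Obj C. isomorphic D (FO F X) Y"
 shows "is_equivalence C D F"
proof -
 interpret C: category C by (rule functorD[OF F])
 interpret D: category D by (rule functorD[OF F])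
 note f [simp] = functorD(3-8)[OF F]
 have "ALL Y. EX X b b'. Y:Obj D --> X:Obj C & b:Arr D & Dom D b = FO F X & Cod D b = Y &
   b':Arr D & Cod D b' = FO F X & Dom D b' = Y & b' o[D] b = Ident D (FO F X) &
   b o[D] b' = Ident D Y"
  using eso by (fastforce simp: isomorphic_def iso_arrows_def inverse_arrows_def Hom_def)
 then obtain g b b' where g: "!!Y. Y:Obj D ==> g Y:Obj C & b Y:Arr D &
   Dom D (b Y) = FO F (g Y) & Cod D (b Y) = Y &
   b' Y:Arr D & Cod D (b' Y) = FO F (g Y) & Dom D (b' Y) = Y &
   b' Y o[D] b Y = Ident D (FO F (g Y)) & b Y o[D] b' Y = Ident D Y"
  by metis
 then have gs [simp]: "!!Y. Y:Obj D ==> g Y:Obj C" "!!Y. Y:Obj D ==> b Y:Arr D"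
   "!!Y. Y:Obj D ==> Dom D (b Y) = FO F (g Y)" "!!Y. Y:Obj D ==> Cod D (b Y) = Y"
   "!!Y. Y:Obj D ==> b' Y:Arr D" "!!Y. Y:Obj D ==> Dom D (b' Y) = Y"
   "!!Y. Y:Obj D ==> Cod D (b' Y) = FO F (g Y)"
   "!!Y. Y:Obj D ==> b' Y o[D] b Y = Ident D (FO F (g Y))"
   "!!Y. Y:Obj D ==> b Y o[D] b' Y = Ident D Y"
  by blast+
 have bb [simp]: "b Y o[D] (b' Y o[D] x) = x" if "x:Arr D" "Cod D x = Y" for x Y
  using that D.assoc[of x "b' Y" "b Y"] D.Cod_closed[of x] by simp
 have b'b [simp]: "b' Y o[D] (b Y o[D] x) = x" if "x:Arr D" "Cod D x = FO F (g Y)" "Y:Obj D" for x Y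
  using that D.assoc[of x "b Y" "b' Y"] by simp
 have "ALL t. EX s. t:Arr D --> s:Hom C (g (Dom D t)) (g (Cod D t)) &
   FA F s = b' (Cod D t) o[D] t o[D] b (Dom D t)"
  using full by (fastforce simp: Hom_def)
 then obtain ga where "ALL t:Arr D. ga t:Hom C (g (Dom D t)) (g (Cod D t)) &
   FA F (ga t) = b' (Cod D t) o[D] t o[D] b (Dom D t)"
  by metis
 then have ga [simp]: "!!t. t:Arr D ==> ga t:Arr C" "!!t. t:Arr D ==> Dom C (ga t) = g (Dom D t)"
   "!!t. t:Arr D ==> Cod C (ga t) = g (Cod D t)"
   "!!t. t:Arr D ==> FA F (ga t) = b' (Cod D t) o[D] t o[D] b (Dom D t)"
  by (auto simp: Hom_def)
 have faithful': "s = t" if "s:Arr C" "t:Arr C" "Dom C s = Dom C t" "Cod C s = Cod C t" "FA F s = FA F t" for s t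
  using faithful[of s "Dom C s" "Cod C s" t] that by (auto simp: Hom_def)
 define G :: "('p, 'b, 'o, 'a) func" where "G = \<lparr>FO = g, FA = ga\<rparr>"
 have G: "is_functor D C G"
  unfolding is_functor_def G_def
  by (auto simp: C.category_axioms D.category_axioms Hom_def D.assoc intro!: faithful')
 have "ALL X. EX s. X:Obj C --> s:Hom C X (g (FO F X)) & FA F s = b' (FO F X)"
  using full by (fastforce simp: Hom_def)
 then obtain a where "ALL X:Obj C. a X:Hom C X (g (FO F X)) & FA F (a X) = b' (FO F X)"
  by metis
 then have a [simp]: "!!X. X:Obj C ==> a X:Arr C" "!!X. X:Obj C ==> Dom C (a X) = X"
   "!!X. X:Obj C ==> Cod C (a X) = g (FO F X)" "!!X. X:Obj C ==> FA F (a X) = b' (FO F X)"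
  by (auto simp: Hom_def)
 have "ALL X. EX s. X:Obj C --> s:Hom C (g (FO F X)) X & FA F s = b (FO F X)"
  using full by (fastforce simp: Hom_def)
 then obtain a' where "ALL X:Obj C. a' X:Hom C (g (FO F X)) X & FA F (a' X) = b (FO F X)"
  by metis
 then have a' [simp]: "!!X. X:Obj C ==> a' X:Arr C" "!!X. X:Obj C ==> Cod C (a' X) = X"
   "!!X. X:Obj C ==> Dom C (a' X) = g (FO F X)" "!!X. X:Obj C ==> FA F (a' X) = b (FO F X)"
  by (auto simp: Hom_def)
 have inv: "inverse_arrows C (a X) (a' X)" if "X:Obj C" for X
  using that by (auto simp: inverse_arrows_def Hom_def intro!: faithful')
 have "is_nat_iso C C id_func (comp_func G F) (restrict a (Obj C))"
  unfolding is_nat_iso_def is_nat_def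
  using inv by (auto simp: id_func_def comp_func_def G_def Hom_def D.assoc iso_arrows_def intro!: faithful')
 moreover have "inverse_arrows D (b Y) (b' Y)" if "Y:Obj D" for Y
  using that by (auto simp: inverse_arrows_def Hom_def)
 then have "is_nat_iso D D (comp_func F G) id_func (restrict b (Obj D))"
  unfolding is_nat_iso_def is_nat_def
  by (auto simp: id_func_def comp_func_def G_def Hom_def D.assoc iso_arrows_def)
 ultimately show ?thesis using F G unfolding is_equivalence_def by blast
qed

section \<open>Automorphisms in Picard categories\<close>

definition ginv :: "('o, 'a, 'x) cat_scheme => 'a => 'a" where
 "ginv C f = (SOME g. inverse_arrows C f g)"

context picard_category
begin

lemma arr_iso: "f:Arr P ==> f:iso_arrows P"
 using groupoid by blast

lemma inverse_ginv: "f:Arr P ==> inverse_arrows P f (ginv P f)"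
 unfolding ginv_def by (rule someI_ex) (use arr_iso in \<open>auto simp: iso_arrows_def\<close>)

lemma ginv [simp]:
 assumes "f:Arr P"
 shows "ginv P f:Arr P" "Dom P (ginv P f) = Cod P f" "Cod P (ginv P f) = Dom P f"
  "ginv P f oo f = Ident P (Dom P f)" "f oo ginv P f = Ident P (Cod P f)"
 using inverse_ginv[OF assms] by (auto simp: inverse_arrows_def Hom_def)

lemma ginv_cancel [simp]:
 assumes "f:Arr P" "x:Arr P"
 shows "Cod P x = Dom P f ==> ginv P f oo f oo x = x" "Cod P x = Cod P f ==> f oo ginv P f oo x = x"
proof -
 assume "Cod P x = Dom P f"
 then have "ginv P f oo f oo x = (ginv P f oo f) oo x" using assms by (subst assoc) auto
 then show "ginv P f oo f oo x = x" using assms \<open>Cod P x = Dom P f\<close> by (simp only: ginv id_left)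
next
 assume "Cod P x = Cod P f"
 then have "f oo ginv P f oo x = (f oo ginv P f) oo x" using assms by (subst assoc) auto
 then show "f oo ginv P f oo x = x" using assms \<open>Cod P x = Cod P f\<close> by (simp only: ginv id_left)
qed

lemma cancel_left:
 "[|h oo f = h oo g; h:Arr P; f:Arr P; g:Arr P; Cod P f = Dom P h; Cod P g = Dom P h|] ==> f = g"
 by (rule iso_cancel_left[of h]) (auto intro: arr_iso)

lemma cancel_right:
 "[|f oo h = g oo h; h:Arr P; f:Arr P; g:Arr P; Dom P f = Cod P h; Dom P g = Cod P h|] ==> f = g"
 by (rule iso_cancel_right[of h]) (auto intro: arr_iso)

lemma ten_arr [simp]:
 assumes "f:Arr P" "g:Arr P"
 shows "f #a g:Arr P" "Dom P (f #a g) = Dom P f #o Dom P g" "Cod P (f #a g) = Cod P f #o Cod P g"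
 using TenA_closed[OF Arr_in_Hom[OF assms(1)] Arr_in_Hom[OF assms(2)]] by (auto simp: Hom_def)

lemma phi_arr [simp]:
 assumes "X:Obj P" "Y:Obj P" "Z:Obj P"
 shows "\<phi> X Y Z:Arr P" "Dom P (\<phi> X Y Z) = X #o (Y #o Z)" "Cod P (\<phi> X Y Z) = (X #o Y) #o Z"
 using Phi_closed[OF assms] by (auto simp: Hom_def)

lemma psi_arr [simp]:
 assumes "X:Obj P" "Y:Obj P"
 shows "\<psi> X Y:Arr P" "Dom P (\<psi> X Y) = X #o Y" "Cod P (\<psi> X Y) = Y #o X"
 using Psi_closed[OF assms] by (auto simp: Hom_def)

declare TenO_closed [simp] Ten_Ident [simp]

lemma ten_comp:
 assumes "f:Arr P" "f':Arr P" "g:Arr P" "g':Arr P" "Dom P f' = Cod P f" "Dom P g' = Cod P g"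
 shows "(f' #a g') oo (f #a g) = (f' oo f) #a (g' oo g)"
 using Ten_Comp[of f "Dom P f" "Cod P f" f' "Cod P f'" g "Dom P g" "Cod P g" g' "Cod P g'"] assms
 by (auto simp: Hom_def)

lemma ten_comp_assoc:
 assumes "f:Arr P" "f':Arr P" "g:Arr P" "g':Arr P" "Dom P f' = Cod P f" "Dom P g' = Cod P g"
  "x:Arr P" "Cod P x = Dom P f #o Dom P g"
 shows "(f' #a g') oo (f #a g) oo x = ((f' oo f) #a (g' oo g)) oo x"
 using assoc[of x "f #a g" "f' #a g'"] ten_comp[of f f' g g'] assms by simp

lemma ginv_unique:
 assumes "f:Arr P" "g:Arr P" "Dom P g = Cod P f" "g oo f = Ident P (Dom P f)"
 shows "ginv P f = g"
proof -
 have "Cod P g = Dom P f" using assms cod_comp[of f g] by simp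
 then have "g = g oo f oo ginv P f" using assms by simp
 also have "... = (g oo f) oo ginv P f" using assms(1-3) by (simp only: assoc ginv)
 also have "... = ginv P f" using assms(1) unfolding assms(4) by simp
 finally show ?thesis by simp
qed

lemma phi_nat:
 assumes "f:Arr P" "g:Arr P" "h:Arr P"
 shows "\<phi> (Cod P f) (Cod P g) (Cod P h) oo (f #a g #a h) = ((f #a g) #a h) oo \<phi> (Dom P f) (Dom P g) (Dom P h)"
 using Phi_natural[OF assms[THEN Arr_in_Hom]] .

lemma psi_nat:
 assumes "f:Arr P" "g:Arr P"
 shows "\<psi> (Cod P f) (Cod P g) oo (f #a g) = (g #a f) oo \<psi> (Dom P f) (Dom P g)"
 using Psi_natural[OF assms[THEN Arr_in_Hom]] .

lemma ten_left_faithful: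
 assumes "Ident P X #a f = Ident P X #a g" "X:Obj P" "f:Arr P" "g:Arr P"
  "Dom P f = Dom P g" "Cod P f = Cod P g"
 shows "f = g"
 using equivalence_faithful[OF autoequivalence[OF assms(2)], of f "Dom P f" "Cod P f" g] assms
 by (auto simp: Hom_def)

lemma ten_left_full:
 assumes "X:Obj P" "Y:Obj P" "Z:Obj P" "t:Arr P" "Dom P t = X #o Y" "Cod P t = X #o Z"
 shows "EX f:Arr P. Dom P f = Y & Cod P f = Z & Ident P X #a f = t"
 using equivalence_full[OF autoequivalence[OF assms(1)] assms(2,3), of t] assms
 by (auto simp: Hom_def)

lemma ten_right_faithful:
 assumes "f #a Ident P X = g #a Ident P X" "X:Obj P" "f:Arr P" "g:Arr P"
  "Dom P f = Dom P g" "Cod P f = Cod P g"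
 shows "f = g"
proof -
 have "(Ident P X #a f) oo \<psi> (Dom P f) X = (Ident P X #a g) oo \<psi> (Dom P f) X"
  using psi_nat[of f "Ident P X"] psi_nat[of g "Ident P X"] assms by simp
 then have "Ident P X #a f = Ident P X #a g"
  by (rule cancel_right) (use assms in auto)
 then show ?thesis by (rule ten_left_faithful) (use assms in auto)
qed

text \<open>Eckmann--Hilton without a unit object: any automorphism of \<open>X \<otimes> X\<close> has the form
 \<open>1 \<otimes> b\<close> and also the form \<open>c \<otimes> 1\<close>, and these two kinds commute with each other.\<close>

lemma aut_commute:
 assumes "a:Hom P X X" "b:Hom P X X"
 shows "a oo b = b oo a"
proof -
 have ab [simp]: "a:Arr P" "Dom P a = X" "Cod P a = X" "b:Arr P" "Dom P b = X" "Cod P b = X"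
  using assms by (auto simp: Hom_def)
 then have X [simp]: "X:Obj P" by (metis Dom_closed)
 obtain c where c [simp]: "c:Arr P" "Dom P c = X" "Cod P c = X"
  and c': "Ident P X #a c = \<psi> X X oo (Ident P X #a b) oo ginv P (\<psi> X X)"
  using ten_left_full[of X X X "\<psi> X X oo (Ident P X #a b) oo ginv P (\<psi> X X)"] by auto
 have "\<psi> X X oo (c #a Ident P X) = (Ident P X #a c) oo \<psi> X X"
  using psi_nat[of c "Ident P X"] by simp
 also have "... = \<psi> X X oo (Ident P X #a b)"
  by (simp add: c' assoc)
 finally have cb: "c #a Ident P X = Ident P X #a b"
  by (rule cancel_left) auto
 have "Ident P X #a (a oo b) = (Ident P X #a a) oo (c #a Ident P X)"
  by (simp add: cb ten_comp)
 also have "... = (c #a Ident P X) oo (Ident P X #a a)"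
  by (simp add: ten_comp)
 also have "... = Ident P X #a (b oo a)"
  by (simp add: cb ten_comp)
 finally show ?thesis by (rule ten_left_faithful) auto
qed

lemma aut_exchange:
 assumes "a:Hom P X X"
 shows "a #a Ident P X = Ident P X #a a"
proof -
 have ab [simp]: "a:Arr P" "Dom P a = X" "Cod P a = X"
  using assms by (auto simp: Hom_def)
 then have X [simp]: "X:Obj P" by (metis Dom_closed)
 have "\<psi> X X oo (a #a Ident P X) = (Ident P X #a a) oo \<psi> X X"
  using psi_nat[of a "Ident P X"] by simp
 also have "... = \<psi> X X oo (Ident P X #a a)"
  by (rule aut_commute[of _ "X #o X"]) (auto simp: Hom_def)
 finally show ?thesis by (rule cancel_left) auto
qed

text \<open>The functor \<open>Z \<otimes> -\<close> is full, being an equivalence.\<close>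

lemma aut_transfer:
 assumes "a:Hom P Z Z" "Y:Obj P"
 shows "EX b:Hom P Y Y. a #a Ident P Y = Ident P Z #a b"
proof -
 have a: "a:Arr P" "Dom P a = Z" "Cod P a = Z" using assms by (auto simp: Hom_def)
 then have "Z:Obj P" by (metis Dom_closed)
 then show ?thesis
  using ten_left_full[of Z Y Y "a #a Ident P Y"] a assms(2) by (fastforce simp: Hom_def)
qed

lemma aut_transfer_coherent:
 assumes "a:Hom P Z Z" "b:Hom P X X" "c:Hom P Y Y"
  and ab: "a #a Ident P X = Ident P Z #a b" and ac: "a #a Ident P Y = Ident P Z #a c"
 shows "b #a Ident P Y = Ident P X #a c"
proof -
 have [simp]: "a:Arr P" "Dom P a = Z" "Cod P a = Z" "b:Arr P" "Dom P b = X" "Cod P b = X"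
  "c:Arr P" "Dom P c = Y" "Cod P c = Y"
  using assms by (auto simp: Hom_def)
 have [simp]: "X:Obj P" "Y:Obj P" "Z:Obj P"
  using Dom_closed[of a] Dom_closed[of b] Dom_closed[of c] by auto
 have "((Ident P X #a a) #a Ident P Y) oo \<phi> X Z Y = \<phi> X Z Y oo (Ident P X #a (a #a Ident P Y))"
  using phi_nat[of "Ident P X" a "Ident P Y"] by simp
 also have "... = \<phi> X Z Y oo (Ident P X #a (Ident P Z #a c))" by (simp add: ac)
 also have "... = (Ident P (X #o Z) #a c) oo \<phi> X Z Y"
  using phi_nat[of "Ident P X" "Ident P Z" c] by simp
 finally have 1: "(Ident P X #a a) #a Ident P Y = Ident P (X #o Z) #a c"
  by (rule cancel_right) auto
 have "(\<psi> Z X #a Ident P Y) oo ((a #a Ident P X) #a Ident P Y) =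
   ((Ident P X #a a) #a Ident P Y) oo (\<psi> Z X #a Ident P Y)"
  using psi_nat[of a "Ident P X"] by (simp add: ten_comp)
 also have "... = (\<psi> Z X #a Ident P Y) oo (Ident P (Z #o X) #a c)"
  by (simp add: 1 ten_comp)
 finally have 2: "(a #a Ident P X) #a Ident P Y = Ident P (Z #o X) #a c"
  by (rule cancel_left) auto
 have "\<phi> Z X Y oo (Ident P Z #a (b #a Ident P Y)) = ((Ident P Z #a b) #a Ident P Y) oo \<phi> Z X Y"
  using phi_nat[of "Ident P Z" b "Ident P Y"] by simp
 also have "... = (Ident P (Z #o X) #a c) oo \<phi> Z X Y" by (simp add: ab[symmetric] 2)
 also have "... = \<phi> Z X Y oo (Ident P Z #a (Ident P X #a c))"
  using phi_nat[of "Ident P Z" "Ident P X" c] by simp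
 finally have "Ident P Z #a (b #a Ident P Y) = Ident P Z #a (Ident P X #a c)"
  by (rule cancel_left) auto
 then show ?thesis by (rule ten_left_faithful) auto
qed

lemma pi1D:
 assumes "a:carrier (pi1 P)"
 shows "X:Obj P ==> a X:Arr P" "X:Obj P ==> Dom P (a X) = X" "X:Obj P ==> Cod P (a X) = X"
  "X:Obj P ==> Y:Obj P ==> a X #a Ident P Y = Ident P X #a a Y" "a:extensional (Obj P)"
 using assms by (auto simp: pi1_def Hom_def)

lemma pi1_eqI:
 assumes "a:carrier (pi1 P)" "b:carrier (pi1 P)" "X:Obj P" "a X = b X"
 shows "a = b"
proof (rule extensionalityI)
 fix Y assume Y: "Y:Obj P"
 have "Ident P X #a a Y = Ident P X #a b Y"
  using pi1D(4)[OF assms(1,3) Y] pi1D(4)[OF assms(2,3) Y] assms(4) by simp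
 then show "a Y = b Y"
  by (rule ten_left_faithful) (use Y assms(3) pi1D[OF assms(1)] pi1D[OF assms(2)] in auto)
qed (use pi1D(5) assms in auto)

lemma pi1_extend:
 assumes "Z:Obj P" "a:Hom P Z Z"
 shows "EX b:carrier (pi1 P). b Z = a"
proof -
 obtain b where b: "ALL Y:Obj P. b Y:Hom P Y Y & a #a Ident P Y = Ident P Z #a b Y"
  using aut_transfer[OF assms(2)] by metis
 have "b X #a Ident P Y = Ident P X #a b Y" if "X:Obj P" "Y:Obj P" for X Y
  using aut_transfer_coherent[OF assms(2)] b that by blast
 then have "restrict b (Obj P):carrier (pi1 P)"
  using b arr_iso by (auto simp: pi1_def Hom_def)
 moreover have "b Z = a"
 proof (rule ten_left_faithful)
  show "Ident P Z #a b Z = Ident P Z #a a" using b assms aut_exchange by auto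
 qed (use b assms in \<open>auto simp: Hom_def\<close>)
 ultimately show ?thesis using assms(1) by (intro bexI[of _ "restrict b (Obj P)"]) auto
qed

lemma pi1_natural:
 assumes "a:carrier (pi1 P)" "t:Arr P"
 shows "t oo a (Dom P t) = a (Cod P t) oo t"
proof -
 note [simp] = pi1D(1-3)[OF assms(1)] assms(2)
 have e: "a X #a Ident P X' = Ident P X #a a X'" if "X:Obj P" "X':Obj P" for X X'
  using that pi1D(4)[OF assms(1)] by simp
 let ?X = "Dom P t"
 have "(t oo a ?X) #a Ident P ?X = (t #a Ident P ?X) oo (a ?X #a Ident P ?X)"
  by (simp add: ten_comp)
 also have "... = (Ident P (Cod P t) #a a ?X) oo (t #a Ident P ?X)"
  by (simp add: e ten_comp)
 also have "... = (a (Cod P t) oo t) #a Ident P ?X"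
  by (simp add: e[symmetric] ten_comp)
 finally show ?thesis by (rule ten_right_faithful) auto
qed

lemma pi1_one: "one (pi1 P):carrier (pi1 P)"
 using arr_iso by (auto simp: pi1_def Hom_def)

lemma pi1_mult:
 assumes "a:carrier (pi1 P)" "b:carrier (pi1 P)"
 shows "a *[pi1 P] b:carrier (pi1 P)"
proof -
 note [simp] = pi1D(1-3)[OF assms(1)] pi1D(1-3)[OF assms(2)]
 have "(a X oo b X) #a Ident P Y = Ident P X #a (a Y oo b Y)" if [simp]: "X:Obj P" "Y:Obj P" for X Y
 proof -
  have "(a X oo b X) #a Ident P Y = (a X #a Ident P Y) oo (b X #a Ident P Y)" by (simp add: ten_comp)
  also have "... = Ident P X #a (a Y oo b Y)"
   by (simp add: pi1D(4)[OF assms(1)] pi1D(4)[OF assms(2)] ten_comp)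
  finally show ?thesis .
 qed
 then show ?thesis using arr_iso by (auto simp: pi1_def Hom_def)
qed

end

section \<open>Monoidal functors on automorphism groups\<close>

lemma monD:
 assumes "monoidal_functor P Q M"
 shows "is_functor P Q M"
  "[|X:Obj P; Y:Obj P|] ==> MC M X Y:Arr Q"
  "[|X:Obj P; Y:Obj P|] ==> Dom Q (MC M X Y) = FO M (X *o[P] Y)"
  "[|X:Obj P; Y:Obj P|] ==> Cod Q (MC M X Y) = FO M X *o[Q] FO M Y"
  "[|f:Arr P; g:Arr P|] ==> MC M (Cod P f) (Cod P g) o[Q] FA M (f *a[P] g) =
    (FA M f *a[Q] FA M g) o[Q] MC M (Dom P f) (Dom P g)"
  "[|X:Obj P; Y:Obj P; Z:Obj P|] ==>
    Phi Q (FO M X) (FO M Y) (FO M Z) o[Q]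
     (Ident Q (FO M X) *a[Q] MC M Y Z) o[Q] MC M X (Y *o[P] Z) =
    (MC M X Y *a[Q] Ident Q (FO M Z)) o[Q]
     MC M (X *o[P] Y) Z o[Q] FA M (Phi P X Y Z)"
  "[|X:Obj P; Y:Obj P|] ==>
    Psi Q (FO M X) (FO M Y) o[Q] MC M X Y = MC M Y X o[Q] FA M (Psi P X Y)"
 using assms unfolding monoidal_functor_def by (auto simp: Hom_def)

lemma pi1_map_ex:
 assumes P: "picard_category P" and Q: "picard_category Q" and M: "monoidal_functor P Q M"
  and a: "a:carrier (pi1 P)"
 shows "EX! b. b:carrier (pi1 Q) & (ALL X:Obj P. b (FO M X) = FA M (a X))"
proof -
 interpret P: picard_category P by fact
 interpret Q: picard_category Q by fact
 note [simp] = functorD(3-8)[OF monD(1)[OF M]] P.pi1D(1-3)[OF a] monD(2-4)[OF M]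
 obtain Z where Z [simp]: "Z:Obj P" using P.nonempty by blast
 obtain b where b: "b:carrier (pi1 Q)" "b (FO M Z) = FA M (a Z)"
  using Q.pi1_extend[of "FO M Z" "FA M (a Z)"] by (auto simp: Hom_def)
 have "b (FO M X) = FA M (a X)" if [simp]: "X:Obj P" for X
 proof -
  have "(FA M (a Z) *a[Q] FA M (Ident P X)) o[Q] MC M Z X =
    (FA M (Ident P Z) *a[Q] FA M (a X)) o[Q] MC M Z X"
   using monD(5)[OF M, of "a Z" "Ident P X"] monD(5)[OF M, of "Ident P Z" "a X"] P.pi1D(4)[OF a, of Z X]
   by simp
  then have "FA M (a Z) *a[Q] FA M (Ident P X) = FA M (Ident P Z) *a[Q] FA M (a X)"
   by (rule Q.cancel_right) auto
  then have "Ident Q (FO M Z) *a[Q] b (FO M X) = Ident Q (FO M Z) *a[Q] FA M (a X)"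
   using Q.pi1D(4)[OF b(1), of "FO M Z" "FO M X"] b(2) by simp
  then show ?thesis
   by (rule Q.ten_left_faithful) (auto simp: Q.pi1D[OF b(1)])
 qed
 moreover have "b' = b" if "b':carrier (pi1 Q)" "ALL X:Obj P. b' (FO M X) = FA M (a X)" for b'
  by (rule Q.pi1_eqI[of _ _ "FO M Z"]) (use that b in auto)
 ultimately show ?thesis using b by blast
qed

lemma pi1_mapD:
 assumes P: "picard_category P" and Q: "picard_category Q" and M: "monoidal_functor P Q M"
  and a: "a:carrier (pi1 P)"
 shows "pi1_map P Q M a:carrier (pi1 Q)" "X:Obj P ==> pi1_map P Q M a (FO M X) = FA M (a X)"
 using theI'[OF pi1_map_ex[OF assms]] a by (auto simp: pi1_map_def)

lemma pi1_map_eqI: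
 assumes P: "picard_category P" and Q: "picard_category Q" and M: "monoidal_functor P Q M"
  and a: "a:carrier (pi1 P)" and b: "b:carrier (pi1 Q)" and X: "X:Obj P" "b (FO M X) = FA M (a X)"
 shows "pi1_map P Q M a = b"
 using picard_category.pi1_eqI[OF Q pi1_mapD(1)[OF P Q M a] b _] pi1_mapD(2)[OF P Q M a X(1)] X
  functorD(3)[OF monD(1)[OF M]] by metis

lemma pi1_map_hom:
 assumes P: "picard_category P" and Q: "picard_category Q" and M: "monoidal_functor P Q M"
 shows "pi1_map P Q M:hom (pi1 P) (pi1 Q)"
proof (rule homI)
 interpret P: picard_category P by fact
 interpret Q: picard_category Q by fact
 obtain Z where Z [simp]: "Z:Obj P" using P.nonempty by blast
 fix a b assume ab: "a:carrier (pi1 P)" "b:carrier (pi1 P)"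
 show "pi1_map P Q M (a *[pi1 P] b) = pi1_map P Q M a *[pi1 Q] pi1_map P Q M b"
 proof (rule pi1_map_eqI[OF P Q M _ _ Z])
  have "(pi1_map P Q M a *[pi1 Q] pi1_map P Q M b) (FO M Z) = FA M (a Z) o[Q] FA M (b Z)"
   using pi1_mapD(2)[OF P Q M _ Z] ab functorD(3)[OF monD(1)[OF M] Z] by (simp add: pi1_def)
  also have "... = FA M (a Z o[P] b Z)"
   using functorD(8)[OF monD(1)[OF M]] P.pi1D[OF ab(1)] P.pi1D[OF ab(2)] by simp
  finally show "(pi1_map P Q M a *[pi1 Q] pi1_map P Q M b) (FO M Z) = FA M ((a *[pi1 P] b) Z)"
   by (simp add: pi1_def)
 qed (use P.pi1_mult Q.pi1_mult ab pi1_mapD(1)[OF P Q M] in auto)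
qed (use pi1_mapD(1)[OF P Q M] in auto)

lemma pi1_map_iso_invariant:
 assumes P: "picard_category P" and Q: "picard_category Q"
  and M: "monoidal_functor P Q M" and N: "monoidal_functor P Q N" and mu: "is_nat P Q M N mu"
 shows "pi1_map P Q M = pi1_map P Q N"
proof
 interpret P: picard_category P by fact
 interpret Q: picard_category Q by fact
 obtain Z where Z [simp]: "Z:Obj P" using P.nonempty by blast
 fix a
 show "pi1_map P Q M a = pi1_map P Q N a"
 proof (cases "a:carrier (pi1 P)")
  case a: True
  note [simp] = functorD(3-8)[OF monD(1)[OF M]] functorD(3-8)[OF monD(1)[OF N]] P.pi1D(1-3)[OF a] natD(1-3)[OF mu]
   Q.pi1D(1-3)[OF pi1_mapD(1)[OF P Q N a]] pi1_mapD(2)[OF P Q N a]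
  have "mu Z o[Q] FA M (a Z) = FA N (a Z) o[Q] mu Z" using natD(4)[OF mu, of "a Z"] by simp
  also have "... = mu Z o[Q] pi1_map P Q N a (FO M Z)"
   using Q.pi1_natural[OF pi1_mapD(1)[OF P Q N a], of "mu Z"] by simp
  finally have "FA M (a Z) = pi1_map P Q N a (FO M Z)" by (rule Q.cancel_left) auto
  then show ?thesis by (intro pi1_map_eqI[OF P Q M a _ Z]) (auto simp: pi1_mapD(1)[OF P Q N a])
 qed (auto simp: pi1_map_def)
qed

section \<open>The image of a monoidal functor\<close>

text \<open>Identifying parallel arrows of \<open>V\<close> with the same image under \<open>M\<close> factors \<open>M\<close> as a full functor
 followed by a faithful one. Each class is represented by a chosen member, so that the arrows of
 the quotient are again arrows of \<open>V\<close>.\<close>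

definition rep :: "('o, 'a, 'x) cat_scheme => ('o, 'a, 'p, 'b, 'z) func_scheme => 'a => 'a" where
 "rep V M a = (SOME b. b:Arr V & Dom V b = Dom V a & Cod V b = Cod V a & FA M b = FA M a)"

definition image_picard :: "('o, 'a) picard => ('o, 'a, 'p, 'b, 'z) func_scheme => ('o, 'a) picard" where
 "image_picard V M = \<lparr>Obj = Obj V, Arr = rep V M ` Arr V, Dom = Dom V, Cod = Cod V,
   Ident = (%X. rep V M (Ident V X)), Comp = (%g f. rep V M (g o[V] f)),
   TenO = TenO V, TenA = (%f g. rep V M (f *a[V] g)),
   Phi = (%X Y Z. rep V M (Phi V X Y Z)), Psi = (%X Y. rep V M (Psi V X Y))\<rparr>"

locale monoidal = V: picard_category V+W: picard_category W
 for V :: "('o, 'a) picard" and W :: "('p, 'b) picard" +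
 fixes M :: "('o, 'a, 'p, 'b) mon_func"
 assumes mon: "monoidal_functor V W M"
begin

abbreviation "I \<equiv> image_picard V M"
abbreviation "r \<equiv> rep V M"

lemmas M [simp] = functorD(3-8)[OF monD(1)[OF mon]]
lemmas MC [simp] = monD(2-4)[OF mon]

lemma r [simp]:
 assumes "a:Arr V"
 shows "r a:Arr V" "Dom V (r a) = Dom V a" "Cod V (r a) = Cod V a" "FA M (r a) = FA M a"
proof -
 have "r a:Arr V & Dom V (r a) = Dom V a & Cod V (r a) = Cod V a & FA M (r a) = FA M a"
  unfolding rep_def by (rule someI[of _ a]) (use assms in simp)
 then show "r a:Arr V" "Dom V (r a) = Dom V a" "Cod V (r a) = Cod V a" "FA M (r a) = FA M a"
  by blast+
qed

lemma r_eqI: "[|Dom V a = Dom V b; Cod V a = Cod V b; FA M a = FA M b|] ==> r a = r b"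
 by (simp add: rep_def)

lemma r_r [simp]: "a:Arr V ==> r (r a) = r a"
 by (rule r_eqI) auto

lemma M_ginv [simp]:
 assumes "f:Arr V"
 shows "FA M (ginv V f) = ginv W (FA M f)"
proof -
 have "FA M (ginv V f) o[W] FA M f = FA M (ginv V f o[V] f)" using assms by (simp del: V.ginv(4))
 then show ?thesis using assms by (intro W.ginv_unique[symmetric]) auto
qed

lemma M_ten:
 assumes "f:Arr V" "g:Arr V"
 shows "FA M (f *a[V] g) = ginv W (MC M (Cod V f) (Cod V g)) o[W] (FA M f *a[W] FA M g) o[W] MC M (Dom V f) (Dom V g)"
 using monD(5)[OF mon assms] assms by (simp flip: monD(5)[OF mon assms])

lemma r_comp [simp]:
 assumes "f:Arr V" "g:Arr V" "Dom V g = Cod V f"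
 shows "r (r g o[V] f) = r (g o[V] f)" "r (g o[V] r f) = r (g o[V] f)"
 using assms by (auto intro!: r_eqI)

lemma r_ten [simp]:
 assumes "f:Arr V" "g:Arr V"
 shows "r (r f *a[V] g) = r (f *a[V] g)" "r (f *a[V] r g) = r (f *a[V] g)"
 using assms by (auto intro!: r_eqI simp: M_ten)

lemma I_simps [simp]:
 "Obj I = Obj V" "Arr I = r ` Arr V" "Dom I = Dom V" "Cod I = Cod V" "Ident I X = r (Ident V X)"
 "Comp I g f = r (g o[V] f)" "TenO I X Y = TenO V X Y" "TenA I f g = r (f *a[V] g)"
 "Phi I X Y Z = r (Phi V X Y Z)" "Psi I X Y = r (Psi V X Y)"
 by (simp_all add: image_picard_def)

lemma Hom_I: "f:Hom I X Y \<longleftrightarrow> (EX a:Arr V. Dom V a = X & Cod V a = Y & f = r a)"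
 by (auto simp: Hom_def)

lemma I_category: "category I"
proof
 fix f X assume "f:Arr I"
 then show "Dom I f:Obj I" "Cod I f:Obj I" by auto
next
 fix X assume "X:Obj I" then show "Ident I X:Hom I X X" by (auto simp: Hom_def intro!: imageI)
next
 fix f X Y g Z assume "f:Hom I X Y" "g:Hom I Y Z"
 then show "g o[I] f:Hom I X Z" by (auto simp: Hom_def intro!: imageI)
next
 fix f W X g Y h Z assume "f:Hom I W X" "g:Hom I X Y" "h:Hom I Y Z"
 then show "h o[I] g o[I] f = (h o[I] g) o[I] f" by (auto simp: Hom_I V.assoc)
next
 fix f X Y assume "f:Hom I X Y"
 then show "Ident I Y o[I] f = f" "f o[I] Ident I X = f" by (auto simp: Hom_I)
qed

lemma I_inverse:
 assumes "f:Arr I"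
 shows "inverse_arrows I f (r (ginv V f))"
 using assms by (auto simp: inverse_arrows_def Hom_def intro!: r_eqI)

lemma I_iso: "isomorphic V X Y ==> isomorphic I X Y"
 using I_inverse by (fastforce simp: isomorphic_def Hom_def iso_arrows_def)

lemma I_autoequivalence:
 assumes X [simp]: "X:Obj V"
 shows "is_equivalence I I \<lparr>FO = TenO I X, FA = TenA I (Ident I X)\<rparr>" (is "is_equivalence I I ?F")
proof (rule equivalenceI)
 show "is_functor I I ?F"
  unfolding is_functor_def using I_category
  by (auto simp: Hom_def V.ten_comp intro!: imageI r_eqI)
next
 fix Y Z f g assume fg: "f:Hom I Y Z" "g:Hom I Y Z" and eq: "FA ?F f = FA ?F g"
 obtain a b where ab [simp]: "f = r a" "g = r b" "a:Arr V" "b:Arr V" "Dom V a = Y" "Dom V b = Y"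
   "Cod V a = Z" "Cod V b = Z"
  using fg by (auto simp: Hom_I)
 have [simp]: "Y:Obj V" "Z:Obj V" using V.Dom_closed[of a] V.Cod_closed[of a] by simp_all
 have "FA M (Ident V X *a[V] a) = FA M (Ident V X *a[V] b)"
  using arg_cong[OF eq, of "FA M"] by simp
 then have "MC M X Z o[W] FA M (Ident V X *a[V] a) = MC M X Z o[W] FA M (Ident V X *a[V] b)" by simp
 then have "(Ident W (FO M X) *a[W] FA M a) o[W] MC M X Y = (Ident W (FO M X) *a[W] FA M b) o[W] MC M X Y"
  using monD(5)[OF mon, of "Ident V X" a] monD(5)[OF mon, of "Ident V X" b] by simp
 then have "Ident W (FO M X) *a[W] FA M a = Ident W (FO M X) *a[W] FA M b"
  by (rule W.cancel_right) auto
 then have "FA M a = FA M b" by (rule W.ten_left_faithful) auto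
 then show "f = g" by (auto intro!: r_eqI)
next
 fix Y Z t assume "Y:Obj I" "Z:Obj I" "t:Hom I (FO ?F Y) (FO ?F Z)"
 then obtain a where [simp]: "Y:Obj V" "Z:Obj V" "a:Arr V" "t = r a"
   "Dom V a = X *o[V] Y" "Cod V a = X *o[V] Z"
  by (auto simp: Hom_I)
 obtain b where "b:Arr V" "Dom V b = Y" "Cod V b = Z" "Ident V X *a[V] b = a"
  using V.ten_left_full[of X Y Z a] by auto
 then show "EX f:Hom I Y Z. FA ?F f = t" by (intro bexI[of _ "r b"]) (auto simp: Hom_I)
next
 fix Y assume "Y:Obj I"
 then show "EX Z:Obj I. isomorphic I (FO ?F Z) Y"
  using equivalence_eso[OF V.autoequivalence[OF X], of Y] I_iso by auto
qed

lemma I_picard: "picard_category I"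
proof -
 interpret I: category I by (rule I_category)
 show ?thesis
 proof
  show "Obj I ~= {}" using V.nonempty by simp
  show "Arr I <= iso_arrows I" using I_inverse by (auto simp: iso_arrows_def simp del: I_simps)
  show "X *o[I] Y:Obj I" if "X:Obj I" "Y:Obj I" for X Y using that by simp
  show "f *a[I] g:Hom I (X *o[I] Y) (X' *o[I] Y')" if "f:Hom I X X'" "g:Hom I Y Y'" for f g X Y X' Y'
   using that by (auto simp: Hom_def intro!: imageI)
  show "Ident I X *a[I] Ident I Y = Ident I (X *o[I] Y)" if "X:Obj I" "Y:Obj I" for X Y
   using that by simp
  show "(f' o[I] f) *a[I] (g' o[I] g) = (f' *a[I] g') o[I] (f *a[I] g)"
   if "f:Hom I X X'" "f':Hom I X' X''" "g:Hom I Y Y'" "g':Hom I Y' Y''" for f g f' g' X Y X' Y' X'' Y''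
   using that by (auto simp: Hom_I V.ten_comp)
  show "Phi I X Y Z:Hom I (X *o[I] (Y *o[I] Z)) ((X *o[I] Y) *o[I] Z)"
   if "X:Obj I" "Y:Obj I" "Z:Obj I" for X Y Z using that by (auto simp: Hom_def)
  show "Phi I X' Y' Z' o[I] (f *a[I] (g *a[I] h)) = ((f *a[I] g) *a[I] h) o[I] Phi I X Y Z"
   if "f:Hom I X X'" "g:Hom I Y Y'" "h:Hom I Z Z'" for f g h X Y Z X' Y' Z'
  proof -
   obtain a b c where "a:Arr V" "b:Arr V" "c:Arr V" "f = r a" "g = r b" "h = r c"
    "Dom V a = X" "Cod V a = X'" "Dom V b = Y" "Cod V b = Y'" "Dom V c = Z" "Cod V c = Z'"
    using \<open>f:Hom I X X'\<close> \<open>g:Hom I Y Y'\<close> \<open>h:Hom I Z Z'\<close> unfolding Hom_I by blast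
   then show ?thesis using V.phi_nat[of a b c] by auto
  qed
  show "Psi I X Y:Hom I (X *o[I] Y) (Y *o[I] X)" if "X:Obj I" "Y:Obj I" for X Y
   using that by (auto simp: Hom_def)
  show "Psi I X' Y' o[I] (f *a[I] g) = (g *a[I] f) o[I] Psi I X Y"
   if "f:Hom I X X'" "g:Hom I Y Y'" for f g X Y X' Y'
  proof -
   obtain a b where "a:Arr V" "b:Arr V" "f = r a" "g = r b"
    "Dom V a = X" "Cod V a = X'" "Dom V b = Y" "Cod V b = Y'"
    using \<open>f:Hom I X X'\<close> \<open>g:Hom I Y Y'\<close> unfolding Hom_I by blast
   then show ?thesis using V.psi_nat[of a b] by auto
  qed
  show "Psi I Y X o[I] Psi I X Y = Ident I (X *o[I] Y)" if "X:Obj I" "Y:Obj I" for X Y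
   using that by (simp add: V.Psi_symmetry)
  show "Phi I (W *o[I] X) Y Z o[I] Phi I W X (Y *o[I] Z) =
     (Phi I W X Y *a[I] Ident I Z) o[I] Phi I W (X *o[I] Y) Z o[I] (Ident I W *a[I] Phi I X Y Z)"
   if "W:Obj I" "X:Obj I" "Y:Obj I" "Z:Obj I" for W X Y Z
   using that V.pentagon[of W X Y Z] by simp
  show "Phi I Z X Y o[I] Psi I (X *o[I] Y) Z o[I] Phi I X Y Z =
     (Psi I X Z *a[I] Ident I Y) o[I] Phi I X Z Y o[I] (Ident I X *a[I] Psi I Y Z)"
   if "X:Obj I" "Y:Obj I" "Z:Obj I" for X Y Z
   using that V.hexagon[of X Y Z] by simp
  show "is_equivalence I I \<lparr>FO = TenO I X, FA = TenA I (Ident I X)\<rparr>" if "X:Obj I" for X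
   using I_autoequivalence that by simp
 qed
qed

lemma I_monoidal: "monoidal_functor I W M"
 unfolding monoidal_functor_def is_functor_def
 using I_category W.category_axioms W.arr_iso monD(5-7)[OF mon]
 by (auto simp: Hom_def)

end

lemma comp_monoidal:
 assumes P: "picard_category P" and Q: "picard_category Q" and R: "picard_category R"
  and M: "monoidal_functor P Q M" and N: "monoidal_functor Q R N"
 shows "monoidal_functor P R \<lparr>FO = FO N \<circ> FO M, FA = FA N \<circ> FA M,
  MC = (%X Y. MC N (FO M X) (FO M Y) o[R] FA N (MC M X Y))\<rparr>"
proof -
 interpret P: picard_category P by fact
 interpret Q: picard_category Q by fact
 interpret R: picard_category R by fact
 note m [simp] = functorD(3-8)[OF monD(1)[OF M]] functorD(3-8)[OF monD(1)[OF N]] monD(2-4)[OF M] monD(2-4)[OF N]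
 have 1: "(MC N (FO M (Cod P f)) (FO M (Cod P g)) o[R] FA N (MC M (Cod P f) (Cod P g))) o[R] FA N (FA M (f *a[P] g)) =
    (FA N (FA M f) *a[R] FA N (FA M g)) o[R] MC N (FO M (Dom P f)) (FO M (Dom P g)) o[R] FA N (MC M (Dom P f) (Dom P g))"
  if [simp]: "f:Arr P" "g:Arr P" for f g
 proof -
  have "(MC N (FO M (Cod P f)) (FO M (Cod P g)) o[R] FA N (MC M (Cod P f) (Cod P g))) o[R] FA N (FA M (f *a[P] g)) =
    MC N (FO M (Cod P f)) (FO M (Cod P g)) o[R] FA N (MC M (Cod P f) (Cod P g) o[Q] FA M (f *a[P] g))"
   by (simp add: R.assoc)
  also have "... = MC N (FO M (Cod P f)) (FO M (Cod P g)) o[R] FA N (FA M f *a[Q] FA M g) o[R] FA N (MC M (Dom P f) (Dom P g))"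
   by (simp add: monD(5)[OF M])
  also have "... = (MC N (FO M (Cod P f)) (FO M (Cod P g)) o[R] FA N (FA M f *a[Q] FA M g)) o[R] FA N (MC M (Dom P f) (Dom P g))"
   by (simp add: R.assoc)
  also have "... = (FA N (FA M f) *a[R] FA N (FA M g)) o[R] MC N (FO M (Dom P f)) (FO M (Dom P g)) o[R] FA N (MC M (Dom P f) (Dom P g))"
   using monD(5)[OF N, of "FA M f" "FA M g"] by (simp add: R.assoc)
  finally show ?thesis .
 qed
 have 2: "Phi R (FO N (FO M X)) (FO N (FO M Y)) (FO N (FO M Z)) o[R]
     (Ident R (FO N (FO M X)) *a[R] (MC N (FO M Y) (FO M Z) o[R] FA N (MC M Y Z))) o[R]
     MC N (FO M X) (FO M (Y *o[P] Z)) o[R] FA N (MC M X (Y *o[P] Z)) =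
    ((MC N (FO M X) (FO M Y) o[R] FA N (MC M X Y)) *a[R] Ident R (FO N (FO M Z))) o[R]
     (MC N (FO M (X *o[P] Y)) (FO M Z) o[R] FA N (MC M (X *o[P] Y) Z)) o[R] FA N (FA M (Phi P X Y Z))"
  (is "?L = ?R") if o [simp]: "X:Obj P" "Y:Obj P" "Z:Obj P" for X Y Z
 proof -
  let ?X = "FO M X" and ?Y = "FO M Y" and ?Z = "FO M Z"
  let ?f = "Phi R (FO N ?X) (FO N ?Y) (FO N ?Z)"
  have n1: "(Ident R (FO N ?X) *a[R] FA N (MC M Y Z)) o[R] MC N ?X (FO M (Y *o[P] Z)) =
    MC N ?X (?Y *o[Q] ?Z) o[R] FA N (Ident Q ?X *a[Q] MC M Y Z)"
   using monD(5)[OF N, of "Ident Q ?X" "MC M Y Z"] by simp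
  have n2: "(FA N (MC M X Y) *a[R] Ident R (FO N ?Z)) o[R] MC N (FO M (X *o[P] Y)) ?Z =
    MC N (?X *o[Q] ?Y) ?Z o[R] FA N (MC M X Y *a[Q] Ident Q ?Z)"
   using monD(5)[OF N, of "MC M X Y" "Ident Q ?Z"] by simp
  have "?L = ?f o[R] (Ident R (FO N ?X) *a[R] MC N ?Y ?Z) o[R]
   ((Ident R (FO N ?X) *a[R] FA N (MC M Y Z)) o[R] MC N ?X (FO M (Y *o[P] Z))) o[R] FA N (MC M X (Y *o[P] Z))"
   by (simp add: R.assoc R.ten_comp_assoc)
  also have "... = (?f o[R] (Ident R (FO N ?X) *a[R] MC N ?Y ?Z) o[R] MC N ?X (?Y *o[Q] ?Z)) o[R]
   FA N ((Ident Q ?X *a[Q] MC M Y Z) o[Q] MC M X (Y *o[P] Z))"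
   unfolding n1 by (simp add: R.assoc)
  also have "... = ((MC N ?X ?Y *a[R] Ident R (FO N ?Z)) o[R] MC N (?X *o[Q] ?Y) ?Z o[R] FA N (Phi Q ?X ?Y ?Z)) o[R]
   FA N ((Ident Q ?X *a[Q] MC M Y Z) o[Q] MC M X (Y *o[P] Z))"
   using monD(6)[OF N, of ?X ?Y ?Z] by simp
  also have "... = (MC N ?X ?Y *a[R] Ident R (FO N ?Z)) o[R] MC N (?X *o[Q] ?Y) ?Z o[R]
   FA N (Phi Q ?X ?Y ?Z o[Q] (Ident Q ?X *a[Q] MC M Y Z) o[Q] MC M X (Y *o[P] Z))"
   by (simp add: R.assoc)
  also have "... = (MC N ?X ?Y *a[R] Ident R (FO N ?Z)) o[R] (MC N (?X *o[Q] ?Y) ?Z o[R]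
   FA N (MC M X Y *a[Q] Ident Q ?Z)) o[R] FA N (MC M (X *o[P] Y) Z o[Q] FA M (Phi P X Y Z))"
   unfolding monD(6)[OF M o] by (simp add: R.assoc)
  also have "... = (MC N ?X ?Y *a[R] Ident R (FO N ?Z)) o[R] ((FA N (MC M X Y) *a[R] Ident R (FO N ?Z)) o[R] MC N (FO M (X *o[P] Y)) ?Z) o[R]
   FA N (MC M (X *o[P] Y) Z o[Q] FA M (Phi P X Y Z))"
   unfolding n2 ..
  also have "... = ?R"
   by (simp add: R.assoc R.ten_comp_assoc)
  finally show ?thesis .
 qed
 have 3: "Psi R (FO N (FO M X)) (FO N (FO M Y)) o[R] MC N (FO M X) (FO M Y) o[R] FA N (MC M X Y) =
   (MC N (FO M Y) (FO M X) o[R] FA N (MC M Y X)) o[R] FA N (FA M (Psi P X Y))"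
  if o [simp]: "X:Obj P" "Y:Obj P" for X Y
 proof -
  have "Psi R (FO N (FO M X)) (FO N (FO M Y)) o[R] MC N (FO M X) (FO M Y) o[R] FA N (MC M X Y) =
    (Psi R (FO N (FO M X)) (FO N (FO M Y)) o[R] MC N (FO M X) (FO M Y)) o[R] FA N (MC M X Y)" by (simp add: R.assoc)
  also have "... = MC N (FO M Y) (FO M X) o[R] FA N (Psi Q (FO M X) (FO M Y) o[Q] MC M X Y)"
   using monD(7)[OF N, of "FO M X" "FO M Y"] by (simp add: R.assoc)
  also have "... = (MC N (FO M Y) (FO M X) o[R] FA N (MC M Y X)) o[R] FA N (FA M (Psi P X Y))"
   unfolding monD(7)[OF M o] by (simp add: R.assoc)
  finally show ?thesis .
 qed
 show ?thesis
  unfolding monoidal_functor_def is_functor_def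
  using P.category_axioms R.category_axioms R.arr_iso 1 2 3
  by (auto simp: Hom_def)
qed

lemma id_monoidal:
 assumes "picard_category P"
 shows "monoidal_functor P P \<lparr>FO = (%X. X), FA = (%f. f), MC = (%X Y. Ident P (X *o[P] Y))\<rparr>"
proof -
 interpret P: picard_category P by fact
 show ?thesis
  unfolding monoidal_functor_def is_functor_def
  using P.category_axioms P.arr_iso by (auto simp: Hom_def)
qed

section \<open>Picard categories with one object\<close>

text \<open>An abelian group \<open>G\<close>, encoded injectively by \<open>e\<close>, as the automorphism group of a single object.\<close>

definition group_picard :: "('g, 'x) monoid_scheme => ('g => 'u) => ('u, 'u) picard" where
 "group_picard G e = (let op = (%x y. e (inv_into (carrier G) e x *[G] inv_into (carrier G) e y)) in
   \<lparr>Obj = {undefined}, Arr = e ` carrier G, Dom = (%_. undefined), Cod = (%_. undefined),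
   Ident = (%_. e 1[G]), Comp = op, TenO = (%_ _. undefined), TenA = op,
   Phi = (%_ _ _. e 1[G]), Psi = (%_ _. e 1[G])\<rparr>)"

context comm_group
begin

context
 fixes e :: "'a => 'u"
 assumes e: "inj_on e (carrier G)"
begin

abbreviation "B \<equiv> group_picard G e"

lemma group_picard_simps [simp]:
 "Obj B = {undefined}" "Arr B = e ` carrier G" "Dom B f = undefined" "Cod B f = undefined"
 "Ident B X = e \<one>" "TenO B X Y = undefined" "Phi B X Y Z = e \<one>" "Psi B X Y = e \<one>"
 "[|x:carrier G; y:carrier G|] ==> Comp B (e x) (e y) = e (x \<otimes> y)"
 "[|x:carrier G; y:carrier G|] ==> TenA B (e x) (e y) = e (x \<otimes> y)"
 by (simp_all add: group_picard_def Let_def e)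

lemma group_picard_hom: "f:Hom B X Y \<longleftrightarrow> X = undefined & Y = undefined & f:e ` carrier G"
 by (auto simp: Hom_def)

lemma group_picard: "picard_category B"
proof -
 have c: "category B"
  by unfold_locales (auto simp: group_picard_hom m_assoc)
 then interpret category B .
 have iso: "Arr B <= iso_arrows B"
 proof
  fix f assume "f:Arr B"
  then obtain x where "x:carrier G" "f = e x" by auto
  then have "inverse_arrows B f (e (inv x))" by (auto simp: inverse_arrows_def group_picard_hom)
  then show "f:iso_arrows B" by (auto simp: iso_arrows_def)
 qed
 have "is_equivalence B B \<lparr>FO = (%Y. undefined), FA = (%f. Comp B (e \<one>) f)\<rparr>"
 proof (rule equivalenceI)
  fix Y assume "Y:Obj B"
  moreover have "e \<one>:Hom B undefined undefined \<inter> iso_arrows B"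
   using iso by (auto simp: group_picard_hom)
  ultimately show "EX Z:Obj B. isomorphic B (FO \<lparr>FO = %Y. undefined, FA = Comp B (e \<one>)\<rparr> Z) Y"
   by (auto simp: isomorphic_def)
 qed (force simp: is_functor_def c group_picard_hom)+
 moreover have "TenA B f g = Comp B f g" for f g by (simp add: group_picard_def Let_def)
 ultimately show ?thesis
  by unfold_locales (use iso in \<open>auto simp: group_picard_hom m_ac\<close>)
qed

end

end

section \<open>Finitely generated projective modules\<close>

text \<open>It is injective because \<open>'m\<close> will be infinite, and lets direct sums have
 carriers in the same type.\<close>

definition pr :: "'m \<times> 'm => 'm" where
 "pr = (SOME f. inj f)"

definition dsum :: "('r, 'm) module => ('r, 'm) module => ('r, 'm) module" where
 "dsum M N = (let fst' = (%z. fst (inv_into UNIV pr z)); snd' = (%z. snd (inv_into UNIV pr z)) in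
   \<lparr>carrier = pr ` (carrier M \<times> carrier N), mult = undefined, one = undefined,
   zero = pr (0[M], 0[N]),
   add = (%z z'. pr (fst' z +[M] fst' z', snd' z +[N] snd' z')),
   smult = (%r z. pr (r \<odot>[M] fst' z, r \<odot>[N] snd' z))\<rparr>)"

definition zmod :: "('r, 'm) module" where
 "zmod = \<lparr>carrier = {undefined}, mult = undefined, one = undefined, zero = undefined,
   add = (%_ _. undefined), smult = (%_ _. undefined)\<rparr>"

definition regular :: "'r ring => ('r => 'm) => ('r, 'm) module" where
 "regular R e = (let d = inv_into (carrier R) e in
   \<lparr>carrier = e ` carrier R, mult = undefined, one = undefined, zero = e 0[R],
   add = (%x y. e (d x +[R] d y)), smult = (%r x. e (r *[R] d x))\<rparr>)"

lemma left_moduleI: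
 assumes "ring R"
  and "!!x y. [|x:carrier M; y:carrier M|] ==> x +[M] y:carrier M"
  and "0[M]:carrier M"
  and "!!x y z. [|x:carrier M; y:carrier M; z:carrier M|] ==> (x +[M] y) +[M] z = x +[M] (y +[M] z)"
  and "!!x y. [|x:carrier M; y:carrier M|] ==> x +[M] y = y +[M] x"
  and "!!x. x:carrier M ==> 0[M] +[M] x = x"
  and "!!x. x:carrier M ==> EX y:carrier M. y +[M] x = 0[M]"
  and "!!r x. [|r:carrier R; x:carrier M|] ==> r \<odot>[M] x:carrier M"
  and "!!r s x. [|r:carrier R; s:carrier R; x:carrier M|]
   ==> (r +[R] s) \<odot>[M] x = r \<odot>[M] x +[M] s \<odot>[M] x"
  and "!!r x y. [|r:carrier R; x:carrier M; y:carrier M|]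
   ==> r \<odot>[M] (x +[M] y) = r \<odot>[M] x +[M] r \<odot>[M] y"
  and "!!r s x. [|r:carrier R; s:carrier R; x:carrier M|]
   ==> (r *[R] s) \<odot>[M] x = r \<odot>[M] (s \<odot>[M] x)"
  and "!!x. x:carrier M ==> 1[R] \<odot>[M] x = x"
 shows "left_module R M"
proof -
 interpret ring R by fact
 interpret M: abelian_group M by (rule abelian_groupI) (use assms in auto)
 show ?thesis
  by (intro left_module.intro left_module_axioms.intro) (use assms M.abelian_group_axioms in auto)
qed

lemma (in left_module) smult_zero: "r:carrier R ==> r \<odot> \<zero> = \<zero>"
 using smult_r_distr[of r \<zero> \<zero>] smult_closed[of r \<zero>] M.l_neg M.add.r_cancel_one by (metis M.zero_closed M.l_zero)

lemma (in left_module) smult_minus: "[|r:carrier R; x:carrier M|] ==> r \<odot> (\<ominus> x) = \<ominus> (r \<odot> x)"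
 using smult_r_distr[of r "\<ominus> x" x] smult_closed[of r] M.l_neg smult_zero
 by (metis M.a_inv_closed M.minus_equality)

lemma (in left_module) smult_ring_zero: "x:carrier M ==> 0[R] \<odot> x = \<zero>"
 using smult_l_distr[of "0[R]" "0[R]" x] smult_closed[of "0[R]" x]
 by (metis R.zero_closed R.l_zero M.add.l_cancel_one)

lemma mod_homD:
 assumes "f:mod_hom R M N"
 shows "x:carrier M ==> f x:carrier N"
  "x:carrier M ==> y:carrier M ==> f (x +[M] y) = f x +[N] f y"
  "r:carrier R ==> x:carrier M ==> f (r \<odot>[M] x) = r \<odot>[N] f x"
  "f:extensional (carrier M)"
 using assms by (auto simp: mod_hom_def PiE_def)

lemma mod_homI:
 assumes "!!x. x:carrier M ==> f x:carrier N"
  "!!x y. x:carrier M ==> y:carrier M ==> f (x +[M] y) = f x +[N] f y"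
  "!!r x. r:carrier R ==> x:carrier M ==> f (r \<odot>[M] x) = r \<odot>[N] f x"
  "f:extensional (carrier M)"
 shows "f:mod_hom R M N"
 using assms by (auto simp: mod_hom_def PiE_def)

lemma mod_hom_zero:
 assumes "f:mod_hom R M N" "abelian_group M" "abelian_group N"
 shows "f 0[M] = 0[N]"
proof -
 interpret M: abelian_group M by fact
 interpret N: abelian_group N by fact
 have "f 0[M] +[N] f 0[M] = f 0[M]" using mod_homD(2)[OF assms(1), of "0[M]" "0[M]"] by simp
 then show ?thesis using N.add.r_cancel_one mod_homD(1)[OF assms(1)] by auto
qed

lemma mod_hom_minus:
 assumes "f:mod_hom R M N" "abelian_group M" "abelian_group N" "x:carrier M"
 shows "f (-[M] x) = -[N] f x"
proof -
 interpret M: abelian_group M by fact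
 interpret N: abelian_group N by fact
 have "f (-[M] x) +[N] f x = 0[N]"
  using mod_homD(2)[OF assms(1), of "-[M] x" x] assms mod_hom_zero[OF assms(1-3)] by (simp add: M.l_neg)
 then show ?thesis using mod_homD(1)[OF assms(1)] assms(4) N.minus_equality by auto
qed

lemma mod_hom_comp:
 assumes "f:mod_hom R M N" "g:mod_hom R N L"
  "!!x y. x:carrier M ==> y:carrier M ==> x +[M] y:carrier M"
   "!!r x. r:carrier R ==> x:carrier M ==> r \<odot>[M] x:carrier M"
 shows "compose (carrier M) g f:mod_hom R M L"
 by (rule mod_homI)
  (use assms(3,4) mod_homD[OF assms(1)] mod_homD[OF assms(2)] in \<open>auto simp: compose_def\<close>)

lemma submoduleI':
 assumes "left_module R M" "H <= carrier M" "0[M]:H"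
  "!!x y. x:H ==> y:H ==> x +[M] y:H" "!!r x. r:carrier R ==> x:H ==> r \<odot>[M] x:H"
 shows "submodule H R M"
proof -
 interpret left_module R M by fact
 have neg: "-[M] x:H" if "x:H" for x
 proof -
  have x: "x:carrier M" using that assms by auto
  have "(-[R] 1[R]) \<odot>[M] x +[M] x = 0[M]"
   using smult_l_distr[of "-[R] 1[R]" "1[R]" x] smult_one[OF x] smult_ring_zero[OF x] x
   by (simp add: R.l_neg)
  then have "(-[R] 1[R]) \<odot>[M] x = -[M] x" using x smult_closed M.minus_equality by auto
  then show ?thesis using assms(5)[of "-[R] 1[R]" x] that by simp
 qed
 show ?thesis
  by (intro submodule.intro subgroup.intro submodule_axioms.intro)
    (use assms neg in \<open>auto simp: a_inv_def\<close>)
qed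

lemma submoduleD:
 assumes "submodule H R M"
 shows "H <= carrier M" "0[M]:H" "x:H ==> y:H ==> x +[M] y:H"
  "r:carrier R ==> x:H ==> r \<odot>[M] x:H"
 using assms subgroup.m_closed[of H "add_monoid M" x y] subgroup.one_closed[of H "add_monoid M"]
  subgroup.subset[of H "add_monoid M"]
 by (auto simp: submodule_def submodule_axioms_def)

locale proj_modules =
 fixes R :: "'r ring" and wit :: "'r list => 'm"
 assumes ring: "ring R" and wit: "inj_on wit (lists (carrier R))"
begin

sublocale R: ring R by (rule ring)

abbreviation "E \<equiv> (Rproj R :: (('r, 'm) module, ('r, 'm) mmap) exact_cat)"

lemma infinite_UNIV: "infinite (UNIV :: 'm set)"
proof
 assume fin: "finite (UNIV :: 'm set)"
 have "inj_on (%n. wit (replicate n 0[R])) (UNIV :: nat set)"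
  using inj_onD[OF wit] by (fastforce intro!: inj_onI)
 then have "finite (UNIV :: nat set)" using fin by (metis finite_imageD finite_subset subset_UNIV)
 then show False by simp
qed

lemma inj_pr: "inj (pr :: 'm \<times> 'm => 'm)"
proof -
 have "(card_of ((UNIV :: 'm set) \<times> (UNIV :: 'm set)), card_of (UNIV :: 'm set)):ordLeq"
  using card_of_Times_same_infinite[OF infinite_UNIV] ordIso_iff_ordLeq by blast
 then have "EX f :: 'm \<times> 'm => 'm. inj f" by (auto simp: card_of_ordLeq[symmetric])
 then show ?thesis unfolding pr_def by (rule someI_ex)
qed

lemma pr_eq [simp]: "pr (a, b) = pr (c, d) \<longleftrightarrow> a = c & b = (d :: 'm)"
 by (simp add: inj_eq[OF inj_pr])

lemma dsum_simps [simp]: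
 fixes M N :: "('r, 'm) module"
 shows "carrier (dsum M N) = pr ` (carrier M \<times> carrier N)" "0[dsum M N] = pr (0[M], 0[N])"
  "pr (a, b) +[dsum M N] pr (c, d) = pr (a +[M] c, b +[N] d)"
  "r \<odot>[dsum M N] pr (a, b) = pr (r \<odot>[M] a, r \<odot>[N] b)"
 by (simp_all add: dsum_def Let_def inj_pr)

lemma dsum_left_module:
 fixes M N :: "('r, 'm) module"
 assumes "left_module R M" "left_module R N"
 shows "left_module R (dsum M N)"
proof -
 interpret M: left_module R M by fact
 interpret N: left_module R N by fact
 show ?thesis
 proof (rule left_moduleI[OF ring])
  fix z assume "z:carrier (dsum M N)"
  then obtain x y where [simp]: "z = pr (x, y)" "x:carrier M" "y:carrier N" by auto
  show "EX w:carrier (dsum M N). w +[dsum M N] z = 0[dsum M N]"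
   by (rule bexI[of _ "pr (-[M] x, -[N] y)"]) (auto simp: M.M.l_neg N.M.l_neg)
 qed (auto simp: M.M.a_ac N.M.a_ac M.smult_closed N.smult_closed M.smult_l_distr N.smult_l_distr
   M.smult_r_distr N.smult_r_distr M.smult_assoc N.smult_assoc M.smult_one N.smult_one)
qed

lemma zmod_left_module: "left_module R zmod"
 by (rule left_moduleI[OF ring]) (auto simp: zmod_def)

definition rg :: "('r, 'm) module" where "rg = regular R (%r. wit [r])"

lemma rg_inj: "inj_on (%r. wit [r]) (carrier R)"
 using inj_onD[OF wit] by (fastforce intro!: inj_onI)

lemma rg_simps [simp]:
 "carrier rg = (%r. wit [r]) ` carrier R" "0[rg] = wit [0[R]]"
 "[|x:carrier R; y:carrier R|] ==> wit [x] +[rg] wit [y] = wit [x +[R] y]"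
 "y:carrier R ==> x \<odot>[rg] wit [y] = wit [x *[R] y]"
 "[|x:carrier R; y:carrier R|] ==> wit [x] = wit [y] \<longleftrightarrow> x = y"
 using inv_into_f_f[OF rg_inj] inj_on_eq_iff[OF rg_inj] by (simp_all add: rg_def regular_def Let_def)

lemma rg_left_module: "left_module R rg"
proof (rule left_moduleI[OF ring])
 fix z assume "z:carrier rg"
 then obtain r where [simp]: "z = wit [r]" "r:carrier R" by auto
 show "EX w:carrier rg. w +[rg] z = 0[rg]"
  by (rule bexI[of _ "wit [-[R] r]"]) (auto simp: R.l_neg)
qed (auto simp: R.a_ac R.m_assoc R.l_distr R.r_distr)

lemma zmod_fgp: "fgp R (zmod :: ('r, 'm) module)"
proof -
 let ?Z = "zmod :: ('r, 'm) module"
 have "finitely_generated R ?Z"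
  unfolding finitely_generated_def
  by (rule exI[of _ "{undefined}"]) (auto simp: zmod_def dest!: submoduleD(1))
 moreover have "projective R ?Z"
  unfolding projective_def
 proof (intro allI impI ballI)
  fix N N' :: "('r, 'm) module" and e h
  assume m: "left_module R N & left_module R N'" and e: "e:mod_hom R N N'" and h: "h:mod_hom R ?Z N'"
  interpret N: left_module R N using m by blast
  interpret N': left_module R N' using m by blast
  have 1: "(\<lambda>x\<in>carrier ?Z. 0[N]):mod_hom R ?Z N"
   by (rule mod_homI) (auto simp: zmod_def N.smult_zero)
  have "compose (carrier ?Z) e (\<lambda>x\<in>carrier ?Z. 0[N]) = h"
  proof (rule extensionalityI[of _ "carrier ?Z"])
   fix x :: 'm assume "x:carrier ?Z"
   then have [simp]: "x = 0[?Z]"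
    "0[?Z]:carrier ?Z" by (simp_all add: zmod_def)
   have z: "abelian_group ?Z"
    by (rule left_module.axioms(2)[OF zmod_left_module])
   show "compose (carrier ?Z) e (\<lambda>x\<in>carrier ?Z. 0[N]) x = h x"
    using mod_hom_zero[OF e] mod_hom_zero[OF h z] N.abelian_group_axioms N'.abelian_group_axioms
    by (simp add: compose_def)
  qed (use mod_homD(4)[OF h] in auto)
  then show "EX l:mod_hom R ?Z N. compose (carrier ?Z) e l = h" using 1 by blast
 qed
 ultimately show ?thesis using zmod_left_module by (simp add: fgp_def)
qed

lemma rg_fgp: "fgp R rg"
proof -
 have "finitely_generated R rg"
  unfolding finitely_generated_def
 proof (intro exI conjI allI impI)
  fix N assume N: "submodule N R rg & {wit [1[R]]} <= N"
  have "wit [r]:N" if "r:carrier R" for r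
   using submoduleD(4)[of N R rg r "wit [1[R]]"] N that by simp
  then show "N = carrier rg" using N submoduleD(1)[of N R rg] by auto
 qed auto
 moreover have "projective R rg"
  unfolding projective_def
 proof (intro allI impI ballI)
  fix N N' :: "('r, 'm) module" and e h
  assume m: "left_module R N & left_module R N'" and e: "e:mod_hom R N N'" and h: "h:mod_hom R rg N'"
   and onto: "e ` carrier N = carrier N'"
  interpret N: left_module R N using m by blast
  interpret N': left_module R N' using m by blast
  have "h (wit [1[R]]):carrier N'" by (rule mod_homD(1)[OF h]) simp
  then have "h (wit [1[R]]):e ` carrier N" by (simp add: onto)
  then obtain n where n: "n:carrier N" "e n = h (wit [1[R]])" by (metis imageE)
  define l where "l = (\<lambda>x\<in>carrier rg. inv_into (carrier R) (%r. wit [r]) x \<odot>[N] n)"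
  have l: "l (wit [r]) = r \<odot>[N] n" if "r:carrier R" for r
   using that inv_into_f_f[OF rg_inj] by (simp add: l_def)
  have 1: "l:mod_hom R rg N"
   by (rule mod_homI) (use n in \<open>auto simp: l N.smult_closed N.smult_l_distr N.smult_assoc\<close>, simp add: l_def)
  have "compose (carrier rg) e l = h"
  proof (rule extensionalityI[of _ "carrier rg"])
   fix x assume "x:carrier rg"
   then obtain r where r: "x = wit [r]" "r:carrier R" by auto
   have "h (r \<odot>[rg] wit [1[R]]) = r \<odot>[N'] h (wit [1[R]])"
    by (rule mod_homD(3)[OF h r(2)]) simp
   then show "compose (carrier rg) e l x = h x"
    using r n l mod_homD(3)[OF e r(2) n(1)] by (simp add: compose_def)
  qed (use mod_homD(4)[OF h] in auto)
  then show "EX l:mod_hom R rg N. compose (carrier rg) e l = h" using 1 by blast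
 qed
 ultimately show ?thesis using rg_left_module by (simp add: fgp_def)
qed

definition inl :: "('r, 'm) module => ('r, 'm) module => 'm => 'm" where
 "inl M N = (\<lambda>x\<in>carrier M. pr (x, 0[N]))"
definition inr :: "('r, 'm) module => ('r, 'm) module => 'm => 'm" where
 "inr M N = (\<lambda>y\<in>carrier N. pr (0[M], y))"
definition prl :: "('r, 'm) module => ('r, 'm) module => 'm => 'm" where
 "prl M N = (\<lambda>z\<in>carrier (dsum M N). fst (inv_into UNIV pr z))"
definition prr :: "('r, 'm) module => ('r, 'm) module => 'm => 'm" where
 "prr M N = (\<lambda>z\<in>carrier (dsum M N). snd (inv_into UNIV pr z))"

lemma dsum_maps [simp]:
 shows "x:carrier M ==> inl M N x = pr (x, 0[N])" "y:carrier N ==> inr M N y = pr (0[M], y)"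
  "[|x:carrier M; y:carrier N|] ==> prl M N (pr (x, y)) = x"
  "[|x:carrier M; y:carrier N|] ==> prr M N (pr (x, y)) = y"
 by (auto simp: inl_def inr_def prl_def prr_def inj_pr)

lemma dsum_maps_hom:
 fixes M N :: "('r, 'm) module"
 assumes "left_module R M" "left_module R N"
 shows "inl M N:mod_hom R M (dsum M N)" "inr M N:mod_hom R N (dsum M N)"
  "prl M N:mod_hom R (dsum M N) M" "prr M N:mod_hom R (dsum M N) N"
proof -
 interpret M: left_module R M by fact
 interpret N: left_module R N by fact
 show "inl M N:mod_hom R M (dsum M N)" "inr M N:mod_hom R N (dsum M N)"
  "prl M N:mod_hom R (dsum M N) M" "prr M N:mod_hom R (dsum M N) N"
  by (auto intro!: mod_homI simp: M.smult_closed N.smult_closed M.smult_zero N.smult_zero)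
    (auto simp: inl_def inr_def prl_def prr_def)
qed

text \<open>A summand of a free module in each factor gives a summand of the sum of the free modules.\<close>

lemma dsum_fgp:
 fixes M N :: "('r, 'm) module"
 assumes "fgp R M" "fgp R N"
 shows "fgp R (dsum M N)"
proof -
 have lm: "left_module R M" "left_module R N" using assms by (auto simp: fgp_def)
 interpret M: left_module R M by fact
 interpret N: left_module R N by fact
 interpret S: left_module R "dsum M N" by (rule dsum_left_module[OF lm])
 note hom = dsum_maps_hom[OF lm]
 obtain S where S: "finite S" "S <= carrier M" "!!H. submodule H R M ==> S <= H ==> H = carrier M"
  using assms(1) by (auto simp: fgp_def finitely_generated_def)
 obtain T where T: "finite T" "T <= carrier N" "!!H. submodule H R N ==> T <= H ==> H = carrier N"
  using assms(2) by (auto simp: fgp_def finitely_generated_def)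
 have "finitely_generated R (dsum M N)"
  unfolding finitely_generated_def
 proof (intro exI conjI allI impI)
  show "finite (inl M N ` S \<union> inr M N ` T)" using S T by simp
  show "inl M N ` S \<union> inr M N ` T <= carrier (dsum M N)" using S T mod_homD(1)[OF hom(1)] mod_homD(1)[OF hom(2)] by blast
  fix H assume H: "submodule H R (dsum M N) & inl M N ` S \<union> inr M N ` T <= H"
  note Hd = submoduleD[OF H[THEN conjunct1]]
  have "submodule {x:carrier M. inl M N x:H} R M"
   by (rule submoduleI'[OF lm(1)]) (use Hd in \<open>auto simp: mod_homD(2,3)[OF hom(1)] M.smult_closed simp del: dsum_maps dsum_simps(3,4), simp\<close>)
  then have 1: "{x:carrier M. inl M N x:H} = carrier M" by (rule S(3)) (use S H in auto)
  have "submodule {x:carrier N. inr M N x:H} R N"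
   by (rule submoduleI'[OF lm(2)]) (use Hd in \<open>auto simp: mod_homD(2,3)[OF hom(2)] N.smult_closed simp del: dsum_maps dsum_simps(3,4), simp\<close>)
  then have 2: "{x:carrier N. inr M N x:H} = carrier N" by (rule T(3)) (use T H in auto)
  have "pr (x, y):H" if "x:carrier M" "y:carrier N" for x y
  proof -
   have "inl M N x:H" "inr M N y:H" using 1 2 that by blast+
   then show ?thesis using Hd(3)[of "inl M N x" "inr M N y"] that by simp
  qed
  then show "H = carrier (dsum M N)" using Hd(1) by auto
 qed
 moreover have "projective R (dsum M N)"
  unfolding projective_def
 proof (intro allI impI ballI)
  fix L L' :: "('r, 'm) module" and e h
  assume m: "left_module R L & left_module R L'" and e: "e:mod_hom R L L'" and h: "h:mod_hom R (dsum M N) L'"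
   and onto: "e ` carrier L = carrier L'"
  interpret L: left_module R L using m by blast
  interpret L': left_module R L' using m by blast
  have "compose (carrier M) h (inl M N):mod_hom R M L'"
   by (rule mod_hom_comp[OF hom(1) h]) (auto simp: M.smult_closed)
  then have "EX l:mod_hom R M L. compose (carrier M) e l = compose (carrier M) h (inl M N)"
   using assms(1) m e onto unfolding fgp_def projective_def by blast
  then obtain l1 where l1: "l1:mod_hom R M L" "compose (carrier M) e l1 = compose (carrier M) h (inl M N)"
   by blast
  have "compose (carrier N) h (inr M N):mod_hom R N L'"
   by (rule mod_hom_comp[OF hom(2) h]) (auto simp: N.smult_closed)
  then have "EX l:mod_hom R N L. compose (carrier N) e l = compose (carrier N) h (inr M N)"
   using assms(2) m e onto unfolding fgp_def projective_def by blast
  then obtain l2 where l2: "l2:mod_hom R N L" "compose (carrier N) e l2 = compose (carrier N) h (inr M N)"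
   by blast
  note l = mod_homD[OF l1(1)] mod_homD[OF l2(1)]
  define l where "l = (\<lambda>z\<in>carrier (dsum M N). l1 (prl M N z) +[L] l2 (prr M N z))"
  have ls: "l (pr (x, y)) = l1 x +[L] l2 y" if "x:carrier M" "y:carrier N" for x y
   using that by (simp add: l_def)
  have 1: "l:mod_hom R (dsum M N) L"
   by (rule mod_homI) (auto simp: ls l L.M.a_ac M.smult_closed N.smult_closed L.smult_r_distr, simp add: l_def)
  have "compose (carrier (dsum M N)) e l = h"
  proof (rule extensionalityI[of _ "carrier (dsum M N)"])
   fix z assume "z:carrier (dsum M N)"
   then obtain x y where z [simp]: "z = pr (x, y)" "x:carrier M" "y:carrier N" by auto
   have "e (l1 x) = h (inl M N x)" using fun_cong[OF l1(2), of x] by (simp add: compose_def)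
   moreover have "e (l2 y) = h (inr M N y)" using fun_cong[OF l2(2), of y] by (simp add: compose_def)
   moreover have "h (inl M N x +[dsum M N] inr M N y) = h (inl M N x) +[L'] h (inr M N y)"
    by (rule mod_homD(2)[OF h]) auto
   ultimately show "compose (carrier (dsum M N)) e l z = h z"
    using mod_homD(2)[OF e, of "l1 x" "l2 y"] l by (simp add: compose_def ls)
  qed (use mod_homD(4)[OF h] in auto)
  then show "EX l:mod_hom R (dsum M N) L. compose (carrier (dsum M N)) e l = h" using 1 by blast
 qed
 ultimately show ?thesis using dsum_left_module[OF lm] by (simp add: fgp_def)
qed

end

section \<open>Dual bases\<close>

fun comb :: "('r, 'm) module => 'r list => 'm list => 'm" where
 "comb M (c # cs) (x # xs) = c \<odot>[M] x +[M] comb M cs xs"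
| "comb M _ _ = 0[M]"

definition linear_form :: "'r ring => ('r, 'm) module => ('m => 'r) => bool" where
 "linear_form R M xi \<longleftrightarrow> (ALL x:carrier M. xi x:carrier R) &
   (ALL x:carrier M. ALL y:carrier M. xi (x +[M] y) = xi x +[R] xi y) &
   (ALL r:carrier R. ALL x:carrier M. xi (r \<odot>[M] x) = r *[R] xi x)"

definition dual_basis :: "'r ring => ('r, 'm) module => ('m => 'r) list => 'm list => bool" where
 "dual_basis R M xis xs \<longleftrightarrow> length xis = length xs & set xs <= carrier M & (ALL xi:set xis. linear_form R M xi) &
   (ALL m:carrier M. m = comb M (map (%xi. xi m) xis) xs)"

lemma linear_form_zero:
 assumes "left_module R M" "linear_form R M xi"
 shows "xi 0[M] = 0[R]"
proof -
 interpret left_module R M by fact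
 have "xi 0[M] +[R] xi 0[M] = xi 0[M]" "xi 0[M]:carrier R"
  using assms(2) M.zero_closed M.l_zero[of "0[M]"] unfolding linear_form_def by metis+
 then show ?thesis using R.add.r_cancel_one by auto
qed

context proj_modules
begin

text \<open>A free module with basis mapping to \<open>xs\<close>, together with its coordinate functions.\<close>

lemma free_cover:
 fixes M :: "('r, 'm) module"
 assumes M: "left_module R M" and "set xs <= carrier M"
 shows "EX (F :: ('r, 'm) module) e xis. left_module R F & e:mod_hom R F M & set xs <= e ` carrier F & length xis = length xs &
  (ALL xi:set xis. linear_form R F xi) & (ALL v:carrier F. e v = comb M (map (%xi. xi v) xis) xs)"
 using assms(2)
proof (induction xs)
 case Nil
 interpret M: left_module R M by fact
 have "(\<lambda>x\<in>carrier zmod. 0[M]):mod_hom R zmod M"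
  by (rule mod_homI) (auto simp: zmod_def M.smult_zero)
 then show ?case using zmod_left_module by (intro exI[of _ zmod] exI[of _ "[]"]) auto
next
 case (Cons x xs)
 interpret M: left_module R M by fact
 obtain F :: "('r, 'm) module" and e xis where F: "left_module R F" "e:mod_hom R F M" "set xs <= e ` carrier F" "length xis = length xs"
  "ALL xi:set xis. linear_form R F xi" "ALL v:carrier F. e v = comb M (map (%xi. xi v) xis) xs"
  using Cons by auto
 interpret F: left_module R F by fact
 have x: "x:carrier M" using Cons by simp
 let ?F = "dsum rg F"
 define ch where "ch = (%z. inv_into (carrier R) (%r. wit [r]) (prl rg F z))"
 have ch: "ch (pr (wit [r], v)) = r" if "r:carrier R" "v:carrier F" for r v
  using that inv_into_f_f[OF rg_inj] by (simp add: ch_def)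
 define e' where "e' = (\<lambda>z\<in>carrier ?F. ch z \<odot>[M] x +[M] e (prr rg F z))"
 have e': "e' (pr (wit [r], v)) = r \<odot>[M] x +[M] e v" if "r:carrier R" "v:carrier F" for r v
  using that by (simp add: e'_def ch)
 note ed = mod_homD[OF F(2)]
 have 1: "e':mod_hom R ?F M"
 proof (rule mod_homI)
  fix z w assume "z:carrier ?F" "w:carrier ?F"
  then obtain a b c d where "z = pr (wit [a], b)" "w = pr (wit [c], d)" "a:carrier R" "c:carrier R"
   "b:carrier F" "d:carrier F" by auto
  then show "e' (z +[?F] w) = e' z +[M] e' w"
   using x ed by (simp add: e' M.smult_l_distr M.smult_closed M.M.a_ac)
 next
  fix r z assume "r:carrier R" "z:carrier ?F"
  then obtain a b where "z = pr (wit [a], b)" "a:carrier R" "b:carrier F" by auto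
  then show "e' (r \<odot>[?F] z) = r \<odot>[M] e' z"
   using x ed \<open>r:carrier R\<close> by (simp add: e' M.smult_r_distr M.smult_closed M.smult_assoc F.smult_closed)
 next
  fix z assume "z:carrier ?F"
  then show "e' z:carrier M" using x ed by (auto simp: e' M.smult_closed)
 qed (simp add: e'_def)
 have z0: "e 0[F] = 0[M]" using mod_hom_zero[OF F(2)] F.abelian_group_axioms M.abelian_group_axioms by simp
 have "x = e' (pr (wit [1[R]], 0[F]))" using x z0 by (simp add: e' M.smult_one)
 moreover have "y:e' ` carrier ?F" if y: "y:set xs" for y
 proof -
  obtain v where v: "v:carrier F" "y = e v" using F(3) y by auto
  then have "y = e' (pr (wit [0[R]], v))" using x ed by (simp add: e' M.smult_ring_zero)
  then show ?thesis using v by auto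
 qed
 ultimately have 2: "set (x # xs) <= e' ` carrier ?F" by auto
 let ?xis = "ch # map (%xi. xi \<circ> prr rg F) xis"
 have 3: "linear_form R ?F xi" if "xi:set ?xis" for xi
  using that F(5) by (fastforce simp: linear_form_def ch F.smult_closed)
 have 4: "e' v = comb M (map (%xi. xi v) ?xis) (x # xs)" if "v:carrier ?F" for v
  using that F(6) by (auto simp: e' ch comp_def)
 show ?case
  using dsum_left_module[OF rg_left_module F(1)] 1 2 3 4 F(4)
  by (intro exI[of _ ?F] exI[of _ e'] exI[of _ ?xis]) auto
qed

lemma dual_basis_ex:
 fixes M :: "('r, 'm) module"
 assumes "fgp R M"
 shows "EX xis xs. dual_basis R M xis xs"
proof -
 have M: "left_module R M" using assms by (simp add: fgp_def)
 interpret M: left_module R M by fact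
 obtain S where S: "finite S" "S <= carrier M" "!!H. submodule H R M ==> S <= H ==> H = carrier M"
  using assms by (auto simp: fgp_def finitely_generated_def)
 obtain xs where xs: "set xs = S" using finite_list[OF S(1)] by auto
 obtain F :: "('r, 'm) module" and e xis where F: "left_module R F" "e:mod_hom R F M" "set xs <= e ` carrier F" "length xis = length xs"
  "ALL xi:set xis. linear_form R F xi" "ALL v:carrier F. e v = comb M (map (%xi. xi v) xis) xs"
  using free_cover[OF M, of xs] S(2) xs by auto
 interpret F: left_module R F by fact
 note ed = mod_homD[OF F(2)]
 have "submodule (e ` carrier F) R M"
 proof (rule submoduleI'[OF M])
  show "0[M]:e ` carrier F"
   using mod_hom_zero[OF F(2) F.abelian_group_axioms M.abelian_group_axioms] by (metis F.zero_closed image_eqI)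
  show "x +[M] y:e ` carrier F" if "x:e ` carrier F" "y:e ` carrier F" for x y
   using that by (auto simp: ed(2)[symmetric])
  show "r \<odot>[M] x:e ` carrier F" if "x:e ` carrier F" "r:carrier R" for x r
   using that by (auto simp: ed(3)[symmetric] F.smult_closed)
 qed (use ed(1) in auto)
 then have onto: "e ` carrier F = carrier M" using S(3) F(3) xs by simp
 have "(\<lambda>x\<in>carrier M. x):mod_hom R M M" by (rule mod_homI) (auto simp: M.smult_closed)
 then have "EX l:mod_hom R M F. compose (carrier M) e l = (\<lambda>x\<in>carrier M. x)"
  using assms F(1,2) M onto unfolding fgp_def projective_def by blast
 then obtain l where l: "l:mod_hom R M F" "compose (carrier M) e l = (\<lambda>x\<in>carrier M. x)"
  by blast
 note ld = mod_homD[OF l(1)]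
 have "dual_basis R M (map (%xi. xi \<circ> l) xis) xs"
  unfolding dual_basis_def
 proof (intro conjI ballI)
  fix m assume m: "m:carrier M"
  have "m = e (l m)" using fun_cong[OF l(2), of m] m by (simp add: compose_def)
  also have "... = comb M (map (%xi. xi (l m)) xis) xs" using F(6) ld(1)[OF m] by blast
  finally show "m = comb M (map (%xi. xi m) (map (%xi. xi \<circ> l) xis)) xs" by (simp add: comp_def)
 next
  fix xi assume "xi:set (map (%xi. xi \<circ> l) xis)"
  then show "linear_form R M xi" using F(5) ld by (fastforce simp: linear_form_def)
 qed (use S xs F(4) in auto)
 then show ?thesis by blast
qed

section \<open>The additive category of finitely generated projective modules\<close>

lemma fgp_module: "fgp R M ==> left_module R M"
 by (simp add: fgp_def)

lemma fgp_group: "fgp R M ==> abelian_group M"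
 by (simp add: fgp_def left_module_def)

lemma Hom_E: "a:Hom E M N \<longleftrightarrow> fgp R M & fgp R N & a = (M, fun_of a, N) & fun_of a:mod_hom R M N"
 by (cases a rule: prod_cases3) (auto simp: Hom_def Rproj_def fun_of_def)

lemma E_simps:
 "Ident E M = (M, \<lambda>x\<in>carrier M. x, M)" "ZeroA E M N = (M, \<lambda>x\<in>carrier M. 0[N], N)"
 "(N, g, L) o[E] (M, f, N') = (M, compose (carrier M) g f, L)"
 "AddA E (M, f, N) (M', g, N') = (M, \<lambda>x\<in>carrier M. f x +[N] g x, N)"
 "NegA E (M, f, N) = (M, \<lambda>x\<in>carrier M. -[N] f x, N)"
 by (simp_all add: Rproj_def)

lemma E_obj [simp]: "Obj E = {M. fgp R M}"
 by (simp add: Rproj_def)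

lemma fun_of_closed: "a:Hom E M N ==> x:carrier M ==> fun_of a x:carrier N"
 by (auto simp: Hom_E intro: mod_homD)

lemma Hom_E_eqI:
 assumes "a:Hom E M N" "b:Hom E M N" "!!x. x:carrier M ==> fun_of a x = fun_of b x"
 shows "a = b"
proof -
 have "fun_of a = fun_of b"
  by (rule extensionalityI[of _ "carrier M"]) (use assms in \<open>auto simp: Hom_E dest: mod_homD(4)\<close>)
 then show ?thesis using assms(1,2) by (simp add: Hom_E)
qed

lemma Ident_E: "fgp R M ==> Ident E M:Hom E M M" "x:carrier M ==> fun_of (Ident E M) x = x"
proof -
 show "Ident E M:Hom E M M" if "fgp R M"
 proof -
  interpret left_module R M using that by (simp add: fgp_def)
  show ?thesis using that by (auto simp: Hom_E E_simps fun_of_def smult_closed intro!: mod_homI)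
 qed
qed (simp add: E_simps fun_of_def)

lemma Zero_E: "fgp R M ==> fgp R N ==> ZeroA E M N:Hom E M N"
 "x:carrier M ==> fun_of (ZeroA E M N) x = 0[N]"
proof -
 show "ZeroA E M N:Hom E M N" if "fgp R M" "fgp R N"
 proof -
  interpret M: left_module R M using that by (simp add: fgp_def)
  interpret N: left_module R N using that by (simp add: fgp_def)
  show ?thesis using that by (auto simp: Hom_E E_simps fun_of_def M.smult_closed N.smult_zero intro!: mod_homI)
 qed
qed (simp add: E_simps fun_of_def)

lemma Comp_E:
 assumes "a:Hom E M N" "b:Hom E N L"
 shows "b o[E] a:Hom E M L" "x:carrier M ==> fun_of (b o[E] a) x = fun_of b (fun_of a x)"
proof -
 obtain f g where [simp]: "a = (M, f, N)" "b = (N, g, L)" and h: "f:mod_hom R M N" "g:mod_hom R N L"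
  and p: "fgp R M" "fgp R N" "fgp R L"
  using assms by (auto simp: Hom_E)
 interpret M: left_module R M using p by (simp add: fgp_def)
 show "b o[E] a:Hom E M L"
  using mod_hom_comp[OF h] M.smult_closed p by (auto simp: Hom_E E_simps fun_of_def)
 show "x:carrier M ==> fun_of (b o[E] a) x = fun_of b (fun_of a x)"
  by (simp add: E_simps fun_of_def compose_def)
qed

lemma Add_E:
 assumes "a:Hom E M N" "b:Hom E M N"
 shows "AddA E a b:Hom E M N" "x:carrier M ==> fun_of (AddA E a b) x = fun_of a x +[N] fun_of b x"
proof -
 obtain f g where [simp]: "a = (M, f, N)" "b = (M, g, N)" and h: "f:mod_hom R M N" "g:mod_hom R M N"
  and p: "fgp R M" "fgp R N"
  using assms by (auto simp: Hom_E)
 interpret M: left_module R M using p by (simp add: fgp_def)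
 interpret N: left_module R N using p by (simp add: fgp_def)
 show "AddA E a b:Hom E M N"
  using p mod_homD(1-3)[OF h(1)] mod_homD(1-3)[OF h(2)]
  by (auto simp: Hom_E E_simps fun_of_def M.smult_closed N.smult_r_distr N.M.a_ac intro!: mod_homI)
 show "x:carrier M ==> fun_of (AddA E a b) x = fun_of a x +[N] fun_of b x"
  by (simp add: E_simps fun_of_def)
qed

lemma Neg_E:
 assumes "a:Hom E M N"
 shows "NegA E a:Hom E M N" "x:carrier M ==> fun_of (NegA E a) x = -[N] fun_of a x"
proof -
 obtain f where [simp]: "a = (M, f, N)" and h: "f:mod_hom R M N" and p: "fgp R M" "fgp R N"
  using assms by (auto simp: Hom_E)
 interpret M: left_module R M using p by (simp add: fgp_def)
 interpret N: left_module R N using p by (simp add: fgp_def)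
 show "NegA E a:Hom E M N"
  using p mod_homD(1-3)[OF h]
  by (auto simp: Hom_E E_simps fun_of_def M.smult_closed N.smult_minus N.M.minus_add intro!: mod_homI)
 show "x:carrier M ==> fun_of (NegA E a) x = -[N] fun_of a x"
  by (simp add: E_simps fun_of_def)
qed

lemma zero_object_E: "zero_object E M \<longleftrightarrow> fgp R M & carrier M = {0[M]}"
proof
 assume z: "zero_object E M"
 then have p: "fgp R M" by (simp add: zero_object_def)
 interpret M: left_module R M using p by (simp add: fgp_def)
 have "x = 0[M]" if "x:carrier M" for x
  using z Ident_E(2)[OF that] Zero_E(2)[OF that] by (simp add: zero_object_def)
 then show "fgp R M & carrier M = {0[M]}" using p by auto
next
 assume m: "fgp R M & carrier M = {0[M]}"
 have "fun_of (Ident E M) x = fun_of (ZeroA E M M) x" if "x:carrier M" for x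
  using m that Ident_E(2)[of x M] Zero_E(2)[of x M M] by auto
 then show "zero_object E M"
  using Hom_E_eqI[of "Ident E M" M M "ZeroA E M M"] Ident_E(1)[of M] Zero_E(1)[of M M] m
  by (metis (no_types, lifting) E_obj mem_Collect_eq zero_object_def)
qed

lemma biproduct_ex:
 assumes "fgp R M" "fgp R N"
 shows "EX S i j p q. biproduct E M N S i j p q & (carrier M = {0[M]} --> carrier N = {0[N]} --> carrier S = {0[S]})"
proof -
 have lm: "left_module R M" "left_module R N" using assms by (auto simp: fgp_def)
 interpret M: left_module R M by fact
 interpret N: left_module R N by fact
 let ?S = "dsum M N"
 let ?i = "(M, inl M N, ?S)" and ?j = "(N, inr M N, ?S)" and ?p = "(?S, prl M N, M)" and ?q = "(?S, prr M N, N)"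
 have S: "fgp R ?S" using dsum_fgp assms by blast
 have h: "?i:Hom E M ?S" "?j:Hom E N ?S" "?p:Hom E ?S M" "?q:Hom E ?S N"
  using dsum_maps_hom[OF lm] assms S by (auto simp: Hom_E fun_of_def)
 have f: "fun_of ?i = inl M N" "fun_of ?j = inr M N" "fun_of ?p = prl M N" "fun_of ?q = prr M N"
  by (simp_all add: fun_of_def)
 have "biproduct E M N ?S ?i ?j ?p ?q"
  unfolding biproduct_def
 proof (intro conjI)
  show "?p o[E] ?i = Ident E M"
   by (rule Hom_E_eqI[of _ M M]) (use h assms in \<open>auto simp: Comp_E f Ident_E\<close>)
  show "?q o[E] ?j = Ident E N"
   by (rule Hom_E_eqI[of _ N N]) (use h assms in \<open>auto simp: Comp_E f Ident_E\<close>)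
  show "?p o[E] ?j = ZeroA E N M"
   by (rule Hom_E_eqI[of _ N M]) (use h assms in \<open>auto simp: Comp_E f Zero_E\<close>)
  show "?q o[E] ?i = ZeroA E M N"
   by (rule Hom_E_eqI[of _ M N]) (use h assms in \<open>auto simp: Comp_E f Zero_E\<close>)
  show "AddA E (?i o[E] ?p) (?j o[E] ?q) = Ident E ?S"
  proof (rule Hom_E_eqI[of _ ?S ?S])
   fix z assume z: "z:carrier ?S"
   then show "fun_of (AddA E (?i o[E] ?p) (?j o[E] ?q)) z = fun_of (Ident E ?S) z"
    unfolding Add_E(2)[OF Comp_E(1)[OF h(3,1)] Comp_E(1)[OF h(4,2)] z]
     Comp_E(2)[OF h(3,1) z] Comp_E(2)[OF h(4,2) z] Ident_E(2)[OF z] f by auto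
  qed (use Add_E(1)[OF Comp_E(1)[OF h(3,1)] Comp_E(1)[OF h(4,2)]] Ident_E(1)[OF S] in auto)
 qed (use h assms S in auto)
 moreover have "carrier ?S = {0[?S]}" if "carrier M = {0[M]}" "carrier N = {0[N]}"
  using that by simp
 ultimately show ?thesis by blast
qed

lemma lift_E:
 assumes u: "u:Hom E X Y" and d: "d:Hom E Z Y" and im: "fun_of u ` carrier X <= fun_of d ` carrier Z"
 shows "EX l:Hom E X Z. d o[E] l = u"
proof -
 have p: "fgp R X" "fgp R Y" "fgp R Z" and hu: "fun_of u:mod_hom R X Y" and hd: "fun_of d:mod_hom R Z Y"
  using u d by (auto simp: Hom_E)
 interpret Y: left_module R Y using p by (simp add: fgp_def)
 interpret Z: left_module R Z using p by (simp add: fgp_def)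
 note d' = mod_homD(1-3)[OF hd]
 let ?N = "Y\<lparr>carrier := fun_of d ` carrier Z\<rparr>"
 have sub: "x:carrier Z ==> fun_of d x:carrier Y" for x by (rule d'(1))
 have addc: "fun_of d x +[Y] fun_of d y:fun_of d ` carrier Z" if "x:carrier Z" "y:carrier Z" for x y
  using that d'(2)[OF that, symmetric] by simp
 have smc: "r \<odot>[Y] fun_of d x:fun_of d ` carrier Z" if "r:carrier R" "x:carrier Z" for r x
  using that d'(3)[OF that, symmetric] Z.smult_closed by simp
 have N: "left_module R ?N"
 proof (rule left_moduleI[OF ring])
  show "0[?N]:carrier ?N"
   using mod_hom_zero[OF hd Z.abelian_group_axioms Y.abelian_group_axioms] by (simp, metis Z.zero_closed image_eqI)
  fix x assume "x:carrier ?N"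
  then obtain z where z: "z:carrier Z" "x = fun_of d z" by auto
  have "fun_of d (-[Z] z) +[Y] fun_of d z = 0[Y]"
   using d'(2)[of "-[Z] z" z] z mod_hom_zero[OF hd Z.abelian_group_axioms Y.abelian_group_axioms]
   by (simp add: Z.M.l_neg)
  then show "EX y:carrier ?N. y +[?N] x = 0[?N]"
   using z by (intro bexI[of _ "fun_of d (-[Z] z)"]) auto
 qed (auto simp: Y.M.a_ac Y.smult_l_distr Y.smult_r_distr Y.smult_assoc Y.smult_one sub intro: addc smc)
 have e: "fun_of d:mod_hom R Z ?N" using hd by (auto simp: mod_hom_def PiE_def)
 have h: "fun_of u:mod_hom R X ?N" using hu im by (auto simp: mod_hom_def PiE_def)
 have "EX l:mod_hom R X Z. compose (carrier X) (fun_of d) l = fun_of u"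
  using p(1) N Z.left_module_axioms e h unfolding fgp_def projective_def by fastforce
 then obtain l where l: "l:mod_hom R X Z" "compose (carrier X) (fun_of d) l = fun_of u" by blast
 have 1: "(X, l, Z):Hom E X Z" using l p by (auto simp: Hom_E fun_of_def)
 have "d o[E] (X, l, Z) = u"
 proof (rule Hom_E_eqI[OF Comp_E(1)[OF 1 d] u])
  fix x assume x: "x:carrier X"
  then show "fun_of (d o[E] (X, l, Z)) x = fun_of u x"
   using Comp_E(2)[OF 1 d x] fun_cong[OF l(2), of x] by (simp add: fun_of_def compose_def)
 qed
 then show ?thesis using 1 by blast
qed

text \<open>Short exact sequences are exactly the split ones, because their third term is projective.\<close>

lemma Ses_E: "(a, b):Ses E \<longleftrightarrow> (EX L M N s t. biproduct E L N M a s t b)"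
proof
 assume "(a, b):Ses E"
 then obtain L f M g N where [simp]: "a = (L, f, M)" "b = (M, g, N)" and p: "fgp R L" "fgp R M" "fgp R N"
  and f: "f:mod_hom R L M" "inj_on f (carrier L)" and g: "g:mod_hom R M N" "g ` carrier M = carrier N"
  and ex: "f ` carrier L = {x:carrier M. g x = 0[N]}"
  by (auto simp: Rproj_def)
 interpret L: left_module R L using p by (simp add: fgp_def)
 interpret M: left_module R M using p by (simp add: fgp_def)
 interpret N: left_module R N using p by (simp add: fgp_def)
 have a: "a:Hom E L M" "fun_of a = f" and b: "b:Hom E M N" "fun_of b = g"
  using p f g by (auto simp: Hom_E fun_of_def)
 have "EX s:Hom E N M. b o[E] s = Ident E N"
  by (rule lift_E[OF Ident_E(1)[OF p(3)] b(1)]) (use g(2) b(2) Ident_E(2)[of _ N] in auto)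
 then obtain s where s: "s:Hom E N M" "b o[E] s = Ident E N" by blast
 have bs: "g (fun_of s x) = x" if "x:carrier N" for x
  using Comp_E(2)[OF s(1) b(1) that] s(2) b(2) Ident_E(2)[OF that] by simp
 have ba: "g (f x) = 0[N]" if "x:carrier L" for x using ex that by auto
 define u where "u = AddA E (Ident E M) (NegA E (s o[E] b))"
 have sb: "s o[E] b:Hom E M M" by (rule Comp_E(1)[OF b(1) s(1)])
 have u: "u:Hom E M M" unfolding u_def by (rule Add_E(1)[OF Ident_E(1)[OF p(2)] Neg_E(1)[OF sb]])
 have ux: "fun_of u x = x +[M] -[M] fun_of s (g x)" if x: "x:carrier M" for x
  unfolding u_def Add_E(2)[OF Ident_E(1)[OF p(2)] Neg_E(1)[OF sb] x] Neg_E(2)[OF sb x] Comp_E(2)[OF b(1) s(1) x] Ident_E(2)[OF x] b(2) ..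
 have sc: "x:carrier N ==> fun_of s x:carrier M" for x by (rule fun_of_closed[OF s(1)])
 note gc = mod_homD[OF g(1)] and fc = mod_homD[OF f(1)]
 have "fun_of u ` carrier M <= fun_of a ` carrier L"
 proof
  fix y assume "y:fun_of u ` carrier M"
  then obtain x where x: "x:carrier M" "y = fun_of u x" by auto
  have "g (fun_of u x) = g x +[N] -[N] g (fun_of s (g x))"
   unfolding ux[OF x(1)] using x(1) sc gc
   by (simp add: gc(2) mod_hom_minus[OF g(1) M.abelian_group_axioms N.abelian_group_axioms])
  then have "g y = 0[N]" using bs x gc by (simp add: N.M.r_neg)
  then show "y:fun_of a ` carrier L" using ex a(2) fun_of_closed[OF u x(1)] x by auto
 qed
 then obtain t where t: "t:Hom E M L" "a o[E] t = u" using lift_E[OF u a(1)] by blast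
 have ft: "f (fun_of t x) = x +[M] -[M] fun_of s (g x)" if x: "x:carrier M" for x
  using Comp_E(2)[OF t(1) a(1) x] t(2) a(2) ux[OF x] by simp
 have tc: "x:carrier M ==> fun_of t x:carrier L" for x by (rule fun_of_closed[OF t(1)])
 have s0: "fun_of s 0[N] = 0[M]"
  using mod_hom_zero[of "fun_of s" R N M] s(1) N.abelian_group_axioms M.abelian_group_axioms by (simp add: Hom_E)
 have f0: "f 0[L] = 0[M]" by (rule mod_hom_zero[OF f(1) L.abelian_group_axioms M.abelian_group_axioms])
 have ta: "fun_of t (f x) = x" if x: "x:carrier L" for x
  by (rule inj_onD[OF f(2)]) (use x fc ft[OF fc(1)[OF x]] ba[OF x] s0 tc in auto)
 have ts: "fun_of t (fun_of s x) = 0[L]" if x: "x:carrier N" for x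
  by (rule inj_onD[OF f(2)]) (use x ft[OF sc[OF x]] bs[OF x] f0 tc sc in \<open>auto simp: M.M.r_neg\<close>)
 have "biproduct E L N M a s t b"
  unfolding biproduct_def
 proof (intro conjI)
  show "t o[E] a = Ident E L"
   by (rule Hom_E_eqI[OF Comp_E(1)[OF a(1) t(1)] Ident_E(1)[OF p(1)]]) (simp add: Comp_E(2)[OF a(1) t(1)] Ident_E(2) ta a(2) del: \<open>a = _\<close>)
  show "t o[E] s = ZeroA E N L"
   by (rule Hom_E_eqI[OF Comp_E(1)[OF s(1) t(1)] Zero_E(1)[OF p(3,1)]]) (simp add: Comp_E(2)[OF s(1) t(1)] Zero_E(2) ts)
  show "b o[E] a = ZeroA E L N"
   by (rule Hom_E_eqI[OF Comp_E(1)[OF a(1) b(1)] Zero_E(1)[OF p(1,3)]])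
    (simp add: Comp_E(2)[OF a(1) b(1)] Zero_E(2) ba a(2) b(2) del: \<open>a = _\<close> \<open>b = _\<close>)
  have at: "a o[E] t:Hom E M M" by (rule Comp_E(1)[OF t(1) a(1)])
  show "AddA E (a o[E] t) (s o[E] b) = Ident E M"
  proof (rule Hom_E_eqI[OF Add_E(1)[OF at sb] Ident_E(1)[OF p(2)]])
   fix x assume x: "x:carrier M"
   have "(x +[M] -[M] fun_of s (g x)) +[M] fun_of s (g x) = x"
    using x sc gc by (simp add: M.M.a_assoc M.M.l_neg)
   then show "fun_of (AddA E (a o[E] t) (s o[E] b)) x = fun_of (Ident E M) x"
    unfolding Add_E(2)[OF at sb x] Comp_E(2)[OF t(1) a(1) x] Comp_E(2)[OF b(1) s(1) x] Ident_E(2)[OF x] a(2) b(2) ft[OF x] .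
  qed
 qed (use a b s t p in auto)
 then show "EX L M N s t. biproduct E L N M a s t b" by blast
next
 assume "EX L M N s t. biproduct E L N M a s t b"
 then obtain L M N s t where bi: "biproduct E L N M a s t b" by blast
 then have h: "a:Hom E L M" "s:Hom E N M" "t:Hom E M L" "b:Hom E M N"
  and e: "t o[E] a = Ident E L" "b o[E] s = Ident E N" "b o[E] a = ZeroA E L N"
   "AddA E (a o[E] t) (s o[E] b) = Ident E M" and p: "fgp R L" "fgp R M" "fgp R N"
  by (auto simp: biproduct_def)
 interpret M: left_module R M using p by (simp add: fgp_def)
 interpret N: left_module R N using p by (simp add: fgp_def)
 note c = fun_of_closed[OF h(1)] fun_of_closed[OF h(2)] fun_of_closed[OF h(3)] fun_of_closed[OF h(4)]
 have ta: "fun_of t (fun_of a x) = x" if "x:carrier L" for x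
  using Comp_E(2)[OF h(1,3) that] e(1) Ident_E(2)[OF that] by simp
 have bs: "fun_of b (fun_of s x) = x" if "x:carrier N" for x
  using Comp_E(2)[OF h(2,4) that] e(2) Ident_E(2)[OF that] by simp
 have ba: "fun_of b (fun_of a x) = 0[N]" if "x:carrier L" for x
  using Comp_E(2)[OF h(1,4) that] e(3) Zero_E(2)[OF that] by simp
 have sum: "fun_of a (fun_of t x) +[M] fun_of s (fun_of b x) = x" if "x:carrier M" for x
  using Add_E(2)[OF Comp_E(1)[OF h(3,1)] Comp_E(1)[OF h(4,2)] that] e(4) Ident_E(2)[OF that]
   Comp_E(2)[OF h(3,1) that] Comp_E(2)[OF h(4,2) that] by simp
 have s0: "fun_of s 0[N] = 0[M]"
  using mod_hom_zero[of "fun_of s" R N M] h(2) N.abelian_group_axioms M.abelian_group_axioms by (simp add: Hom_E)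
 have "x:fun_of a ` carrier L" if "x:carrier M" "fun_of b x = 0[N]" for x
 proof -
  have "x = fun_of a (fun_of t x)" using sum[OF that(1)] that s0 c by simp
  then show ?thesis using c that by blast
 qed
 then have "fun_of a ` carrier L = {x:carrier M. fun_of b x = 0[N]}" using ba c by auto
 moreover have "inj_on (fun_of a) (carrier L)" by (rule inj_on_inverseI[where g = "fun_of t"], rule ta)
 moreover have "fun_of b ` carrier M = carrier N" using bs c by (auto simp: image_iff) metis
 moreover have "a = (L, fun_of a, M)" "b = (M, fun_of b, N)" "fun_of a:mod_hom R L M" "fun_of b:mod_hom R M N"
  using h by (auto simp: Hom_E)
 moreover obtain f g where "a = (L, f, M)" "b = (M, g, N)" using h by (auto simp: Hom_E)
 ultimately show "(a, b):Ses E" using p by (simp add: Rproj_def fun_of_def)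
qed

lemma E_category: "category E"
proof
 fix f assume "f:Arr E"
 then show "Dom E f:Obj E" "Cod E f:Obj E" by (auto simp: Rproj_def)
next
 fix f g h W X Y Z assume h: "f:Hom E W X" "g:Hom E X Y" "h:Hom E Y Z"
 show "h o[E] g o[E] f = (h o[E] g) o[E] f"
 proof (rule Hom_E_eqI)
  fix x assume x: "x:carrier W"
  show "fun_of (h o[E] g o[E] f) x = fun_of ((h o[E] g) o[E] f) x"
   unfolding Comp_E(2)[OF Comp_E(1)[OF h(1,2)] h(3) x] Comp_E(2)[OF h(1,2) x]
    Comp_E(2)[OF h(1) Comp_E(1)[OF h(2,3)] x] Comp_E(2)[OF h(2,3) fun_of_closed[OF h(1) x]] ..
 qed (use h Comp_E(1) in blast)+
next
 fix f X Y assume f: "f:Hom E X Y"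
 then have p: "fgp R X" "fgp R Y" by (auto simp: Hom_E)
 show "Ident E Y o[E] f = f"
  by (rule Hom_E_eqI[OF Comp_E(1)[OF f Ident_E(1)[OF p(2)]] f]) (simp add: Comp_E(2)[OF f Ident_E(1)[OF p(2)]] Ident_E(2) fun_of_closed[OF f])
 show "f o[E] Ident E X = f"
  by (rule Hom_E_eqI[OF Comp_E(1)[OF Ident_E(1)[OF p(1)] f] f]) (simp add: Comp_E(2)[OF Ident_E(1)[OF p(1)] f] Ident_E(2))
qed (auto intro: Ident_E Comp_E)

end

section \<open>A ring containing all graded maps\<close>

text \<open>A graded map of degree \<open>k\<close> between complexes of modules is a family \<open>X\<^sup>n \<rightarrow> Y\<^sup>n\<^sup>+\<^sup>k\<close>, and
 identities between such maps would need a source and a target for every composite. All of them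
 can be computed in one ring instead: each family acts on the product of all groups \<open>X\<^sup>n\<close>, for
 \<open>X\<close> ranging over all complexes, and composites, sums and negatives of graded maps are products,
 sums and negatives of additive endomorphisms of this product. Homotopies, cones and extensions
 then become calculations in a ring.\<close>

type_synonym ('r, 'm) mcpx = "(('r, 'm) module, ('r, 'm) mmap) cpx"

definition grp :: "('r, 'm) mcpx \<times> int => ('r, 'm) module" where
 "grp i = cob (fst i) (snd i)"

typedef ('r, 'm) sec = "{v :: ('r, 'm) mcpx \<times> int => 'm.
  ALL i. if abelian_group (grp i) then v i:carrier (grp i) else v i = undefined}"
proof
 show "(%i. if abelian_group (grp i) then 0[grp i] else undefined):{v :: ('r, 'm) mcpx \<times> int => 'm.
  ALL i. if abelian_group (grp i) then v i:carrier (grp i) else v i = undefined}"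
  by (simp add: abelian_group.axioms(1) abelian_monoid.zero_closed)
qed

setup_lifting type_definition_sec

instantiation sec :: (type, type) ab_group_add
begin

lift_definition zero_sec :: "('a, 'b) sec" is
 "%i. if abelian_group (grp i) then 0[grp i] else undefined"
 by (simp add: abelian_group.axioms(1) abelian_monoid.zero_closed)

lift_definition plus_sec :: "('a, 'b) sec => ('a, 'b) sec => ('a, 'b) sec" is
 "%v w i. if abelian_group (grp i) then v i +[grp i] w i else undefined"
 by (auto simp: abelian_group.axioms(1) abelian_monoid.a_closed)

lift_definition uminus_sec :: "('a, 'b) sec => ('a, 'b) sec" is
 "%v i. if abelian_group (grp i) then \<ominus>\<^bsub>grp i\<^esub> v i else undefined"
 by (auto simp: abelian_group.a_inv_closed)

definition minus_sec :: "('a, 'b) sec => ('a, 'b) sec => ('a, 'b) sec" where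
 "minus_sec v w = v+- w"

instance
proof
 fix a b c :: "('a, 'b) sec"
 show "a+b+c = a+(b+c)"
  by transfer (rule ext, auto simp: abelian_monoid.a_assoc abelian_group.axioms(1))
 show "a+b = b+a"
  by transfer (rule ext, auto simp: abelian_monoid.a_comm abelian_group.axioms(1))
 show "0+a = a"
  by transfer (rule ext, auto simp: abelian_monoid.l_zero abelian_group.axioms(1))
 show "- a+a = 0"
  by transfer (rule ext, auto simp: abelian_group.l_neg)
 show "a - b = a+- b" by (simp add: minus_sec_def)
qed

end

typedef ('r, 'm) gop = "{F :: ('r, 'm) sec => ('r, 'm) sec. ALL v w. F (v+w) = F v+F w}"
 morphisms app Abs_gop
 by (rule exI[of _ "%_. 0"]) simp

setup_lifting type_definition_gop

instantiation gop :: (type, type) ring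
begin

lift_definition zero_gop :: "('a, 'b) gop" is "%_. 0" by simp
lift_definition plus_gop :: "('a, 'b) gop => ('a, 'b) gop => ('a, 'b) gop" is "%F G v. F v+G v" by simp
lift_definition uminus_gop :: "('a, 'b) gop => ('a, 'b) gop" is "%F v. - F v" by simp
lift_definition minus_gop :: "('a, 'b) gop => ('a, 'b) gop => ('a, 'b) gop" is "%F G v. F v - G v" by simp
lift_definition times_gop :: "('a, 'b) gop => ('a, 'b) gop => ('a, 'b) gop" is "%F G v. F (G v)" by simp

instance
 by (standard; transfer) (auto simp: alg)

end

lemma gop_eqI: "(!!v. app F v = app G v) ==> F = G"
 by (metis app_inject ext)

definition coord :: "('r, 'm) sec => ('r, 'm) mcpx => int => 'm" where
 "coord v X n = Rep_sec v (X, n)"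

lemma sec_eqI: "(!!X n. abelian_group (cob X n) ==> coord v X n = coord w X n) ==> v = w"
proof -
 assume a: "!!X n. abelian_group (cob X n) ==> coord v X n = coord w X n"
 have "Rep_sec v (X, n) = Rep_sec w (X, n)" for X n
  using a[of X n] Rep_sec[of v] Rep_sec[of w] by (cases "abelian_group (cob X n)") (auto simp: coord_def grp_def)
 then have "Rep_sec v = Rep_sec w" by auto
 then show ?thesis by (simp add: Rep_sec_inject)
qed

lemma coord_closed [simp]: "abelian_group (cob X n) ==> coord v X n:carrier (cob X n)"
proof -
 assume "abelian_group (cob X n)"
 moreover have "ALL i. if abelian_group (grp i) then Rep_sec v i:carrier (grp i) else Rep_sec v i = undefined"
  using Rep_sec[of v] by simp
 then have "if abelian_group (grp (X, n)) then Rep_sec v (X, n):carrier (grp (X, n)) else Rep_sec v (X, n) = undefined"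
  by (rule spec)
 ultimately show ?thesis by (simp add: coord_def grp_def)
qed

lemma coord_add: "abelian_group (cob X n) ==> coord (v+w) X n = coord v X n +[cob X n] coord w X n"
 and coord_zero: "abelian_group (cob X n) ==> coord 0 X n = 0[cob X n]"
 and coord_minus: "abelian_group (cob X n) ==> coord (- v) X n = -[cob X n] coord v X n"
 by (simp_all add: coord_def plus_sec.rep_eq zero_sec.rep_eq uminus_sec.rep_eq grp_def)

text \<open>The section with prescribed coordinates (made trivial where they do not lie in the groups).\<close>

definition mk_sec :: "(('r, 'm) mcpx => int => 'm) => ('r, 'm) sec" where
 "mk_sec c = Abs_sec (%(X, n). if abelian_group (cob X n) then
   (if c X n:carrier (cob X n) then c X n else 0[cob X n]) else undefined)"

lemma coord_mk_sec: "abelian_group (cob X n) ==> c X n:carrier (cob X n) ==> coord (mk_sec c) X n = c X n"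
 unfolding coord_def mk_sec_def
 by (subst Abs_sec_inverse)
   (auto simp: grp_def abelian_group.axioms(1) abelian_monoid.zero_closed)

definition gm :: "('r, 'm) mcpx => ('r, 'm) mcpx => int => (int => ('r, 'm) mmap) => ('r, 'm) gop" where
 "gm X Y k f = Abs_gop (%v. mk_sec (%Z n. if Z = Y then fun_of (f (n - k)) (coord v X (n - k)) else 0[cob Z n]))"

context proj_modules
begin

definition fam :: "('r, 'm) mcpx => ('r, 'm) mcpx => int => (int => ('r, 'm) mmap) => bool" where
 "fam X Y k f \<longleftrightarrow> (ALL n. f n:Hom E (cob X n) (cob Y (n+k)))"

definition gob :: "('r, 'm) mcpx => bool" where
 "gob X \<longleftrightarrow> (ALL n. fgp R (cob X n))"

lemma gob_group: "gob X ==> abelian_group (cob X n)"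
 by (simp add: gob_def fgp_group)

lemma famD:
 assumes "fam X Y k f"
 shows "f n:Hom E (cob X n) (cob Y (n+k))" "gob X" "gob Y"
  "x:carrier (cob X (n - k)) ==> fun_of (f (n - k)) x:carrier (cob Y n)"
proof -
 show f: "f n:Hom E (cob X n) (cob Y (n+k))" for n using assms by (simp add: fam_def)
 show "gob X" using f by (simp add: gob_def Hom_E)
 have "f (n - k):Hom E (cob X (n - k)) (cob Y n)" for n using f[of "n - k"] by simp
 then show "gob Y" by (auto simp: gob_def Hom_E)
 show "x:carrier (cob X (n - k)) ==> fun_of (f (n - k)) x:carrier (cob Y n)"
  using fun_of_closed[OF f[of "n - k"], of x] by simp
qed

lemma coord_gm:
 assumes f: "fam X Y k f" and Z: "abelian_group (cob Z n)"
 shows "coord (app (gm X Y k f) v) Z n = (if Z = Y then fun_of (f (n - k)) (coord v X (n - k)) else 0[cob Z n])"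
proof -
 define F where "F = (%v. mk_sec (%Z n. if Z = Y then fun_of (f (n - k)) (coord v X (n - k)) else 0[cob Z n]))"
 have X: "abelian_group (cob X n)" for n using gob_group famD(2)[OF f] by blast
 have F: "coord (F v) Z n = (if Z = Y then fun_of (f (n - k)) (coord v X (n - k)) else 0[cob Z n])"
  if Z: "abelian_group (cob Z n)" for v Z n
  unfolding F_def using Z famD(4)[OF f] X
  by (subst coord_mk_sec) (auto simp: abelian_group.axioms(1) abelian_monoid.zero_closed)
 have "F (v+w) = F v+F w" for v w
 proof (rule sec_eqI)
  fix Z :: "('r, 'm) mcpx" and n assume Z: "abelian_group (cob Z n)"
  have "fun_of (f (n - k)):mod_hom R (cob X (n - k)) (cob Y n)" using famD(1)[OF f, of "n - k"] by (simp add: Hom_E)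
  then show "coord (F (v+w)) Z n = coord (F v+F w) Z n"
   using Z X by (simp add: F coord_add mod_homD(2) abelian_monoid.l_zero abelian_monoid.zero_closed abelian_group.axioms(1))
 qed
 then have "app (gm X Y k f) = F" unfolding gm_def F_def[symmetric] by (simp add: Abs_gop_inverse)
 then show ?thesis using F[OF Z] by simp
qed

definition single :: "('r, 'm) mcpx => int => 'm => ('r, 'm) sec" where
 "single X n x = mk_sec (%Z m. if Z = X & m = n then x else 0[cob Z m])"

lemma gm_inj:
 assumes f: "fam X Y k f" and g: "fam X Y k g" and eq: "gm X Y k f = gm X Y k g"
 shows "f = g"
proof
 fix n
 note gb = famD(2,3)[OF f]
 have "fun_of (f n) x = fun_of (g n) x" if x: "x:carrier (cob X n)" for x
 proof -
  have "coord (single X n x) X n = x"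
   unfolding single_def by (subst coord_mk_sec) (use x gb gob_group in auto)
  then show ?thesis
   using coord_gm[OF f, of Y "n+k" "single X n x"] coord_gm[OF g, of Y "n+k" "single X n x"] eq gob_group[OF gb(2)]
   by simp
 qed
 then show "f n = g n" by (rule Hom_E_eqI[OF famD(1)[OF f] famD(1)[OF g]])
qed

lemma fam_add: "fam X Y k f ==> fam X Y k g ==> fam X Y k (%n. AddA E (f n) (g n))"
 by (simp add: fam_def Add_E)
lemma fam_neg: "fam X Y k f ==> fam X Y k (%n. NegA E (f n))"
 by (simp add: fam_def Neg_E)
lemma fam_zero: "gob X ==> gob Y ==> fam X Y k (%n. ZeroA E (cob X n) (cob Y (n+k)))"
 by (simp add: fam_def gob_def Zero_E)
lemma fam_ident: "gob X ==> fam X X 0 (%n. Ident E (cob X n))"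
 by (simp add: fam_def gob_def Ident_E)
lemma fam_comp: "fam X Y k f ==> fam Y Z l g ==> fam X Z (k+l) (%n. g (n+k) o[E] f n)"
 using Comp_E(1)[OF famD(1)[of X Y k f n for n] famD(1)[of Y Z l g "n+k" for n]]
 unfolding fam_def add.assoc by auto

lemma gm_eqI:
 assumes "fam X Y k f" "!!v n. coord (app F v) Y n = fun_of (f (n - k)) (coord v X (n - k))"
  "!!v Z n. abelian_group (cob Z n) ==> Z ~= Y ==> coord (app F v) Z n = 0[cob Z n]"
 shows "gm X Y k f = F"
 by (intro gop_eqI sec_eqI) (use assms in \<open>auto simp: coord_gm\<close>)

lemma gm_add:
 assumes "fam X Y k f" "fam X Y k g"
 shows "gm X Y k (%n. AddA E (f n) (g n)) = gm X Y k f+gm X Y k g"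
proof (rule gm_eqI[OF fam_add[OF assms]])
 note gb = gob_group[OF famD(2)[OF assms(1)]] gob_group[OF famD(3)[OF assms(1)]]
 show "coord (app (gm X Y k f+gm X Y k g) v) Y n = fun_of (AddA E (f (n - k)) (g (n - k))) (coord v X (n - k))" for v n
  using Add_E(2)[OF famD(1)[OF assms(1)] famD(1)[OF assms(2)], of "coord v X (n - k)" "n - k"] gb assms
  by (simp add: plus_gop.rep_eq coord_add coord_gm)
 show "coord (app (gm X Y k f+gm X Y k g) v) Z n = 0[cob Z n]" if "abelian_group (cob Z n)" "Z ~= Y" for v Z n
  using that assms by (simp add: plus_gop.rep_eq coord_add coord_gm abelian_monoid.l_zero abelian_group.axioms(1) abelian_monoid.zero_closed)
qed

lemma gm_neg:
 assumes "fam X Y k f"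
 shows "gm X Y k (%n. NegA E (f n)) = - gm X Y k f"
proof (rule gm_eqI[OF fam_neg[OF assms]])
 note gb = gob_group[OF famD(2)[OF assms(1)]] gob_group[OF famD(3)[OF assms(1)]]
 show "coord (app (- gm X Y k f) v) Y n = fun_of (NegA E (f (n - k))) (coord v X (n - k))" for v n
  using Neg_E(2)[OF famD(1)[OF assms(1)], of "coord v X (n - k)" "n - k"] gb assms
  by (simp add: uminus_gop.rep_eq coord_minus coord_gm)
 show "coord (app (- gm X Y k f) v) Z n = 0[cob Z n]" if Z: "abelian_group (cob Z n)" "Z ~= Y" for v Z n
 proof -
  interpret abelian_group "cob Z n" by fact
  show ?thesis using that assms by (simp add: uminus_gop.rep_eq coord_minus coord_gm)
 qed
qed

lemma gm_zero:
 assumes "gob X" "gob Y"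
 shows "gm X Y k (%n. ZeroA E (cob X n) (cob Y (n+k))) = 0"
 by (rule gm_eqI[OF fam_zero[OF assms]])
  (use Zero_E(2) gob_group[OF assms(1)] gob_group[OF assms(2)] in \<open>auto simp: zero_gop.rep_eq coord_zero\<close>)

lemma gm_comp:
 assumes "fam X Y k f" "fam Y Z l g"
 shows "gm X Z (k+l) (%n. g (n+k) o[E] f n) = gm Y Z l g*gm X Y k f"
proof (rule gm_eqI[OF fam_comp[OF assms]])
 note gb = gob_group[OF famD(2)[OF assms(1)]] gob_group[OF famD(3)[OF assms(1)]] gob_group[OF famD(3)[OF assms(2)]]
 show "coord (app (gm Y Z l g*gm X Y k f) v) Z n =
   fun_of (g (n - (k+l)+k) o[E] f (n - (k+l))) (coord v X (n - (k+l)))" for v n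
 proof -
  have i: "n - (k+l)+k = n - l" "n - l - k = n - (k+l)" by simp_all
  have "f (n - (k+l)):Hom E (cob X (n - (k+l))) (cob Y (n - l))" using famD(1)[OF assms(1), of "n - (k+l)"] by (simp only: i)
  from Comp_E(2)[OF this famD(1)[OF assms(2)], of "coord v X (n - (k+l))"] show ?thesis
   using gb assms by (simp add: times_gop.rep_eq coord_gm i)
 qed
 show "coord (app (gm Y Z l g*gm X Y k f) v) Z' n = 0[cob Z' n]" if "abelian_group (cob Z' n)" "Z' ~= Z" for v Z' n
  using that assms by (simp add: times_gop.rep_eq coord_gm)
qed

definition H :: "('r, 'm) mcpx => ('r, 'm) mcpx => int => ('r, 'm) gop set" where
 "H X Y k = gm X Y k ` {f. fam X Y k f}"

definition fm :: "('r, 'm) mcpx => ('r, 'm) mcpx => int => ('r, 'm) gop => int => ('r, 'm) mmap" where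
 "fm X Y k F = (THE f. fam X Y k f & gm X Y k f = F)"

definition uno :: "('r, 'm) mcpx => ('r, 'm) gop" where
 "uno X = gm X X 0 (%n. Ident E (cob X n))"

definition dd :: "('r, 'm) mcpx => ('r, 'm) gop" where
 "dd X = gm X X 1 (cdif X)"

lemma fm_gm [simp]: "fam X Y k f ==> fm X Y k (gm X Y k f) = f"
 unfolding fm_def by (rule the_equality) (auto intro: gm_inj)

lemma gm_H: "fam X Y k f ==> gm X Y k f:H X Y k"
 by (auto simp: H_def)

lemma fm [simp]: "F:H X Y k ==> fam X Y k (fm X Y k F)" "F:H X Y k ==> gm X Y k (fm X Y k F) = F"
 by (auto simp: H_def)

lemma H_gob: "F:H X Y k ==> gob X" "F:H X Y k ==> gob Y"
 by (auto simp: H_def dest: famD)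

lemma H_add: "F:H X Y k ==> G:H X Y k ==> F+G:H X Y k"
 by (auto simp: H_def gm_add[symmetric] fam_add)
lemma H_neg: "F:H X Y k ==> - F:H X Y k"
 by (auto simp: H_def gm_neg[symmetric] fam_neg)
lemma H_diff: "F:H X Y k ==> G:H X Y k ==> F - G:H X Y k"
 using H_add[of F X Y k "- G"] H_neg by simp
lemma H_zero: "gob X ==> gob Y ==> 0:H X Y k"
 using gm_H[OF fam_zero[of X Y k]] by (simp add: gm_zero)
lemma H_mult: "F:H X Y k ==> G:H Y Z l ==> m = k+l ==> G*F:H X Z m"
 by (auto simp: H_def gm_comp[symmetric] fam_comp)
lemma H_uno: "gob X ==> uno X:H X X 0"
 by (simp add: uno_def gm_H fam_ident)

lemma fm_eq: "fam X Y k f ==> F = gm X Y k f ==> fm X Y k F = f"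
 by simp

lemma fm_add: "F:H X Y k ==> G:H X Y k ==> fm X Y k (F+G) = (%n. AddA E (fm X Y k F n) (fm X Y k G n))"
 by (rule fm_eq) (simp_all add: gm_add fam_add)
lemma fm_mult: "F:H X Y k ==> G:H Y Z l ==> fm X Z (k+l) (G*F) = (%n. fm Y Z l G (n+k) o[E] fm X Y k F n)"
proof -
 assume F: "F:H X Y k" and G: "G:H Y Z l"
 note f = fm(1)[OF F] and g = fm(1)[OF G]
 show ?thesis by (rule fm_eq[OF fam_comp[OF f g]]) (simp add: gm_comp[OF f g] F G)
qed
lemma fm_zero: "gob X ==> gob Y ==> fm X Y k 0 = (%n. ZeroA E (cob X n) (cob Y (n+k)))"
 by (rule fm_eq) (simp_all add: gm_zero fam_zero)
lemma fm_uno: "gob X ==> fm X X 0 (uno X) = (%n. Ident E (cob X n))"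
 by (rule fm_eq) (simp_all add: uno_def fam_ident)

lemma unl: "F:H X Y k ==> uno Y*F = F"
proof -
 assume F: "F:H X Y k"
 have u: "uno Y:H Y Y 0" using F H_gob H_uno by blast
 interpret category E by (rule E_category)
 have "fm X Y (k+0) (uno Y*F) = fm X Y k F"
  unfolding fm_mult[OF F u] using Ident_left[OF famD(1)[OF fm(1)[OF F]]] fm_uno H_gob(2)[OF F] by simp
 then show ?thesis using fm(2)[OF F] fm(2)[OF H_mult[OF F u refl]] by simp
qed

lemma unr: "F:H X Y k ==> F*uno X = F"
proof -
 assume F: "F:H X Y k"
 have u: "uno X:H X X 0" using F H_gob H_uno by blast
 interpret category E by (rule E_category)
 have "fm X Y (0+k) (F*uno X) = fm X Y k F"
  unfolding fm_mult[OF u F] using Ident_right[OF famD(1)[OF fm(1)[OF F]]] fm_uno H_gob(1)[OF F] by simp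
 then show ?thesis using fm(2)[OF F] fm(2)[OF H_mult[OF u F refl]] by simp
qed

end

section \<open>Complexes, homotopies and cones\<close>

lemma msub: "a*b = c ==> a*(b*x) = c*(x :: 'a :: semigroup_mult)"
 by (simp add: ma[symmetric])

context proj_modules
begin

abbreviation "C \<equiv> Cb E"
abbreviation "K \<equiv> Kb E"

definition cpx :: "('r, 'm) mcpx => bool" where
 "cpx X \<longleftrightarrow> bounded_cpx E X"

lemma gm_cong: "(!!n. f n = g n) ==> gm X Y k f = gm X Y k g"
 by (metis ext)

lemma gm_eq_iff: "fam X Y k f ==> fam X Y k g ==> gm X Y k f = gm X Y k g \<longleftrightarrow> (ALL n. f n = g n)"
 using gm_inj[of X Y k f g] gm_cong[of f g X Y k] by auto

lemma cpx_iff: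
 "cpx X \<longleftrightarrow> fam X X 1 (cdif X) & dd X*dd X = 0 & finite {n. ~ zero_object E (cob X n)}"
proof (cases "fam X X 1 (cdif X)")
 case True
 note g = famD(2)[OF True]
 have e: "dd X*dd X = gm X X (1+1) (%n. cdif X (n+1) o[E] cdif X n)"
  unfolding dd_def by (rule gm_comp[OF True True, symmetric])
 have "dd X*dd X = 0 \<longleftrightarrow> (ALL n. cdif X (n+1) o[E] cdif X n = ZeroA E (cob X n) (cob X (n+2)))"
  unfolding e gm_zero[OF g g, of "1+1", symmetric]
  using gm_eq_iff[OF fam_comp[OF True True] fam_zero[OF g g, of "1+1"]] by simp
 then show ?thesis using True g unfolding cpx_def bounded_cpx_def by (auto simp: fam_def gob_def)
qed (auto simp: cpx_def bounded_cpx_def fam_def)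

lemma cpxD:
 assumes "cpx X"
 shows "gob X" "fam X X 1 (cdif X)" "dd X:H X X 1" "dd X*dd X = 0"
  "finite {n. ~ zero_object E (cob X n)}" "uno X:H X X 0"
 using assms famD(2)[of X X 1 "cdif X"] by (auto simp: cpx_iff dd_def intro: gm_H H_uno)

text \<open>Chain maps, homotopy and arrows of the two categories are restated for ring elements.\<close>

definition chain :: "('r, 'm) mcpx => ('r, 'm) mcpx => ('r, 'm) gop => bool" where
 "chain X Y F \<longleftrightarrow> cpx X & cpx Y & F:H X Y 0 & dd Y*F = F*dd X"

definition heq :: "('r, 'm) mcpx => ('r, 'm) mcpx => ('r, 'm) gop => ('r, 'm) gop => bool" where
 "heq X Y F G \<longleftrightarrow> (EX h:H X Y (-1). F = G+(dd Y*h+h*dd X))"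

definition cb :: "('r, 'm) mcpx => ('r, 'm) mcpx => ('r, 'm) gop => (('r, 'm) module, ('r, 'm) mmap) cmap" where
 "cb X Y F = (X, fm X Y 0 F, Y)"

definition kb :: "('r, 'm) mcpx => ('r, 'm) mcpx => ('r, 'm) gop => (('r, 'm) module, ('r, 'm) mmap) hmap" where
 "kb X Y F = (X, homotopy_class E X Y (fm X Y 0 F), Y)"

lemma chainD:
 assumes "chain X Y F"
 shows "cpx X" "cpx Y" "F:H X Y 0" "dd Y*F = F*dd X"
 using assms by (auto simp: chain_def)

lemma chain_map_iff:
 assumes "cpx X" "cpx Y"
 shows "chain_map E X Y f \<longleftrightarrow> fam X Y 0 f & chain X Y (gm X Y 0 f)"
proof (cases "fam X Y 0 f")
 case True
 note dX = cpxD(2)[OF assms(1)] and dY = cpxD(2)[OF assms(2)]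
 have "dd Y*gm X Y 0 f = gm X Y (0+1) (%n. cdif Y (n+0) o[E] f n)"
  unfolding dd_def by (rule gm_comp[OF True dY, symmetric])
 moreover have "gm X Y 0 f*dd X = gm X Y (1+0) (%n. f (n+1) o[E] cdif X n)"
  unfolding dd_def by (rule gm_comp[OF dX True, symmetric])
 moreover have "fam X Y (0+1) (%n. cdif Y (n+0) o[E] f n)" "fam X Y (1+0) (%n. f (n+1) o[E] cdif X n)"
  using fam_comp[OF True dY] fam_comp[OF dX True] by auto
 ultimately have "dd Y*gm X Y 0 f = gm X Y 0 f*dd X \<longleftrightarrow> (ALL n. cdif Y n o[E] f n = f (n+1) o[E] cdif X n)"
  using gm_eq_iff[of X Y 1] by simp
 then show ?thesis using True gm_H[OF True] assms by (auto simp: chain_map_def chain_def fam_def)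
qed (auto simp: chain_map_def fam_def)

lemma homotopic_iff:
 assumes "cpx X" "cpx Y" "fam X Y 0 f" "fam X Y 0 g"
 shows "homotopic E X Y f g \<longleftrightarrow> heq X Y (gm X Y 0 f) (gm X Y 0 g)"
proof -
 note dX = cpxD(2)[OF assms(1)] and dY = cpxD(2)[OF assms(2)]
 have "gm X Y 0 f = gm X Y 0 g+(dd Y*gm X Y (-1) h+gm X Y (-1) h*dd X) \<longleftrightarrow>
  (ALL n. f n = AddA E (g n) (AddA E (cdif Y (n - 1) o[E] h n) (h (n+1) o[E] cdif X n)))"
  if h: "fam X Y (-1) h" for h
 proof -
  have 1: "dd Y*gm X Y (-1) h = gm X Y 0 (%n. cdif Y (n - 1) o[E] h n)"
   using gm_comp[OF h dY] by (simp add: dd_def)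
  have 2: "gm X Y (-1) h*dd X = gm X Y 0 (%n. h (n+1) o[E] cdif X n)"
   using gm_comp[OF dX h] by (simp add: dd_def)
  have f1: "fam X Y 0 (%n. cdif Y (n - 1) o[E] h n)" using fam_comp[OF h dY] by simp
  have f2: "fam X Y 0 (%n. h (n+1) o[E] cdif X n)" using fam_comp[OF dX h] by simp
  show ?thesis
   unfolding 1 2 gm_add[OF f1 f2, symmetric] gm_add[OF assms(4) fam_add[OF f1 f2], symmetric]
   by (rule gm_eq_iff[OF assms(3) fam_add[OF assms(4) fam_add[OF f1 f2]]])
 qed
 moreover have "homotopic E X Y f g \<longleftrightarrow> (EX h. fam X Y (-1) h &
   (ALL n. f n = AddA E (g n) (AddA E (cdif Y (n - 1) o[E] h n) (h (n+1) o[E] cdif X n))))"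
  by (auto simp: homotopic_def fam_def)
 ultimately show ?thesis by (auto simp: heq_def H_def)
qed

lemma chain_uno: "cpx X ==> chain X X (uno X)"
 by (simp add: chain_def cpxD(1) H_uno unl[OF cpxD(3)] unr[OF cpxD(3)])

lemma chain_zero: "cpx X ==> cpx Y ==> chain X Y 0"
 by (simp add: chain_def H_zero cpxD)

lemma chain_mult: "chain X Y F ==> chain Y Z G ==> chain X Z (G*F)"
 unfolding chain_def by (auto intro: H_mult) (metis ma)

lemma chain_add: "chain X Y F ==> chain X Y G ==> chain X Y (F+G)"
 unfolding chain_def by (auto intro: H_add simp: alg)

lemma chain_neg: "chain X Y F ==> chain X Y (- F)"
 unfolding chain_def by (auto intro: H_neg)

lemma heq_refl: "chain X Y F ==> heq X Y F F"
 unfolding heq_def by (rule bexI[of _ 0]) (auto intro: H_zero simp: chain_def cpxD)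

lemma heqI: "h:H X Y (-1) ==> F = G+(dd Y*h+h*dd X) ==> heq X Y F G"
 by (auto simp: heq_def)

lemma heqE: "heq X Y F G ==> (!!h. h:H X Y (-1) ==> F = G+(dd Y*h+h*dd X) ==> thesis) ==> thesis"
 by (auto simp: heq_def)

lemma heq_sym: "heq X Y F G ==> heq X Y G F"
 by (erule heqE, rule_tac h = "- h" in heqI) (auto intro: H_neg)

lemma heq_trans: "heq X Y F G ==> heq X Y G G' ==> heq X Y F G'"
 by (elim heqE, rule_tac h = "h+ha" in heqI) (auto intro: H_add simp: alg)

lemma heq_add: "heq X Y F F' ==> heq X Y G G' ==> heq X Y (F+G) (F'+G')"
 by (elim heqE, rule_tac h = "h+ha" in heqI) (auto intro: H_add simp: alg)

lemma heq_multL: "heq X Y F F' ==> chain Y Z G ==> heq X Z (G*F) (G*F')"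
proof -
 assume a: "heq X Y F F'" and G: "chain Y Z G"
 then obtain h where h: "h:H X Y (-1)" "F = F'+(dd Y*h+h*dd X)" by (auto simp: heq_def)
 have "G*F = G*F'+(dd Z*(G*h)+(G*h)*dd X)"
  by (simp add: h(2) alg msub[OF chainD(4)[OF G]])
 then show ?thesis using H_mult[OF h(1) chainD(3)[OF G], of "-1"] by (auto simp: heq_def)
qed

lemma heq_multR: "heq Y Z F F' ==> chain X Y G ==> heq X Z (F*G) (F'*G)"
proof -
 assume a: "heq Y Z F F'" and G: "chain X Y G"
 then obtain h where h: "h:H Y Z (-1)" "F = F'+(dd Z*h+h*dd Y)" by (auto simp: heq_def)
 have "F*G = F'*G+(dd Z*(h*G)+(h*G)*dd X)"
  by (simp add: h(2) alg chainD(4)[OF G])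
 then show ?thesis using H_mult[OF chainD(3)[OF G] h(1), of "-1"] by (auto simp: heq_def)
qed

lemma heq_mult: "[|heq X Y F F'; heq Y Z G G'; chain X Y F; chain Y Z G'|] ==> heq X Z (G*F) (G'*F')"
 by (meson heq_multL heq_multR heq_trans)

subsection \<open>The categories of complexes in terms of ring elements\<close>

lemma C_arr: "s:Arr C \<longleftrightarrow> (EX X Y F. chain X Y F & s = cb X Y F)"
proof
 assume "s:Arr C"
 then obtain X f Y where s: "s = (X, f, Y)" "cpx X" "cpx Y" "chain_map E X Y f" by (auto simp: Cb_def cpx_def)
 then have "fam X Y 0 f" "chain X Y (gm X Y 0 f)" by (auto simp: chain_map_iff)
 then show "EX X Y F. chain X Y F & s = cb X Y F" using s by (auto simp: cb_def intro!: exI[of _ "gm X Y 0 f"])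
next
 assume "EX X Y F. chain X Y F & s = cb X Y F"
 then obtain X Y F where s: "chain X Y F" "s = cb X Y F" by blast
 then have "chain_map E X Y (fm X Y 0 F)" using chainD[OF s(1)] by (simp add: chain_map_iff)
 then show "s:Arr C" using s chainD[OF s(1)] by (simp add: Cb_def cb_def cpx_def)
qed

lemma cb_arr: "chain X Y F ==> cb X Y F:Arr C"
 using C_arr by blast

lemma C_simps [simp]: "Obj C = {X. cpx X}" "Dom C (cb X Y F) = X" "Cod C (cb X Y F) = Y"
 by (simp_all add: Cb_def cb_def cpx_def)

lemma cb_eq_iff: "chain X Y F ==> chain X Y G ==> cb X Y F = cb X Y G \<longleftrightarrow> F = G"
 unfolding cb_def by (metis Pair_inject chainD(3) fm(2))

lemma cb_comp: "chain X Y F ==> chain Y Z G ==> Comp C (cb Y Z G) (cb X Y F) = cb X Z (G*F)"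
 using fm_mult[OF chainD(3) chainD(3), of X Y F Z G] by (simp add: Cb_def cb_def)

lemma cb_ident: "cpx X ==> Ident C X = cb X X (uno X)"
 using fm_uno[OF cpxD(1)] by (simp add: Cb_def cb_def)

lemma cb_zero: "cpx X ==> cpx Y ==> ZeroA C X Y = cb X Y 0"
 using fm_zero[OF cpxD(1) cpxD(1), of X Y 0] by (simp add: Cb_def cb_def)

lemma cb_add: "chain X Y F ==> chain X Y G ==> AddA C (cb X Y F) (cb X Y G) = cb X Y (F+G)"
 using fm_add[OF chainD(3) chainD(3), of X Y F G] by (simp add: Cb_def cb_def)

lemma C_category: "category C"
proof
 fix f assume "f:Arr C" then show "Dom C f:Obj C" "Cod C f:Obj C" by (auto simp: C_arr chain_def)
next
 fix X assume "X:Obj C" then show "Ident C X:Hom C X X" by (simp add: cb_ident Hom_def cb_arr chain_uno)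
next
 fix f g X Y Z assume "f:Hom C X Y" "g:Hom C Y Z"
 then obtain F G where "chain X Y F" "chain Y Z G" "f = cb X Y F" "g = cb Y Z G" by (auto simp: Hom_def C_arr)
 then show "Comp C g f:Hom C X Z" by (simp add: cb_comp Hom_def cb_arr chain_mult)
next
 fix f g h W X Y Z assume "f:Hom C W X" "g:Hom C X Y" "h:Hom C Y Z"
 then obtain F G H where "chain W X F" "chain X Y G" "chain Y Z H" "f = cb W X F" "g = cb X Y G" "h = cb Y Z H"
  by (auto simp: Hom_def C_arr)
 then show "Comp C h (Comp C g f) = Comp C (Comp C h g) f" by (simp add: cb_comp chain_mult ma)
next
 fix f X Y assume "f:Hom C X Y"
 then obtain F where F: "chain X Y F" "f = cb X Y F" by (auto simp: Hom_def C_arr)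
 then show "Comp C (Ident C Y) f = f" "Comp C f (Ident C X) = f"
  using chainD[OF F(1)] by (simp_all add: cb_ident cb_comp chain_uno unl unr)
qed

lemma to_Kb_cb [simp]: "to_Kb E (cb X Y F) = kb X Y F"
 by (simp add: to_Kb_def cb_def kb_def)

lemma class_iff:
 assumes "chain X Y F"
 shows "g:homotopy_class E X Y (fm X Y 0 F) \<longleftrightarrow> (EX G. chain X Y G & g = fm X Y 0 G & heq X Y F G)"
proof
 note X = chainD(1)[OF assms] and Y = chainD(2)[OF assms] and F = chainD(3)[OF assms]
 assume "g:homotopy_class E X Y (fm X Y 0 F)"
 then have g: "chain_map E X Y g" "homotopic E X Y (fm X Y 0 F) g" by (auto simp: homotopy_class_def)
 then have fg: "fam X Y 0 g" "chain X Y (gm X Y 0 g)" using chain_map_iff[OF X Y] by auto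
 moreover have "heq X Y F (gm X Y 0 g)" using homotopic_iff[OF X Y fm(1)[OF F] fg(1)] g(2) fm(2)[OF F] by simp
 ultimately show "EX G. chain X Y G & g = fm X Y 0 G & heq X Y F G" by (intro exI[of _ "gm X Y 0 g"]) simp
next
 note X = chainD(1)[OF assms] and Y = chainD(2)[OF assms] and F = chainD(3)[OF assms]
 assume "EX G. chain X Y G & g = fm X Y 0 G & heq X Y F G"
 then obtain G where G: "chain X Y G" "g = fm X Y 0 G" "heq X Y F G" by blast
 note H = chainD(3)[OF G(1)]
 have "chain_map E X Y g" using chain_map_iff[OF X Y] G(1,2) fm[OF H] by simp
 moreover have "homotopic E X Y (fm X Y 0 F) g"
  using homotopic_iff[OF X Y fm(1)[OF F] fm(1)[OF H]] G(2,3) fm(2)[OF F] fm(2)[OF H] by simp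
 ultimately show "g:homotopy_class E X Y (fm X Y 0 F)" by (simp add: homotopy_class_def)
qed

lemma kb_eq_iff:
 assumes "chain X Y F" "chain X Y G"
 shows "kb X Y F = kb X Y G \<longleftrightarrow> heq X Y F G"
proof
 assume "kb X Y F = kb X Y G"
 then have "fm X Y 0 G:homotopy_class E X Y (fm X Y 0 F)"
  using class_iff[OF assms(2)] heq_refl[OF assms(2)] assms(2) by (auto simp: kb_def)
 then obtain G' where "chain X Y G'" "fm X Y 0 G = fm X Y 0 G'" "heq X Y F G'" using class_iff[OF assms(1)] by blast
 then show "heq X Y F G" using chainD(3)[OF assms(2)] by (metis chainD(3) fm(2))
next
 assume a: "heq X Y F G"
 have "g:homotopy_class E X Y (fm X Y 0 F) \<longleftrightarrow> g:homotopy_class E X Y (fm X Y 0 G)" for g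
  unfolding class_iff[OF assms(1)] class_iff[OF assms(2)] using a heq_sym heq_trans by blast
 then show "kb X Y F = kb X Y G" by (auto simp: kb_def)
qed

lemma kb_eqI: "heq X Y F G ==> chain X Y F ==> chain X Y G ==> kb X Y F = kb X Y G"
 using kb_eq_iff by blast

lemma K_arr: "s:Arr K \<longleftrightarrow> (EX X Y F. chain X Y F & s = kb X Y F)"
proof
 assume "s:Arr K"
 then obtain X f Y where s: "s = (X, homotopy_class E X Y f, Y)" "cpx X" "cpx Y" "chain_map E X Y f"
  by (auto simp: Kb_def Kb_pre_def cpx_def)
 then have "fam X Y 0 f" "chain X Y (gm X Y 0 f)" by (auto simp: chain_map_iff)
 then show "EX X Y F. chain X Y F & s = kb X Y F"
  using s(1) by (intro exI[of _ X] exI[of _ Y] exI[of _ "gm X Y 0 f"]) (simp add: kb_def)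
next
 assume "EX X Y F. chain X Y F & s = kb X Y F"
 then obtain X Y F where s: "chain X Y F" "s = kb X Y F" by blast
 then have "chain_map E X Y (fm X Y 0 F)" using chainD[OF s(1)] by (simp add: chain_map_iff)
 then show "s:Arr K" using s(2) chainD(1,2)[OF s(1)] by (auto simp: Kb_def Kb_pre_def kb_def cpx_def)
qed

lemma kb_arr: "chain X Y F ==> kb X Y F:Arr K"
 using K_arr by blast

lemma K_simps [simp]: "Obj K = {X. cpx X}" "Dom K (kb X Y F) = X" "Cod K (kb X Y F) = Y" "ShO K X = shift_cpx E X"
 by (simp_all add: Kb_def Kb_pre_def kb_def cpx_def)

lemma kb_comp:
 assumes "chain X Y F" "chain Y Z G"
 shows "Comp K (kb Y Z G) (kb X Y F) = kb X Z (G*F)"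
proof -
 let ?S = "\<Union>g\<in>homotopy_class E Y Z (fm Y Z 0 G). \<Union>f\<in>homotopy_class E X Y (fm X Y 0 F).
   homotopy_class E X Z (%n. g n o[E] f n)"
 have e: "homotopy_class E X Z (%n. g n o[E] f n) = homotopy_class E X Z (fm X Z 0 (G*F))"
  if gf: "g:homotopy_class E Y Z (fm Y Z 0 G)" "f:homotopy_class E X Y (fm X Y 0 F)" for f g
 proof -
  obtain G' where G': "chain Y Z G'" "g = fm Y Z 0 G'" "heq Y Z G G'" using gf(1) class_iff[OF assms(2)] by blast
  obtain F' where F': "chain X Y F'" "f = fm X Y 0 F'" "heq X Y F F'" using gf(2) class_iff[OF assms(1)] by blast
  have "(%n. g n o[E] f n) = fm X Z 0 (G'*F')"
   using fm_mult[OF chainD(3)[OF F'(1)] chainD(3)[OF G'(1)]] F' G' by simp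
  moreover have "kb X Z (G*F) = kb X Z (G'*F')"
   by (rule kb_eqI) (use F' G' assms heq_mult chain_mult in blast)+
  ultimately show ?thesis by (simp add: kb_def)
 qed
 have "fm Y Z 0 G:homotopy_class E Y Z (fm Y Z 0 G)" "fm X Y 0 F:homotopy_class E X Y (fm X Y 0 F)"
  using class_iff assms heq_refl by blast+
 then have "?S = homotopy_class E X Z (fm X Z 0 (G*F))" using e by blast
 then show ?thesis by (simp add: Kb_def Kb_pre_def kb_def)
qed

lemma kb_add:
 assumes "chain X Y F" "chain X Y G"
 shows "AddA K (kb X Y F) (kb X Y G) = kb X Y (F+G)"
proof -
 let ?S = "\<Union>f\<in>homotopy_class E X Y (fm X Y 0 F). \<Union>g\<in>homotopy_class E X Y (fm X Y 0 G).
   homotopy_class E X Y (%n. AddA E (f n) (g n))"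
 have e: "homotopy_class E X Y (%n. AddA E (f n) (g n)) = homotopy_class E X Y (fm X Y 0 (F+G))"
  if gf: "g:homotopy_class E X Y (fm X Y 0 G)" "f:homotopy_class E X Y (fm X Y 0 F)" for f g
 proof -
  obtain G' where G': "chain X Y G'" "g = fm X Y 0 G'" "heq X Y G G'" using gf(1) class_iff[OF assms(2)] by blast
  obtain F' where F': "chain X Y F'" "f = fm X Y 0 F'" "heq X Y F F'" using gf(2) class_iff[OF assms(1)] by blast
  have "(%n. AddA E (f n) (g n)) = fm X Y 0 (F'+G')"
   using fm_add[OF chainD(3)[OF F'(1)] chainD(3)[OF G'(1)]] F' G' by simp
  moreover have "kb X Y (F+G) = kb X Y (F'+G')"
   by (rule kb_eqI) (use F' G' assms heq_add chain_add in blast)+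
  ultimately show ?thesis by (simp add: kb_def)
 qed
 have "fm X Y 0 G:homotopy_class E X Y (fm X Y 0 G)" "fm X Y 0 F:homotopy_class E X Y (fm X Y 0 F)"
  using class_iff assms heq_refl by blast+
 then have "?S = homotopy_class E X Y (fm X Y 0 (F+G))" using e by blast
 then show ?thesis by (simp add: Kb_def Kb_pre_def kb_def)
qed

lemma kb_ident: "cpx X ==> Ident K X = kb X X (uno X)"
 using fm_uno[OF cpxD(1)] by (simp add: Kb_def Kb_pre_def kb_def)

lemma kb_zero: "cpx X ==> cpx Y ==> ZeroA K X Y = kb X Y 0"
 using fm_zero[OF cpxD(1) cpxD(1), of X Y 0] by (simp add: Kb_def Kb_pre_def kb_def)

lemma K_hom: "s:Hom K X Y \<longleftrightarrow> (EX F. chain X Y F & s = kb X Y F)"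
 by (auto simp: Hom_def K_arr)

lemma K_category: "category K"
proof
 fix f assume "f:Arr K" then show "Dom K f:Obj K" "Cod K f:Obj K" by (auto simp: K_arr chain_def)
next
 fix X assume "X:Obj K" then show "Ident K X:Hom K X X" by (auto simp: kb_ident K_hom intro: chain_uno)
next
 fix f g X Y Z assume "f:Hom K X Y" "g:Hom K Y Z"
 then show "Comp K g f:Hom K X Z" by (auto simp: K_hom kb_comp intro: chain_mult)
next
 fix f g h W X Y Z assume "f:Hom K W X" "g:Hom K X Y" "h:Hom K Y Z"
 then show "Comp K h (Comp K g f) = Comp K (Comp K h g) f" by (auto simp: K_hom kb_comp chain_mult ma)
next
 fix f X Y assume "f:Hom K X Y"
 then obtain F where F: "chain X Y F" "f = kb X Y F" by (auto simp: K_hom)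
 then show "Comp K (Ident K Y) f = f" "Comp K f (Ident K X) = f"
  using chainD[OF F(1)] by (simp_all add: kb_ident kb_comp chain_uno unl unr)
qed

lemma kb_inverse_iff:
 assumes "chain X Y F" "chain Y X G"
 shows "inverse_arrows K (kb X Y F) (kb Y X G) \<longleftrightarrow> heq X X (G*F) (uno X) & heq Y Y (F*G) (uno Y)"
 using assms chainD(1,2)[OF assms(1)]
 by (auto simp: inverse_arrows_def kb_arr Hom_def kb_comp kb_ident kb_eq_iff chain_mult chain_uno)

lemma kb_iso_iff:
 assumes "chain X Y F"
 shows "kb X Y F:iso_arrows K \<longleftrightarrow> (EX G. chain Y X G & heq X X (G*F) (uno X) & heq Y Y (F*G) (uno Y))"
proof
 assume "kb X Y F:iso_arrows K"
 then obtain t where t: "inverse_arrows K (kb X Y F) t" by (auto simp: iso_arrows_def)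
 then have "t:Hom K Y X" by (simp add: inverse_arrows_def)
 then obtain G where "chain Y X G" "t = kb Y X G" by (auto simp: K_hom)
 then show "EX G. chain Y X G & heq X X (G*F) (uno X) & heq Y Y (F*G) (uno Y)"
  using t kb_inverse_iff[OF assms] by blast
next
 assume "EX G. chain Y X G & heq X X (G*F) (uno X) & heq Y Y (F*G) (uno Y)"
 then obtain G where "inverse_arrows K (kb X Y F) (kb Y X G)" using kb_inverse_iff[OF assms] by blast
 then show "kb X Y F:iso_arrows K" unfolding iso_arrows_def by blast
qed

subsection \<open>Shift\<close>

abbreviation "sh \<equiv> shift_cpx E"

definition eta :: "('r, 'm) mcpx => ('r, 'm) gop" where
 "eta X = gm X (sh X) (-1) (%n. Ident E (cob X n))"
definition ate :: "('r, 'm) mcpx => ('r, 'm) gop" where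
 "ate X = gm (sh X) X 1 (%n. Ident E (cob X (n+1)))"

lemma sh_simps [simp]: "cob (sh X) n = cob X (n+1)" "cdif (sh X) n = NegA E (cdif X (n+1))"
 by (simp_all add: shift_cpx_def)

lemma eta_fam: "gob X ==> fam X (sh X) (-1) (%n. Ident E (cob X n))"
 "gob X ==> fam (sh X) X 1 (%n. Ident E (cob X (n+1)))"
 by (simp_all add: fam_def gob_def Ident_E)

lemma eta_H: "gob X ==> eta X:H X (sh X) (-1)" "gob X ==> ate X:H (sh X) X 1"
 using eta_fam gm_H by (auto simp: eta_def ate_def)

lemma Ident_Ident: "fgp R M ==> Ident E M o[E] Ident E M = Ident E M"
 using category.Ident_left[OF E_category Ident_E(1)] by blast

lemma eta_inv:
 assumes "gob X"
 shows "ate X*eta X = uno X" "eta X*ate X = uno (sh X)"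
proof -
 have "ate X*eta X = gm X X (-1+1) (%n. Ident E (cob X (n+-1+1)) o[E] Ident E (cob X n))"
  unfolding eta_def ate_def by (rule gm_comp[OF eta_fam[OF assms], symmetric])
 then show "ate X*eta X = uno X" using assms by (simp add: uno_def gob_def Ident_Ident)
 have "eta X*ate X = gm (sh X) (sh X) (1+-1) (%n. Ident E (cob X (n+1)) o[E] Ident E (cob X (n+1)))"
  unfolding eta_def ate_def by (rule gm_comp[OF eta_fam(2)[OF assms] eta_fam(1)[OF assms], symmetric])
 then show "eta X*ate X = uno (sh X)" using assms by (simp add: uno_def gob_def Ident_Ident)
qed

text \<open>A family \<open>Q\<^sup>n \<rightarrow> X\<^sup>n\<^sup>+\<^sup>1\<close>, read as a map of degree \<open>0\<close> to the shift.\<close>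

lemma gm_to_shift:
 assumes "fam Q X (k+1) f"
 shows "gm Q (sh X) k f = eta X*gm Q X (k+1) f" "fam Q (sh X) k f"
proof -
 show 1: "fam Q (sh X) k f" using assms by (simp add: fam_def add.assoc)
 have "eta X*gm Q X (k+1) f = gm Q (sh X) ((k+1)+-1) (%n. Ident E (cob X (n+(k+1))) o[E] f n)"
  unfolding eta_def by (rule gm_comp[OF assms eta_fam(1)[OF famD(3)[OF assms]], symmetric])
 then show "gm Q (sh X) k f = eta X*gm Q X (k+1) f"
  using category.Ident_left[OF E_category famD(1)[OF assms]] by simp
qed

lemma gm_shift:
 assumes "fam X Y k f"
 shows "gm (sh X) (sh Y) k (%n. f (n+1)) = eta Y*gm X Y k f*ate X" "fam (sh X) (sh Y) k (%n. f (n+1))"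
proof -
 have g: "gob X" by (rule famD(2)[OF assms])
 show "fam (sh X) (sh Y) k (%n. f (n+1))"
  using famD(1)[OF assms, of "n+1" for n] by (simp add: fam_def alg)
 have "gm X Y k f*ate X = gm (sh X) Y (1+k) (%n. f (n+1) o[E] Ident E (cob X (n+1)))"
  unfolding ate_def by (rule gm_comp[OF eta_fam(2)[OF g] assms, symmetric])
 also have "... = gm (sh X) Y (k+1) (%n. f (n+1))"
  using category.Ident_right[OF E_category famD(1)[OF assms]] by (simp add: add.commute)
 finally have 1: "gm X Y k f*ate X = gm (sh X) Y (k+1) (%n. f (n+1))" .
 have "fam (sh X) Y (k+1) (%n. f (n+1))"
  using famD(1)[OF assms, of "n+1" for n] by (simp add: fam_def alg)
 from gm_to_shift(1)[OF this] show "gm (sh X) (sh Y) k (%n. f (n+1)) = eta Y*gm X Y k f*ate X"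
  by (simp add: 1 ma)
qed

lemma dd_sh: "cpx X ==> dd (sh X) = - (eta X*dd X*ate X)"
proof -
 assume X: "cpx X"
 have "dd (sh X) = gm (sh X) (sh X) 1 (%n. NegA E (cdif X (n+1)))"
  unfolding dd_def by (rule gm_cong) simp
 also have "... = - gm (sh X) (sh X) 1 (%n. cdif X (n+1))" by (rule gm_neg[OF gm_shift(2)[OF cpxD(2)[OF X]]])
 finally show ?thesis by (simp add: gm_shift(1)[OF cpxD(2)[OF X]] dd_def)
qed

lemma sh_cpx: "cpx X ==> cpx (sh X)"
proof -
 assume X: "cpx X"
 have "fam (sh X) (sh X) 1 (cdif (sh X))" using fam_neg[OF gm_shift(2)[OF cpxD(2)[OF X]]] by (simp add: fam_def)
 moreover have "dd (sh X)*dd (sh X) = 0"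
  using unl[OF cpxD(3)[OF X]] cpxD(4)[OF X] eta_inv(1)[OF cpxD(1)[OF X]]
  by (simp add: dd_sh[OF X] ma msub[OF eta_inv(1)[OF cpxD(1)[OF X]]] msub[OF cpxD(4)[OF X]] msub[OF unl[OF cpxD(3)[OF X]]])
 moreover have "{n. ~ zero_object E (cob (sh X) n)} = (%n. n - 1) ` {n. ~ zero_object E (cob X n)}"
  by (force simp: image_iff)
 ultimately show ?thesis using cpxD(5)[OF X] by (simp add: cpx_iff)
qed

lemma chain_shift: "chain X Y F ==> chain (sh X) (sh Y) (eta Y*F*ate X)"
proof -
 assume F: "chain X Y F"
 note X = chainD(1)[OF F] and Y = chainD(2)[OF F] and d = chainD(4)[OF F]
 have "eta Y*F*ate X:H (sh X) (sh Y) 0"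
  using H_mult[OF H_mult[OF eta_H(2)[OF cpxD(1)[OF X]] chainD(3)[OF F] refl] eta_H(1)[OF cpxD(1)[OF Y]], of 0]
  by (simp add: ma)
 moreover have "dd (sh Y)*(eta Y*F*ate X) = eta Y*F*ate X*dd (sh X)"
  by (simp add: dd_sh X Y ma msub[OF eta_inv(1)[OF cpxD(1)[OF X]]] msub[OF eta_inv(1)[OF cpxD(1)[OF Y]]]
    msub[OF unl[OF chainD(3)[OF F]]] msub[OF unl[OF cpxD(3)[OF X]]] msub[OF d])
 ultimately show ?thesis using sh_cpx X Y by (simp add: chain_def)
qed

lemma heq_shift: "heq X Y F G ==> cpx X ==> cpx Y ==> heq (sh X) (sh Y) (eta Y*F*ate X) (eta Y*G*ate X)"
proof -
 assume "heq X Y F G" and X: "cpx X" and Y: "cpx Y"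
 then obtain h where h: "h:H X Y (-1)" "F = G+(dd Y*h+h*dd X)" by (auto simp: heq_def)
 note e = eta_inv(1)[OF cpxD(1)[OF X]] eta_inv(1)[OF cpxD(1)[OF Y]] unl[OF h(1)] unl[OF cpxD(3)[OF X]]
 show ?thesis
 proof (rule heqI)
  show "- (eta Y*h*ate X):H (sh X) (sh Y) (-1)"
   using H_neg[OF H_mult[OF H_mult[OF eta_H(2)[OF cpxD(1)[OF X]] h(1) refl] eta_H(1)[OF cpxD(1)[OF Y]], of "-1"]]
   by (simp add: ma)
  show "eta Y*F*ate X = eta Y*G*ate X+(dd (sh Y)*- (eta Y*h*ate X)+- (eta Y*h*ate X)*dd (sh X))"
   by (simp add: dd_sh X Y h(2) alg e[THEN msub])
 qed
qed

lemma kb_sh: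
 assumes "chain X Y F"
 shows "ShA K (kb X Y F) = kb (sh X) (sh Y) (eta Y*F*ate X)"
proof -
 note X = chainD(1)[OF assms] and Y = chainD(2)[OF assms]
 have fm_sh: "(%n. fm X Y 0 G (n+1)) = fm (sh X) (sh Y) 0 (eta Y*G*ate X)" if "chain X Y G" for G
  using fm_eq[OF gm_shift(2)[OF fm(1)[OF chainD(3)[OF that]]]] gm_shift(1)[OF fm(1)[OF chainD(3)[OF that]]] fm(2)[OF chainD(3)[OF that]]
  by simp
 have "(%f n. f (n+1)) ` homotopy_class E X Y (fm X Y 0 F) = homotopy_class E (sh X) (sh Y) (fm (sh X) (sh Y) 0 (eta Y*F*ate X))"
 proof (rule Set.set_eqI, rule iffI)
  fix g assume "g:(%f n. f (n+1)) ` homotopy_class E X Y (fm X Y 0 F)"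
  then obtain G where "chain X Y G" "g = (%n. fm X Y 0 G (n+1))" "heq X Y F G" by (auto simp: class_iff[OF assms])
  then show "g:homotopy_class E (sh X) (sh Y) (fm (sh X) (sh Y) 0 (eta Y*F*ate X))"
   unfolding class_iff[OF chain_shift[OF assms]] using chain_shift heq_shift fm_sh X Y by blast
 next
  fix g assume "g:homotopy_class E (sh X) (sh Y) (fm (sh X) (sh Y) 0 (eta Y*F*ate X))"
  then obtain G where G: "chain (sh X) (sh Y) G" "g = fm (sh X) (sh Y) 0 G" "heq (sh X) (sh Y) (eta Y*F*ate X) G"
   unfolding class_iff[OF chain_shift[OF assms]] by blast
  note GH = chainD(3)[OF G(1)] and eX = eta_inv[OF cpxD(1)[OF X]] and eY = eta_inv[OF cpxD(1)[OF Y]]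
  note u = unl[OF GH] unr[OF GH] unl[OF chainD(3)[OF assms]] unr[OF chainD(3)[OF assms]]
   unl[OF cpxD(3)[OF X]] unr[OF cpxD(3)[OF Y]] unl[OF cpxD(3)[OF Y]]
  define G' where "G' = ate Y*G*eta X"
  have G'H: "G':H X Y 0"
   unfolding G'_def ma
   using H_mult[OF H_mult[OF eta_H(1)[OF cpxD(1)[OF X]] GH refl] eta_H(2)[OF cpxD(1)[OF Y]], of 0] by simp
  have G'_back: "eta Y*G'*ate X = G" unfolding G'_def by (simp add: ma msub[OF eY(2)] msub[OF u(1)] eX u)
  have "dd Y*G' = G'*dd X"
  proof -
   have "ate Y*(dd (sh Y)*G)*eta X = ate Y*(G*dd (sh X))*eta X" using chainD(4)[OF G(1)] by simp
   then have "- (uno Y*dd Y*ate Y*G*eta X) = - (ate Y*G*eta X*dd X*uno X)"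
    by (simp add: dd_sh X Y ma eX msub[OF eY(1)])
   then show ?thesis unfolding G'_def using unr[OF cpxD(3)[OF X]] by (simp add: ma msub[OF u(7)])
  qed
  then have c: "chain X Y G'" using G'H X Y by (simp add: chain_def)
  obtain h where h: "h:H (sh X) (sh Y) (-1)" "eta Y*F*ate X = G+(dd (sh Y)*h+h*dd (sh X))"
   using G(3) by (auto simp: heq_def)
  have "ate Y*(eta Y*F*ate X)*eta X = ate Y*(G+(dd (sh Y)*h+h*dd (sh X)))*eta X" using h by simp
  then have "F = G'+(dd Y*- (ate Y*h*eta X)+- (ate Y*h*eta X)*dd X)"
   using unr[OF cpxD(3)[OF X]]
   by (simp add: dd_sh X Y G'_def alg eX eY msub[OF eY(1)] msub[OF eX(1)] u msub[OF u(7)])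
  moreover have "- (ate Y*h*eta X):H X Y (-1)"
   using H_neg[OF H_mult[OF H_mult[OF eta_H(1)[OF cpxD(1)[OF X]] h(1) refl] eta_H(2)[OF cpxD(1)[OF Y]], of "-1"]]
   by (simp add: ma)
  ultimately have "heq X Y F G'" by (rule heqI[rotated])
  then have "fm X Y 0 G':homotopy_class E X Y (fm X Y 0 F)" using c class_iff[OF assms] by blast
  moreover have "g = (%n. fm X Y 0 G' (n+1))" using fm_sh[OF c] G'_back G(2) by simp
  ultimately show "g:(%f n. f (n+1)) ` homotopy_class E X Y (fm X Y 0 F)" by blast
 qed
 then show ?thesis by (simp add: Kb_def Kb_pre_def kb_def)
qed

end

section \<open>Cones and contractions\<close>

context proj_modules
begin

text \<open>A cone is described up to isomorphism by its inclusions \<open>I\<close>, \<open>J\<close>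
 and projections \<open>P\<close>, \<open>L\<close> and by the formula for its differential.\<close>

definition cone where
 "cone X Y F Q I J P L \<longleftrightarrow> chain X Y F & cpx Q & I:H X Q (-1) & J:H Y Q 0 & P:H Q X 1 & L:H Q Y 0 &
   P*I = uno X & L*J = uno Y & P*J = 0 & L*I = 0 & I*P+J*L = uno Q &
   dd Q = - (I*dd X*P)+J*F*P+J*dd Y*L"

lemma cone_ring_relations:
 assumes X: "cpx X" and Y: "cpx Y" and f: "fam X Y 0 f"
  and bi: "!!n. biproduct E (cob X (n+1)) (cob Y n) (cob Q n) (i n) (j n) (p n) (q n)"
  and d: "!!n. cdif Q n = AddA E (i (n+1) o[E] NegA E (cdif X (n+1)) o[E] p n)
      (AddA E (j (n+1) o[E] f (n+1) o[E] p n) (j (n+1) o[E] cdif Y n o[E] q n))"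
 defines "I \<equiv> gm X Q (-1) (%n. i (n - 1))" and "J \<equiv> gm Y Q 0 j" and "P \<equiv> gm Q X 1 p" and "L \<equiv> gm Q Y 0 q"
 shows "I:H X Q (-1)" "J:H Y Q 0" "P:H Q X 1" "L:H Q Y 0"
  "P*I = uno X" "L*J = uno Y" "P*J = 0" "L*I = 0" "I*P+J*L = uno Q"
  "fam Q Q 1 (cdif Q)" "dd Q = - (I*dd X*P)+J*gm X Y 0 f*P+J*dd Y*L"
  "fam X Q (-1) (%n. i (n - 1))" "fam Y Q 0 j" "fam Q X 1 p" "fam Q Y 0 q"
proof -
 note b = bi[unfolded biproduct_def]
 have "i (n - 1):Hom E (cob X n) (cob Q (n+-1))" for n using b[of "n - 1"] by simp
 then show fi: "fam X Q (-1) (%n. i (n - 1))" by (simp add: fam_def)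
 show fj: "fam Y Q 0 j" using b by (simp add: fam_def)
 show fp: "fam Q X 1 p" using b by (simp add: fam_def)
 show fq: "fam Q Y 0 q" using b by (simp add: fam_def)
 show "I:H X Q (-1)" "J:H Y Q 0" "P:H Q X 1" "L:H Q Y 0"
  unfolding I_def J_def P_def L_def using fi fj fp fq gm_H by auto
 have b1: "p (n+-1) o[E] i (n - 1) = Ident E (cob X n)"
   "q (n+-1) o[E] i (n - 1) = ZeroA E (cob X n) (cob Y (n+-1))" for n
  using b[of "n - 1"] by simp_all
 note gX = famD(3)[OF fp] and gY = famD(3)[OF fq] and gQ = famD(2)[OF fp]
 have "P*I = gm X X (-1+1) (%n. p (n+-1) o[E] i (n - 1))"
  unfolding P_def I_def by (rule gm_comp[OF fi fp, symmetric])
 also have "... = uno X" unfolding uno_def b1 by simp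
 finally show "P*I = uno X" .
 have "L*J = gm Y Y (0+0) (%n. q (n+0) o[E] j n)"
  unfolding L_def J_def by (rule gm_comp[OF fj fq, symmetric])
 also have "... = uno Y" unfolding uno_def using b by simp
 finally show "L*J = uno Y" .
 have "P*J = gm Y X (0+1) (%n. p (n+0) o[E] j n)"
  unfolding P_def J_def by (rule gm_comp[OF fj fp, symmetric])
 also have "... = gm Y X 1 (%n. ZeroA E (cob Y n) (cob X (n+1)))" using b by simp
 finally show "P*J = 0" by (simp add: gm_zero[OF gY gX])
 have "L*I = gm X Y (-1+0) (%n. q (n+-1) o[E] i (n - 1))"
  unfolding L_def I_def by (rule gm_comp[OF fi fq, symmetric])
 also have "... = gm X Y (-1) (%n. ZeroA E (cob X n) (cob Y (n+-1)))" unfolding b1 by simp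
 finally show "L*I = 0" by (simp only: gm_zero[OF gX gY])
 have "I*P = gm Q Q (1+-1) (%n. i (n+1 - 1) o[E] p n)"
  unfolding P_def I_def by (rule gm_comp[OF fp fi, symmetric])
 moreover have "J*L = gm Q Q (0+0) (%n. j (n+0) o[E] q n)"
  unfolding L_def J_def by (rule gm_comp[OF fq fj, symmetric])
 moreover have "gm Q Q 0 (%n. AddA E (i n o[E] p n) (j n o[E] q n)) = gm Q Q 0 (%n. i n o[E] p n)+gm Q Q 0 (%n. j n o[E] q n)"
  by (rule gm_add) (use fam_comp[OF fp fi] fam_comp[OF fq fj] in simp_all)
 moreover have "gm Q Q 0 (%n. AddA E (i n o[E] p n) (j n o[E] q n)) = uno Q"
  unfolding uno_def using b by simp
 ultimately show "I*P+J*L = uno Q" by simp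
 note dX = cpxD(2)[OF X] and dY = cpxD(2)[OF Y]
 have f1: "fam Q Q 1 (%n. i (n+1) o[E] NegA E (cdif X (n+1)) o[E] p n)"
  using fam_comp[OF fam_comp[OF fp fam_neg[OF dX]] fi] by (simp add: add.commute)
 have f2: "fam Q Q 1 (%n. j (n+1) o[E] f (n+1) o[E] p n)"
  using fam_comp[OF fam_comp[OF fp f] fj] by simp
 have f3: "fam Q Q 1 (%n. j (n+1) o[E] cdif Y n o[E] q n)"
  using fam_comp[OF fam_comp[OF fq dY] fj] by simp
 have e: "cdif Q = (%n. AddA E (i (n+1) o[E] NegA E (cdif X (n+1)) o[E] p n)
      (AddA E (j (n+1) o[E] f (n+1) o[E] p n) (j (n+1) o[E] cdif Y n o[E] q n)))"
  using d by (rule ext)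
 show "fam Q Q 1 (cdif Q)" unfolding e by (rule fam_add[OF f1 fam_add[OF f2 f3]])
 have "I*(- dd X*P) = gm Q Q 1 (%n. i (n+1) o[E] NegA E (cdif X (n+1)) o[E] p n)"
  unfolding I_def P_def dd_def gm_neg[OF dX, symmetric] gm_comp[OF fp fam_neg[OF dX], symmetric]
   gm_comp[OF fam_comp[OF fp fam_neg[OF dX]] fi, symmetric] by (simp add: add.commute)
 moreover have "J*(gm X Y 0 f*P) = gm Q Q 1 (%n. j (n+1) o[E] f (n+1) o[E] p n)"
  unfolding J_def P_def gm_comp[OF fp f, symmetric] gm_comp[OF fam_comp[OF fp f] fj, symmetric] by simp
 moreover have "J*(dd Y*L) = gm Q Q 1 (%n. j (n+1) o[E] cdif Y n o[E] q n)"
  unfolding J_def L_def dd_def gm_comp[OF fq dY, symmetric] gm_comp[OF fam_comp[OF fq dY] fj, symmetric] by simp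
 moreover have "dd Q = gm Q Q 1 (%n. i (n+1) o[E] NegA E (cdif X (n+1)) o[E] p n) +
   (gm Q Q 1 (%n. j (n+1) o[E] f (n+1) o[E] p n)+gm Q Q 1 (%n. j (n+1) o[E] cdif Y n o[E] q n))"
  unfolding dd_def e gm_add[OF f2 f3, symmetric] by (rule gm_add[OF f1 fam_add[OF f2 f3]])
 ultimately show "dd Q = - (I*dd X*P)+J*gm X Y 0 f*P+J*dd Y*L"
  by (simp add: ma)
qed

lemma cone_of_is_cone:
 assumes F: "chain X Y F" and c: "is_cone E (cb X Y F) Q i j p q"
 shows "cone X Y F Q (gm X Q (-1) (%n. i (n - 1))) (gm Y Q 0 j) (gm Q X 1 p) (gm Q Y 0 q)"
  "fam Y Q 0 j" "fam Q X 1 p" "fam Q Y 0 q"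
proof -
 note X = chainD(1)[OF F] and Y = chainD(2)[OF F] and FH = chainD(3)[OF F]
 have c': "cpx Q" "!!n. biproduct E (cob X (n+1)) (cob Y n) (cob Q n) (i n) (j n) (p n) (q n)"
  "!!n. cdif Q n = AddA E (i (n+1) o[E] NegA E (cdif X (n+1)) o[E] p n)
      (AddA E (j (n+1) o[E] fm X Y 0 F (n+1) o[E] p n) (j (n+1) o[E] cdif Y n o[E] q n))"
  using c unfolding is_cone_def cb_def by (auto simp: cpx_def)
 note r = cone_ring_relations[OF X Y fm(1)[OF FH] c'(2,3)]
 show "cone X Y F Q (gm X Q (-1) (%n. i (n - 1))) (gm Y Q 0 j) (gm Q X 1 p) (gm Q Y 0 q)"
  unfolding cone_def using r F c'(1) fm(2)[OF FH] by simp
 show "fam Y Q 0 j" "fam Q X 1 p" "fam Q Y 0 q" using r by auto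
qed

lemma is_cone_ex:
 assumes F: "chain X Y F"
 shows "EX Q i j p q. is_cone E (cb X Y F) Q i j p q"
proof -
 note X = chainD(1)[OF F] and Y = chainD(2)[OF F] and FH = chainD(3)[OF F] and com = chainD(4)[OF F]
 have "ALL n. EX S i j p q. biproduct E (cob X (n+1)) (cob Y n) S i j p q &
  (carrier (cob X (n+1)) = {0[cob X (n+1)]} --> carrier (cob Y n) = {0[cob Y n]} --> carrier S = {0[S]})"
  using biproduct_ex cpxD(1)[OF X] cpxD(1)[OF Y] by (simp add: gob_def)
 then obtain S i j p q where b: "!!n. biproduct E (cob X (n+1)) (cob Y n) (S n) (i n) (j n) (p n) (q n)"
  and z: "!!n. carrier (cob X (n+1)) = {0[cob X (n+1)]} ==> carrier (cob Y n) = {0[cob Y n]} ==> carrier (S n) = {0[S n]}"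
  by metis
 define Q :: "('r, 'm) mcpx" where "Q = \<lparr>cob = S, cdif = (%n. AddA E (i (n+1) o[E] NegA E (cdif X (n+1)) o[E] p n)
      (AddA E (j (n+1) o[E] fm X Y 0 F (n+1) o[E] p n) (j (n+1) o[E] cdif Y n o[E] q n)))\<rparr>"
 have b': "!!n. biproduct E (cob X (n+1)) (cob Y n) (cob Q n) (i n) (j n) (p n) (q n)"
  and dQ: "!!n. cdif Q n = AddA E (i (n+1) o[E] NegA E (cdif X (n+1)) o[E] p n)
      (AddA E (j (n+1) o[E] fm X Y 0 F (n+1) o[E] p n) (j (n+1) o[E] cdif Y n o[E] q n))"
  using b by (simp_all add: Q_def)
 note r = cone_ring_relations[OF X Y fm(1)[OF FH] b' dQ]
 define I where "I = gm X Q (-1) (%n. i (n - 1))"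
 define J where "J = gm Y Q 0 j"
 define P where "P = gm Q X 1 p"
 define L where "L = gm Q Y 0 q"
 note r' = r[folded I_def J_def P_def L_def, unfolded fm(2)[OF FH]]
 have "dd Q*dd Q = 0"
  unfolding r'(11)
  using cpxD(4)[OF X] cpxD(4)[OF Y] com
  by (simp add: alg msub[OF r'(5)] msub[OF r'(6)] msub[OF r'(7)] msub[OF r'(8)]
    msub[OF unl[OF r'(3)]] msub[OF unl[OF r'(4)]] unl[OF r'(3)] unl[OF r'(4)]
    msub[OF cpxD(4)[OF X]] msub[OF cpxD(4)[OF Y]] msub[OF com] msub[OF unl[OF FH]]
    msub[OF unl[OF cpxD(3)[OF X]]] msub[OF unl[OF cpxD(3)[OF Y]]])
 moreover have "{n. ~ zero_object E (cob Q n)} <= (%n. n - 1) ` {n. ~ zero_object E (cob X n)} \<union> {n. ~ zero_object E (cob Y n)}"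
 proof
  fix n assume n: "n:{n. ~ zero_object E (cob Q n)}"
  have "fgp R (cob Q n)" using r'(10) famD(2) gob_def by blast
  then have "~ (zero_object E (cob X (n+1)) & zero_object E (cob Y n))"
   using z[of n] n by (auto simp: zero_object_E Q_def)
  then show "n:(%n. n - 1) ` {n. ~ zero_object E (cob X n)} \<union> {n. ~ zero_object E (cob Y n)}"
   by (force simp: image_iff)
 qed
 then have "finite {n. ~ zero_object E (cob Q n)}" by (rule finite_subset) (use cpxD(5)[OF X] cpxD(5)[OF Y] in simp)
 ultimately have "cpx Q" using r'(10) by (simp add: cpx_iff)
 then have "is_cone E (cb X Y F) Q i j p q" using b' dQ by (simp add: is_cone_def cb_def cpx_def)
 then show ?thesis by blast
qed

lemma cone_ex: "chain X Y F ==> EX Q I J P L. cone X Y F Q I J P L"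
 using is_cone_ex cone_of_is_cone(1) by blast

lemma coneD:
 assumes "cone X Y F Q I J P L"
 shows "chain X Y F" "cpx X" "cpx Y" "cpx Q" "I:H X Q (-1)" "J:H Y Q 0" "P:H Q X 1" "L:H Q Y 0"
   "P*I = uno X" "L*J = uno Y" "P*J = 0" "L*I = 0" "I*P+J*L = uno Q"
   "P*dd Q = - (dd X*P)" "L*dd Q = F*P+dd Y*L" "dd Q*I = - (I*dd X)+J*F" "dd Q*J = J*dd Y"
   "chain Y Q J"
proof -
 have a: "chain X Y F" "cpx Q" "I:H X Q (-1)" "J:H Y Q 0" "P:H Q X 1" "L:H Q Y 0"
   "P*I = uno X" "L*J = uno Y" "P*J = 0" "L*I = 0" "I*P+J*L = uno Q"
   "dd Q = - (I*dd X*P)+J*F*P+J*dd Y*L"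
  using assms by (auto simp: cone_def)
 then show "chain X Y F" "cpx X" "cpx Y" "cpx Q" "I:H X Q (-1)" "J:H Y Q 0" "P:H Q X 1" "L:H Q Y 0"
   "P*I = uno X" "L*J = uno Y" "P*J = 0" "L*I = 0" "I*P+J*L = uno Q"
  by (auto simp: chain_def)
 note X = chainD(1)[OF a(1)] and Y = chainD(2)[OF a(1)] and FH = chainD(3)[OF a(1)]
 note u = unl[OF cpxD(3)[OF X]] unl[OF cpxD(3)[OF Y]] unl[OF FH] unr[OF cpxD(3)[OF X]]
  unr[OF cpxD(3)[OF Y]] unr[OF FH]
 note s = a(7-10) a(7-10)[THEN msub] u u[THEN msub]
 show "P*dd Q = - (dd X*P)" "L*dd Q = F*P+dd Y*L" "dd Q*I = - (I*dd X)+J*F" "dd Q*J = J*dd Y"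
  unfolding a(12) by (simp_all add: alg s)
 then show "chain Y Q J" using a Y by (simp add: chain_def)
qed

subsection \<open>Acyclic complexes are contractible\<close>

lemma Hom_from_zero:
 assumes "a:Hom E M N" "b:Hom E M N" "zero_object E M"
 shows "a = b"
proof (rule Hom_E_eqI[OF assms(1,2)])
 have p: "fgp R M" "fgp R N" using assms(1) by (auto simp: Hom_E)
 have z: "fun_of c 0[M] = 0[N]" if "c:Hom E M N" for c
  using that mod_hom_zero[of "fun_of c" R M N] fgp_group p by (auto simp: Hom_E)
 show "fun_of a x = fun_of b x" if "x:carrier M" for x
  using that assms(3) z[OF assms(1)] z[OF assms(2)] by (simp add: zero_object_E)
qed

text \<open>Contracting maps are constructed by descending induction on the degree: once \<open>s\<close> is chosen
 on \<open>X\<^sup>n\<^sup>+\<^sup>1\<close>, the map \<open>1 - s d\<close> sends \<open>X\<^sup>n\<close> to cycles, which are boundaries, and can be lifted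
 along \<open>d\<close> because \<open>X\<^sup>n\<close> is projective.\<close>

lemma contraction_ex:
 assumes X: "cpx X" and ac: "!!n. cycles X n <= boundaries X n"
 shows "EX S:H X X (-1). dd X*S+S*dd X = uno X"
proof -
 note fd = cpxD(2)[OF X]
 note gX = cpxD(1)[OF X]
 have dH: "cdif X n:Hom E (cob X n) (cob X (n+1))" for n using famD(1)[OF fd] by simp
 have fgX: "fgp R (cob X n)" for n using gX by (simp add: gob_def)
 have dd0: "cdif X (n+1) o[E] cdif X n = ZeroA E (cob X n) (cob X (n+2))" for n
  using X by (simp add: cpx_def bounded_cpx_def)
 obtain N where N: "!!n. n > N ==> zero_object E (cob X n)"
 proof -
  have "finite (insert 0 {n. ~ zero_object E (cob X n)})" using cpxD(5)[OF X] by simp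
  then have "!!n. n > Max (insert 0 {n. ~ zero_object E (cob X n)}) ==> zero_object E (cob X n)"
   by (metis (mono_tags, lifting) Max_ge insertI2 linorder_not_less mem_Collect_eq)
  then show ?thesis using that by blast
 qed
 define pr0 where "pr0 = (%m t. t:Hom E (cob X (m+1)) (cob X m) &
   (ALL x:carrier (cob X m). fun_of (cdif X m) (fun_of t (fun_of (cdif X m) x)) = fun_of (cdif X m) x))"
 define rel where "rel = (%m (t :: ('r, 'm) mmap) (t' :: ('r, 'm) mmap). (ALL x:carrier (cob X m).
    fun_of (cdif X (m - 1)) (fun_of t' x) +[cob X m] fun_of t (fun_of (cdif X m) x) = x))"
 have dc: "x:carrier (cob X n) ==> fun_of (cdif X n) x:carrier (cob X (n+1))" for n x
  by (rule fun_of_closed[OF dH])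
 have dh: "fun_of (cdif X n):mod_hom R (cob X n) (cob X (n+1))" for n using dH by (simp add: Hom_E)
 have ddx: "fun_of (cdif X (n+1)) (fun_of (cdif X n) x) = 0[cob X (n+2)]" if "x:carrier (cob X n)" for n x
  using Comp_E(2)[OF dH dH that] Zero_E(2)[OF that] dd0[of n] by simp
 have step: "EX t'. pr0 (m - 1) t' & rel m t t'" if t: "pr0 m t" for m t
 proof -
  interpret M: abelian_group "cob X m" by (rule gob_group[OF gX])
  have tH: "t:Hom E (cob X (m+1)) (cob X m)" using t by (simp add: pr0_def)
  have th: "fun_of t:mod_hom R (cob X (m+1)) (cob X m)" using tH by (simp add: Hom_E)
  define u where "u = AddA E (Ident E (cob X m)) (NegA E (t o[E] cdif X m))"
  note tdH = Comp_E(1)[OF dH tH]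
  have uH: "u:Hom E (cob X m) (cob X m)" unfolding u_def
   by (rule Add_E(1)[OF Ident_E(1)[OF fgX] Neg_E(1)[OF tdH]])
  have ux: "fun_of u x = x +[cob X m] -[cob X m] fun_of t (fun_of (cdif X m) x)" if x: "x:carrier (cob X m)" for x
   unfolding u_def Add_E(2)[OF Ident_E(1)[OF fgX] Neg_E(1)[OF tdH] x] Neg_E(2)[OF tdH x] Comp_E(2)[OF dH tH x] Ident_E(2)[OF x] ..
  have tc: "fun_of t (fun_of (cdif X m) x):carrier (cob X m)" if "x:carrier (cob X m)" for x
   by (rule fun_of_closed[OF tH dc[OF that]])
  have d': "cdif X (m - 1):Hom E (cob X (m - 1)) (cob X m)" using dH[of "m - 1"] by simp
  have "fun_of u ` carrier (cob X m) <= fun_of (cdif X (m - 1)) ` carrier (cob X (m - 1))"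
  proof
   fix y assume "y:fun_of u ` carrier (cob X m)"
   then obtain x where x: "x:carrier (cob X m)" "y = fun_of u x" by auto
   interpret M1: abelian_group "cob X (m+1)" by (rule gob_group[OF gX])
   have "fun_of (cdif X m) y = fun_of (cdif X m) x +[cob X (m+1)] -[cob X (m+1)] fun_of (cdif X m) (fun_of t (fun_of (cdif X m) x))"
    unfolding x(2) ux[OF x(1)] using x(1) tc
    by (simp add: mod_homD(2)[OF dh] mod_hom_minus[OF dh gob_group[OF gX] gob_group[OF gX]])
   also have "... = 0[cob X (m+1)]" using t x(1) dc by (simp add: pr0_def M1.r_neg)
   finally have "y:cycles X m" using fun_of_closed[OF uH x(1)] x(2) by (simp add: cycles_def)
   then show "y:fun_of (cdif X (m - 1)) ` carrier (cob X (m - 1))" using ac by (auto simp: boundaries_def)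
  qed
  then obtain t' where t': "t':Hom E (cob X m) (cob X (m - 1))" "cdif X (m - 1) o[E] t' = u"
   using lift_E[OF uH d'] by blast
  have e: "fun_of (cdif X (m - 1)) (fun_of t' x) = x +[cob X m] -[cob X m] fun_of t (fun_of (cdif X m) x)"
   if x: "x:carrier (cob X m)" for x
   using Comp_E(2)[OF t'(1) d' x] t'(2) ux[OF x] by simp
  have "rel m t t'"
   unfolding rel_def using e tc by (simp add: M.a_assoc M.l_neg)
  moreover have "pr0 (m - 1) t'"
   unfolding pr0_def
  proof (intro conjI ballI)
   fix x assume x: "x:carrier (cob X (m - 1))"
   have dx: "fun_of (cdif X (m - 1)) x:carrier (cob X m)" using dc[OF x] by simp
   have "fun_of t (fun_of (cdif X m) (fun_of (cdif X (m - 1)) x)) = 0[cob X m]"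
    using ddx[OF x] mod_hom_zero[OF th gob_group[OF gX] gob_group[OF gX]] by (simp add: add.commute)
   then show "fun_of (cdif X (m - 1)) (fun_of t' (fun_of (cdif X (m - 1)) x)) = fun_of (cdif X (m - 1)) x"
    using e[OF dx] dx by simp
  qed (use t' in simp)
  ultimately show ?thesis by blast
 qed
 have start: "pr0 N (ZeroA E (cob X (N+1)) (cob X N))"
  unfolding pr0_def
 proof (intro conjI ballI)
  fix x assume x: "x:carrier (cob X N)"
  have "carrier (cob X (N+1)) = {0[cob X (N+1)]}" using N[of "N+1"] by (simp add: zero_object_E)
  moreover have "fun_of (cdif X N) (fun_of (ZeroA E (cob X (N+1)) (cob X N)) (fun_of (cdif X N) x)):carrier (cob X (N+1))"
   by (intro dc fun_of_closed[OF Zero_E(1)[OF fgX fgX]] x)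
  ultimately show "fun_of (cdif X N) (fun_of (ZeroA E (cob X (N+1)) (cob X N)) (fun_of (cdif X N) x)) = fun_of (cdif X N) x"
   using dc[OF x] by simp
 qed (rule Zero_E(1)[OF fgX fgX])
 have "EX t. ALL k. pr0 (N - int k) (t k) & rel (N - int k) (t k) (t (Suc k))"
 proof (rule dependent_nat_choice)
  show "EX x. pr0 (N - int 0) x" using start by (intro exI[of _ "ZeroA E (cob X (N+1)) (cob X N)"]) simp
  show "EX y. pr0 (N - int (Suc n)) y & rel (N - int n) x y" if "pr0 (N - int n) x" for x n
   using step[OF that] by (simp add: alg)
 qed
 then obtain t where t: "!!k. pr0 (N - int k) (t k)" "!!k. rel (N - int k) (t k) (t (Suc k))" by blast
 define s where "s = (%n. if n \<le> N+1 then t (nat (N+1 - n)) else ZeroA E (cob X n) (cob X (n+-1)))"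
 have sH: "s n:Hom E (cob X n) (cob X (n+-1))" for n
  using t(1)[of "nat (N+1 - n)"] Zero_E(1)[OF fgX fgX] by (auto simp: s_def pr0_def)
 then have fs: "fam X X (-1) s" by (simp add: fam_def)
 have d': "cdif X (n+-1):Hom E (cob X (n+-1)) (cob X n)" for n using dH[of "n+-1"] by simp
 have sH': "s (n+1):Hom E (cob X (n+1)) (cob X n)" for n using sH[of "n+1"] by simp
 have key: "AddA E (cdif X (n+-1) o[E] s n) (s (n+1) o[E] cdif X n) = Ident E (cob X n)" for n
 proof (cases "n \<le> N")
  case True
  show ?thesis
  proof (rule Hom_E_eqI[OF Add_E(1)[OF Comp_E(1)[OF sH d'] Comp_E(1)[OF dH sH']] Ident_E(1)[OF fgX]])
   fix x assume x: "x:carrier (cob X n)"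
   have i: "N - int (nat (N - n)) = n" "nat (N+1 - n) = Suc (nat (N - n))" "nat (N+1 - (n+1)) = nat (N - n)"
    using True by auto
   have "rel n (s (n+1)) (s n)" using t(2)[of "nat (N - n)"] True by (simp add: s_def i)
   then show "fun_of (AddA E (cdif X (n+-1) o[E] s n) (s (n+1) o[E] cdif X n)) x = fun_of (Ident E (cob X n)) x"
    unfolding Add_E(2)[OF Comp_E(1)[OF sH d'] Comp_E(1)[OF dH sH'] x] Comp_E(2)[OF sH d' x] Comp_E(2)[OF dH sH' x] Ident_E(2)[OF x]
    using x by (simp add: rel_def)
  qed
 next
  case False
  show ?thesis
   by (rule Hom_from_zero[OF Add_E(1)[OF Comp_E(1)[OF sH d'] Comp_E(1)[OF dH sH']] Ident_E(1)[OF fgX]]) (use N False in auto)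
 qed
 define S where "S = gm X X (-1) s"
 have "dd X*S+S*dd X = gm X X 0 (%n. AddA E (cdif X (n+-1) o[E] s n) (s (n+1) o[E] cdif X n))"
  unfolding S_def dd_def gm_comp[OF fs fd, symmetric] gm_comp[OF fd fs, symmetric]
  using gm_add[of X X 0 "%n. cdif X (n+-1) o[E] s n" "%n. s (n+1) o[E] cdif X n"] fam_comp[OF fs fd] fam_comp[OF fd fs]
  by simp
 also have "... = uno X" unfolding uno_def using key by simp
 finally show ?thesis using gm_H[OF fs] by (auto simp: S_def)
qed

end

section \<open>Quasi-isomorphisms are homotopy equivalences\<close>

lemma (in abelian_group) a_rcos_eq:
 assumes B: "B <= carrier G" "\<zero>:B" "!!x y. x:B ==> y:B ==> x \<oplus> y:B" "!!x. x:B ==> \<ominus> x:B"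
  and x: "x:carrier G" and y: "y:carrier G"
 shows "B +> x = B +> y \<longleftrightarrow> x \<ominus> y:B"
proof
 assume "B +> x = B +> y"
 moreover have "x:B +> x" using B(2) x by (force simp: a_r_coset_def' l_zero)
 ultimately obtain b where b: "b:B" "x = b \<oplus> y" by (auto simp: a_r_coset_def')
 then have "x \<ominus> y = b" using y B(1) by (auto simp: a_minus_def a_assoc r_neg)
 then show "x \<ominus> y:B" using b by simp
next
 have *: "B +> x <= B +> y" if xy: "x \<ominus> y:B" "x:carrier G" "y:carrier G" for x y
 proof
  fix z assume "z:B +> x"
  then obtain b where b: "b:B" "z = b \<oplus> x" by (auto simp: a_r_coset_def')
  have bc: "b:carrier G" using b B(1) by auto
  have "(b \<oplus> (x \<ominus> y)) \<oplus> y = z" using xy bc b by (simp add: a_minus_def a_assoc l_neg)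
  then show "z:B +> y" using B(3)[OF b(1) xy(1)] by (force simp: a_r_coset_def')
 qed
 assume d: "x \<ominus> y:B"
 have "\<ominus> (x \<ominus> y) = y \<ominus> x" using x y by (simp add: a_minus_def minus_add a_comm)
 then have "y \<ominus> x:B" using B(4)[OF d] by simp
 then show "B +> x = B +> y" using *[OF d x y] *[OF _ y x] by blast
qed

text \<open>The map on quotients is injective exactly if elements mapped to \<open>BN\<close> lie in
 \<open>BM\<close>, and surjective exactly if every class is hit.\<close>

lemma coset_bij:
 assumes M: "abelian_group M" and N: "abelian_group N"
  and BM: "BM <= ZM" "0[M]:BM" "!!x y. x:BM ==> y:BM ==> x +[M] y:BM" "!!x. x:BM ==> -[M] x:BM"
  and ZM: "ZM <= carrier M" "!!x y. x:ZM ==> y:ZM ==> x +[M] y:ZM" "!!x. x:ZM ==> -[M] x:ZM"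
  and BN: "BN <= ZN" "0[N]:BN" "!!x y. x:BN ==> y:BN ==> x +[N] y:BN" "!!x. x:BN ==> -[N] x:BN"
  and ZN: "ZN <= carrier N"
  and f: "!!x. x:ZM ==> f x:ZN" "!!x y. x:ZM ==> y:ZM ==> f (x +[M] y) = f x +[N] f y"
   "!!x. x:ZM ==> f (-[M] x) = -[N] f x" "!!x. x:BM ==> f x:BN"
 shows "bij_betw (%c. \<Union>x\<in>c. BN +>\<^bsub>N\<^esub> f x) ((%x. BM +>\<^bsub>M\<^esub> x) ` ZM) ((%y. BN +>\<^bsub>N\<^esub> y) ` ZN) \<longleftrightarrow>
  (ALL x:ZM. f x:BN --> x:BM) & (ALL y:ZN. EX x:ZM. y \<ominus>\<^bsub>N\<^esub> f x:BN)"
proof -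
 interpret M: abelian_group M by fact
 interpret N: abelian_group N by fact
 define g where "g = (%c. \<Union>x\<in>c. BN +>\<^bsub>N\<^esub> f x)"
 have eqM: "BM +>\<^bsub>M\<^esub> x = BM +>\<^bsub>M\<^esub> y \<longleftrightarrow> x \<ominus>\<^bsub>M\<^esub> y:BM" if "x:ZM" "y:ZM" for x y
  by (rule M.a_rcos_eq) (use BM ZM that in auto)
 have eqN: "BN +>\<^bsub>N\<^esub> x = BN +>\<^bsub>N\<^esub> y \<longleftrightarrow> x \<ominus>\<^bsub>N\<^esub> y:BN" if "x:ZN" "y:ZN" for x y
  by (rule N.a_rcos_eq) (use BN ZN that in auto)
 have g: "g (BM +>\<^bsub>M\<^esub> x) = BN +>\<^bsub>N\<^esub> f x" if x: "x:ZM" for x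
 proof -
  have 1: "BN +>\<^bsub>N\<^esub> f y = BN +>\<^bsub>N\<^esub> f x" if yx: "y:BM +>\<^bsub>M\<^esub> x" for y
  proof -
   obtain b where b: "b:BM" "y = b +[M] x" using yx by (auto simp: a_r_coset_def')
   then have "f y = f b +[N] f x" using f(2) x BM(1) by auto
   moreover have c: "f b:carrier N" "f x:carrier N" "b:ZM" using f(1) x b BM(1) ZN by auto
   ultimately have "f y \<ominus>\<^bsub>N\<^esub> f x = f b" by (simp add: a_minus_def N.a_assoc N.r_neg)
   then show ?thesis using eqN[of "f y" "f x"] f(4)[OF b(1)] f(1) ZM(2)[OF c(3) x] b x by auto
  qed
  have "x:BM +>\<^bsub>M\<^esub> x" using BM(2) x ZM(1) by (force simp: a_r_coset_def' M.l_zero)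
  then show ?thesis unfolding g_def using 1 by blast
 qed
 have fd: "f (x \<ominus>\<^bsub>M\<^esub> y) = f x \<ominus>\<^bsub>N\<^esub> f y" "x \<ominus>\<^bsub>M\<^esub> y:ZM" if "x:ZM" "y:ZM" for x y
  using that ZM(2,3) f(2,3) by (simp_all add: a_minus_def)
 have 1: "inj_on g ((%x. BM +>\<^bsub>M\<^esub> x) ` ZM) \<longleftrightarrow> (ALL x:ZM. f x:BN --> x:BM)"
 proof
  assume inj: "inj_on g ((%x. BM +>\<^bsub>M\<^esub> x) ` ZM)"
  show "ALL x:ZM. f x:BN --> x:BM"
  proof (intro ballI impI)
   fix x assume x: "x:ZM" "f x:BN"
   have z: "0[M]:ZM" using BM by auto
   have "f 0[M] +[N] f 0[M] = f 0[M]" using f(2)[OF z z] by simp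
   then have f0: "f 0[M] = 0[N]" using f(1)[OF z] ZN N.add.r_cancel_one by auto
   have "f x \<ominus>\<^bsub>N\<^esub> f 0[M] = f x" using f0 f(1)[OF x(1)] ZN by (auto simp: a_minus_def)
   then have "BN +>\<^bsub>N\<^esub> f x = BN +>\<^bsub>N\<^esub> f 0[M]" using eqN[OF f(1)[OF x(1)] f(1)[OF z]] x(2) by simp
   then have "g (BM +>\<^bsub>M\<^esub> x) = g (BM +>\<^bsub>M\<^esub> 0[M])" unfolding g[OF x(1)] g[OF z] .
   then have "BM +>\<^bsub>M\<^esub> x = BM +>\<^bsub>M\<^esub> 0[M]" using inj_onD[OF inj] x(1) z by blast
   moreover have "-[M] 0[M] = 0[M]" using M.minus_equality[of "0[M]" "0[M]"] by simp
   ultimately show "x:BM" using eqM[OF x(1) z] x(1) ZM(1) by (auto simp: a_minus_def)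
  qed
 next
  assume k: "ALL x:ZM. f x:BN --> x:BM"
  show "inj_on g ((%x. BM +>\<^bsub>M\<^esub> x) ` ZM)"
  proof (rule inj_onI)
   fix c d assume "c:(%x. BM +>\<^bsub>M\<^esub> x) ` ZM" "d:(%x. BM +>\<^bsub>M\<^esub> x) ` ZM" and e: "g c = g d"
   then obtain x y where xy: "x:ZM" "y:ZM" "c = BM +>\<^bsub>M\<^esub> x" "d = BM +>\<^bsub>M\<^esub> y" by blast
   have "f x \<ominus>\<^bsub>N\<^esub> f y:BN" using e unfolding xy g[OF xy(1)] g[OF xy(2)] eqN[OF f(1)[OF xy(1)] f(1)[OF xy(2)]] .
   then have "x \<ominus>\<^bsub>M\<^esub> y:BM" using k fd xy by metis
   then show "c = d" using eqM xy by simp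
  qed
 qed
 have 2: "g ` ((%x. BM +>\<^bsub>M\<^esub> x) ` ZM) = (%y. BN +>\<^bsub>N\<^esub> y) ` ZN \<longleftrightarrow> (ALL y:ZN. EX x:ZM. y \<ominus>\<^bsub>N\<^esub> f x:BN)"
 proof -
  have "g ` ((%x. BM +>\<^bsub>M\<^esub> x) ` ZM) = (%x. BN +>\<^bsub>N\<^esub> f x) ` ZM" unfolding image_image using g by (rule image_cong[OF refl])
  moreover have "(%x. BN +>\<^bsub>N\<^esub> f x) ` ZM <= (%y. BN +>\<^bsub>N\<^esub> y) ` ZN" using f(1) by blast
  moreover have "(%y. BN +>\<^bsub>N\<^esub> y) ` ZN <= (%x. BN +>\<^bsub>N\<^esub> f x) ` ZM \<longleftrightarrow> (ALL y:ZN. EX x:ZM. BN +>\<^bsub>N\<^esub> y = BN +>\<^bsub>N\<^esub> f x)" by blast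
  ultimately show ?thesis using eqN f(1) by (metis (no_types, lifting) subset_antisym subset_refl)
 qed
 show ?thesis unfolding bij_betw_def g_def[symmetric] 1 2 ..
qed

context proj_modules
begin

definition ac where "ac X Y k F n x = fun_of (fm X Y k F n) x"

lemma ac_closed: "F:H X Y k ==> x:carrier (cob X n) ==> ac X Y k F n x:carrier (cob Y (n+k))"
 unfolding ac_def by (rule fun_of_closed[OF famD(1)[OF fm(1)]])

lemma ac_hom: "F:H X Y k ==> ac X Y k F n:mod_hom R (cob X n) (cob Y (n+k))"
 unfolding ac_def using famD(1)[OF fm(1)] by (simp add: Hom_E)

lemma ac_mult: "F:H X Y k ==> G:H Y Z l ==> x:carrier (cob X n) ==>
  ac X Z (k+l) (G*F) n x = ac Y Z l G (n+k) (ac X Y k F n x)"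
 unfolding ac_def by (simp add: fm_mult Comp_E(2)[OF famD(1)[OF fm(1)] famD(1)[OF fm(1)]])

lemma ac_add: "F:H X Y k ==> G:H X Y k ==> x:carrier (cob X n) ==>
  ac X Y k (F+G) n x = ac X Y k F n x +[cob Y (n+k)] ac X Y k G n x"
 unfolding ac_def by (simp add: fm_add Add_E(2)[OF famD(1)[OF fm(1)] famD(1)[OF fm(1)]])

lemma ac_uno: "gob X ==> x:carrier (cob X n) ==> ac X X 0 (uno X) n x = x"
 unfolding ac_def by (simp add: fm_uno Ident_E)

lemma ac_dd: "cpx X ==> ac X X 1 (dd X) n = fun_of (cdif X n)"
 unfolding ac_def dd_def by (rule ext) (simp add: cpxD)

lemma cycles_ac: "cpx X ==> cycles X n = {x:carrier (cob X n). ac X X 1 (dd X) n x = 0[cob X (n+1)]}"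
 by (simp add: cycles_def ac_dd)

lemma boundaries_ac: "cpx X ==> boundaries X n = ac X X 1 (dd X) (n - 1) ` carrier (cob X (n - 1))"
 by (simp add: boundaries_def ac_dd)

lemma ac_zero: "F:H X Y k ==> ac X Y k F n 0[cob X n] = 0[cob Y (n+k)]"
 using mod_hom_zero[OF ac_hom gob_group gob_group] H_gob by blast

lemma ac_zero_map: "gob X ==> gob Y ==> x:carrier (cob X n) ==> ac X Y k 0 n x = 0[cob Y (n+k)]"
 by (simp add: ac_def fm_zero Zero_E)

lemma cocycle_props:
 assumes X: "cpx X"
 shows "boundaries X n <= cycles X n" "0[cob X n]:boundaries X n"
  "x:boundaries X n ==> y:boundaries X n ==> x +[cob X n] y:boundaries X n"
  "x:boundaries X n ==> -[cob X n] x:boundaries X n"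
  "cycles X n <= carrier (cob X n)"
  "x:cycles X n ==> y:cycles X n ==> x +[cob X n] y:cycles X n"
  "x:cycles X n ==> -[cob X n] x:cycles X n"
proof -
 have M: "abelian_group (cob X n)" for n by (rule gob_group[OF cpxD(1)[OF X]])
 interpret M: abelian_group "cob X n" by (rule M)
 interpret L: abelian_group "cob X (n - 1)" by (rule M)
 interpret N: abelian_group "cob X (n+1)" by (rule M)
 note dH = cpxD(3)[OF X]
 let ?d = "ac X X 1 (dd X)"
 have h: "?d n:mod_hom R (cob X n) (cob X (n+1))" by (rule ac_hom[OF dH])
 have h': "?d (n - 1):mod_hom R (cob X (n - 1)) (cob X n)" using ac_hom[OF dH, of "n - 1"] by simp
 have dd: "?d n (?d (n - 1) x) = 0[cob X (n+1)]" if "x:carrier (cob X (n - 1))" for x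
  using ac_mult[OF dH dH that] cpxD(4)[OF X] ac_zero_map[OF cpxD(1)[OF X] cpxD(1)[OF X] that, of "1+1"] by (simp add: add.commute)
 show "boundaries X n <= cycles X n" using dd mod_homD(1)[OF h'] by (auto simp: cycles_ac[OF X] boundaries_ac[OF X])
 have "?d (n - 1) 0[cob X (n - 1)] = 0[cob X n]" by (rule mod_hom_zero[OF h' M M])
 then show "0[cob X n]:boundaries X n" unfolding boundaries_ac[OF X] by (metis L.zero_closed image_eqI)
 show "x +[cob X n] y:boundaries X n" if xy: "x:boundaries X n" "y:boundaries X n"
 proof -
  obtain a b where "a:carrier (cob X (n - 1))" "b:carrier (cob X (n - 1))" "x = ?d (n - 1) a" "y = ?d (n - 1) b"
   using xy unfolding boundaries_ac[OF X] by blast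
  then have "a +[cob X (n - 1)] b:carrier (cob X (n - 1))" "x +[cob X n] y = ?d (n - 1) (a +[cob X (n - 1)] b)"
   using mod_homD(2)[OF h'] by auto
  then show ?thesis unfolding boundaries_ac[OF X] by blast
 qed
 show "-[cob X n] x:boundaries X n" if xy: "x:boundaries X n"
 proof -
  obtain a where "a:carrier (cob X (n - 1))" "x = ?d (n - 1) a" using xy unfolding boundaries_ac[OF X] by blast
  then have "-[cob X (n - 1)] a:carrier (cob X (n - 1))" "-[cob X n] x = ?d (n - 1) (-[cob X (n - 1)] a)"
   using mod_hom_minus[OF h' M M] by auto
  then show ?thesis unfolding boundaries_ac[OF X] by blast
 qed
 show "cycles X n <= carrier (cob X n)" by (auto simp: cycles_def)
 show "x +[cob X n] y:cycles X n" if "x:cycles X n" "y:cycles X n"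
  using that mod_homD(2)[OF h] by (simp add: cycles_ac[OF X])
 show "-[cob X n] x:cycles X n" if "x:cycles X n"
  using that mod_hom_minus[OF h M M] by (simp add: cycles_ac[OF X])
qed

lemma chain_ac:
 assumes F: "chain X Y F" and x: "x:carrier (cob X n)"
 shows "ac Y Y 1 (dd Y) n (ac X Y 0 F n x) = ac X Y 0 F (n+1) (ac X X 1 (dd X) n x)"
 using ac_mult[OF chainD(3)[OF F] cpxD(3)[OF chainD(2)[OF F]] x] ac_mult[OF cpxD(3)[OF chainD(1)[OF F]] chainD(3)[OF F] x]
  chainD(4)[OF F] by simp

lemma chain_cycles:
 assumes F: "chain X Y F"
 shows "x:cycles X n ==> ac X Y 0 F n x:cycles Y n" "x:boundaries X n ==> ac X Y 0 F n x:boundaries Y n"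
proof -
 note X = chainD(1)[OF F] and Y = chainD(2)[OF F] and FH = chainD(3)[OF F]
 show "ac X Y 0 F n x:cycles Y n" if "x:cycles X n"
  using that chain_ac[OF F, of x n] ac_closed[OF FH, of x n] ac_zero[OF FH, of "n+1"] by (simp add: cycles_ac[OF X] cycles_ac[OF Y])
 show "ac X Y 0 F n x:boundaries Y n" if x: "x:boundaries X n"
 proof -
  obtain a where a: "a:carrier (cob X (n - 1))" "x = ac X X 1 (dd X) (n - 1) a" using x unfolding boundaries_ac[OF X] by blast
  then have "ac X Y 0 F n x = ac Y Y 1 (dd Y) (n - 1) (ac X Y 0 F (n - 1) a)" using chain_ac[OF F, of a "n - 1"] by simp
  moreover have "ac X Y 0 F (n - 1) a:carrier (cob Y (n - 1))" using ac_closed[OF FH a(1)] by simp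
  ultimately show ?thesis unfolding boundaries_ac[OF Y] by blast
 qed
qed

lemma cohomology_carrier: "carrier (cohomology X n) = (%x. boundaries X n +>\<^bsub>cob X n\<^esub> x) ` cycles X n"
 by (auto simp: cohomology_def FactGroup_def RCOSETS_def r_coset_def a_r_coset_def)

lemma qis_elements:
 assumes F: "chain X Y F"
 shows "cb X Y F:qis R \<longleftrightarrow> (ALL n. (ALL x:cycles X n. ac X Y 0 F n x:boundaries Y n --> x:boundaries X n) &
   (ALL y:cycles Y n. EX x:cycles X n. y \<ominus>\<^bsub>cob Y n\<^esub> ac X Y 0 F n x:boundaries Y n))"
proof -
 note X = chainD(1)[OF F] and Y = chainD(2)[OF F] and FH = chainD(3)[OF F]
 note gX = gob_group[OF cpxD(1)[OF X]] and gY = gob_group[OF cpxD(1)[OF Y]]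
 have h: "ac X Y 0 F n:mod_hom R (cob X n) (cob Y n)" for n using ac_hom[OF FH] by simp
 have "cohomology_map (cb X Y F) n = (%c. \<Union>x\<in>c. boundaries Y n +>\<^bsub>cob Y n\<^esub> ac X Y 0 F n x)" for n
  by (simp add: cohomology_map_def cb_def ac_def)
 moreover have "bij_betw (%c. \<Union>x\<in>c. boundaries Y n +>\<^bsub>cob Y n\<^esub> ac X Y 0 F n x)
   ((%x. boundaries X n +>\<^bsub>cob X n\<^esub> x) ` cycles X n) ((%y. boundaries Y n +>\<^bsub>cob Y n\<^esub> y) ` cycles Y n) \<longleftrightarrow>
  (ALL x:cycles X n. ac X Y 0 F n x:boundaries Y n --> x:boundaries X n) &
   (ALL y:cycles Y n. EX x:cycles X n. y \<ominus>\<^bsub>cob Y n\<^esub> ac X Y 0 F n x:boundaries Y n)" for n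
  using cocycle_props(5)[OF X, of n]
  by (intro coset_bij[OF gX gY] cocycle_props[OF X] cocycle_props[OF Y] chain_cycles[OF F])
   (auto intro: mod_homD(2)[OF h] mod_hom_minus[OF h gX gY])
 ultimately show ?thesis
  using cb_arr[OF F] by (simp add: qis_def cohomology_carrier)
qed

text \<open>The entries of a contraction of the cone of \<open>F\<close>: a homotopy inverse \<open>g\<close>, homotopies \<open>h\<close> and
 \<open>h'\<close> for the two composites, and a second order homotopy \<open>m\<close> which makes \<open>h\<close> and \<open>h'\<close> compatible.\<close>

definition hinv where
 "hinv X Y F g h h' m \<longleftrightarrow> chain X Y F & chain Y X g & h:H X X (-1) & h':H Y Y (-1) & m:H X Y (-2) &
   g*F = uno X+dd X*h+h*dd X & F*g = uno Y - dd Y*h' - h'*dd Y &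
   F*h+h'*F+dd Y*m - m*dd X = 0"

text \<open>The four entries of a contraction of the cone, regarded as a two by two matrix, give four
 identities, which are the relations of \<open>hinv\<close>.\<close>

lemma contraction_hinv:
 assumes c: "cone X Y F Q I J P L" and S: "S:H Q Q (-1)" "dd Q*S+S*dd Q = uno Q"
 shows "hinv X Y F (P*S*J) (P*S*I) (L*S*J) (L*S*I)"
proof -
 note c = coneD[OF c]
 have HH: "P*S*J:H Y X 0" "P*S*I:H X X (-1)" "L*S*J:H Y Y (-1)" "L*S*I:H X Y (-2)"
  using H_mult[OF H_mult[OF c(6) S(1) refl] c(7) refl] H_mult[OF H_mult[OF c(5) S(1) refl] c(7) refl]
   H_mult[OF H_mult[OF c(6) S(1) refl] c(8) refl] H_mult[OF H_mult[OF c(5) S(1) refl] c(8) refl]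
  by (simp_all add: ma)
 have e: "A*(dd Q*S+S*dd Q)*B = A*uno Q*B" for A B using S(2) by simp
 have "P*uno Q = P" "L*uno Q = L" using unr[OF c(7)] unr[OF c(8)] by auto
 note u = this
 have eq: "A*dd Q*S*B+A*S*(dd Q*B) = A*uno Q*B" for A B
  using e[of A B] by (simp add: alg)
 have "- (dd X*(P*S*I))+P*S*(- (I*dd X)+J*F) = uno X"
  using eq[of P I] unfolding c(14,16) u c(9) by (simp add: ma)
 moreover have "- (dd X*(P*S*J))+(P*S*J)*dd Y = 0"
  using eq[of P J] unfolding c(14,17) u c(11) by (simp add: ma)
 moreover have "(F*P+dd Y*L)*S*J+L*S*(J*dd Y) = uno Y"
  using eq[of L J] unfolding c(15,17) u c(10) by (simp add: ma)
 moreover have "(F*P+dd Y*L)*S*I+L*S*(- (I*dd X)+J*F) = 0"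
  using eq[of L I] unfolding c(15,16) u c(12) by (simp add: ma)
 ultimately show ?thesis
  unfolding hinv_def chain_def using c(1-3) HH
  by (auto simp: alg chain_def)
qed

lemma qis_contraction:
 assumes F: "cb X Y F:qis R" "chain X Y F" and c: "cone X Y F Q I J P L"
 shows "EX S:H Q Q (-1). dd Q*S+S*dd Q = uno Q"
proof (rule contraction_ex)
 note c = coneD[OF c]
 note X = c(2) and Y = c(3) and FH = chainD(3)[OF F(2)]
 show "cpx Q" by (rule c)
 fix n
 note q = F(1)[unfolded qis_elements[OF F(2)]]
 show "cycles Q n <= boundaries Q n"
 proof
  fix z assume z: "z:cycles Q n"
  then have zc: "z:carrier (cob Q n)" and dz: "ac Q Q 1 (dd Q) n z = 0[cob Q (n+1)]" by (auto simp: cycles_ac[OF c(4)])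
  interpret Xn: abelian_group "cob X (n+1)" by (rule gob_group[OF cpxD(1)[OF X]])
  interpret X0: abelian_group "cob X n" by (rule gob_group[OF cpxD(1)[OF X]])
  interpret Yn: abelian_group "cob Y n" by (rule gob_group[OF cpxD(1)[OF Y]])
  interpret Y1: abelian_group "cob Y (n+1)" by (rule gob_group[OF cpxD(1)[OF Y]])
  interpret Qn: abelian_group "cob Q n" by (rule gob_group[OF cpxD(1)[OF c(4)]])
  interpret Qm: abelian_group "cob Q (n - 1)" by (rule gob_group[OF cpxD(1)[OF c(4)]])
  let ?x = "ac Q X 1 P n z" and ?y = "ac Q Y 0 L n z"
  have xc: "?x:carrier (cob X (n+1))" and yc: "?y:carrier (cob Y n)"
   using ac_closed[OF c(7) zc] ac_closed[OF c(8) zc] by simp_all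
  have dXH: "dd X*P:H Q X (1+1)" by (rule H_mult[OF c(7) cpxD(3)[OF X] refl])
  have "ac Q X (1+1) (P*dd Q) n z = 0[cob X (n+(1+1))]"
   using ac_mult[OF cpxD(3)[OF c(4)] c(7) zc] dz ac_zero[OF c(7), of "n+1"] by (simp add: add.commute add.left_commute)
  then have "P*dd Q+dd X*P = 0 & ac Q X (1+1) (P*dd Q) n z = 0[cob X (n+(1+1))]" using c(14) by simp
  then have "ac Q X (1+1) (dd X*P) n z = 0[cob X (n+(1+1))]"
   using ac_add[OF H_mult[OF cpxD(3)[OF c(4)] c(7) refl] dXH zc] ac_zero_map[OF cpxD(1)[OF c(4)] cpxD(1)[OF X] zc, of "1+1"]
    abelian_monoid.l_zero[OF abelian_group.axioms(1)[OF gob_group[OF cpxD(1)[OF X]]] ac_closed[OF dXH zc]] by simp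
  then have xz: "?x:cycles X (n+1)"
   using ac_mult[OF c(7) cpxD(3)[OF X] zc] xc by (simp add: cycles_ac[OF X] add.commute add.left_commute)
  have "ac Q Y (1+0) (L*dd Q) n z = 0[cob Y (n+1)]"
   using ac_mult[OF cpxD(3)[OF c(4)] c(8) zc] dz ac_zero[OF c(8), of "n+1"] by simp
  moreover have "F*P:H Q Y 1" "dd Y*L:H Q Y 1"
   using H_mult[OF c(7) FH, of 1] H_mult[OF c(8) cpxD(3)[OF Y], of 1] by simp_all
  then have "ac Q Y 1 (L*dd Q) n z = ac X Y 0 F (n+1) ?x +[cob Y (n+1)] ac Y Y 1 (dd Y) n ?y"
   unfolding c(15) using ac_add[of "F*P" Q Y 1 "dd Y*L" z n] zc ac_mult[OF c(7) FH zc] ac_mult[OF c(8) cpxD(3)[OF Y] zc] by simp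
  ultimately have fx: "ac X Y 0 F (n+1) ?x +[cob Y (n+1)] ac Y Y 1 (dd Y) n ?y = 0[cob Y (n+1)]" by simp
  have dyc: "ac Y Y 1 (dd Y) n ?y:carrier (cob Y (n+1))" by (rule ac_closed[OF cpxD(3)[OF Y] yc])
  have fxc: "ac X Y 0 F (n+1) ?x:carrier (cob Y (n+1))" using ac_closed[OF FH xc] by simp
  have "ac X Y 0 F (n+1) ?x = -[cob Y (n+1)] ac Y Y 1 (dd Y) n ?y"
   using Y1.minus_equality[OF fx dyc fxc] by simp
  moreover have "ac Y Y 1 (dd Y) n ?y:boundaries Y (n+1)" using yc by (simp add: boundaries_ac[OF Y])
  ultimately have "ac X Y 0 F (n+1) ?x:boundaries Y (n+1)" using cocycle_props(4)[OF Y] by simp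
  then have "?x:boundaries X (n+1)" using q xz by blast
  then obtain x' where x': "x':carrier (cob X n)" "?x = ac X X 1 (dd X) n x'" by (auto simp: boundaries_ac[OF X])
  let ?w = "?y +[cob Y n] ac X Y 0 F n x'"
  have Fx'c: "ac X Y 0 F n x':carrier (cob Y n)" using ac_closed[OF FH x'(1)] by simp
  have dYh: "ac Y Y 1 (dd Y) n:mod_hom R (cob Y n) (cob Y (n+1))" by (rule ac_hom[OF cpxD(3)[OF Y]])
  have "ac Y Y 1 (dd Y) n ?w = ac Y Y 1 (dd Y) n ?y +[cob Y (n+1)] ac X Y 0 F (n+1) ?x"
   using mod_homD(2)[OF dYh yc Fx'c] chain_ac[OF F(2) x'(1)] x'(2) by simp
  then have wz: "?w:cycles Y n" using fx dyc fxc yc Fx'c by (simp add: cycles_ac[OF Y] Y1.a_comm)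
  then obtain x'' where x'': "x'':cycles X n" "?w \<ominus>\<^bsub>cob Y n\<^esub> ac X Y 0 F n x'':boundaries Y n" using q by blast
  then obtain y' where y': "y':carrier (cob Y (n - 1))" "?w \<ominus>\<^bsub>cob Y n\<^esub> ac X Y 0 F n x'' = ac Y Y 1 (dd Y) (n - 1) y'"
   by (auto simp: boundaries_ac[OF Y])
  have x''c: "x'':carrier (cob X n)" using x''(1) cocycle_props(5)[OF X] by blast
  define x0 where "x0 = x'' \<ominus>\<^bsub>cob X n\<^esub> x'"
  have x0c: "x0:carrier (cob X n)" using x''c x'(1) by (simp add: x0_def)
  have JH: "ac Y Q 0 J (n - 1) y':carrier (cob Q (n - 1))" using ac_closed[OF c(6) y'(1)] by simp
  have IH: "ac X Q (-1) I n x0:carrier (cob Q (n - 1))" using ac_closed[OF c(5) x0c] by simp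
  define z' where "z' = ac X Q (-1) I n x0 +[cob Q (n - 1)] ac Y Q 0 J (n - 1) y'"
  have z'c: "z':carrier (cob Q (n - 1))" using JH IH by (simp add: z'_def)
  have dXh: "ac X X 1 (dd X) n:mod_hom R (cob X n) (cob X (n+1))" by (rule ac_hom[OF cpxD(3)[OF X]])
  have Fh: "ac X Y 0 F n:mod_hom R (cob X n) (cob Y n)" using ac_hom[OF FH] by simp
  have dx0: "ac X X 1 (dd X) n x0 = -[cob X (n+1)] ?x"
   using x''(1) x' mod_homD(2)[OF dXh, of x'' "-[cob X n] x'"] mod_hom_minus[OF dXh X0.abelian_group_axioms Xn.abelian_group_axioms x'(1)]
    xc by (simp add: x0_def a_minus_def cycles_ac[OF X])
  have Fx0: "ac X Y 0 F n x0 = ac X Y 0 F n x'' +[cob Y n] -[cob Y n] ac X Y 0 F n x'"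
   using x''c x' mod_homD(2)[OF Fh, of x'' "-[cob X n] x'"] mod_hom_minus[OF Fh X0.abelian_group_axioms Yn.abelian_group_axioms x'(1)]
   by (simp add: x0_def a_minus_def)
  have Fx''c: "ac X Y 0 F n x'':carrier (cob Y n)" using ac_closed[OF FH x''c] by simp
  have dQm: "ac Q Q 1 (dd Q) (n - 1):mod_hom R (cob Q (n - 1)) (cob Q n)" using ac_hom[OF cpxD(3)[OF c(4)], of "n - 1"] by simp
  have Ih: "ac X Q (-1) I (n+1):mod_hom R (cob X (n+1)) (cob Q n)" using ac_hom[OF c(5), of "n+1"] by simp
  have Jh: "ac Y Q 0 J n:mod_hom R (cob Y n) (cob Q n)" using ac_hom[OF c(6)] by simp
  have "ac X Q (-1+1) (dd Q*I) n x0 = ac Q Q 1 (dd Q) (n - 1) (ac X Q (-1) I n x0)"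
   using ac_mult[OF c(5) cpxD(3)[OF c(4)] x0c] by simp
  have HH: "- (I*dd X):H X Q 0" "I*dd X:H X Q 0" "J*F:H X Q 0"
   using H_mult[OF cpxD(3)[OF X] c(5), of 0] H_mult[OF FH c(6), of 0] H_neg by auto
  have "ac X Q 0 (I*dd X) n x0 +[cob Q n] ac X Q 0 (- (I*dd X)) n x0 = 0[cob Q n]"
   using ac_add[OF HH(2,1) x0c] ac_zero_map[OF cpxD(1)[OF X] cpxD(1)[OF c(4)] x0c, of 0] by simp
  then have neg: "ac X Q 0 (- (I*dd X)) n x0 = -[cob Q n] ac X Q (-1) I (n+1) (ac X X 1 (dd X) n x0)"
   using Qn.minus_equality ac_closed[OF HH(1) x0c] ac_closed[OF HH(2) x0c] ac_mult[OF cpxD(3)[OF X] c(5) x0c]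
   by (simp add: Qn.a_comm)
  have dI: "ac X Q 0 (dd Q*I) n x0 = ac X Q (-1) I (n+1) ?x +[cob Q n] ac Y Q 0 J n (ac X Y 0 F n x0)"
   unfolding c(16) using ac_add[OF HH(1,3) x0c] neg ac_mult[OF FH c(6) x0c]
    mod_hom_minus[OF Ih Xn.abelian_group_axioms Qn.abelian_group_axioms xc] mod_homD(1)[OF Ih xc] by (simp add: dx0)
  have "ac Q Q 1 (dd Q) (n - 1) (ac Y Q 0 J (n - 1) y') = ac Y Q 0 J n (ac Y Y 1 (dd Y) (n - 1) y')"
   using ac_mult[OF c(6) cpxD(3)[OF c(4)] y'(1)] ac_mult[OF cpxD(3)[OF Y] c(6) y'(1)] c(17) by simp
  note dJ = this[folded y'(2)]
  have "ac Q Q 1 (dd Q) (n - 1) z' = ac X Q (-1) I (n+1) ?x +[cob Q n] ac Y Q 0 J n (ac X Y 0 F n x0)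
    +[cob Q n] ac Y Q 0 J n (?w \<ominus>\<^bsub>cob Y n\<^esub> ac X Y 0 F n x'')"
   using mod_homD(2)[OF dQm IH JH] dJ dI ac_mult[OF c(5) cpxD(3)[OF c(4)] x0c] by (simp add: z'_def)
  also have "... = ac X Q (-1) I (n+1) ?x +[cob Q n] ac Y Q 0 J n (ac X Y 0 F n x0 +[cob Y n] (?w \<ominus>\<^bsub>cob Y n\<^esub> ac X Y 0 F n x''))"
   using mod_homD(1)[OF Ih xc] mod_homD(1)[OF Jh] mod_homD(2)[OF Jh, of "ac X Y 0 F n x0"] ac_closed[OF FH x0c] yc Fx'c Fx''c
   by (simp add: Qn.a_assoc)
  also have "ac X Y 0 F n x0 +[cob Y n] (?w \<ominus>\<^bsub>cob Y n\<^esub> ac X Y 0 F n x'') = ?y"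
  proof -
   have "(b +[cob Y n] -[cob Y n] a) +[cob Y n] ((y +[cob Y n] a) +[cob Y n] -[cob Y n] b) = y"
    if "a:carrier (cob Y n)" "b:carrier (cob Y n)" "y:carrier (cob Y n)" for a b y
   proof -
    have "(b +[cob Y n] -[cob Y n] a) +[cob Y n] ((y +[cob Y n] a) +[cob Y n] -[cob Y n] b) =
     y +[cob Y n] ((a +[cob Y n] -[cob Y n] a) +[cob Y n] (b +[cob Y n] -[cob Y n] b))"
     using that by (simp only: Yn.a_ac Yn.a_closed Yn.a_inv_closed)
    then show ?thesis using that by (simp add: Yn.r_neg)
   qed
   from this[OF Fx'c Fx''c yc] show ?thesis unfolding Fx0 a_minus_def .
  qed
  also have "ac X Q (-1) I (n+1) ?x +[cob Q n] ac Y Q 0 J n ?y = z"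
  proof -
   have "I*P:H Q Q 0" "J*L:H Q Q 0" using H_mult[OF c(7,5), of 0] H_mult[OF c(8,6), of 0] by simp_all
   then show ?thesis
    using ac_add[of "I*P" Q Q 0 "J*L" z n] zc ac_mult[OF c(7,5) zc] ac_mult[OF c(8,6) zc] c(13) ac_uno[OF cpxD(1)[OF c(4)] zc] by simp
  qed
  finally show "z:boundaries Q n" using z'c unfolding boundaries_ac[OF c(4)] by (metis image_eqI)
 qed
qed

end

context proj_modules
begin

lemma hinv_heq:
 assumes "hinv X Y F g h h' m"
 shows "heq X X (g*F) (uno X)" "heq Y Y (F*g) (uno Y)"
proof -
 show "heq X X (g*F) (uno X)"
  by (rule heqI[of h]) (use assms in \<open>auto simp: hinv_def alg\<close>)
 show "heq Y Y (F*g) (uno Y)"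
  by (rule heqI[of "- h'"]) (use assms in \<open>auto simp: hinv_def alg intro: H_neg\<close>)
qed

lemma qis_hinv:
 assumes "chain X Y F" "cb X Y F:qis R"
 shows "EX g h h' m. hinv X Y F g h h' m"
proof -
 obtain Q I J P L where c: "cone X Y F Q I J P L" using cone_ex assms(1) by blast
 then show ?thesis using qis_contraction[OF assms(2,1) c] contraction_hinv[OF c] by blast
qed

lemma heq_act:
 assumes X: "cpx X" and e: "heq X X F (uno X)" and F: "F:H X X 0" and x: "x:cycles X n"
 shows "x \<ominus>\<^bsub>cob X n\<^esub> ac X X 0 F n x:boundaries X n"
proof -
 interpret M: abelian_group "cob X n" by (rule gob_group[OF cpxD(1)[OF X]])
 obtain h where h: "h:H X X (-1)" "F = uno X+(dd X*h+h*dd X)" using e by (auto simp: heq_def)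
 have xc: "x:carrier (cob X n)" and dx: "ac X X 1 (dd X) n x = 0[cob X (n+1)]" using x by (auto simp: cycles_ac[OF X])
 note dH = cpxD(3)[OF X] and uH = cpxD(6)[OF X]
 have H1: "dd X*h:H X X 0" "h*dd X:H X X 0" using H_mult[OF h(1) dH, of 0] H_mult[OF dH h(1), of 0] by simp_all
 let ?b = "ac X X 1 (dd X) (n - 1) (ac X X (-1) h n x)"
 have hc: "ac X X (-1) h n x:carrier (cob X (n - 1))" using ac_closed[OF h(1) xc] by simp
 have b: "?b:boundaries X n" using hc by (simp add: boundaries_ac[OF X])
 then have bc: "?b:carrier (cob X n)" using cocycle_props(1,5)[OF X] by blast
 have "ac X X 0 F n x = x +[cob X n] (?b +[cob X n] ac X X (-1) h (n+1) (ac X X 1 (dd X) n x))"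
  unfolding h(2) using ac_add[OF uH H_add[OF H1] xc] ac_add[OF H1 xc] ac_uno[OF cpxD(1)[OF X] xc]
   ac_mult[OF h(1) dH xc] ac_mult[OF dH h(1) xc] by simp
 also have "ac X X (-1) h (n+1) (ac X X 1 (dd X) n x) = 0[cob X n]" unfolding dx using ac_zero[OF h(1), of "n+1"] by simp
 finally have "x \<ominus>\<^bsub>cob X n\<^esub> ac X X 0 F n x = -[cob X n] ?b"
  using xc bc by (simp add: a_minus_def M.minus_add M.a_ac M.r_neg1 M.r_neg2)
 then show ?thesis using cocycle_props(4)[OF X b] by simp
qed

lemma qis_iff_iso:
 assumes F: "chain X Y F"
 shows "cb X Y F:qis R \<longleftrightarrow> kb X Y F:iso_arrows K"
proof
 assume "cb X Y F:qis R"
 then obtain g h h' m where h: "hinv X Y F g h h' m" using qis_hinv[OF F] by blast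
 then show "kb X Y F:iso_arrows K" using hinv_heq[OF h] by (auto simp: kb_iso_iff[OF F] hinv_def)
next
 assume "kb X Y F:iso_arrows K"
 then obtain G where G: "chain Y X G" "heq X X (G*F) (uno X)" "heq Y Y (F*G) (uno Y)"
  using kb_iso_iff[OF F] by blast
 note X = chainD(1)[OF F] and Y = chainD(2)[OF F] and FH = chainD(3)[OF F] and GH = chainD(3)[OF G(1)]
 have m: "ac X X 0 (G*F) n x = ac Y X 0 G n (ac X Y 0 F n x)" if "x:carrier (cob X n)" for x n
  using ac_mult[OF FH GH that] by simp
 have m': "ac Y Y 0 (F*G) n y = ac X Y 0 F n (ac Y X 0 G n y)" if "y:carrier (cob Y n)" for y n
  using ac_mult[OF GH FH that] by simp
 have HH: "G*F:H X X 0" "F*G:H Y Y 0" using H_mult[OF FH GH] H_mult[OF GH FH] by simp_all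
 show "cb X Y F:qis R"
  unfolding qis_elements[OF F]
 proof (intro allI conjI ballI impI)
  fix n x assume x: "x:cycles X n" "ac X Y 0 F n x:boundaries Y n"
  interpret M: abelian_group "cob X n" by (rule gob_group[OF cpxD(1)[OF X]])
  have xc: "x:carrier (cob X n)" using x(1) cocycle_props(5)[OF X] by blast
  have 1: "ac X X 0 (G*F) n x:boundaries X n" unfolding m[OF xc] by (rule chain_cycles(2)[OF G(1) x(2)])
  then have "(x \<ominus>\<^bsub>cob X n\<^esub> ac X X 0 (G*F) n x) +[cob X n] ac X X 0 (G*F) n x:boundaries X n"
   using heq_act[OF X G(2) HH(1) x(1)] cocycle_props(3)[OF X] by blast
  moreover have "ac X X 0 (G*F) n x:carrier (cob X n)" using ac_closed[OF HH(1) xc] by simp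
  ultimately show "x:boundaries X n" using xc by (simp add: a_minus_def M.a_assoc M.l_neg)
 next
  fix n y assume y: "y:cycles Y n"
  have yc: "y:carrier (cob Y n)" using y cocycle_props(5)[OF Y] by blast
  show "EX x:cycles X n. y \<ominus>\<^bsub>cob Y n\<^esub> ac X Y 0 F n x:boundaries Y n"
   using heq_act[OF Y G(3) HH(2) y] m'[OF yc] chain_cycles(1)[OF G(1) y] by auto
 qed
qed

lemma qis_cb: "s:qis R \<longleftrightarrow> (EX X Y F. s = cb X Y F & chain X Y F & kb X Y F:iso_arrows K)"
proof
 assume s: "s:qis R"
 then have "s:Arr C" by (simp add: qis_def)
 then obtain X Y F where "chain X Y F" "s = cb X Y F" using C_arr by blast
 then show "EX X Y F. s = cb X Y F & chain X Y F & kb X Y F:iso_arrows K" using s qis_iff_iso by blast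
next
 assume "EX X Y F. s = cb X Y F & chain X Y F & kb X Y F:iso_arrows K"
 then show "s:qis R" using qis_iff_iso by blast
qed

section \<open>Short exact sequences of complexes and their triangles\<close>

definition ses where
 "ses X Y Z a b s t \<longleftrightarrow> chain X Y a & chain Y Z b & s:H Z Y 0 & t:H Y X 0 &
   t*a = uno X & b*s = uno Z & t*s = 0 & b*a = 0 & a*t+s*b = uno Y"

lemma biproduct_families:
 assumes f: "fam X Y 0 a" "fam Y Z 0 b" "fam Z Y 0 s" "fam Y X 0 t"
 shows "(ALL n. biproduct E (cob X n) (cob Z n) (cob Y n) (a n) (s n) (t n) (b n)) \<longleftrightarrow>
  gm Y X 0 t*gm X Y 0 a = uno X & gm Y Z 0 b*gm Z Y 0 s = uno Z & gm Y X 0 t*gm Z Y 0 s = 0 &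
  gm Y Z 0 b*gm X Y 0 a = 0 & gm X Y 0 a*gm Y X 0 t+gm Z Y 0 s*gm Y Z 0 b = uno Y"
proof -
 have g: "gob X" "gob Y" "gob Z" using famD(2,3) f by blast+
 note c = gm_comp[OF f(1) f(4), simplified] gm_comp[OF f(3) f(2), simplified] gm_comp[OF f(3) f(4), simplified]
  gm_comp[OF f(1) f(2), simplified] gm_comp[OF f(4) f(1), simplified] gm_comp[OF f(2) f(3), simplified]
 note k = fam_comp[OF f(1) f(4), simplified] fam_comp[OF f(3) f(2), simplified] fam_comp[OF f(3) f(4), simplified]
  fam_comp[OF f(1) f(2), simplified] fam_comp[OF f(4) f(1), simplified] fam_comp[OF f(2) f(3), simplified]
 have z: "gm Z X 0 (%n. ZeroA E (cob Z n) (cob X n)) = 0" "gm X Z 0 (%n. ZeroA E (cob X n) (cob Z n)) = 0"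
  using gm_zero[OF g(3,1), of 0] gm_zero[OF g(1,3), of 0] by simp_all
 have fz: "fam Z X 0 (%n. ZeroA E (cob Z n) (cob X n))" "fam X Z 0 (%n. ZeroA E (cob X n) (cob Z n))"
  using fam_zero[OF g(3,1), of 0] fam_zero[OF g(1,3), of 0] by simp_all
 have s: "gm X Y 0 a*gm Y X 0 t+gm Z Y 0 s*gm Y Z 0 b = gm Y Y 0 (%n. AddA E (a n o[E] t n) (s n o[E] b n))"
  using gm_add[OF k(5,6)] c by simp
 have "gm Y X 0 t*gm X Y 0 a = uno X \<longleftrightarrow> (ALL n. t n o[E] a n = Ident E (cob X n))"
  unfolding c(1)[symmetric] uno_def by (rule gm_eq_iff[OF k(1) fam_ident[OF g(1)]])
 moreover have "gm Y Z 0 b*gm Z Y 0 s = uno Z \<longleftrightarrow> (ALL n. b n o[E] s n = Ident E (cob Z n))"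
  unfolding c(2)[symmetric] uno_def by (rule gm_eq_iff[OF k(2) fam_ident[OF g(3)]])
 moreover have "gm Y X 0 t*gm Z Y 0 s = 0 \<longleftrightarrow> (ALL n. t n o[E] s n = ZeroA E (cob Z n) (cob X n))"
  unfolding c(3)[symmetric] z(1)[symmetric] by (rule gm_eq_iff[OF k(3) fz(1)])
 moreover have "gm Y Z 0 b*gm X Y 0 a = 0 \<longleftrightarrow> (ALL n. b n o[E] a n = ZeroA E (cob X n) (cob Z n))"
  unfolding c(4)[symmetric] z(2)[symmetric] by (rule gm_eq_iff[OF k(4) fz(2)])
 moreover have "gm X Y 0 a*gm Y X 0 t+gm Z Y 0 s*gm Y Z 0 b = uno Y \<longleftrightarrow>
   (ALL n. AddA E (a n o[E] t n) (s n o[E] b n) = Ident E (cob Y n))"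
  unfolding s uno_def by (rule gm_eq_iff[OF fam_add[OF k(5,6)] fam_ident[OF g(2)]])
 ultimately show ?thesis
  using f g by (auto simp: biproduct_def fam_def gob_def)
qed

lemma Ses_iff: "(x, y):Ses C \<longleftrightarrow> (EX X Y Z a b s t. ses X Y Z a b s t & x = cb X Y a & y = cb Y Z b)"
proof
 assume "(x, y):Ses C"
 then obtain X a Y b Z where xy: "x = (X, a, Y)" "y = (Y, b, Z)" and c: "cpx X" "cpx Y" "cpx Z"
   "chain_map E X Y a" "chain_map E Y Z b" and ex: "!!n. (a n, b n):Ses E"
  by (auto simp: Cb_def cpx_def)
 have fa: "fam X Y 0 a" "chain X Y (gm X Y 0 a)" and fb: "fam Y Z 0 b" "chain Y Z (gm Y Z 0 b)"
  using chain_map_iff c by auto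
 have "EX s t. biproduct E (cob X n) (cob Z n) (cob Y n) (a n) s t (b n)" for n
 proof -
  obtain L M N s t where bi: "biproduct E L N M (a n) s t (b n)" using ex[of n] unfolding Ses_E by blast
  then have "a n:Hom E L M" "b n:Hom E M N" by (auto simp: biproduct_def)
  then have "L = cob X n" "M = cob Y n" "N = cob Z n" using famD(1)[OF fa(1), of n] famD(1)[OF fb(1), of n] by (auto simp: Hom_def)
  then show ?thesis using bi by blast
 qed
 then obtain s t where bi: "!!n. biproduct E (cob X n) (cob Z n) (cob Y n) (a n) (s n) (t n) (b n)" by metis
 then have fs: "fam Z Y 0 s" "fam Y X 0 t" by (auto simp: fam_def biproduct_def)
 have "ses X Y Z (gm X Y 0 a) (gm Y Z 0 b) (gm Z Y 0 s) (gm Y X 0 t)"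
  unfolding ses_def using biproduct_families[OF fa(1) fb(1) fs] bi fa fb gm_H[OF fs(1)] gm_H[OF fs(2)] by blast
 then show "EX X Y Z a b s t. ses X Y Z a b s t & x = cb X Y a & y = cb Y Z b"
 proof -
  have "x = cb X Y (gm X Y 0 a)" "y = cb Y Z (gm Y Z 0 b)" using xy fa fb by (simp_all add: cb_def)
  then show ?thesis using \<open>ses X Y Z (gm X Y 0 a) (gm Y Z 0 b) (gm Z Y 0 s) (gm Y X 0 t)\<close> by blast
 qed
next
 assume "EX X Y Z a b s t. ses X Y Z a b s t & x = cb X Y a & y = cb Y Z b"
 then obtain X Y Z a b s t where se: "ses X Y Z a b s t" and xy: "x = cb X Y a" "y = cb Y Z b" by blast
 then have c: "chain X Y a" "chain Y Z b" "s:H Z Y 0" "t:H Y X 0" by (auto simp: ses_def)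
 note f = fm(1)[OF chainD(3)[OF c(1)]] fm(1)[OF chainD(3)[OF c(2)]] fm(1)[OF c(3)] fm(1)[OF c(4)]
 have "ALL n. biproduct E (cob X n) (cob Z n) (cob Y n) (fm X Y 0 a n) (fm Z Y 0 s n) (fm Y X 0 t n) (fm Y Z 0 b n)"
  unfolding biproduct_families[OF f] using se c by (simp add: ses_def chain_def)
 then have "(fm X Y 0 a n, fm Y Z 0 b n):Ses E" for n unfolding Ses_E by blast
 moreover have "chain_map E X Y (fm X Y 0 a)" "chain_map E Y Z (fm Y Z 0 b)"
  using chain_map_iff chainD[OF c(1)] chainD[OF c(2)] c by auto
 ultimately show "(x, y):Ses C" using xy chainD[OF c(1)] chainD[OF c(2)] by (simp add: Cb_def cb_def cpx_def)
qed

lemma sesD: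
 assumes "ses X Y Z a b s t"
 shows "chain X Y a" "chain Y Z b" "s:H Z Y 0" "t:H Y X 0" "cpx X" "cpx Y" "cpx Z" "a:H X Y 0" "b:H Y Z 0"
  "t*a = uno X" "b*s = uno Z" "t*s = 0" "b*a = 0" "a*t+s*b = uno Y" "dd Y*a = a*dd X" "dd Z*b = b*dd Y"
 using assms by (auto simp: ses_def chain_def)

text \<open>The connecting map attached to the splitting, and how \<open>d\<close> acts with respect to the splitting.\<close>

lemma ses_connecting:
 assumes se: "ses X Y Z a b s t"
 defines "c \<equiv> t*dd Y*s"
 shows "c:H Z X 1" "dd X*c+c*dd Z = 0" "t*dd Y = dd X*t+c*b" "dd Y*s = a*c+s*dd Z"
proof -
 note r = sesD[OF se]
 show "c:H Z X 1" unfolding c_def ma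
  using H_mult[OF H_mult[OF r(3) cpxD(3)[OF r(6)] refl] r(4), of 1] by simp
 note u = unl[OF cpxD(3)[OF r(5)]] unl[OF cpxD(3)[OF r(6)]] unr[OF cpxD(3)[OF r(6)]]
 have "t*dd Y*(a*t+s*b) = t*dd Y" unfolding r(14) using u by (simp add: ma)
 then show td: "t*dd Y = dd X*t+c*b"
  using r(10,15) u by (simp add: c_def alg msub[OF r(10)] msub[OF r(15)] msub[OF u(1)])
 have "(a*t+s*b)*(dd Y*s) = dd Y*s" unfolding r(14) by (simp add: msub[OF u(2)])
 moreover have "b*(dd Y*s) = dd Z"
  using r(11) unr[OF cpxD(3)[OF r(7)]] by (simp add: ma[symmetric] r(16)[symmetric]) (simp add: ma)
 ultimately show ds: "dd Y*s = a*c+s*dd Z" by (simp add: c_def alg)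
 have "(dd X*t+c*b)*dd Y*s = 0" unfolding td[symmetric] by (simp add: ma msub[OF cpxD(4)[OF r(6)]])
 moreover have "c*b*dd Y*s = c*dd Z"
  using \<open>b*(dd Y*s) = dd Z\<close> by (simp add: ma)
 ultimately show "dd X*c+c*dd Z = 0" by (simp add: c_def alg)
qed

lemma ses_connecting_chain:
 assumes se: "ses X Y Z a b s t"
 shows "chain Z (sh X) (eta X*(t*dd Y*s))"
proof -
 note r = sesD[OF se] and c = ses_connecting[OF se]
 note g = cpxD(1)[OF r(5)]
 have "dd (sh X)*(eta X*(t*dd Y*s)) = - (eta X*(dd X*(t*dd Y*s)))"
  using unl[OF cpxD(3)[OF r(5)]] unl[OF c(1)]
  by (simp add: dd_sh[OF r(5)] ma msub[OF eta_inv(1)[OF g]] msub[OF unl[OF sesD(4)[OF se]]])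
 also have "dd X*(t*dd Y*s) = - ((t*dd Y*s)*dd Z)" using c(2) by (simp add: eq_neg_iff_add_eq_0)
 finally show ?thesis
  using H_mult[OF c(1) eta_H(1)[OF g], of 0] sh_cpx[OF r(5)] r(7) by (simp add: chain_def ma)
qed

text \<open>The comparison of the cone of \<open>a\<close> with the quotient, and its homotopy inverse.\<close>

lemma cone_quotient:
 assumes se: "ses X Y Z a b s t" and co: "cone X Y a Q I J P L"
 defines "k \<equiv> J*s - I*(t*dd Y*s)"
 shows "chain Q Z (b*L)" "chain Z Q k" "heq Q Q (k*(b*L)) (uno Q)" "b*L*k = uno Z" "P*k = - (t*dd Y*s)"
   "b*L*J = b" "chain Q (sh X) (- (eta X*P))"
proof -
 note r = sesD[OF se] and cc = ses_connecting[OF se] and c = coneD[OF co]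
 note u = unl[OF r(9)] unr[OF r(9)] unl[OF r(8)] unr[OF r(8)] unl[OF r(3)] unr[OF r(3)]
   unl[OF r(4)] unr[OF r(4)] unl[OF cc(1)] unr[OF cc(1)]
   unl[OF c(7)] unr[OF c(7)] unl[OF c(8)] unr[OF c(8)] unl[OF c(6)] unr[OF c(6)]
   unl[OF c(5)] unr[OF c(5)] unl[OF cpxD(3)[OF r(5)]]  unl[OF cpxD(3)[OF r(6)]] unr[OF cpxD(3)[OF r(6)]]
 let ?c = "t*dd Y*s"
 have H1: "b*L:H Q Z 0" using H_mult[OF c(8) r(9)] by simp
 have "b*(a*P+dd Y*L) = dd Z*(b*L)" using msub[OF r(13)] msub[OF r(16)] by (simp add: alg)
 then have "dd Z*(b*L) = b*L*dd Q" by (simp add: ma c(15))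
 then show bL: "chain Q Z (b*L)" using H1 c(4) r(7) by (simp add: chain_def)
 have "k:H Z Q 0" unfolding k_def using H_diff[OF H_mult[OF r(3) c(6)] H_mult[OF cc(1) c(5)], of 0] by simp
 moreover have "dd Q*k = k*dd Z"
 proof -
  have "dd Q*k = J*(dd Y*s) - (- (I*dd X)+J*a)*?c"
   unfolding k_def right_diff_distrib ma[symmetric] c(16,17) ..
  also have "... = J*s*dd Z+I*(dd X*?c)" unfolding cc(4) by (simp add: alg)
  also have "dd X*?c = - (?c*dd Z)" using cc(2) by (simp add: eq_neg_iff_add_eq_0)
  finally show ?thesis by (simp add: k_def alg)
 qed
 ultimately show "chain Z Q k" using c(4) r(7) by (simp add: chain_def)
 show "b*L*k = uno Z"
  unfolding k_def by (simp add: alg msub[OF c(10)] msub[OF c(12)] msub[OF u(5)] r(11))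
   (simp add: ma[symmetric] u r(11))
 show "P*k = - ?c"
  unfolding k_def by (simp add: alg msub[OF c(9)] msub[OF c(11)]) (simp add: ma[symmetric] u)
 show "b*L*J = b" by (simp add: ma c(10) u)
 have g: "gob X" using cpxD(1)[OF r(5)] .
 have "dd (sh X)*(eta X*P) = - (eta X*(dd X*P))"
  by (simp add: dd_sh[OF r(5)] ma msub[OF eta_inv(1)[OF g]]) (simp add: ma[symmetric] u)
 then show "chain Q (sh X) (- (eta X*P))"
  using H_neg[OF H_mult[OF c(7) eta_H(1)[OF g]], of 0] sh_cpx[OF r(5)] c(4,14) by (simp add: chain_def ma)
 show "heq Q Q (k*(b*L)) (uno Q)"
 proof (rule heqI[of "- (I*t*L)"])
  show "- (I*t*L):H Q Q (-1)"
   using H_neg[OF H_mult[OF c(8) H_mult[OF r(4) c(5) refl] refl]] by simp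
  have 1: "dd Q*(I*t*L) = - (I*dd X*t*L)+J*a*t*L"
   by (simp add: ma[symmetric] c(16)) (simp add: alg)
  have "I*t*L*dd Q = I*(t*a)*P+I*(t*dd Y)*L"
   unfolding ma c(15) by (simp add: alg)
  then have 2: "I*t*L*dd Q = I*P+I*(dd X*t+?c*b)*L"
   by (simp only: r(10) u(18) arg_cong[OF cc(3), of "%x. I*x*L"])
  have sb: "s*b = uno Y - a*t" using r(14) by (simp add: alg)
  have "k*(b*L) = J*(s*b)*L - I*?c*b*L" by (simp add: k_def alg)
  also have "... = J*L - J*a*t*L - I*?c*b*L"
   unfolding sb by (simp add: alg msub[OF u(13)] u)
  also have "... = uno Q+(dd Q*- (I*t*L)+- (I*t*L)*dd Q)"
   using 1 2 by (simp add: c(13)[symmetric] alg)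
  finally show "k*(b*L) = uno Q+(dd Q*- (I*t*L)+- (I*t*L)*dd Q)" .
 qed
qed

lemma cone_maps_family:
 assumes F: "chain X Y F" and c: "is_cone E (cb X Y F) Q i j p q"
 shows "to_Kb E (Q, %n. NegA E (p n), sh X) = kb Q (sh X) (- (eta X*gm Q X 1 p))" "to_Kb E (Y, j, Q) = kb Y Q (gm Y Q 0 j)"
  "chain Y Z b ==> to_Kb E (Q, %n. fm Y Z 0 b n o[E] q n, Z) = kb Q Z (b*gm Q Y 0 q)"
proof -
 note co = cone_of_is_cone[OF F c]
 have "fam Q (sh X) 0 (%n. NegA E (p n))" using fam_neg[OF gm_to_shift(2)[of Q X 0 p]] co(3) by simp
 moreover have "gm Q (sh X) 0 (%n. NegA E (p n)) = - (eta X*gm Q X 1 p)"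
  using gm_neg[OF gm_to_shift(2)[of Q X 0 p]] gm_to_shift(1)[of Q X 0 p] co(3) by simp
 ultimately show "to_Kb E (Q, %n. NegA E (p n), sh X) = kb Q (sh X) (- (eta X*gm Q X 1 p))"
  using fm_eq[of Q "sh X" 0 "%n. NegA E (p n)" "- (eta X*gm Q X 1 p)"] by (simp add: to_Kb_def kb_def)
 show "to_Kb E (Y, j, Q) = kb Y Q (gm Y Q 0 j)" using co(2) by (simp add: to_Kb_def kb_def)
 assume b: "chain Y Z b"
 have "fm Q Z (0+0) (b*gm Q Y 0 q) = (%n. fm Y Z 0 b (n+0) o[E] fm Q Y 0 (gm Q Y 0 q) n)"
  by (rule fm_mult[OF gm_H[OF co(4)] chainD(3)[OF b]])
 then show "to_Kb E (Q, %n. fm Y Z 0 b n o[E] q n, Z) = kb Q Z (b*gm Q Y 0 q)"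
  using co(4) by (simp add: to_Kb_def kb_def)
qed

lemma connecting_eq:
 assumes se: "ses X Y Z a b s t"
 shows "connecting E (cb X Y a, cb Y Z b) = kb Z (sh X) (eta X*(t*dd Y*s))"
proof -
 note r = sesD[OF se]
 let ?P = "%c. EX Q i j p q k. is_cone E (cb X Y a) Q i j p q &
   inverse_arrows K (to_Kb E (Q, %n. fm Y Z 0 b n o[E] q n, Z)) k &
   c = Comp K (to_Kb E (Q, %n. NegA E (p n), sh X)) k"
 have e: "connecting E (cb X Y a, cb Y Z b) = (THE c. ?P c)"
  unfolding connecting_def by (simp add: cb_def)
 have val: "Comp K (to_Kb E (Q, %n. NegA E (p n), sh X)) (kb Z Q (gm Y Q 0 j*s - gm X Q (-1) (%n. i (n - 1))*(t*dd Y*s)))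
   = kb Z (sh X) (eta X*(t*dd Y*s)) &
   inverse_arrows K (to_Kb E (Q, %n. fm Y Z 0 b n o[E] q n, Z)) (kb Z Q (gm Y Q 0 j*s - gm X Q (-1) (%n. i (n - 1))*(t*dd Y*s)))"
  if c: "is_cone E (cb X Y a) Q i j p q" for Q i j p q
 proof -
  note co = cone_of_is_cone[OF r(1) c]
  note q = cone_quotient[OF se co(1)]
  show ?thesis
   unfolding cone_maps_family(1)[OF r(1) c] cone_maps_family(3)[OF r(1) c r(2)] kb_inverse_iff[OF q(1,2)] kb_comp[OF q(2,7)]
   using q heq_refl[OF chain_uno[OF r(7)]] by (simp add: ma)
 qed
 have "(THE c. ?P c) = kb Z (sh X) (eta X*(t*dd Y*s))"
 proof (rule the_equality)
  obtain Q i j p q where c: "is_cone E (cb X Y a) Q i j p q" using is_cone_ex[OF r(1)] by blast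
  show "?P (kb Z (sh X) (eta X*(t*dd Y*s)))"
   by (intro exI conjI, rule c, rule val[OF c, THEN conjunct2], rule val[OF c, THEN conjunct1, symmetric])
 next
  fix c assume "?P c"
  then obtain Q i j p q k where co: "is_cone E (cb X Y a) Q i j p q"
   and k: "inverse_arrows K (to_Kb E (Q, %n. fm Y Z 0 b n o[E] q n, Z)) k"
   and c: "c = Comp K (to_Kb E (Q, %n. NegA E (p n), sh X)) k" by blast
  interpret K: category K by (rule K_category)
  note v = val[OF co]
  define k' where "k' = kb Z Q (gm Y Q 0 j*s - gm X Q (-1) (%n. i (n - 1))*(t*dd Y*s))"
  let ?g = "to_Kb E (Q, %n. fm Y Z 0 b n o[E] q n, Z)"
  have k': "inverse_arrows K ?g k'" using v k'_def by simp
  have "?g:iso_arrows K" using k' unfolding iso_arrows_def by blast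
  then have "k = k'"
   by (rule K.iso_cancel_left) (use k k' in \<open>auto simp: inverse_arrows_def Hom_def\<close>)
  then show "c = kb Z (sh X) (eta X*(t*dd Y*s))" using c v k'_def by simp
 qed
 then show ?thesis using e by simp
qed

lemma ses_triangle_eq:
 "ses X Y Z a b s t ==> ses_triangle E (cb X Y a, cb Y Z b) = (kb X Y a, kb Y Z b, kb Z (sh X) (eta X*(t*dd Y*s)))"
 by (simp add: ses_triangle_def connecting_eq)

end

section \<open>Distinguished triangles of the homotopy category\<close>

context proj_modules
begin

lemma biproduct_ses:
 assumes "biproduct C X Z Y i j p q"
 shows "EX a b s t. i = cb X Y a & j = cb Z Y s & p = cb Y X t & q = cb Y Z b & ses X Y Z a b s t & chain Z Y s & chain Y X t"
proof -
 have h: "i:Hom C X Y" "j:Hom C Z Y" "p:Hom C Y X" "q:Hom C Y Z" and o: "cpx X" "cpx Z" "cpx Y"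
  and e: "Comp C p i = Ident C X" "Comp C q j = Ident C Z" "Comp C p j = ZeroA C Z X" "Comp C q i = ZeroA C X Z"
   "AddA C (Comp C i p) (Comp C j q) = Ident C Y"
  using assms by (auto simp: biproduct_def)
 obtain a s t b where c: "chain X Y a" "chain Z Y s" "chain Y X t" "chain Y Z b"
  and m: "i = cb X Y a" "j = cb Z Y s" "p = cb Y X t" "q = cb Y Z b"
  using h by (auto simp: Hom_def C_arr)
 have "t*a = uno X" "b*s = uno Z" "t*s = 0" "b*a = 0" "a*t+s*b = uno Y"
  using e[unfolded m] c o
  by (simp_all add: cb_comp cb_ident cb_zero cb_add chain_mult chain_uno chain_zero chain_add cb_eq_iff)
 then have "ses X Y Z a b s t" using c chainD(3) by (simp add: ses_def)
 then show ?thesis using m c by blast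
qed

lemma kb_biproduct:
 assumes "ses X Y Z a b s t" "chain Z Y s" "chain Y X t"
 shows "biproduct K X Z Y (kb X Y a) (kb Z Y s) (kb Y X t) (kb Y Z b)"
 using sesD[OF assms(1)] assms(2,3)
 by (auto simp: biproduct_def K_hom kb_comp kb_ident kb_zero kb_add chain_mult)

lemma Sh_arr:
 assumes "f:Arr K"
 shows "ShA K f:Arr K" "Dom K (ShA K f) = sh (Dom K f)" "Cod K (ShA K f) = sh (Cod K f)"
proof -
 obtain X Y F where f: "chain X Y F" "f = kb X Y F" using assms by (auto simp: K_arr)
 show "ShA K f:Arr K" "Dom K (ShA K f) = sh (Dom K f)" "Cod K (ShA K f) = sh (Cod K f)"
  using kb_arr[OF chain_shift[OF f(1)]] by (simp_all add: f(2) kb_sh[OF f(1)])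
qed

lemma Sh_comp:
 assumes "f:Arr K" "g:Arr K" "Dom K g = Cod K f"
 shows "ShA K (Comp K g f) = Comp K (ShA K g) (ShA K f)"
proof -
 obtain X Y Z F G where f: "chain X Y F" "f = kb X Y F" and g: "chain Y Z G" "g = kb Y Z G"
  using assms by (auto simp: K_arr)
 show ?thesis
  unfolding f(2) g(2) kb_comp[OF f(1) g(1)] kb_sh[OF f(1)] kb_sh[OF g(1)] kb_sh[OF chain_mult[OF f(1) g(1)]]
   kb_comp[OF chain_shift[OF f(1)] chain_shift[OF g(1)]]
  by (simp add: ma msub[OF eta_inv(1)[OF cpxD(1)[OF chainD(2)[OF f(1)]]]] msub[OF unl[OF chainD(3)[OF f(1)]]])
qed

lemma triangle_iso_pre: "triangle_iso (Kb_pre E) = triangle_iso K"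
proof -
 have "iso_arrows (Kb_pre E) = iso_arrows K" by (simp add: iso_arrows_def inverse_arrows_def Hom_def Kb_def)
 then show ?thesis by (auto simp: triangle_iso_def triangle_def Hom_def Kb_def fun_eq_iff)
qed

lemma Tri_iff:
 "De:Tri K \<longleftrightarrow> (EX X Y F Q i j p q al be gg. chain X Y F & is_cone E (cb X Y F) Q i j p q &
   triangle_iso K De (kb X Y F, kb Y Q (gm Y Q 0 j), kb Q (sh X) (- (eta X*gm Q X 1 p))) al be gg)"
proof -
 have ct: "cone_triangle E (cb X Y F) Q j p = (kb X Y F, kb Y Q (gm Y Q 0 j), kb Q (sh X) (- (eta X*gm Q X 1 p)))"
  if "chain X Y F" "is_cone E (cb X Y F) Q i j p q" for X Y F Q i j p q
  using cone_maps_family(1,2)[OF that] by (simp add: cone_triangle_def cb_def kb_def to_Kb_def)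
 have "De:Tri K \<longleftrightarrow> (EX X f Y Q i j p q al be gg. bounded_cpx E X & bounded_cpx E Y & chain_map E X Y f &
   is_cone E (X, f, Y) Q i j p q & triangle_iso K De (cone_triangle E (X, f, Y) Q j p) al be gg)"
 proof -
  have T: "Tri K = {De. EX X f Y Q i j p q al be gg. bounded_cpx E X & bounded_cpx E Y & chain_map E X Y f &
   is_cone E (X, f, Y) Q i j p q & triangle_iso (Kb_pre E) De (cone_triangle E (X, f, Y) Q j p) al be gg}"
   by (simp add: Kb_def)
  show ?thesis unfolding T triangle_iso_pre by (rule mem_Collect_eq)
 qed
 also have "... \<longleftrightarrow> (EX X Y F Q i j p q al be gg. chain X Y F & is_cone E (cb X Y F) Q i j p q &
   triangle_iso K De (kb X Y F, kb Y Q (gm Y Q 0 j), kb Q (sh X) (- (eta X*gm Q X 1 p))) al be gg)" (is "?L \<longleftrightarrow> ?R")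
 proof
  assume ?L
  then obtain X f Y Q i j p q al be gg where f: "cpx X" "cpx Y" "chain_map E X Y f"
   "is_cone E (X, f, Y) Q i j p q" "triangle_iso K De (cone_triangle E (X, f, Y) Q j p) al be gg" unfolding cpx_def by blast
  have "fam X Y 0 f" and c: "chain X Y (gm X Y 0 f)" using f chain_map_iff by auto
  then have cbf: "cb X Y (gm X Y 0 f) = (X, f, Y)" by (simp add: cb_def)
  show ?R using f(4,5) c ct[OF c, unfolded cbf, OF f(4)] cbf by metis
 next
  assume ?R
  then obtain X Y F Q i j p q al be gg where F: "chain X Y F" and r: "is_cone E (cb X Y F) Q i j p q"
    "triangle_iso K De (kb X Y F, kb Y Q (gm Y Q 0 j), kb Q (sh X) (- (eta X*gm Q X 1 p))) al be gg" by blast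
  have "bounded_cpx E X & bounded_cpx E Y & chain_map E X Y (fm X Y 0 F)"
   using chainD[OF F] chain_map_iff[of X Y "fm X Y 0 F"] F by (auto simp: cpx_def)
  then show ?L using r ct[OF F r(1)] unfolding cb_def by metis
 qed
 finally show ?thesis .
qed

lemma kb_uno_iso: "cpx X ==> kb X X (uno X):iso_arrows K"
 using kb_iso_iff[OF chain_uno] chain_uno heq_refl unl[OF cpxD(6)] by metis

lemma tri_isoI:
 assumes "chain X Y u" "chain Y Z v" "chain Z (sh X) w" "chain X' Y' u'" "chain Y' Z' v'" "chain Z' (sh X') w'"
  and c: "chain X X' al" "chain Y Y' be" "chain Z Z' gg"
  and i: "kb X X' al:iso_arrows K" "kb Y Y' be:iso_arrows K" "kb Z Z' gg:iso_arrows K"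
  and e: "heq X Y' (be*u) (u'*al)" "heq Y Z' (gg*v) (v'*be)" "heq Z (sh X') (eta X'*al*ate X*w) (w'*gg)"
 shows "triangle_iso K (kb X Y u, kb Y Z v, kb Z (sh X) w) (kb X' Y' u', kb Y' Z' v', kb Z' (sh X') w')
  (kb X X' al) (kb Y Y' be) (kb Z Z' gg)"
proof -
 note m = chain_mult[OF assms(1) c(2)] chain_mult[OF c(1) assms(4)] chain_mult[OF assms(2) c(3)] chain_mult[OF c(2) assms(5)]
  chain_mult[OF assms(3) chain_shift[OF c(1)]] chain_mult[OF c(3) assms(6)]
 show ?thesis
  unfolding triangle_iso_def triangle_def
  using assms(1-6) c i e m
  by (simp add: kb_arr Hom_def kb_comp[OF assms(1) c(2)] kb_comp[OF c(1) assms(4)] kb_comp[OF assms(2) c(3)]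
    kb_comp[OF c(2) assms(5)] kb_comp[OF assms(3) chain_shift[OF c(1)]] kb_comp[OF c(3) assms(6)] kb_sh kb_eq_iff)
qed

lemma eta_simps:
 assumes "cpx X"
 shows "F:H Z X k ==> eta X*uno X*ate X*(eta X*F) = eta X*F"
  "F:H Y X k ==> G:H Z Y l ==> cpx Y ==> eta X*F*ate Y*(eta Y*G) = eta X*(F*G)"
proof -
 note g = cpxD(1)[OF assms]
 show "eta X*uno X*ate X*(eta X*F) = eta X*F" if "F:H Z X k"
  using unl[OF that] by (simp add: ma msub[OF eta_inv(1)[OF g]])
 show "eta X*F*ate Y*(eta Y*G) = eta X*(F*G)" if "F:H Y X k" "G:H Z Y l" "cpx Y"
  using unl[OF that(2)] eta_inv(1)[OF cpxD(1)[OF that(3)]] by (simp add: ma msub[OF eta_inv(1)[OF cpxD(1)[OF that(3)]]])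
qed

lemma ses_triangle_Tri:
 assumes se: "ses X Y Z a b s t"
 shows "ses_triangle E (cb X Y a, cb Y Z b):Tri K"
proof -
 note r = sesD[OF se] and cc = ses_connecting[OF se] and ch = ses_connecting_chain[OF se]
 obtain Q i j p q where c: "is_cone E (cb X Y a) Q i j p q" using is_cone_ex[OF r(1)] by blast
 define I J P L where "I = gm X Q (-1) (%n. i (n - 1))" and "J = gm Y Q 0 j" and "P = gm Q X 1 p" and "L = gm Q Y 0 q"
 have co: "cone X Y a Q I J P L" using cone_of_is_cone(1)[OF r(1) c] by (simp add: I_def J_def P_def L_def)
 let ?c = "t*dd Y*s"
 define k where "k = J*s - I*?c"
 note q = cone_quotient[OF se co, folded k_def]
 have kiso: "kb Z Q k:iso_arrows K"
  using kb_iso_iff[OF q(2)] q(1,3,4) heq_refl[OF chain_uno[OF r(7)]] by auto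
 have "triangle_iso K (kb X Y a, kb Y Z b, kb Z (sh X) (eta X*?c)) (kb X Y a, kb Y Q J, kb Q (sh X) (- (eta X*P)))
  (kb X X (uno X)) (kb Y Y (uno Y)) (kb Z Q k)"
 proof (rule tri_isoI[OF r(1,2) ch r(1) coneD(18)[OF co] q(7) chain_uno[OF r(5)] chain_uno[OF r(6)] q(2) kb_uno_iso[OF r(5)] kb_uno_iso[OF r(6)] kiso])
  show "heq X Y (uno Y*a) (a*uno X)" using heq_refl[OF r(1)] by (simp add: unl[OF r(8)] unr[OF r(8)])
  have "heq Y Q (k*(b*L)*J) (uno Q*J)" by (rule heq_multR[OF q(3) coneD(18)[OF co]])
  then show "heq Y Q (k*b) (J*uno Y)"
   using q(6) unl[OF coneD(6)[OF co]] unr[OF coneD(6)[OF co]] by (simp add: ma)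
  have "eta X*uno X*ate X*(eta X*?c) = - (eta X*P)*k"
   using eta_simps(1)[OF r(5) cc(1)] q(5) by (simp add: ma)
  then show "heq Z (sh X) (eta X*uno X*ate X*(eta X*?c)) (- (eta X*P)*k)"
   using chain_mult[OF q(2,7)] heq_refl by simp
 qed
 then show ?thesis unfolding Tri_iff ses_triangle_eq[OF se] using r(1) c unfolding J_def P_def by blast
qed

lemma ses_triangle_natural:
 assumes se: "ses X Y Z a b s t" and se': "ses X' Y' Z' a' b' s' t'"
  and c: "chain X X' al" "chain Y Y' be" "chain Z Z' gg" and e: "be*a = a'*al" "gg*b = b'*be"
  and i: "kb X X' al:iso_arrows K" "kb Y Y' be:iso_arrows K" "kb Z Z' gg:iso_arrows K"
 shows "triangle_iso K (ses_triangle E (cb X Y a, cb Y Z b)) (ses_triangle E (cb X' Y' a', cb Y' Z' b'))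
  (kb X X' al) (kb Y Y' be) (kb Z Z' gg)"
proof -
 note r = sesD[OF se] and cc = ses_connecting[OF se] and ch = ses_connecting_chain[OF se]
 note r' = sesD[OF se'] and cc' = ses_connecting[OF se'] and ch' = ses_connecting_chain[OF se']
 let ?c = "t*dd Y*s" and ?c' = "t'*dd Y'*s'"
 note aH = chainD(3)[OF c(1)] and bH = chainD(3)[OF c(2)] and gH = chainD(3)[OF c(3)]
 define ka where "ka = t'*be*s"
 have kH: "ka:H Z X' 0" unfolding ka_def ma using H_mult[OF H_mult[OF r(3) bH refl] r'(4)] by simp
 have "(a'*t'+s'*b')*(be*s) = be*s" unfolding r'(14) using unl[OF bH] by (simp add: ma[symmetric])
 moreover have "b'*(be*s) = gg"
  using unr[OF gH] r(11) by (simp add: ma[symmetric] e(2)[symmetric]) (simp add: ma)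
 ultimately have bs: "be*s = s'*gg+a'*ka" by (simp add: ka_def alg)
 have "t'*be*(a*t+s*b) = t'*be" unfolding r(14) using unr[OF bH] by (simp add: ma)
 moreover have "t'*be*a = al" using unl[OF aH] by (simp add: ma e(1)) (simp add: ma[symmetric] r'(10))
 moreover from this have "t'*be*(a*t) = al*t" by (simp add: ma[symmetric])
 ultimately have tb: "t'*be = al*t+ka*b" by (simp add: ka_def alg)
 have "t'*dd Y'*(be*s) = ?c'*gg+dd X'*ka"
  unfolding bs using cc'(3)
  by (simp add: alg msub[OF r'(15)] msub[OF r'(10)] msub[OF r'(13)] unl[OF kH] msub[OF unl[OF cpxD(3)[OF r'(5)]]])
 moreover have "t'*dd Y'*(be*s) = (t'*be)*dd Y*s" by (simp add: ma msub[OF chainD(4)[OF c(2)]])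
 moreover have "(t'*be)*dd Y*s = al*?c+ka*dd Z"
 proof -
  have "b*(dd Y*s) = dd Z" using r(11) unr[OF cpxD(3)[OF r(7)]]
   by (simp add: ma[symmetric] r(16)[symmetric]) (simp add: ma)
  then show ?thesis unfolding tb by (simp add: alg)
 qed
 ultimately have key: "al*?c = ?c'*gg+dd X'*ka - ka*dd Z" by (simp add: alg)
 show ?thesis
  unfolding ses_triangle_eq[OF se] ses_triangle_eq[OF se']
 proof (rule tri_isoI[OF r(1,2) ch r'(1,2) ch' c i])
  show "heq X Y' (be*a) (a'*al)" using e(1) heq_refl[OF chain_mult[OF r(1) c(2)]] by simp
  show "heq Y Z' (gg*b) (b'*be)" using e(2) heq_refl[OF chain_mult[OF r(2) c(3)]] by simp
  show "heq Z (sh X') (eta X'*al*ate X*(eta X*?c)) (eta X'*?c'*gg)"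
  proof (rule heqI[of "- (eta X'*ka)"])
   show "- (eta X'*ka):H Z (sh X') (-1)" using H_neg[OF H_mult[OF kH eta_H(1)[OF cpxD(1)[OF r'(5)]], of "-1"]] by simp
   have "dd (sh X')*(eta X'*ka) = - (eta X'*(dd X'*ka))"
    using unl[OF kH] by (simp add: dd_sh[OF r'(5)] ma msub[OF eta_inv(1)[OF cpxD(1)[OF r'(5)]]])
   then show "eta X'*al*ate X*(eta X*?c) = eta X'*?c'*gg+(dd (sh X')*- (eta X'*ka)+- (eta X'*ka)*dd Z)"
    unfolding eta_simps(2)[OF r'(5) aH cc(1) r(5)] key by (simp add: alg)
  qed
 qed
qed

lemma ses_triangle_biproduct:
 assumes se: "ses X Y Z a b s t" and "chain Z Y s" "chain Y X t"
 shows "ses_triangle E (cb X Y a, cb Y Z b) = (kb X Y a, kb Y Z b, ZeroA K Z (ShO K X))"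
proof -
 note r = sesD[OF se]
 have "t*dd Y*s = 0" using chainD(4)[OF assms(2)] r(12) by (simp add: ma) (simp add: ma[symmetric])
 then show ?thesis by (simp add: ses_triangle_eq[OF se] kb_zero r sh_cpx)
qed

text \<open>For \<open>X \<rightarrow> Y \<rightarrow> Z\<close> with quotients \<open>U = Y/X\<close>, \<open>V = Z/X\<close>, \<open>W = Z/Y\<close>, splittings of \<open>X \<rightarrow> Y\<close> and
 \<open>Y \<rightarrow> Z\<close> induce compatible splittings of the other two sequences. With these, all relations of the
 octahedron but one hold before passing to homotopy classes.\<close>

lemma ses_compatible_splittings:
 assumes s1: "ses X Y U a p sgp pja" and s2: "ses X Z V (b*a) q sgq pjq" and s3: "ses Y Z W b r sgr pjb"
  and s4: "ses U V W s t sgt pjs" and e: "s*p = q*b" "t*q = r"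
 shows "EX sg pj. ses X Z V (b*a) q sg (pja*pjb) & ses U V W s t (q*sgr) pj & pj*q = p*pjb &
  sg = b*sgp*pj+sgr*t"
proof -
 note r1 = sesD[OF s1] and r2 = sesD[OF s2] and r3 = sesD[OF s3] and r4 = sesD[OF s4]
 define ta where "ta = q*sgr"
 define pj where "pj = pjs - pjs*ta*t"
 define sg where "sg = b*sgp*pj+sgr*t"
 note un = unl[OF r1(8)] unl[OF r1(9)] unl[OF r1(3)] unl[OF r1(4)] unr[OF r1(8)] unr[OF r1(9)] unr[OF r1(3)] unr[OF r1(4)]
  unl[OF r3(8)] unl[OF r3(9)] unl[OF r3(3)] unl[OF r3(4)] unr[OF r3(8)] unr[OF r3(9)] unr[OF r3(3)] unr[OF r3(4)]
  unl[OF r4(8)] unl[OF r4(9)] unl[OF r4(3)] unl[OF r4(4)] unr[OF r4(8)] unr[OF r4(9)] unr[OF r4(3)] unr[OF r4(4)]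
  unl[OF r2(9)] unr[OF r2(9)]
 have tH: "ta:H W V 0" unfolding ta_def using H_mult[OF r3(3) r2(9)] by simp
 have pH: "pj:H V U 0" unfolding pj_def
  using H_diff[OF r4(4) H_mult[OF r4(9) H_mult[OF tH r4(4) refl], of 0]] by simp
 have sH: "sg:H V Z 0" unfolding sg_def
  using H_add[OF H_mult[OF pH H_mult[OF r1(3) r3(8) refl], of 0] H_mult[OF r4(9) r3(3), of 0]] by simp
 note unn = unl[OF tH] unr[OF tH] unl[OF pH] unr[OF pH] unl[OF sH] unr[OF sH]
 have tt: "t*ta = uno W" unfolding ta_def using e(2) r3(11) by (simp add: ma[symmetric])
 have ps: "pj*s = uno U" unfolding pj_def using r4(10,13) by (simp add: alg)
 have pt: "pj*ta = 0" unfolding pj_def using tt unn(2) by (simp add: alg)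
 have spi: "s*pj+ta*t = uno V"
 proof -
  have "s*pj = s*pjs - (s*pjs)*ta*t" by (simp add: pj_def alg)
  also have "s*pjs = uno V - sgt*t" using r4(14) by (simp add: alg)
  also have "uno V - sgt*t - (uno V - sgt*t)*ta*t = uno V - ta*t"
   by (simp add: alg msub[OF tt] msub[OF unn(1)] msub[OF un(18)] un(18))
  finally show ?thesis by simp
 qed
 have S4: "ses U V W s t ta pj" unfolding ses_def using r4 tH pH tt ps pt spi by simp
 have pq: "pj*q = p*pjb"
 proof -
  have "pj*q*(b*pjb+sgr*r) = pj*q" unfolding r3(14) using un(26) by (simp add: ma)
  moreover have "pj*q*(b*pjb) = p*pjb" using msub[OF e(1)] by (simp add: ma msub[OF e(1)[symmetric]] msub[OF ps] msub[OF un(2)])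
  moreover have "pj*q*(sgr*r) = 0" using pt by (simp add: ta_def ma[symmetric])
  ultimately show ?thesis by (simp add: distrib_left)
 qed
 have qs: "q*sg = uno V"
 proof -
  have "q*sg = (q*b)*sgp*pj+ta*t" by (simp add: sg_def ta_def alg)
  also have "... = uno V" unfolding e(1)[symmetric] using spi by (simp add: ma msub[OF r1(11)] unn(3))
  finally show ?thesis .
 qed
 have S2: "ses X Z V (b*a) q sg (pja*pjb)"
  unfolding ses_def
 proof (intro conjI)
  show "pja*pjb:H Z X 0" using H_mult[OF r3(4) r1(4)] by simp
  show "pja*pjb*(b*a) = uno X" by (simp add: ma msub[OF r3(10)] un(1) r1(10))
  have "pja*pjb*sg = pja*(pjb*b)*sgp*pj+pja*(pjb*sgr)*t" by (simp add: sg_def alg)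
  also have "... = 0" unfolding r3(10,12) using r1(12) by (simp add: un(8))
  finally show "pja*pjb*sg = 0" .
  have "b*a*(pja*pjb)+sg*q = b*(a*pja)*pjb+b*sgp*(pj*q)+sgr*(t*q)" by (simp add: sg_def alg)
  also have "... = b*(a*pja+sgp*p)*pjb+sgr*r" unfolding pq e(2) by (simp add: alg)
  also have "... = uno Z" unfolding r1(14) using r3(14) un(13) by simp
  finally show "b*a*(pja*pjb)+sg*q = uno Z" .
 qed (use r2 sH qs in auto)
 show ?thesis using S2 S4 pq unfolding ta_def sg_def by blast
qed

text \<open>The octahedron is written with the third objects being the actual quotients, so that its
 faces are the triangles of the four given sequences.\<close>

lemma ses_octahedron:
 assumes s1: "ses X Y U a p sgp pja" and s2: "ses X Z V (b*a) q sgq pjq" and s3: "ses Y Z W b r sgr pjb"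
  and s4: "ses U V W s t sgt pjs" and e: "s*p = q*b" "t*q = r"
 shows "octahedron K (ses_triangle E (cb X Y a, cb Y U p)) (ses_triangle E (cb X Z (b*a), cb Z V q))
   (ses_triangle E (cb Y Z b, cb Z W r)) (ses_triangle E (cb U V s, cb V W t))"
proof -
 note r1 = sesD[OF s1] and r3 = sesD[OF s3]
 obtain sg pj where S2: "ses X Z V (b*a) q sg (pja*pjb)" and S4: "ses U V W s t (q*sgr) pj"
  and pq: "pj*q = p*pjb" and sg_def: "sg = b*sgp*pj+sgr*t"
  using ses_compatible_splittings[OF s1 s2 s3 s4 e] by blast
 define ta where "ta = q*sgr"
 note S4 = S4[folded ta_def]
 note r2 = sesD[OF S2] and r4 = sesD[OF S4]
 note un = unl[OF r1(8)] unl[OF r1(9)] unl[OF r1(3)] unl[OF r1(4)] unr[OF r1(8)] unr[OF r1(9)] unr[OF r1(3)] unr[OF r1(4)]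
  unl[OF r3(8)] unl[OF r3(9)] unl[OF r3(3)] unl[OF r3(4)] unr[OF r3(8)] unr[OF r3(9)] unr[OF r3(3)] unr[OF r3(4)]
  unl[OF r4(8)] unl[OF r4(9)] unl[OF r4(3)] unl[OF r4(4)] unr[OF r4(8)] unr[OF r4(9)] unr[OF r4(3)] unr[OF r4(4)]
  unl[OF r2(9)] unr[OF r2(9)]
 note tH = r4(3) and pH = r4(4) and sH = r2(3) and tt = r4(11) and ps = r4(10) and pt = r4(12) and qs = r2(11) and spi = r4(14)
 note unn = unl[OF tH] unr[OF tH] unl[OF pH] unr[OF pH] unl[OF sH] unr[OF sH]
 note c1 = ses_connecting[OF s1] and c3 = ses_connecting[OF s3]
 note c2 = ses_connecting[OF S2] and c4 = ses_connecting[OF S4]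
 note h1 = ses_connecting_chain[OF s1] and h3 = ses_connecting_chain[OF s3] and h2 = ses_connecting_chain[OF S2] and h4 = ses_connecting_chain[OF S4]
 let ?c1 = "pja*dd Y*sgp" and ?c2 = "pja*pjb*dd Z*sg" and ?c3 = "pjb*dd Z*sgr" and ?c4 = "pj*dd V*ta"
 note dY = cpxD(3)[OF r1(6)] and dZ = cpxD(3)[OF r3(6)] and dV = cpxD(3)[OF r4(6)]
 have ss: "sg*s = b*sgp" unfolding sg_def by (simp add: alg ps r4(13) un(7))
 have k1: "?c2*s = ?c1"
 proof -
  have "?c2*s = pja*pjb*(dd Z*b)*sgp" by (simp add: ma ss)
  then show ?thesis unfolding r3(15) by (simp add: ma msub[OF r3(10)] msub[OF unl[OF dY]])
 qed
 have k2: "?c4 = p*?c3"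
 proof -
  have "?c4 = pj*(dd V*q)*sgr" by (simp add: ta_def ma)
  also have "... = (pj*q)*dd Z*sgr" unfolding r2(16) by (simp add: ma)
  finally show ?thesis by (simp add: pq ma)
 qed
 define h where "h = sgp*pj"
 have hH: "h:H V Y 0" unfolding h_def using H_mult[OF pH r1(3)] by simp
 have k3: "?c3*t = a*?c2 - dd Y*h+h*dd V"
 proof -
  have "a*?c2 = (a*pja)*(pjb*dd Z*sg)" by (simp add: ma)
  also have "pjb*dd Z*sg = dd Y*sgp*pj+?c3*t"
  proof -
   have "pjb*dd Z*sg = pjb*(dd Z*b)*sgp*pj+?c3*t" by (simp add: sg_def alg)
   then show ?thesis unfolding r3(15) by (simp add: ma msub[OF r3(10)] msub[OF unl[OF dY]])
  qed
  also have "a*pja = uno Y - sgp*p" using r1(14) by (simp add: alg)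
  finally have A: "a*?c2 = dd Y*sgp*pj+?c3*t - sgp*(p*dd Y*sgp*pj+p*?c3*t)"
   using unl[OF c3(1)] by (simp add: alg msub[OF unl[OF dY]] msub[OF unl[OF r3(4)]])
  have B: "p*dd Y*sgp*pj = dd U*pj" unfolding r1(16)[symmetric] by (simp add: ma msub[OF r1(11)] unn(3))
  have "pj*dd V = dd U*pj+p*?c3*t" using c4(3) unfolding k2 .
  then show ?thesis unfolding A B h_def by (simp add: alg)
 qed
 have cb': "cb X Z (b*a) = cb X Z (b*a)" ..
 show ?thesis
  unfolding ses_triangle_eq[OF s1] ses_triangle_eq[OF S2] ses_triangle_eq[OF s3] ses_triangle_eq[OF S4] octahedron_def
 proof (simp, intro conjI)
  show "(kb X Y a, kb Y U p, kb U (sh X) (eta X*?c1)):Tri K" using ses_triangle_Tri[OF s1] by (simp add: ses_triangle_eq[OF s1])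
  show "(kb X Z (b*a), kb Z V q, kb V (sh X) (eta X*?c2)):Tri K" using ses_triangle_Tri[OF S2] by (simp add: ses_triangle_eq[OF S2])
  show "(kb Y Z b, kb Z W r, kb W (sh Y) (eta Y*?c3)):Tri K" using ses_triangle_Tri[OF s3] by (simp add: ses_triangle_eq[OF s3])
  show "(kb U V s, kb V W t, kb W (sh U) (eta U*?c4)):Tri K" using ses_triangle_Tri[OF S4] by (simp add: ses_triangle_eq[OF S4])
  show "kb X Z (b*a) = Comp K (kb Y Z b) (kb X Y a)" using kb_comp[OF r1(1) r3(1)] by simp
  show "Comp K (kb V (sh X) (eta X*?c2)) (kb U V s) = kb U (sh X) (eta X*?c1)"
   using kb_comp[OF r4(1) h2] k1 by (simp add: ma)
  show "Comp K (kb V W t) (kb Z V q) = kb Z W r" using kb_comp[OF r2(2) r4(2)] e(2) by simp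
  show "kb W (sh U) (eta U*?c4) = Comp K (ShA K (kb Y U p)) (kb W (sh Y) (eta Y*?c3))"
   unfolding kb_sh[OF r1(2)] kb_comp[OF h3 chain_shift[OF r1(2)]] eta_simps(2)[OF r1(7) r1(9) c3(1) r1(6)] k2 by (simp add: ma)
  show "Comp K (kb U V s) (kb Y U p) = Comp K (kb Z V q) (kb Y Z b)"
   using kb_comp[OF r1(2) r4(1)] kb_comp[OF r3(1) r2(2)] e(1) by simp
  show "Comp K (kb W (sh Y) (eta Y*?c3)) (kb V W t) = Comp K (ShA K (kb X Y a)) (kb V (sh X) (eta X*?c2))"
   unfolding kb_sh[OF r1(1)] kb_comp[OF r4(2) h3] kb_comp[OF h2 chain_shift[OF r1(1)]] eta_simps(2)[OF r1(6) r1(8) c2(1) r1(5)]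
  proof (rule kb_eqI)
   show "heq V (sh Y) (eta Y*?c3*t) (eta Y*(a*?c2))"
   proof (rule heqI[of "eta Y*h"])
    show "eta Y*h:H V (sh Y) (-1)" using H_mult[OF hH eta_H(1)[OF cpxD(1)[OF r1(6)]], of "-1"] by simp
    have "dd (sh Y)*(eta Y*h) = - (eta Y*(dd Y*h))"
     using unl[OF hH] by (simp add: dd_sh[OF r1(6)] ma msub[OF eta_inv(1)[OF cpxD(1)[OF r1(6)]]])
    then show "eta Y*?c3*t = eta Y*(a*?c2)+(dd (sh Y)*(eta Y*h)+eta Y*h*dd V)"
     using k3 by (simp add: ma[of "eta Y" "?c3" t]) (simp add: alg)
   qed
   show "chain V (sh Y) (eta Y*?c3*t)" by (rule chain_mult[OF r4(2) h3])
   show "chain V (sh Y) (eta Y*(a*?c2))"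
    using chain_mult[OF h2 chain_shift[OF r1(1)]] eta_simps(2)[OF r1(6) r1(8) c2(1) r1(5)] by simp
  qed
 qed
qed

definition ush :: "('r, 'm) mcpx => ('r, 'm) mcpx" where
 "ush X = \<lparr>cob = (%n. cob X (n - 1)), cdif = (%n. NegA E (cdif X (n - 1)))\<rparr>"

lemma ush_cpx:
 assumes X: "cpx X"
 shows "cpx (ush X)" "sh (ush X) = X"
proof -
 note fd = cpxD(2)[OF X] and g = cpxD(1)[OF X]
 have "gm X X (1+1) (%n. NegA E (cdif X (n+1)) o[E] NegA E (cdif X n)) = gm X X (1+1) (%n. ZeroA E (cob X n) (cob X (n+(1+1))))"
  using gm_comp[OF fam_neg[OF fd] fam_neg[OF fd]] gm_neg[OF fd] cpxD(4)[OF X] gm_zero[OF g g, of "1+1"] by (simp add: dd_def)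
 then have z: "NegA E (cdif X (n+1)) o[E] NegA E (cdif X n) = ZeroA E (cob X n) (cob X (n+2))" for n
  using gm_eq_iff[OF fam_comp[OF fam_neg[OF fd] fam_neg[OF fd]] fam_zero[OF g g, of "1+1"]] by simp
 have h: "NegA E (cdif X n):Hom E (cob X n) (cob X (n+1))" for n using famD(1)[OF fam_neg[OF fd]] .
 have "{n. ~ zero_object E (cob X (n - 1))} = (%n. n+1) ` {n. ~ zero_object E (cob X n)}"
  by (force simp: image_iff)
 then have "finite {n. ~ zero_object E (cob X (n - 1))}" using cpxD(5)[OF X] by simp
 then show "cpx (ush X)"
  using h[of "n - 1" for n] z[of "n - 1" for n] g unfolding cpx_def bounded_cpx_def
  by (simp add: ush_def gob_def)
 have "gm X X 1 (%n. NegA E (NegA E (cdif X n))) = gm X X 1 (cdif X)"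
  using gm_neg[OF fam_neg[OF fd]] gm_neg[OF fd] by simp
 then have "NegA E (NegA E (cdif X n)) = cdif X n" for n
  using gm_eq_iff[OF fam_neg[OF fam_neg[OF fd]] fd] by simp
 then show "sh (ush X) = X" by (simp add: shift_cpx_def ush_def)
qed

text \<open>An extension with prescribed connecting map \<open>c\<close> is the cone of \<open>c\<close>,
 read as a chain map from the desuspension of \<open>Z\<close> to \<open>X\<close>.\<close>

lemma extension_ex:
 assumes X: "cpx X" and Z: "cpx Z" and c: "c:H Z X 1" "dd X*c+c*dd Z = 0"
 shows "EX Y a b s t. ses X Y Z a b s t & t*dd Y*s = c"
proof -
 note u = ush_cpx[OF Z] and dZ = cpxD(3)[OF Z] and dX = cpxD(3)[OF X]
 note e = eta_H[OF cpxD(1)[OF u(1)], unfolded u(2)] eta_inv[OF cpxD(1)[OF u(1)], unfolded u(2)] dd_sh[OF u(1), unfolded u(2)]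
 note i = unl[OF e(1)] unr[OF e(1)] unl[OF e(2)] unr[OF e(2)]
  unl[OF cpxD(3)[OF u(1)]] unr[OF cpxD(3)[OF u(1)]] unr[OF c(1)]
 let ?F = "c*eta (ush Z)"
 have ed: "dd Z*eta (ush Z) = - (eta (ush Z)*dd (ush Z))"
  unfolding e(5) by (simp add: ma e(3) i)
 have F: "chain (ush Z) X ?F"
  unfolding chain_def using u(1) X H_mult[OF e(1) c(1)] c(2) by (simp add: ma[symmetric] eq_neg_iff_add_eq_0[symmetric]) (simp add: ma ed)
 obtain Y I J P L where co: "cone (ush Z) X ?F Y I J P L" using cone_ex[OF F] by blast
 note d = coneD[OF co]
 note i' = unl[OF d(5)] unr[OF d(5)]
 have m: "I*ate (ush Z):H Z Y 0" "eta (ush Z)*P:H Y Z 0" using H_mult[OF e(2) d(5)] H_mult[OF d(7) e(1)] by simp_all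
 have "ses X Y Z J (eta (ush Z)*P) (I*ate (ush Z)) L"
  unfolding ses_def chain_def using d m X Z
  by (simp add: ma[symmetric] ed) (simp add: ma msub[OF d(9)] msub[OF d(12)] msub[OF e(3)] msub[OF d(14)] msub[OF i(5)] unl[OF d(7)] i i' e(3,4) d add.commute)
 moreover have "L*dd Y*(I*ate (ush Z)) = c"
  unfolding d(15) by (simp add: alg msub[OF d(9)] msub[OF d(12)] msub[OF i(5)] i e(4))
 ultimately show ?thesis by blast
qed

text \<open>Every distinguished triangle comes from a short exact sequence: the cone triangle of \<open>F : X \<rightarrow> Y\<close>
 is isomorphic to the triangle of an extension of the cone by \<open>X\<close>, the one classified by the third map.\<close>

lemma cone_triangle_ses:
 assumes co: "cone X Y F Q I J P L"
 shows "EX B a b s t be. ses X B Q a b s t & kb Y B be:Hom K Y B &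
  triangle_iso K (kb X Y F, kb Y Q J, kb Q (sh X) (- (eta X*P))) (ses_triangle E (cb X B a, cb B Q b))
   (kb X X (uno X)) (kb Y B be) (kb Q Q (uno Q))"
proof -
 note c = coneD[OF co]
 obtain B a b s t where se: "ses X B Q a b s t" and conn: "t*dd B*s = - P"
  using extension_ex[OF c(2,4) H_neg[OF c(7)]] c(14) by auto
 note d = sesD[OF se]
 note u = unl[OF c(6)] unr[OF c(6)] unr[OF c(7)] unl[OF chainD(3)[OF c(1)]] unl[OF d(8)] unr[OF d(8)] unr[OF chainD(3)[OF c(1)]]
 note us = unl[OF d(9)] unr[OF d(9)] unl[OF d(3)] unr[OF d(3)]
 define y where "y = s*J"
 define r where "r = F*t+L*b"
 have yH: "y:H Y B 0" unfolding y_def using H_mult[OF c(6) d(3)] by simp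
 have rH: "r:H B Y 0" unfolding r_def using H_add[OF H_mult[OF d(4) chainD(3)[OF c(1)], of 0] H_mult[OF d(9) c(8), of 0]] by simp
 have ds: "dd B*s = a*(- P)+s*dd Q" using ses_connecting(4)[OF se] unfolding conn .
 have tdd: "t*dd B = dd X*t - P*b" using ses_connecting(3)[OF se] unfolding conn by simp
 have "dd B*y = y*dd Y"
 proof -
  have "dd B*y = (dd B*s)*J" by (simp add: y_def ma)
  then show ?thesis unfolding ds y_def by (simp add: alg c(11,17))
 qed
 then have yc: "chain Y B y" using yH c(3) d(6) by (simp add: chain_def)
 have rc: "chain B Y r"
 proof -
  have "r*dd B = F*(t*dd B)+L*(b*dd B)" by (simp add: r_def alg)
  also have "... = F*dd X*t - F*P*b+(L*dd Q)*b" unfolding tdd d(16)[symmetric] by (simp add: alg)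
  also have "... = dd Y*r" unfolding c(15) r_def chainD(4)[OF c(1), symmetric] by (simp add: alg)
  finally show ?thesis using rH c(3) d(6) by (simp add: chain_def)
 qed
 have ry: "r*y = uno Y"
 proof -
  have "r*y = F*(t*s)*J+L*(b*s)*J" by (simp add: r_def y_def alg)
  then show ?thesis using d(12) d(11) c(10) u(1) by (simp add: ma)
 qed
 define h where "h = s*I*t"
 have hH: "h:H B B (-1)" unfolding h_def using H_mult[OF d(4) H_mult[OF c(5) d(3) refl] refl] by (simp add: ma)
 have yr: "heq B B (y*r) (uno B)"
 proof (rule heqI[OF hH])
  have "dd B*h = (dd B*s)*I*t" by (simp add: h_def ma)
  also have "... = - (a*(P*I)*t)+s*(dd Q*I)*t" unfolding ds by (simp add: alg)
  also have "... = - (a*t) - s*I*dd X*t+s*J*F*t"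
   unfolding c(9,16) by (simp add: alg msub[OF unl[OF d(4)]] unl[OF d(4)])
  finally have 1: "dd B*h = - (a*t) - s*I*dd X*t+s*J*F*t" .
  have "h*dd B = s*I*(t*dd B)" by (simp add: h_def ma)
  then have 2: "h*dd B = s*I*dd X*t - s*(I*P)*b" unfolding tdd by (simp add: alg)
  have "y*r = s*J*F*t+s*(J*L)*b" by (simp add: y_def r_def alg)
  moreover have "J*L = uno Q - I*P" using c(13) by (simp add: alg)
  ultimately have 3: "y*r = s*J*F*t+s*b - s*(I*P)*b" using us(4) by (simp add: alg msub[OF us(1)] us(1))
  show "y*r = uno B+(dd B*h+h*dd B)" unfolding 1 2 3 d(14)[symmetric] by simp
 qed
 have yi: "kb Y B y:iso_arrows K" using kb_iso_iff[OF yc] rc yr ry heq_refl[OF chain_uno[OF c(3)]] by auto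
 have "kb Q (sh X) (eta X*(t*dd B*s)) = kb Q (sh X) (- (eta X*P))" unfolding conn by simp
 then have T: "ses_triangle E (cb X B a, cb B Q b) = (kb X B a, kb B Q b, kb Q (sh X) (- (eta X*P)))"
  using ses_triangle_eq[OF se] by simp
 have wc: "chain Q (sh X) (- (eta X*P))" using ses_connecting_chain[OF se] unfolding conn by simp
 have "triangle_iso K (kb X Y F, kb Y Q J, kb Q (sh X) (- (eta X*P))) (kb X B a, kb B Q b, kb Q (sh X) (- (eta X*P)))
   (kb X X (uno X)) (kb Y B y) (kb Q Q (uno Q))"
 proof (rule tri_isoI[OF c(1,18) wc d(1,2) wc chain_uno[OF c(2)] yc chain_uno[OF c(4)] kb_uno_iso[OF c(2)] yi kb_uno_iso[OF c(4)]])
  have rJ: "r*a = F" by (simp add: r_def alg d(10) u d(13))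
  have "heq X B (y*r*a) (uno B*a)" by (rule heq_multR[OF yr d(1)])
  then show "heq X B (y*F) (a*uno X)" using rJ u(5,6) by (simp add: ma)
  have "b*y = J" by (simp add: y_def ma[symmetric] d(11) u)
  then show "heq Y Q (uno Q*J) (b*y)" using heq_refl[OF c(18)] u(1) by simp
  have "eta X*uno X*ate X*(eta X*P) = eta X*P" by (rule eta_simps(1)[OF c(2,7)])
  then show "heq Q (sh X) (eta X*uno X*ate X*- (eta X*P)) (- (eta X*P)*uno Q)"
   using heq_refl[OF wc] u(3) by (simp add: ma)
 qed
 then show ?thesis using se yc T K_hom by (metis (no_types, lifting))
qed

lemma iso_comp:
 assumes "f:iso_arrows K" "g:iso_arrows K" "Dom K g = Cod K f"
 shows "Comp K g f:iso_arrows K"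
proof -
 interpret K: category K by (rule K_category)
 obtain f' g' where f: "inverse_arrows K f f'" and g: "inverse_arrows K g g'" using assms by (auto simp: iso_arrows_def)
 have 1: "f:Arr K" "g:Arr K" "f':Arr K" "g':Arr K" "Dom K f' = Cod K f" "Cod K f' = Dom K f" "Dom K g' = Cod K g" "Cod K g' = Dom K g"
  "Comp K f' f = Ident K (Dom K f)" "Comp K f f' = Ident K (Cod K f)" "Comp K g' g = Ident K (Dom K g)" "Comp K g g' = Ident K (Cod K g)"
  using f g by (auto simp: inverse_arrows_def Hom_def)
 have "Comp K (Comp K f' g') (Comp K g f) = Comp K f' (Comp K (Comp K g' g) f)" using 1(1-8) assms(3) by (simp add: K.assoc)
 also have "... = Ident K (Dom K f)" unfolding 1(11) using 1(1-10) assms(3) by simp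
 finally have a: "Comp K (Comp K f' g') (Comp K g f) = Ident K (Dom K f)" .
 have "Comp K (Comp K g f) (Comp K f' g') = Comp K g (Comp K (Comp K f f') g')" using 1(1-8) assms(3) by (simp add: K.assoc)
 also have "... = Ident K (Cod K g)" unfolding 1(10) using 1(1-8) 1(12) assms(3) by simp
 finally have "inverse_arrows K (Comp K g f) (Comp K f' g')" using a 1 assms(3) by (simp add: inverse_arrows_def Hom_def)
 then show ?thesis unfolding iso_arrows_def by blast
qed

lemma triangle_iso_trans:
 assumes "triangle_iso K De De' al be gg" "triangle_iso K De' De'' al' be' gg'"
 shows "triangle_iso K De De'' (Comp K al' al) (Comp K be' be) (Comp K gg' gg)"
proof -
 interpret K: category K by (rule K_category)
 obtain u v w where d [simp]: "De = (u, v, w)" by (cases De)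
 obtain u' v' w' where d' [simp]: "De' = (u', v', w')" by (cases De')
 obtain u'' v'' w'' where d'' [simp]: "De'' = (u'', v'', w'')" by (cases De'')
 have t: "triangle K (u, v, w)" "triangle K (u', v', w')" "triangle K (u'', v'', w'')"
  and i: "al:iso_arrows K" "be:iso_arrows K" "gg:iso_arrows K" "al':iso_arrows K" "be':iso_arrows K" "gg':iso_arrows K"
  and h: "al:Hom K (Dom K u) (Dom K u')" "be:Hom K (Cod K u) (Cod K u')" "gg:Hom K (Cod K v) (Cod K v')"
   "al':Hom K (Dom K u') (Dom K u'')" "be':Hom K (Cod K u') (Cod K u'')" "gg':Hom K (Cod K v') (Cod K v'')"
  and e: "Comp K be u = Comp K u' al" "Comp K gg v = Comp K v' be" "Comp K (ShA K al) w = Comp K w' gg"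
   "Comp K be' u' = Comp K u'' al'" "Comp K gg' v' = Comp K v'' be'" "Comp K (ShA K al') w' = Comp K w'' gg'"
  using assms by (auto simp: triangle_iso_def)
 have T: "u:Arr K" "v:Arr K" "w:Arr K" "u':Arr K" "v':Arr K" "w':Arr K" "u'':Arr K" "v'':Arr K" "w'':Arr K"
   "Dom K v = Cod K u" "Dom K w = Cod K v" "Cod K w = sh (Dom K u)" "Dom K v' = Cod K u'" "Dom K w' = Cod K v'" "Cod K w' = sh (Dom K u')"
   "Dom K v'' = Cod K u''" "Dom K w'' = Cod K v''" "Cod K w'' = sh (Dom K u'')"
  using t by (auto simp: triangle_def)
 have A: "al:Arr K" "be:Arr K" "gg:Arr K" "al':Arr K" "be':Arr K" "gg':Arr K"
  "Dom K al = Dom K u" "Cod K al = Dom K u'" "Dom K be = Cod K u" "Cod K be = Cod K u'" "Dom K gg = Cod K v" "Cod K gg = Cod K v'"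
  "Dom K al' = Dom K u'" "Cod K al' = Dom K u''" "Dom K be' = Cod K u'" "Cod K be' = Cod K u''" "Dom K gg' = Cod K v'" "Cod K gg' = Cod K v''"
  using h by (auto simp: Hom_def)
 have "Comp K (Comp K be' be) u = Comp K (Comp K be' u') al" using A T e(1) by (simp add: K.assoc)
 then have 1: "Comp K (Comp K be' be) u = Comp K u'' (Comp K al' al)" unfolding e(4) using A T by (simp add: K.assoc)
 have "Comp K (Comp K gg' gg) v = Comp K (Comp K gg' v') be" using A T e(2) by (simp add: K.assoc)
 then have 2: "Comp K (Comp K gg' gg) v = Comp K v'' (Comp K be' be)" unfolding e(5) using A T by (simp add: K.assoc)
 have "Comp K (ShA K (Comp K al' al)) w = Comp K (Comp K (ShA K al') w') gg"
  using A T e(3) Sh_arr[of al] Sh_arr[of al'] by (simp add: K.assoc Sh_comp)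
 then have 3: "Comp K (ShA K (Comp K al' al)) w = Comp K w'' (Comp K gg' gg)" unfolding e(6) using A T by (simp add: K.assoc)
 show ?thesis using 1 2 3 t A iso_comp i by (simp add: triangle_iso_def Hom_def)
qed

lemma Tri_ses:
 assumes "De:Tri K"
 shows "EX X Y Z a b s t al be gg. ses X Y Z a b s t & triangle_iso K De (ses_triangle E (cb X Y a, cb Y Z b)) al be gg"
proof -
 obtain X Y F Q i j p q al be gg where F: "chain X Y F" and c: "is_cone E (cb X Y F) Q i j p q"
  and t: "triangle_iso K De (kb X Y F, kb Y Q (gm Y Q 0 j), kb Q (sh X) (- (eta X*gm Q X 1 p))) al be gg"
  using assms unfolding Tri_iff by blast
 obtain B a b s u be' where "ses X B Q a b s u"
  "triangle_iso K (kb X Y F, kb Y Q (gm Y Q 0 j), kb Q (sh X) (- (eta X*gm Q X 1 p))) (ses_triangle E (cb X B a, cb B Q b))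
   (kb X X (uno X)) (kb Y B be') (kb Q Q (uno Q))"
  using cone_triangle_ses[OF cone_of_is_cone(1)[OF F c]] by blast
 then show ?thesis using triangle_iso_trans[OF t] by blast
qed

end

section \<open>The induced functor on determinant functors\<close>

lemma wide_simps [simp]:
 "Obj (wide_subcat T w) = Obj T" "Arr (wide_subcat T w) = w" "Dom (wide_subcat T w) = Dom T" "Cod (wide_subcat T w) = Cod T"
 "Ident (wide_subcat T w) = Ident T" "Comp (wide_subcat T w) = Comp T"
 by (simp_all add: wide_subcat_def)

lemma wide_category:
 assumes "category T" "w <= Arr T" "!!X. X:Obj T ==> Ident T X:w"
  "!!f g. f:w ==> g:w ==> Dom T g = Cod T f ==> Comp T g f:w"
 shows "category (wide_subcat T w)"
proof -
 interpret T: category T by fact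
 have a: "f:w ==> f:Arr T" for f using assms(2) by blast
 show ?thesis
  by unfold_locales (use assms(3,4) a in \<open>auto simp: Hom_def T.assoc\<close>)
qed

lemma nat_cat_category:
 assumes P: "category P" and S: "!!F. F:S ==> is_functor T P F"
  and id: "!!F. F:S ==> ok F (\<lambda>X\<in>Obj T. Ident P (FO F X)) F"
  and comp: "!!F G H al be. [|F:S; G:S; H:S; is_nat T P F G al; is_nat T P G H be; ok F al G; ok G be H|]
    ==> ok F (\<lambda>X\<in>Obj T. be X o[P] al X) H"
 shows "category (nat_cat T P S ok)"
proof -
 interpret P: category P by fact
 have nid: "is_nat T P F F (\<lambda>X\<in>Obj T. Ident P (FO F X))" if "F:S" for F
 proof -
  interpret T: category T by (rule functorD[OF S[OF that]])
  show ?thesis using functorD[OF S[OF that]] by (auto simp: is_nat_def Hom_def)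
 qed
 have ncomp: "is_nat T P F H (\<lambda>X\<in>Obj T. be X o[P] al X)" if FS: "F:S" "G:S" "H:S" and n: "is_nat T P F G al" "is_nat T P G H be" for F G H al be
 proof -
  interpret T: category T by (rule functorD[OF S[OF FS(1)]])
  have "(be (Cod T f) o[P] al (Cod T f)) o[P] FA F f = FA H f o[P] be (Dom T f) o[P] al (Dom T f)" if f: "f:Arr T" for f
  proof -
   note [simp] = functorD[OF S[OF FS(1)]] functorD[OF S[OF FS(2)]] functorD[OF S[OF FS(3)]] natD(1-3)[OF n(1)] natD(1-3)[OF n(2)] f
   have "(be (Cod T f) o[P] al (Cod T f)) o[P] FA F f = be (Cod T f) o[P] (al (Cod T f) o[P] FA F f)" by (simp add: P.assoc)
   also have "... = (be (Cod T f) o[P] FA G f) o[P] al (Dom T f)" unfolding natD(4)[OF n(1) f] by (simp add: P.assoc)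
   also have "... = FA H f o[P] be (Dom T f) o[P] al (Dom T f)" unfolding natD(4)[OF n(2) f] by (simp add: P.assoc)
   finally show ?thesis .
  qed
  then show ?thesis using natD(1-3)[OF n(1)] natD(1-3)[OF n(2)] by (simp add: is_nat_def Hom_def)
 qed
 have hom: "x:Hom (nat_cat T P S ok) F G \<longleftrightarrow> (EX al. x = (F, al, G) & F:S & G:S & is_nat T P F G al & ok F al G)" for x F G
  by (auto simp: nat_cat_def Hom_def)
 show ?thesis
 proof
  fix x assume "x:Arr (nat_cat T P S ok)"
  then show "Dom (nat_cat T P S ok) x:Obj (nat_cat T P S ok)" "Cod (nat_cat T P S ok) x:Obj (nat_cat T P S ok)"
   by (auto simp: nat_cat_def)
 next
  fix F assume "F:Obj (nat_cat T P S ok)"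
  then have "F:S" by (simp add: nat_cat_def)
  then show "Ident (nat_cat T P S ok) F:Hom (nat_cat T P S ok) F F" using id nid by (simp add: hom) (simp add: nat_cat_def)
 next
  fix x F G y H assume "x:Hom (nat_cat T P S ok) F G" "y:Hom (nat_cat T P S ok) G H"
  then show "Comp (nat_cat T P S ok) y x:Hom (nat_cat T P S ok) F H"
   unfolding hom using comp ncomp by (fastforce simp: nat_cat_def)
 next
  fix x F G y H z L assume x: "x:Hom (nat_cat T P S ok) F G" and y: "y:Hom (nat_cat T P S ok) G H" and z: "z:Hom (nat_cat T P S ok) H L"
  then obtain al be gg where e: "x = (F, al, G)" "y = (G, be, H)" "z = (H, gg, L)" and n: "is_nat T P F G al" "is_nat T P G H be" "is_nat T P H L gg"
   unfolding hom by blast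
  have "(\<lambda>X\<in>Obj T. gg X o[P] (\<lambda>X\<in>Obj T. be X o[P] al X) X) = (\<lambda>X\<in>Obj T. (\<lambda>X\<in>Obj T. gg X o[P] be X) X o[P] al X)"
   by (rule restrict_ext) (simp add: P.assoc natD(1-3)[OF n(1)] natD(1-3)[OF n(2)] natD(1-3)[OF n(3)])
  then show "Comp (nat_cat T P S ok) z (Comp (nat_cat T P S ok) y x) = Comp (nat_cat T P S ok) (Comp (nat_cat T P S ok) z y) x"
   unfolding e by (simp add: nat_cat_def)
 next
  fix x F G assume "x:Hom (nat_cat T P S ok) F G"
  then obtain al where e: "x = (F, al, G)" and n: "is_nat T P F G al" unfolding hom by blast
  have "(\<lambda>X\<in>Obj T. (\<lambda>X\<in>Obj T. Ident P (FO G X)) X o[P] al X) = al" "(\<lambda>X\<in>Obj T. al X o[P] (\<lambda>X\<in>Obj T. Ident P (FO F X)) X) = al"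
   by (rule extensionalityI[of _ "Obj T"], use natD[OF n] in auto)+
  then show "Comp (nat_cat T P S ok) (Ident (nat_cat T P S ok) G) x = x" "Comp (nat_cat T P S ok) x (Ident (nat_cat T P S ok) F) = x"
   unfolding e by (simp_all add: nat_cat_def)
 qed
qed

text \<open>Compatibility with a map \<open>dl : f B \<rightarrow> f A \<otimes> f C\<close>, attached to either a short exact sequence or a triangle,
 is stable under composition.\<close>

lemma (in picard_category) compat_comp:
 assumes a: "a:Hom P X X'" "b:Hom P Y Y'" "c:Hom P Z Z'" and a': "a':Hom P X' X''" "b':Hom P Y' Y''" "c':Hom P Z' Z''"
  and d: "d:Hom P Y (X #o Z)" "d':Hom P Y' (X' #o Z')" "d'':Hom P Y'' (X'' #o Z'')"
  and e: "(a #a c) oo d = d' oo b" "(a' #a c') oo d' = d'' oo b'"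
 shows "((a' oo a) #a (c' oo c)) oo d = d'' oo b' oo b"
proof -
 have [simp]: "a:Arr P" "b:Arr P" "c:Arr P" "a':Arr P" "b':Arr P" "c':Arr P" "d:Arr P" "d':Arr P" "d'':Arr P"
  "Dom P a = X" "Cod P a = X'" "Dom P b = Y" "Cod P b = Y'" "Dom P c = Z" "Cod P c = Z'" "Dom P a' = X'" "Cod P a' = X''" "Dom P b' = Y'" "Cod P b' = Y''"
  "Dom P c' = Z'" "Cod P c' = Z''" "Dom P d = Y" "Cod P d = X #o Z" "Dom P d' = Y'" "Cod P d' = X' #o Z'" "Dom P d'' = Y''" "Cod P d'' = X'' #o Z''"
  using assms by (auto simp: Hom_def)
 have "((a' oo a) #a (c' oo c)) oo d = (a' #a c') oo ((a #a c) oo d)" by (simp add: ten_comp_assoc)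
 also have "... = ((a' #a c') oo d') oo b" unfolding e(1) by (simp add: assoc)
 finally show ?thesis unfolding e(2) by (simp add: assoc)
qed

lemma det_exactD:
 assumes "det_exact T w P f"
 shows "is_functor (wide_subcat T w) P f"
  "(a, b):Ses T ==> DS f (a, b):Hom P (FO f (Cod T a)) (FO f (Dom T a) *o[P] FO f (Cod T b))"
proof -
 note A = assms[unfolded det_exact_def Ball_def split_paired_All prod.case]
 show "is_functor (wide_subcat T w) P f" by (rule A[THEN conjunct1])
 show "(a, b):Ses T ==> DS f (a, b):Hom P (FO f (Cod T a)) (FO f (Dom T a) *o[P] FO f (Cod T b))"
  by (rule A[THEN conjunct2, THEN conjunct1, rule_format])
qed

lemma det_triD:
 assumes "det_tri T P g"
 shows "is_functor (wide_subcat T (iso_arrows T)) P g"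
  "(u, v, w):Tri T ==> DS g (u, v, w):Hom P (FO g (Cod T u)) (FO g (Dom T u) *o[P] FO g (Cod T v))"
  "[|(u, v, w):Tri T; (u', v', w'):Tri T; triangle_iso T (u, v, w) (u', v', w') al be gg|] ==>
    (FA g al *a[P] FA g gg) o[P] DS g (u, v, w) = DS g (u', v', w') o[P] FA g be"
  "octahedron T (a, p, p') (b o[T] a, q, q') (b, r, r') (s, t, t') ==>
    Phi P (FO g (Dom T a)) (FO g (Cod T p)) (FO g (Cod T r)) o[P]
     (Ident P (FO g (Dom T a)) *a[P] DS g (s, t, t')) o[P] DS g (b o[T] a, q, q') =
    (DS g (a, p, p') *a[P] Ident P (FO g (Cod T r))) o[P] DS g (b, r, r')"
  "biproduct T X Y S i j p'' q'' ==>
    Psi P (FO g X) (FO g Y) o[P] DS g (i, q'', ZeroA T Y (ShO T X)) = DS g (j, p'', ZeroA T X (ShO T Y))"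
proof -
 note A = assms[unfolded det_tri_def Ball_def split_paired_All prod.case]
 note A2 = A[THEN conjunct2]
 note A3 = A2[THEN conjunct2]
 note A4 = A3[THEN conjunct2]
 show "is_functor (wide_subcat T (iso_arrows T)) P g" by (rule A[THEN conjunct1])
 show "(u, v, w):Tri T ==> DS g (u, v, w):Hom P (FO g (Cod T u)) (FO g (Dom T u) *o[P] FO g (Cod T v))"
  by (rule A2[THEN conjunct1, rule_format])
 show "[|(u, v, w):Tri T; (u', v', w'):Tri T; triangle_iso T (u, v, w) (u', v', w') al be gg|] ==>
    (FA g al *a[P] FA g gg) o[P] DS g (u, v, w) = DS g (u', v', w') o[P] FA g be"
  by (rule A3[THEN conjunct1, rule_format])
qed (rule assms[unfolded det_tri_def Ball_def split_paired_All prod.case, THEN conjunct2, THEN conjunct2, THEN conjunct2, THEN conjunct1, rule_format], assumption,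
 rule assms[unfolded det_tri_def Ball_def split_paired_All prod.case, THEN conjunct2, THEN conjunct2, THEN conjunct2, THEN conjunct2, rule_format])

lemma det_exact_cat_category:
 assumes T: "category T" and P: "picard_category P" and ses: "!!a b. (a, b):Ses T ==> a:Arr T & b:Arr T"
 shows "category (det_exact_cat T w P)"
 unfolding det_exact_cat_def
proof (rule nat_cat_category)
 interpret P: picard_category P by fact
 interpret T: category T by fact
 show "category P" by (rule P.category_axioms)
 show f: "is_functor (wide_subcat T w) P F" if "F:{f. det_exact T w P f}" for F using that by (simp add: det_exact_def)
 fix F assume F: "F:{f. det_exact T w P f}"
 have d: "DS F (a, b):Hom P (FO F (Cod T a)) (FO F (Dom T a) *o[P] FO F (Cod T b))" if "det_exact T w P F" "(a, b):Ses T" for F a b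
  using det_exactD(2)[OF that] .
 note fo = functorD(3)[OF f]
 show "det_exact_trans T P F (\<lambda>X\<in>Obj (wide_subcat T w). Ident P (FO F X)) F"
  unfolding det_exact_trans_def using F d[of F] ses fo[OF F] by (fastforce simp: Hom_def)
 fix G H al be assume G: "G:{f. det_exact T w P f}" "H:{f. det_exact T w P f}" and n: "is_nat (wide_subcat T w) P F G al" "is_nat (wide_subcat T w) P G H be"
  and t: "det_exact_trans T P F al G" "det_exact_trans T P G be H"
 note na = natD(1-3)[OF n(1)] natD(1-3)[OF n(2)]
 show "det_exact_trans T P F (\<lambda>X\<in>Obj (wide_subcat T w). be X o[P] al X) H"
  unfolding det_exact_trans_def
 proof (clarify)
  fix a b assume ab: "(a, b):Ses T"
  then have o: "Dom T a:Obj T" "Cod T a:Obj T" "Cod T b:Obj T" using ses by auto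
  have "((be (Dom T a) o[P] al (Dom T a)) *a[P] (be (Cod T b) o[P] al (Cod T b))) o[P] DS F (a, b) = DS H (a, b) o[P] be (Cod T a) o[P] al (Cod T a)"
   by (rule P.compat_comp[where d' = "DS G (a, b)"])
    (use na o t ab d F G in \<open>auto simp: det_exact_trans_def Hom_def\<close>)
  then show "((\<lambda>X\<in>Obj (wide_subcat T w). be X o[P] al X) (Dom T a) *a[P] (\<lambda>X\<in>Obj (wide_subcat T w). be X o[P] al X) (Cod T b)) o[P] DS F (a, b)
   = DS H (a, b) o[P] (\<lambda>X\<in>Obj (wide_subcat T w). be X o[P] al X) (Cod T a)" using o by simp
 qed
qed

lemma det_tri_cat_category:
 assumes T: "category T" and P: "picard_category P" and tri: "!!u v w. (u, v, w):Tri T ==> u:Arr T & v:Arr T"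
 shows "category (det_tri_cat T P)"
 unfolding det_tri_cat_def
proof (rule nat_cat_category)
 interpret P: picard_category P by fact
 interpret T: category T by fact
 show "category P" by (rule P.category_axioms)
 show f: "is_functor (wide_subcat T (iso_arrows T)) P F" if "F:{f. det_tri T P f}" for F using that by (simp add: det_tri_def)
 fix F assume F: "F:{f. det_tri T P f}"
 have d: "DS F (u, v, w):Hom P (FO F (Cod T u)) (FO F (Dom T u) *o[P] FO F (Cod T v))" if "det_tri T P F" "(u, v, w):Tri T" for F u v w
  using det_triD(2)[OF that] .
 note fo = functorD(3)[OF f]
 show "det_tri_trans T P F (\<lambda>X\<in>Obj (wide_subcat T (iso_arrows T)). Ident P (FO F X)) F"
  unfolding det_tri_trans_def using F d[of F] tri fo[OF F] by (fastforce simp: Hom_def)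
 fix G H al be assume G: "G:{f. det_tri T P f}" "H:{f. det_tri T P f}" and n: "is_nat (wide_subcat T (iso_arrows T)) P F G al" "is_nat (wide_subcat T (iso_arrows T)) P G H be"
  and t: "det_tri_trans T P F al G" "det_tri_trans T P G be H"
 note na = natD(1-3)[OF n(1)] natD(1-3)[OF n(2)]
 show "det_tri_trans T P F (\<lambda>X\<in>Obj (wide_subcat T (iso_arrows T)). be X o[P] al X) H"
  unfolding det_tri_trans_def
 proof (clarify)
  fix u v w assume ab: "(u, v, w):Tri T"
  then have o: "Dom T u:Obj T" "Cod T u:Obj T" "Cod T v:Obj T" using tri by auto
  have "((be (Dom T u) o[P] al (Dom T u)) *a[P] (be (Cod T v) o[P] al (Cod T v))) o[P] DS F (u, v, w) = DS H (u, v, w) o[P] be (Cod T u) o[P] al (Cod T u)"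
   by (rule P.compat_comp[where d' = "DS G (u, v, w)"])
    (use na o t ab d F G in \<open>auto simp: det_tri_trans_def Hom_def\<close>)
  then show "((\<lambda>X\<in>Obj (wide_subcat T (iso_arrows T)). be X o[P] al X) (Dom T u) *a[P] (\<lambda>X\<in>Obj (wide_subcat T (iso_arrows T)). be X o[P] al X) (Cod T v)) o[P] DS F (u, v, w)
   = DS H (u, v, w) o[P] (\<lambda>X\<in>Obj (wide_subcat T (iso_arrows T)). be X o[P] al X) (Cod T u)" using o by simp
 qed
qed

context proj_modules
begin

lemma qis_to_Kb:
 assumes "s:qis R"
 shows "to_Kb E s:iso_arrows K" "to_Kb E s:Arr K" "Dom K (to_Kb E s) = Dom C s" "Cod K (to_Kb E s) = Cod C s" "s:Arr C"
 using assms by (auto simp: qis_cb kb_arr cb_arr)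

lemma to_Kb_comp: "f:Arr C ==> g:Arr C ==> Dom C g = Cod C f ==> to_Kb E (Comp C g f) = Comp K (to_Kb E g) (to_Kb E f)"
 by (auto simp: C_arr cb_comp kb_comp)

lemma to_Kb_id: "cpx X ==> to_Kb E (Ident C X) = Ident K X"
 by (simp add: cb_ident kb_ident)

lemma qis_category: "category (wide_subcat C (qis R))"
proof (rule wide_category[OF C_category])
 show "qis R <= Arr C" by (auto simp: qis_to_Kb)
 show "Ident C X:qis R" if "X:Obj C" for X
  using that by (auto simp: cb_ident qis_cb intro: chain_uno kb_uno_iso)
 show "Comp C g f:qis R" if fg: "f:qis R" "g:qis R" "Dom C g = Cod C f" for f g
 proof -
  obtain X Y F Z G where e: "chain X Y F" "f = cb X Y F" "chain Y Z G" "g = cb Y Z G"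
   "kb X Y F:iso_arrows K" "kb Y Z G:iso_arrows K"
   using fg by (auto simp: qis_cb)
  have "kb X Z (G*F):iso_arrows K" using iso_comp[OF e(5,6)] e by (simp add: kb_comp)
  then show ?thesis using chain_mult[OF e(1,3)] e by (auto simp: cb_comp qis_cb)
 qed
qed

lemma Ses_arr: "(a, b):Ses C ==> a:Arr C & b:Arr C"
 by (auto simp: Ses_iff ses_def intro: cb_arr)

lemma Tri_triangle: "De:Tri K ==> triangle K De"
 unfolding Tri_iff by (cases De) (auto simp: triangle_iso_def)

lemma Tri_arr: "(u, v, w):Tri K ==> u:Arr K & v:Arr K"
 by (drule Tri_triangle) (simp add: triangle_def)

lemma ses_configuration:
 assumes S: "(a, p):Ses C" "(b o[C] a, q):Ses C" "(b, r):Ses C" "(s, t):Ses C"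
  and d: "Dom C b = Cod C a" "Dom C s = Cod C p" "Cod C s = Cod C q" "Cod C t = Cod C r"
  and e: "s o[C] p = q o[C] b" "t o[C] q = r"
 obtains X Y Z U V W a' p' b' r' q' s' t' s1 t1 s2 t2 s3 t3 s4 t4 where
  "ses X Y U a' p' s1 t1" "ses X Z V (b'*a') q' s2 t2" "ses Y Z W b' r' s3 t3" "ses U V W s' t' s4 t4"
  "a = cb X Y a'" "p = cb Y U p'" "b = cb Y Z b'" "q = cb Z V q'" "r = cb Z W r'" "s = cb U V s'" "t = cb V W t'"
  "b o[C] a = cb X Z (b'*a')" "s'*p' = q'*b'" "t'*q' = r'"
proof -
 obtain X Y U a' p' s1 t1 where 1: "ses X Y U a' p' s1 t1" "a = cb X Y a'" "p = cb Y U p'" using S(1) unfolding Ses_iff by blast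
 obtain Y' Z W b' r' s3 t3 where 3: "ses Y' Z W b' r' s3 t3" "b = cb Y' Z b'" "r = cb Z W r'" using S(3) unfolding Ses_iff by blast
 obtain X2 Z2 V ba q' s2 t2 where 2: "ses X2 Z2 V ba q' s2 t2" "b o[C] a = cb X2 Z2 ba" "q = cb Z2 V q'" using S(2) unfolding Ses_iff by blast
 obtain U4 V4 W4 s' t' s4 t4 where 4: "ses U4 V4 W4 s' t' s4 t4" "s = cb U4 V4 s'" "t = cb V4 W4 t'" using S(4) unfolding Ses_iff by blast
 note r1 = sesD[OF 1(1)] and r2 = sesD[OF 2(1)] and r3 = sesD[OF 3(1)] and r4 = sesD[OF 4(1)]
 have [simp]: "Y' = Y" "U4 = U" "V4 = V" using d 1 2 3 4 by simp_all
 have ba: "cb X2 Z2 ba = cb X Z (b'*a')" using 2(2) unfolding 1(2) 3(2) using cb_comp[OF r1(1)] r3(1) by simp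
 then have [simp]: "X2 = X" "Z2 = Z" by (simp_all add: cb_def)
 have ba': "ba = b'*a'" using ba cb_eq_iff r2(1) chain_mult[OF r1(1)] r3(1) by simp
 have W: "cb Z W4 (t'*q') = cb Z W r'" using e(2) unfolding 3(3) 2(3) 4(3) using cb_comp[of Z V q' W4 t'] r2(2) r4(2) by simp
 then have [simp]: "W4 = W" by (simp add: cb_def)
 have tq: "t'*q' = r'" using W cb_eq_iff chain_mult[of Z V q' W t'] r2(2) r3(2) r4(2) by simp
 have "s o[C] p = cb Y V (s'*p')" "q o[C] b = cb Y V (q'*b')"
  unfolding 4(2) 1(3) 2(3) 3(2) using cb_comp[OF r1(2), of V s'] cb_comp[of Y Z b' V q'] r2(2) r3(1) r4(1) by simp_all
 then have "cb Y V (s'*p') = cb Y V (q'*b')" using e(1) by simp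
 then have sp: "s'*p' = q'*b'"
  by (subst (asm) cb_eq_iff) (use chain_mult[OF r1(2), of V s'] chain_mult[of Y Z b' V q'] r2(2) r3(1) r4(1) in simp_all)
 have e2: "b o[C] a = cb X Z (b'*a')" unfolding 3(2) 1(2) using cb_comp[OF r1(1), of Z b'] r3(1) by simp
 show ?thesis by (rule that[of X Y U a' p' s1 t1 Z V b' q' s2 t2 W r' s3 t3 s' t' s4 t4])
  (use 1 2 3 4 ba' sp tq e2 in simp_all)
qed

lemma ses_morphism:
 assumes s: "(a, b):Ses C" "(a', b'):Ses C" and q: "al:qis R" "be:qis R" "gg:qis R"
  and h: "al:Hom C (Dom C a) (Dom C a')" "be:Hom C (Cod C a) (Cod C a')" "gg:Hom C (Cod C b) (Cod C b')"
  and e: "be o[C] a = a' o[C] al" "gg o[C] b = b' o[C] be"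
 obtains X Y Z x y sg pj X' Y' Z' x' y' sg' pj' al' be' gg' where
  "ses X Y Z x y sg pj" "a = cb X Y x" "b = cb Y Z y" "ses X' Y' Z' x' y' sg' pj'" "a' = cb X' Y' x'" "b' = cb Y' Z' y'"
  "al = cb X X' al'" "chain X X' al'" "kb X X' al':iso_arrows K" "be = cb Y Y' be'" "chain Y Y' be'" "kb Y Y' be':iso_arrows K"
  "gg = cb Z Z' gg'" "chain Z Z' gg'" "kb Z Z' gg':iso_arrows K" "be'*x = x'*al'" "gg'*y = y'*be'"
proof -
 obtain X Y Z x y sg pj where se: "ses X Y Z x y sg pj" and ab: "a = cb X Y x" "b = cb Y Z y" using s(1) unfolding Ses_iff by blast
 obtain X' Y' Z' x' y' sg' pj' where se': "ses X' Y' Z' x' y' sg' pj'" and ab': "a' = cb X' Y' x'" "b' = cb Y' Z' y'" using s(2) unfolding Ses_iff by blast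
 obtain al' where al: "al = cb X X' al'" "chain X X' al'" "kb X X' al':iso_arrows K" using q(1) h(1) ab ab' by (auto simp: qis_cb Hom_def)
 obtain be' where be: "be = cb Y Y' be'" "chain Y Y' be'" "kb Y Y' be':iso_arrows K" using q(2) h(2) ab ab' by (auto simp: qis_cb Hom_def)
 obtain gg' where ga: "gg = cb Z Z' gg'" "chain Z Z' gg'" "kb Z Z' gg':iso_arrows K" using q(3) h(3) ab ab' by (auto simp: qis_cb Hom_def)
 note r = sesD[OF se] and r' = sesD[OF se']
 have "be'*x = x'*al'" "gg'*y = y'*be'"
  using e unfolding ab ab' al be ga cb_comp[OF r(1) be(2)] cb_comp[OF al(2) r'(1)] cb_comp[OF r(2) ga(2)] cb_comp[OF be(2) r'(2)]
  using cb_eq_iff chain_mult r r' al be ga by blast+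
 then show ?thesis by (rule that[OF se ab se' ab' al be ga])
qed

text \<open>A quasi-isomorphism becomes an isomorphism in \<open>K\<close>, and sequences become
 triangles; each axiom is the axiom for triangles applied to the corresponding statement about
 sequences.\<close>

lemma induced_det_exact:
 assumes P: "picard_category P" and g: "det_tri K P g"
 shows "det_exact C (qis R) P (induced_det E g)"
proof -
 interpret P: picard_category P by fact
 note F = det_triD(1)[OF g] and D = det_triD(2)[OF g] and N = det_triD(3)[OF g] and O = det_triD(4)[OF g] and B = det_triD(5)[OF g]
 note fD = functorD(3-8)[OF F, simplified]
 show ?thesis
  unfolding det_exact_def
 proof (intro conjI)
  show "is_functor (wide_subcat C (qis R)) P (induced_det E g)"
   unfolding is_functor_def
   using qis_category P.category_axioms fD
   by (auto simp: induced_det_def qis_to_Kb Hom_def to_Kb_id to_Kb_comp)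
 next
  show "ALL (a, b):Ses C. DS (induced_det E g) (a, b):Hom P (FO (induced_det E g) (Cod C a))
    (FO (induced_det E g) (Dom C a) *o[P] FO (induced_det E g) (Cod C b))"
  proof clarify
   fix a b assume "(a, b):Ses C"
   then obtain X Y Z a' b' s t where se: "ses X Y Z a' b' s t" and ab: "a = cb X Y a'" "b = cb Y Z b'" unfolding Ses_iff by blast
   show "DS (induced_det E g) (a, b):Hom P (FO (induced_det E g) (Cod C a)) (FO (induced_det E g) (Dom C a) *o[P] FO (induced_det E g) (Cod C b))"
    using ses_triangle_Tri[OF se] D unfolding ab induced_det_def by (fastforce simp: ses_triangle_eq[OF se])
  qed
 next
  show "ALL (a, b):Ses C. ALL (a', b'):Ses C. ALL al:qis R. ALL be:qis R. ALL gg:qis R.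
    al:Hom C (Dom C a) (Dom C a') & be:Hom C (Cod C a) (Cod C a') &
    gg:Hom C (Cod C b) (Cod C b') & be o[C] a = a' o[C] al & gg o[C] b = b' o[C] be -->
    (FA (induced_det E g) al *a[P] FA (induced_det E g) gg) o[P] DS (induced_det E g) (a, b) =
    DS (induced_det E g) (a', b') o[P] FA (induced_det E g) be"
  proof (clarify)
   fix a b a' b' al be gg
   assume s: "(a, b):Ses C" "(a', b'):Ses C" and q: "al:qis R" "be:qis R" "gg:qis R"
    and h: "al:Hom C (Dom C a) (Dom C a')" "be:Hom C (Cod C a) (Cod C a')" "gg:Hom C (Cod C b) (Cod C b')"
    and e: "be o[C] a = a' o[C] al" "gg o[C] b = b' o[C] be"
   from s q h e show "(FA (induced_det E g) al *a[P] FA (induced_det E g) gg) o[P] DS (induced_det E g) (a, b) =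
    DS (induced_det E g) (a', b') o[P] FA (induced_det E g) be"
   proof (cases rule: ses_morphism)
    case (1 X Y Z x y sg pj X' Y' Z' x' y' sg' pj' al' be' gg')
    have "triangle_iso K (ses_triangle E (a, b)) (ses_triangle E (a', b')) (to_Kb E al) (to_Kb E be) (to_Kb E gg)"
     unfolding 1(2,3,5,6,7,10,13) to_Kb_cb by (rule ses_triangle_natural[OF 1(1,4,8,11,14)]) (rule 1)+
    moreover have "ses_triangle E (a, b):Tri K" "ses_triangle E (a', b'):Tri K"
     using ses_triangle_Tri[OF 1(1)] ses_triangle_Tri[OF 1(4)] 1(2,3,5,6) by simp_all
    ultimately show ?thesis
     using N by (cases "ses_triangle E (a, b)"; cases "ses_triangle E (a', b')") (simp add: induced_det_def)
   qed
  qed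
 next
  show "ALL a b p q r s t.
    (a, p):Ses C & (b o[C] a, q):Ses C & (b, r):Ses C & (s, t):Ses C &
    Dom C b = Cod C a & Dom C s = Cod C p & Cod C s = Cod C q & Cod C t = Cod C r &
    s o[C] p = q o[C] b & t o[C] q = r -->
    Phi P (FO (induced_det E g) (Dom C a)) (FO (induced_det E g) (Cod C p)) (FO (induced_det E g) (Cod C r)) o[P]
     (Ident P (FO (induced_det E g) (Dom C a)) *a[P] DS (induced_det E g) (s, t)) o[P] DS (induced_det E g) (b o[C] a, q) =
    (DS (induced_det E g) (a, p) *a[P] Ident P (FO (induced_det E g) (Cod C r))) o[P] DS (induced_det E g) (b, r)"
  proof (intro allI impI, elim conjE)
   fix a b p q r s t
   assume S: "(a, p):Ses C" "(b o[C] a, q):Ses C" "(b, r):Ses C" "(s, t):Ses C"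
    and d: "Dom C b = Cod C a" "Dom C s = Cod C p" "Cod C s = Cod C q" "Cod C t = Cod C r"
    and e: "s o[C] p = q o[C] b" "t o[C] q = r"
   from S d e show "Phi P (FO (induced_det E g) (Dom C a)) (FO (induced_det E g) (Cod C p)) (FO (induced_det E g) (Cod C r)) o[P]
     (Ident P (FO (induced_det E g) (Dom C a)) *a[P] DS (induced_det E g) (s, t)) o[P] DS (induced_det E g) (b o[C] a, q) =
    (DS (induced_det E g) (a, p) *a[P] Ident P (FO (induced_det E g) (Cod C r))) o[P] DS (induced_det E g) (b, r)"
   proof (cases rule: ses_configuration)
    case (1 X Y Z U V W a' p' b' r' q' s' t' s1 t1 s2 t2 s3 t3 s4 t4)
    have k: "to_Kb E (cb X Z (b'*a')) = Comp K (to_Kb E (cb Y Z b')) (to_Kb E (cb X Y a'))"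
     using kb_comp[OF sesD(1)[OF 1(1)] sesD(1)[OF 1(3)]] by (simp add: to_Kb_cb)
    note o = ses_octahedron[OF 1(1,2,3,4,13,14)]
    show ?thesis unfolding 1(12) unfolding 1(5-11)
     using O[OF o[unfolded ses_triangle_def split k]] k by (simp add: induced_det_def ses_triangle_def to_Kb_cb)
   qed
  qed
 next
  show "ALL X Y S i j p q. biproduct C X Y S i j p q -->
    Psi P (FO (induced_det E g) X) (FO (induced_det E g) Y) o[P] DS (induced_det E g) (i, q) = DS (induced_det E g) (j, p)"
  proof (intro allI impI)
   fix X Z Y i j p q assume "biproduct C X Z Y i j p q"
   then obtain a b s t where e: "i = cb X Y a" "j = cb Z Y s" "p = cb Y X t" "q = cb Y Z b" and se: "ses X Y Z a b s t" "chain Z Y s" "chain Y X t"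
    using biproduct_ses by blast
   note r = sesD[OF se(1)]
   have se': "ses Z Y X s t a b" unfolding ses_def using r se by (simp add: chain_def add.commute)
   show "Psi P (FO (induced_det E g) X) (FO (induced_det E g) Z) o[P] DS (induced_det E g) (i, q) = DS (induced_det E g) (j, p)"
    using B[OF kb_biproduct[OF se]] ses_triangle_biproduct[OF se] ses_triangle_biproduct[OF se' r(1,2)]
    unfolding e by (simp add: induced_det_def)
  qed
 qed
qed

lemma induced_functor:
 fixes P :: "('c, 'd) picard"
 assumes P: "picard_category P"
 shows "is_functor (det_tri_cat K P) (det_exact_cat C (qis R) P) (induced_func E)"
proof -
 have c: "category (det_tri_cat K P)" "category (det_exact_cat C (qis R) P)"
  using det_tri_cat_category[OF K_category P] Tri_arr det_exact_cat_category[OF C_category P] Ses_arr by blast+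
 have n: "is_nat (wide_subcat C (qis R)) P (induced_det E g) (induced_det E g') al"
  if "is_nat (wide_subcat K (iso_arrows K)) P g g' al" for g g' :: "(_, _, 'c, 'd, _) det_func" and al
  unfolding is_nat_def
 proof (intro conjI ballI)
  note n = natD[OF that]
  show "al:extensional (Obj (wide_subcat C (qis R)))" using n(5) by simp
  show "al X:Hom P (FO (induced_det E g) X) (FO (induced_det E g') X)" if "X:Obj (wide_subcat C (qis R))" for X
   using n(1-3)[of X] that by (simp add: induced_det_def Hom_def)
  fix f assume "f:Arr (wide_subcat C (qis R))"
  then show "al (Cod (wide_subcat C (qis R)) f) o[P] FA (induced_det E g) f = FA (induced_det E g') f o[P] al (Dom (wide_subcat C (qis R)) f)"
   using n(4)[of "to_Kb E f"] qis_to_Kb[of f] by (simp add: induced_det_def)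
 qed
 have t: "det_exact_trans C P (induced_det E g) al (induced_det E g')" if "det_tri_trans K P g al g'" for g g' :: "(_, _, 'c, 'd, _) det_func" and al
  unfolding det_exact_trans_def
 proof clarify
  fix a b assume "(a, b):Ses C"
  then obtain X Y Z a' b' u v where se: "ses X Y Z a' b' u v" and ab: "a = cb X Y a'" "b = cb Y Z b'" unfolding Ses_iff by blast
  show "(al (Dom C a) *a[P] al (Cod C b)) o[P] DS (induced_det E g) (a, b) = DS (induced_det E g') (a, b) o[P] al (Cod C a)"
   using ses_triangle_Tri[OF se] that unfolding ab det_tri_trans_def by (fastforce simp: ses_triangle_eq[OF se] induced_det_def)
 qed
 have o: "Obj (det_tri_cat K P) = {g. det_tri K P g}" "Obj (det_exact_cat C (qis R) P) = {f. det_exact C (qis R) P f}"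
  by (simp_all add: det_tri_cat_def det_exact_cat_def nat_cat_def)
 show ?thesis
  unfolding is_functor_def
 proof (intro conjI ballI impI)
  show "FO (induced_func E) g:Obj (det_exact_cat C (qis R) P)" if "g:Obj (det_tri_cat K P)" for g
   using that induced_det_exact[OF P] unfolding o by (simp add: induced_func_def)
  show "FA (induced_func E) f:Hom (det_exact_cat C (qis R) P) (FO (induced_func E) (Dom (det_tri_cat K P) f)) (FO (induced_func E) (Cod (det_tri_cat K P) f))"
   if "f:Arr (det_tri_cat K P)" for f
   using that induced_det_exact[OF P] n t by (auto simp: det_tri_cat_def det_exact_cat_def nat_cat_def induced_func_def Hom_def)
  show "FA (induced_func E) (Ident (det_tri_cat K P) g) = Ident (det_exact_cat C (qis R) P) (FO (induced_func E) g)" for g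
   by (simp add: det_tri_cat_def det_exact_cat_def nat_cat_def induced_func_def) (simp add: induced_det_def)
  show "FA (induced_func E) (Comp (det_tri_cat K P) h f) = Comp (det_exact_cat C (qis R) P) (FA (induced_func E) h) (FA (induced_func E) f)"
   if "f:Arr (det_tri_cat K P)" "h:Arr (det_tri_cat K P)" for f h
   using that by (auto simp: det_tri_cat_def det_exact_cat_def nat_cat_def induced_func_def)
 qed (use c in auto)
qed

end

section \<open>Surjectivity\<close>

text \<open>The values of \<open>g\<close> are only isomorphic, by \<open>al\<close>, to values of
 \<open>M\<close>. The last two assumptions say that, up to \<open>al\<close>, the arrows
 \<open>g\<^sub>1(x)\<close> and \<open>g\<^sub>2(De)\<close> are images under \<open>M\<close>.\<close>

locale det_lift = monoidal V W M for V and W (structure) and M +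
 fixes T g ob al
 assumes T: "category T" and g: "det_tri T W g" and tri: "!!u v w. (u, v, w):Tri T ==> triangle T (u, v, w)"
  and bip: "biproduct T X Y S i j p q ==> (i, q, ZeroA T Y (ShO T X)):Tri T & (j, p, ZeroA T X (ShO T Y)):Tri T"
  and ob: "X:Obj T ==> ob X:Obj V"
  and al: "X:Obj T ==> al X:Hom W (FO M (ob X)) (FO g X)"
  and lift_iso: "x:iso_arrows T ==>
   EX a:Hom V (ob (Dom T x)) (ob (Cod T x)). al (Cod T x) oo FA M a = FA g x oo al (Dom T x)"
  and lift_tri: "(u, v, w):Tri T ==> EX a:Hom V (ob (Cod T u)) (ob (Dom T u) *o[V] ob (Cod T v)).
   (al (Dom T u) #a al (Cod T v)) oo MC M (ob (Dom T u)) (ob (Cod T v)) oo FA M a = DS g (u, v, w) oo al (Cod T u)"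
begin

definition lft where
 "lft = \<lparr>FO = ob, FA = (%x. r (SOME a. a:Hom V (ob (Dom T x)) (ob (Cod T x)) &
    al (Cod T x) oo FA M a = FA g x oo al (Dom T x))),
   DS = (%(u, v, w). r (SOME a. a:Hom V (ob (Cod T u)) (ob (Dom T u) *o[V] ob (Cod T v)) &
    (al (Dom T u) #a al (Cod T v)) oo MC M (ob (Dom T u)) (ob (Cod T v)) oo FA M a = DS g (u, v, w) oo al (Cod T u)))\<rparr>"

lemma ob_simps [simp]: "X:Obj T ==> ob X:Obj V" "X:Obj T ==> al X:Arr W"
  "X:Obj T ==> Dom W (al X) = FO M (ob X)" "X:Obj T ==> Cod W (al X) = FO g X" "FO lft X = ob X"
  "X:Obj T ==> FO g X:Obj W"
 using ob al functorD(3)[OF det_triD(1)[OF g]] by (auto simp: Hom_def lft_def)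

lemma tri_obj:
 assumes "(u, v, w):Tri T"
 shows "Dom T u:Obj T" "Cod T u:Obj T" "Cod T v:Obj T" "DS g (u, v, w):Arr W"
  "Dom W (DS g (u, v, w)) = FO g (Cod T u)" "Cod W (DS g (u, v, w)) = FO g (Dom T u) #o FO g (Cod T v)"
proof -
 interpret T: category T by (rule T)
 show "Dom T u:Obj T" "Cod T u:Obj T" "Cod T v:Obj T" using tri[OF assms] by (auto simp: triangle_def)
 show "DS g (u, v, w):Arr W" "Dom W (DS g (u, v, w)) = FO g (Cod T u)" "Cod W (DS g (u, v, w)) = FO g (Dom T u) #o FO g (Cod T v)"
  using det_triD(2)[OF g assms] by (auto simp: Hom_def)
qed

lemma iso_obj [simp]:
 assumes "x:iso_arrows T"
 shows "Dom T x:Obj T" "Cod T x:Obj T" "FA g x:Arr W" "Dom W (FA g x) = FO g (Dom T x)" "Cod W (FA g x) = FO g (Cod T x)"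
 using assms functorD(4-6)[OF det_triD(1)[OF g]] category.Dom_closed[OF T] category.Cod_closed[OF T]
 by (auto simp: iso_arrows_def inverse_arrows_def)

text \<open>The chosen preimages are only determined up to arrows with the same image under
 \<open>M\<close>; such arrows have the same representative \<open>r\<close>, so any arrow with the
 right image may be used.\<close>

lemma lft_iso:
 assumes "x:iso_arrows T"
 shows "FA lft x:Arr V & FA lft x:Arr I & Dom V (FA lft x) = ob (Dom T x) & Cod V (FA lft x) = ob (Cod T x) &
  al (Cod T x) oo FA M (FA lft x) = FA g x oo al (Dom T x)"
proof -
 obtain a where a: "FA lft x = r a" "a:Hom V (ob (Dom T x)) (ob (Cod T x)) &
    al (Cod T x) oo FA M a = FA g x oo al (Dom T x)"
  using someI_ex[OF lift_iso[OF assms, unfolded Bex_def]] unfolding lft_def by simp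
 then show ?thesis by (auto simp: Hom_def)
qed

lemma lft_tri:
 assumes "(u, v, w):Tri T"
 shows "DS lft (u, v, w):Arr V & DS lft (u, v, w):Arr I & Dom V (DS lft (u, v, w)) = ob (Cod T u) &
  Cod V (DS lft (u, v, w)) = ob (Dom T u) *o[V] ob (Cod T v) &
  (al (Dom T u) #a al (Cod T v)) oo MC M (ob (Dom T u)) (ob (Cod T v)) oo FA M (DS lft (u, v, w)) = DS g (u, v, w) oo al (Cod T u)"
proof -
 obtain a where a: "DS lft (u, v, w) = r a" "a:Hom V (ob (Cod T u)) (ob (Dom T u) *o[V] ob (Cod T v)) &
    (al (Dom T u) #a al (Cod T v)) oo MC M (ob (Dom T u)) (ob (Cod T v)) oo FA M a = DS g (u, v, w) oo al (Cod T u)"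
  using someI_ex[OF lift_tri[OF assms, unfolded Bex_def]] unfolding lft_def by simp
 then show ?thesis by (auto simp: Hom_def)
qed

lemma r_in_I: "a:r ` Arr V ==> r a = a" by auto

lemma M_mc: "[|f:Arr V; h:Arr V; x:Arr W; Cod W x = FO M (Dom V f *o[V] Dom V h); Cod V f = X; Cod V h = Y|] ==>
  MC M X Y oo FA M (f *a[V] h) oo x = (FA M f #a FA M h) oo MC M (Dom V f) (Dom V h) oo x"
proof -
 assume a: "f:Arr V" "h:Arr V" "x:Arr W" "Cod W x = FO M (Dom V f *o[V] Dom V h)" and e: "Cod V f = X" "Cod V h = Y"
 have "(MC M X Y oo FA M (f *a[V] h)) oo x = ((FA M f #a FA M h) oo MC M (Dom V f) (Dom V h)) oo x"
  unfolding e[symmetric] monD(5)[OF mon a(1,2)] ..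
 then show ?thesis unfolding e[symmetric] using a by (simp add: W.assoc)
qed

text \<open>An identity between arrows of \<open>I\<close> may be checked after applying
 \<open>M\<close>, where conjugation by \<open>al\<close> turns it into the axiom for
 \<open>g\<close>. The same holds for the next two axioms.\<close>

lemma lft_natural:
 assumes t: "(u, v, w):Tri T" "(u', v', w'):Tri T" and i: "triangle_iso T (u, v, w) (u', v', w') a b c"
 shows "(FA lft a *a[I] FA lft c) o[I] DS lft (u, v, w) = DS lft (u', v', w') o[I] FA lft b"
proof -
 have ab: "a:iso_arrows T" "b:iso_arrows T" "c:iso_arrows T" and [simp]: "Dom T a = Dom T u" "Cod T a = Dom T u'"
  "Dom T b = Cod T u" "Cod T b = Cod T u'" "Dom T c = Cod T v" "Cod T c = Cod T v'"
  using i by (auto simp: triangle_iso_def Hom_def)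
 note [simp] = ab tri_obj[OF t(1)] tri_obj[OF t(2)]
 have [simp]: "Dom W (FA g a) = FO g (Dom T u)" "Dom W (FA g c) = FO g (Cod T v)" "Dom W (FA g b) = FO g (Cod T u)"
  "Cod W (FA g a) = FO g (Dom T u')" "Cod W (FA g c) = FO g (Cod T v')" "Cod W (FA g b) = FO g (Cod T u')"
  using iso_obj(4,5)[OF ab(1)] iso_obj(4,5)[OF ab(2)] iso_obj(4,5)[OF ab(3)] by simp_all
 note A = lft_iso[OF ab(1), simplified] and B = lft_iso[OF ab(2), simplified] and C = lft_iso[OF ab(3), simplified]
  and D' = lft_tri[OF t(2)]
 have D: "DS lft (u, v, w):Arr V" "Dom V (DS lft (u, v, w)) = ob (Cod T u)" "Cod V (DS lft (u, v, w)) = ob (Dom T u) *o[V] ob (Cod T v)"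
  "(al (Dom T u) #a al (Cod T v)) oo MC M (ob (Dom T u)) (ob (Cod T v)) oo FA M (DS lft (u, v, w)) = DS g (u, v, w) oo al (Cod T u)"
  "DS lft (u, v, w):Arr I"
  using lft_tri[OF t(1)] by blast+
 let ?X = "Dom T u" and ?X' = "Dom T u'" and ?Y = "Cod T u" and ?Y' = "Cod T u'" and ?Z = "Cod T v" and ?Z' = "Cod T v'"
 let ?d = "DS lft (u, v, w)" and ?d' = "DS lft (u', v', w')"
 have "(al ?X' #a al ?Z') oo MC M (ob ?X') (ob ?Z') oo FA M ((FA lft a *a[V] FA lft c) o[V] ?d)
  = (al ?X' #a al ?Z') oo (FA M (FA lft a) #a FA M (FA lft c)) oo MC M (ob ?X) (ob ?Z) oo FA M ?d"
  using A C D by (simp add: M_mc)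
 also have "... = (FA g a #a FA g c) oo ((al ?X #a al ?Z) oo MC M (ob ?X) (ob ?Z) oo FA M ?d)"
  using A C D(1-3) by (simp add: W.ten_comp_assoc)
 also have "... = ((FA g a #a FA g c) oo DS g (u, v, w)) oo al ?Y" using D by (simp add: W.assoc)
 also have "... = DS g (u', v', w') oo (FA g b oo al ?Y)" unfolding det_triD(3)[OF g t i] by (simp add: W.assoc)
 also have "... = (DS g (u', v', w') oo al ?Y') oo FA M (FA lft b)" using B by (simp flip: B[THEN conjunct2, THEN conjunct2, THEN conjunct2, THEN conjunct2] add: W.assoc)
 also have "... = (al ?X' #a al ?Z') oo MC M (ob ?X') (ob ?Z') oo FA M (?d' o[V] FA lft b)"
  using B D' by (simp flip: D'[THEN conjunct2, THEN conjunct2, THEN conjunct2, THEN conjunct2] add: W.assoc)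
 finally have "MC M (ob ?X') (ob ?Z') oo FA M ((FA lft a *a[V] FA lft c) o[V] ?d) = MC M (ob ?X') (ob ?Z') oo FA M (?d' o[V] FA lft b)"
  by (rule W.cancel_left) (use A B C D D' in simp_all)
 then have "FA M ((FA lft a *a[V] FA lft c) o[V] ?d) = FA M (?d' o[V] FA lft b)"
  by (rule W.cancel_left) (use A B C D D' in simp_all)
 then have "r ((FA lft a *a[V] FA lft c) o[V] ?d) = r (?d' o[V] FA lft b)"
  by (intro r_eqI) (use A B C D D' in simp_all)
 then show ?thesis using A B C D D' by simp
qed

lemma lft_associative:
 assumes o: "octahedron T (a, p, p') (ba, q, q') (b, x, x') (s, t, t')"
 shows "Phi I (ob (Dom T a)) (ob (Cod T p)) (ob (Cod T x)) o[I]
   (Ident I (ob (Dom T a)) *a[I] DS lft (s, t, t')) o[I] DS lft (ba, q, q') =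
  (DS lft (a, p, p') *a[I] Ident I (ob (Cod T x))) o[I] DS lft (b, x, x')"
proof -
 interpret T: category T by (rule T)
 define X Y Z U V' W' where n: "X = Dom T a" "Y = Cod T a" "Z = Cod T b" "U = Cod T p" "V' = Cod T q" "W' = Cod T x"
 have t: "(a, p, p'):Tri T" "(ba, q, q'):Tri T" "(b, x, x'):Tri T" "(s, t, t'):Tri T"
  and e: "Dom T b = Y" "Dom T s = U" "Cod T s = V'" "Cod T t = W'" and ba: "ba = b o[T] a"
  using o by (auto simp: octahedron_def n)
 have [simp]: "Dom T ba = X" "Cod T ba = Z" using tri[OF t(1)] tri[OF t(3)] e(1) by (simp_all add: ba n triangle_def)
 note [simp] = e n(1,2,3,4,5,6)[symmetric]
 have [simp]: "X:Obj T" "Y:Obj T" "Z:Obj T" "U:Obj T" "V':Obj T" "W':Obj T"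
  using tri_obj(1-3)[OF t(1)] tri_obj(1-3)[OF t(2)] tri_obj(1-3)[OF t(3)] tri_obj(1-3)[OF t(4)] by simp_all
 note [simp] = tri_obj(4-6)[OF t(1), simplified] tri_obj(4-6)[OF t(2), simplified] tri_obj(4-6)[OF t(3), simplified] tri_obj(4-6)[OF t(4), simplified]
 define d1 d2 d3 d4 where d: "d1 = DS lft (a, p, p')" "d2 = DS lft (ba, q, q')" "d3 = DS lft (b, x, x')" "d4 = DS lft (s, t, t')"
 note D = lft_tri[OF t(1), simplified, folded d] lft_tri[OF t(2), simplified, folded d] lft_tri[OF t(3), simplified, folded d] lft_tri[OF t(4), simplified, folded d]
 have D' [simp]: "d1:Arr V" "d2:Arr V" "d3:Arr V" "d4:Arr V" "Dom V d1 = ob Y" "Dom V d2 = ob Z" "Dom V d3 = ob Z" "Dom V d4 = ob V'"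
  "Cod V d1 = ob X *o[V] ob U" "Cod V d2 = ob X *o[V] ob V'" "Cod V d3 = ob Y *o[V] ob W'" "Cod V d4 = ob U *o[V] ob W'"
  using D by blast+
 have E: "(al X #a al U) oo MC M (ob X) (ob U) oo FA M d1 = DS g (a, p, p') oo al Y"
  "(al X #a al V') oo MC M (ob X) (ob V') oo FA M d2 = DS g (ba, q, q') oo al Z"
  "(al Y #a al W') oo MC M (ob Y) (ob W') oo FA M d3 = DS g (b, x, x') oo al Z"
  "(al U #a al W') oo MC M (ob U) (ob W') oo FA M d4 = DS g (s, t, t') oo al V'"
  using D by blast+
 let ?L = "Phi V (ob X) (ob U) (ob W') o[V] (Ident V (ob X) *a[V] d4) o[V] d2"
 let ?R = "(d1 *a[V] Ident V (ob W')) o[V] d3"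
 let ?k = "(MC M (ob X) (ob U) #a Ident W (FO M (ob W'))) oo MC M (ob X *o[V] ob U) (ob W')"
 let ?a = "(al X #a al U) #a al W'"
 let ?p = "Phi W (FO M (ob X)) (FO M (ob U)) (FO M (ob W'))"
 have l: "?a oo ?k oo FA M ?L = ?a oo (((MC M (ob X) (ob U) #a Ident W (FO M (ob W'))) oo MC M (ob X *o[V] ob U) (ob W') oo FA M (Phi V (ob X) (ob U) (ob W'))) oo
   FA M (Ident V (ob X) *a[V] d4) oo FA M d2)"
  by (simp add: W.assoc)
 also have "... = (?a oo ?p) oo (Ident W (FO M (ob X)) #a MC M (ob U) (ob W')) oo
   MC M (ob X) (ob U *o[V] ob W') oo FA M (Ident V (ob X) *a[V] d4) oo FA M d2"
  unfolding monD(6)[OF mon ob_simps(1) ob_simps(1) ob_simps(1), OF \<open>X:Obj T\<close> \<open>U:Obj T\<close> \<open>W':Obj T\<close>, symmetric] by (simp add: W.assoc)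
 also have "... = (Phi W (FO g X) (FO g U) (FO g W') oo (al X #a al U #a al W')) oo (Ident W (FO M (ob X)) #a MC M (ob U) (ob W')) oo
   (Ident W (FO M (ob X)) #a FA M d4) oo MC M (ob X) (ob V') oo FA M d2"
  using W.phi_nat[of "al X" "al U" "al W'"] by (simp add: M_mc)
 also have "... = Phi W (FO g X) (FO g U) (FO g W') oo (al X #a ((al U #a al W') oo MC M (ob U) (ob W') oo FA M d4)) oo MC M (ob X) (ob V') oo FA M d2"
  by (simp add: W.assoc W.ten_comp_assoc)
 also have "... = Phi W (FO g X) (FO g U) (FO g W') oo (Ident W (FO g X) #a DS g (s, t, t')) oo ((al X #a al V') oo MC M (ob X) (ob V') oo FA M d2)"
  unfolding E(4) by (simp add: W.ten_comp_assoc)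
 also have "... = (Phi W (FO g X) (FO g U) (FO g W') oo (Ident W (FO g X) #a DS g (s, t, t')) oo DS g (ba, q, q')) oo al Z"
  unfolding E(2) by (simp add: W.assoc)
 also have "... = (DS g (a, p, p') #a Ident W (FO g W')) oo (DS g (b, x, x') oo al Z)"
  using det_triD(4)[OF g o[unfolded ba]] by (simp flip: ba add: W.assoc)
 also have "... = ((DS g (a, p, p') oo al Y) #a al W') oo MC M (ob Y) (ob W') oo FA M d3"
  unfolding E(3)[symmetric] by (simp add: W.ten_comp_assoc)
 also have "... = ?a oo ?k oo FA M ?R"
  unfolding E(1)[symmetric] by (simp add: W.assoc W.ten_comp_assoc M_mc)
 finally have "?k oo FA M ?L = ?k oo FA M ?R" by (rule W.cancel_left) simp_all
 then have "FA M ?L = FA M ?R" by (rule W.cancel_left) simp_all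
 then have "r ?L = r ?R" by (intro r_eqI) simp_all
 then show ?thesis by (simp flip: d)
qed

lemma lft_commutative:
 assumes b: "biproduct T X Y S i j p q"
 shows "Psi I (ob X) (ob Y) o[I] DS lft (i, q, ZeroA T Y (ShO T X)) = DS lft (j, p, ZeroA T X (ShO T Y))"
proof -
 let ?t = "(i, q, ZeroA T Y (ShO T X))" and ?t' = "(j, p, ZeroA T X (ShO T Y))"
 have [simp]: "X:Obj T" "Y:Obj T" "S:Obj T" "Dom T i = X" "Cod T i = S" "Cod T q = Y" "Dom T j = Y" "Cod T j = S" "Cod T p = X"
  using b by (auto simp: biproduct_def Hom_def)
 have t: "?t:Tri T" "?t':Tri T" using bip[OF b] by auto
 note [simp] = tri_obj(4-6)[OF t(1), simplified] tri_obj(4-6)[OF t(2), simplified]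
 define d d' where d: "d = DS lft ?t" "d' = DS lft ?t'"
 note D = lft_tri[OF t(1), simplified, folded d] lft_tri[OF t(2), simplified, folded d]
 have [simp]: "d:Arr V" "d':Arr V" "Dom V d = ob S" "Dom V d' = ob S" "Cod V d = ob X *o[V] ob Y" "Cod V d' = ob Y *o[V] ob X"
  using D by blast+
 have E: "(al X #a al Y) oo MC M (ob X) (ob Y) oo FA M d = DS g ?t oo al S" "(al Y #a al X) oo MC M (ob Y) (ob X) oo FA M d' = DS g ?t' oo al S"
  using D by blast+
 have "(al Y #a al X) oo MC M (ob Y) (ob X) oo FA M (Psi V (ob X) (ob Y) o[V] d) =
  (al Y #a al X) oo (MC M (ob Y) (ob X) oo FA M (Psi V (ob X) (ob Y))) oo FA M d" by (simp add: W.assoc)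
 also have "... = ((al Y #a al X) oo Psi W (FO M (ob X)) (FO M (ob Y))) oo MC M (ob X) (ob Y) oo FA M d"
  using monD(7)[OF mon, of "ob X" "ob Y"] by (simp flip: monD(7)[OF mon] add: W.assoc)
 also have "(al Y #a al X) oo Psi W (FO M (ob X)) (FO M (ob Y)) = Psi W (FO g X) (FO g Y) oo (al X #a al Y)"
  using W.psi_nat[of "al X" "al Y"] by simp
 also have "(Psi W (FO g X) (FO g Y) oo (al X #a al Y)) oo MC M (ob X) (ob Y) oo FA M d = Psi W (FO g X) (FO g Y) oo ((al X #a al Y) oo MC M (ob X) (ob Y) oo FA M d)"
  by (simp add: W.assoc)
 also have "... = (Psi W (FO g X) (FO g Y) oo DS g ?t) oo al S" unfolding E(1) by (simp add: W.assoc)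
 also have "... = (al Y #a al X) oo MC M (ob Y) (ob X) oo FA M d'" unfolding E(2) det_triD(5)[OF g b] ..
 finally have "MC M (ob Y) (ob X) oo FA M (Psi V (ob X) (ob Y) o[V] d) = MC M (ob Y) (ob X) oo FA M d'"
  by (rule W.cancel_left) simp_all
 then have "FA M (Psi V (ob X) (ob Y) o[V] d) = FA M d'" by (rule W.cancel_left) simp_all
 then have "r (Psi V (ob X) (ob Y) o[V] d) = r d'" by (intro r_eqI) simp_all
 also have "r d' = d'" by (rule r_in_I) (use D in simp)
 finally show ?thesis by (simp flip: d)
qed

lemma lft_functor: "is_functor (wide_subcat T (iso_arrows T)) I lft"
proof -
 note g' = det_triD(1)[OF g]
 note gf = functorD(7,8)[OF g', simplified]
 interpret TT: category "wide_subcat T (iso_arrows T)" by (rule functorD(1)[OF g'])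
 have id: "FA lft (Ident T X) = Ident I (ob X)" if [simp]: "X:Obj T" for X
 proof -
  have i: "Ident T X:iso_arrows T" and [simp]: "Dom T (Ident T X) = X" "Cod T (Ident T X) = X"
   using TT.id_arr[of X] TT.dom_id[of X] TT.cod_id[of X] by simp_all
  note L = lft_iso[OF i, simplified]
  have "al X oo FA M (FA lft (Ident T X)) = al X oo FA M (Ident V (ob X))" using L gf(1)[of X] by simp
  then have "FA M (FA lft (Ident T X)) = FA M (Ident V (ob X))" by (rule W.cancel_left) (use L in simp_all)
  then have "r (FA lft (Ident T X)) = r (Ident V (ob X))" by (intro r_eqI) (use L in simp_all)
  also have "r (FA lft (Ident T X)) = FA lft (Ident T X)" by (rule r_in_I) (use L in simp)
  finally show ?thesis by simp
 qed
 have comp: "FA lft (y o[T] x) = FA lft y o[I] FA lft x" if xy: "x:iso_arrows T" "y:iso_arrows T" and e [simp]: "Dom T y = Cod T x" for x y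
 proof -
  have i: "y o[T] x:iso_arrows T" and [simp]: "Dom T (y o[T] x) = Dom T x" "Cod T (y o[T] x) = Cod T y"
   using TT.comp_arr[of x y] TT.dom_comp[of x y] TT.cod_comp[of x y] xy by simp_all
  note [simp] = xy iso_obj(4)[OF xy(2), simplified]
  note L = lft_iso[OF xy(1)] lft_iso[OF xy(2), simplified] lft_iso[OF i, simplified]
  have l: "FA lft x:Arr V" "Dom V (FA lft x) = ob (Dom T x)" "Cod V (FA lft x) = ob (Cod T x)" "FA lft y:Arr V"
   "Dom V (FA lft y) = ob (Cod T x)" "Cod V (FA lft y) = ob (Cod T y)"
   using L by blast+
  have "al (Cod T y) oo FA M (FA lft (y o[T] x)) = FA g y oo (FA g x oo al (Dom T x))" using L(3) gf(2)[OF xy e] by (simp add: W.assoc)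
  also have "... = (FA g y oo al (Cod T x)) oo FA M (FA lft x)" using L(1) by (simp add: W.assoc)
  also have "... = (al (Cod T y) oo FA M (FA lft y)) oo FA M (FA lft x)" using L(2) by simp
  also have "... = al (Cod T y) oo FA M (FA lft y o[V] FA lft x)" using l by (simp add: W.assoc)
  finally have "FA M (FA lft (y o[T] x)) = FA M (FA lft y o[V] FA lft x)" by (rule W.cancel_left) (use L in simp_all)
  then have "r (FA lft (y o[T] x)) = r (FA lft y o[V] FA lft x)" by (intro r_eqI) (use L in simp_all)
  also have "r (FA lft (y o[T] x)) = FA lft (y o[T] x)" by (rule r_in_I) (use L in simp)
  finally show ?thesis by simp
 qed
 show ?thesis
  unfolding is_functor_def using TT.category_axioms I_category id comp lft_iso by (auto simp: Hom_def simp del: I_simps(5,6))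
qed

lemma lft_det: "det_tri T I lft"
 unfolding det_tri_def
 using lft_functor lft_tri lft_natural lft_associative lft_commutative by (auto simp: Hom_def simp del: I_simps(2,5,6,8-10))

end

context proj_modules
begin

lemma direct_sum_ex:
 assumes X: "cpx X" and Z: "cpx Z"
 shows "EX Y a b s t. ses X Y Z a b s t & chain Z Y s & chain Y X t"
proof -
 have "0:H Z X 1" using H_zero X Z cpxD(1) by blast
 then obtain Y a b s t where se: "ses X Y Z a b s t" and z: "t*dd Y*s = 0" using extension_ex[OF X Z, of 0] by auto
 note r = sesD[OF se] and c = ses_connecting[OF se, unfolded z]
 have "chain Z Y s" "chain Y X t" unfolding chain_def using r c(3,4) by simp_all
 then show ?thesis using se by blast
qed

text \<open>A biproduct in \<open>K\<close> is isomorphic to the direct sum of complexes, whose sequence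
 is split and so has zero connecting map.\<close>

lemma biproduct_Tri:
 assumes "biproduct K X Z S i j p q"
 shows "(i, q, ZeroA K Z (ShO K X)):Tri K"
proof -
 have o: "cpx X" "cpx Z" "cpx S" using assms by (auto simp: biproduct_def)
 obtain i' j' p' q' where e: "i = kb X S i'" "j = kb Z S j'" "p = kb S X p'" "q = kb S Z q'"
  and c: "chain X S i'" "chain Z S j'" "chain S X p'" "chain S Z q'"
  using assms by (auto simp: biproduct_def K_hom)
 have h: "heq X X (p'*i') (uno X)" "heq Z Z (q'*j') (uno Z)" "heq Z X (p'*j') 0" "heq X Z (q'*i') 0" "heq S S (i'*p'+j'*q') (uno S)"
  using assms unfolding biproduct_def e using c o
  by (simp_all add: kb_comp kb_ident kb_zero kb_add chain_mult chain_add kb_eq_iff chain_uno chain_zero)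
 obtain Y a b s t where se: "ses X Y Z a b s t" and st: "chain Z Y s" "chain Y X t" using direct_sum_ex[OF o(1,2)] by blast
 note r = sesD[OF se]
 let ?b = "a*p'+s*q'" and ?c = "i'*t+j'*b"
 have f: "chain S Y ?b" "chain Y S ?c" by (blast intro: chain_add chain_mult r(1,2) st c)+
 have u: "a*uno X = a" "s*uno Z = s" "uno Z*q' = q'" "uno X*p' = p'"
  using unl unr chainD(3) r(1) st c by blast+
 have g: "t*a = uno X" "b*s = uno Z" "t*s = 0" "b*a = 0" "a*t+s*b = uno Y" using se by (auto simp: ses_def)
 have 1: "heq X Y (?b*i') (a*uno X)"
  using heq_add[OF heq_multL[OF h(1) r(1)] heq_multL[OF h(4) st(1)]] by (simp add: alg)
 have 2: "b*?b = q'" by (simp add: alg ma[symmetric] g u)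
 have 3: "heq S S (?c*?b) (uno S)"
  using h(5) by (simp add: alg msub[OF g(1)] msub[OF g(2)] msub[OF g(3)] msub[OF g(4)] u)
 have 4: "heq Y Y (?b*?c) (uno Y)"
  using heq_add[OF heq_add[OF heq_multR[OF heq_multL[OF h(1) r(1)] st(2)] heq_multR[OF heq_multL[OF h(3) r(1)] r(2)]]
   heq_add[OF heq_multR[OF heq_multL[OF h(4) st(1)] st(2)] heq_multR[OF heq_multL[OF h(2) st(1)] r(2)]]]
  by (simp add: u g alg)
 have iso: "kb S Y ?b:iso_arrows K" using kb_iso_iff[OF f(1)] f(2) 3 4 by blast
 have z: "chain Z (sh X) 0" using chain_zero o sh_cpx by blast
 have "triangle_iso K (kb X S i', kb S Z q', kb Z (sh X) 0) (kb X Y a, kb Y Z b, kb Z (sh X) 0) (kb X X (uno X)) (kb S Y ?b) (kb Z Z (uno Z))"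
 proof (rule tri_isoI)
  show "heq S Z (uno Z*q') (b*?b)" using 2 u c heq_refl by simp
 qed (use c r(1,2) z f(1) chain_uno o kb_uno_iso iso 1 heq_refl[OF z] in simp_all)
 then have "triangle_iso K (i, q, ZeroA K Z (ShO K X)) (ses_triangle E (cb X Y a, cb Y Z b)) (kb X X (uno X)) (kb S Y ?b) (kb Z Z (uno Z))"
  unfolding ses_triangle_biproduct[OF se st] e using kb_zero[OF o(2) sh_cpx[OF o(1)]] by simp
 then show ?thesis using ses_triangle_Tri[OF se] triangle_iso_trans unfolding Tri_iff by blast
qed

lemma biproduct_Tri_both:
 assumes "biproduct K X Z S i j p q"
 shows "(i, q, ZeroA K Z (ShO K X)):Tri K & (j, p, ZeroA K X (ShO K Z)):Tri K"
proof
 obtain i' j' p' q' where e: "i = kb X S i'" "j = kb Z S j'" "p = kb S X p'" "q = kb S Z q'"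
  and c: "chain X S i'" "chain Z S j'" "chain S X p'" "chain S Z q'"
  using assms by (auto simp: biproduct_def K_hom)
 have "AddA K (Comp K j q) (Comp K i p) = AddA K (Comp K i p) (Comp K j q)"
  unfolding e by (simp add: c kb_comp kb_add[OF chain_mult[OF c(4,2)] chain_mult[OF c(3,1)]] kb_add[OF chain_mult[OF c(3,1)] chain_mult[OF c(4,2)]] add.commute)
 then have "biproduct K Z X S j i q p" using assms unfolding biproduct_def by metis
 then show "(j, p, ZeroA K X (ShO K Z)):Tri K" by (rule biproduct_Tri)
qed (rule biproduct_Tri[OF assms])

end

lemma universal_exactD:
 fixes V P :: "('u, 'u) picard"
 assumes "universal_det_exact T w V f"
 shows "picard_category V" "det_exact T w V f"
  "picard_category P ==> is_equivalence (Hom_ten V P) (det_exact_cat T w P)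
    \<lparr>FO = (%M. postcomp_exact T P M f), FA = whisker (Obj T) (%M. postcomp_exact T P M f) f\<rparr>"
 using assms by (auto simp: universal_det_exact_def)

lemma universal_triD:
 fixes V P :: "('u, 'u) picard"
 assumes "universal_det_tri T V f"
 shows "picard_category V" "det_tri T V f"
  "picard_category P ==> is_equivalence (Hom_ten V P) (det_tri_cat T P)
    \<lparr>FO = (%M. postcomp_tri T P M f), FA = whisker (Obj T) (%M. postcomp_tri T P M f) f\<rparr>"
 using assms by (auto simp: universal_det_tri_def)

context proj_modules
begin

lemma comparison_arrow:
 assumes "comparison R V f W g M"
 shows "monoidal_functor V W M" "EX al. (postcomp_exact C W M f, al, induced_det E g):Arr (det_exact_cat C (qis R) W)"
 using assms by (auto simp: comparison_def isomorphic_def Hom_def det_exact_cat_def nat_cat_def)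

lemma comparison_ex:
 fixes V W :: "('u, 'u) picard"
 assumes f: "universal_det_exact C (qis R) V f" and g: "universal_det_tri K W g"
 shows "EX M. comparison R V f W g M"
proof -
 have "induced_det E g:Obj (det_exact_cat C (qis R) W)"
  using induced_det_exact[OF universal_triD(1,2)[OF g]] by (simp add: det_exact_cat_def nat_cat_def)
 from equivalence_eso[OF universal_exactD(3)[OF f universal_triD(1)[OF g]] this]
 show ?thesis by (auto simp: comparison_def Hom_ten_def nat_cat_def)
qed

text \<open>Two comparison functors become isomorphic after composition with \<open>f\<close>, hence are
 isomorphic, and isomorphic monoidal functors agree on \<open>\<pi>\<^sub>1\<close>.\<close>

lemma comparison_unique:
 fixes V W :: "('u, 'u) picard"
 assumes f: "universal_det_exact C (qis R) V f" and g: "universal_det_tri K W g"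
  and M: "comparison R V f W g M" and N: "comparison R V f W g N"
 shows "pi1_map V W M = pi1_map V W N"
proof -
 let ?D = "det_exact_cat C (qis R) W"
 note eq = universal_exactD(3)[OF f universal_triD(1)[OF g]]
 interpret D: category ?D by (rule functorD(2)) (use eq in \<open>auto simp: is_equivalence_def\<close>)
 have iso: "EX x:iso_arrows ?D. Dom ?D x = postcomp_exact C W M f & Cod ?D x = induced_det E g" if "comparison R V f W g M" for M
  using that by (auto simp: comparison_def isomorphic_def Hom_def)
 obtain x where x: "x:Arr ?D" "Dom ?D x = postcomp_exact C W M f" "Cod ?D x = induced_det E g"
  using iso[OF M] by (auto simp: iso_arrows_def inverse_arrows_def)
 obtain y where y: "y:Arr ?D" "Dom ?D y = induced_det E g" "Cod ?D y = postcomp_exact C W N f"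
  using iso[OF N] by (auto simp: iso_arrows_def inverse_arrows_def Hom_def)
 have "Comp ?D y x:Hom ?D (postcomp_exact C W M f) (postcomp_exact C W N f)" using x y by (simp add: Hom_def)
 then obtain mu where "mu:Hom (Hom_ten V W) M N"
  using equivalence_full[OF eq, of M N "Comp ?D y x"] M N by (auto simp: comparison_def Hom_ten_def nat_cat_def)
 then have "EX nu. is_nat V W M N nu" by (auto simp: Hom_def Hom_ten_def nat_cat_def)
 then show ?thesis
  using pi1_map_iso_invariant[OF universal_exactD(1)[OF f] universal_triD(1)[OF g]] M N by (auto simp: comparison_def)
qed

text \<open>The isomorphism \<open>al\<close> from \<open>M f\<close> to the functor induced by
 \<open>g\<close> compares all values of \<open>g\<close> with images under \<open>M\<close>:
 isomorphisms of \<open>K\<close> lift to quasi-isomorphisms, and a triangle is replaced by the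
 isomorphic triangle of a short exact sequence.\<close>

lemma comparison_lift:
 assumes V: "picard_category V" and f: "det_exact C (qis R) V f" and W: "picard_category W" and g: "det_tri K W g"
  and M: "monoidal_functor V W M"
  and arr: "(postcomp_exact C W M f, al, induced_det E g):Arr (det_exact_cat C (qis R) W)"
 shows "det_lift V W M K g (FO f) al"
proof -
 interpret V: picard_category V by fact
 interpret W: picard_category W by fact
 interpret monoidal V W M by unfold_locales fact
 interpret K: category K by (rule K_category)
 have nat: "is_nat (wide_subcat C (qis R)) W (postcomp_exact C W M f) (induced_det E g) al"
  and tr: "det_exact_trans C W (postcomp_exact C W M f) al (induced_det E g)"
  using arr by (auto simp: det_exact_cat_def nat_cat_def)
 note F = functorD(3-6)[OF det_exactD(1)[OF f], simplified] and G = functorD(3-6)[OF det_triD(1)[OF g], simplified]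
 note n [simp] = natD(1-3)[OF nat, simplified, unfolded postcomp_exact_def induced_det_def, simplified]
 have lift: "EX a:Hom V (FO f (Dom K x)) (FO f (Cod K x)). al (Cod K x) o[W] FA M a = FA g x o[W] al (Dom K x)"
  if "x:iso_arrows K" for x
 proof -
  have "x:Arr K" using that by (auto simp: iso_arrows_def inverse_arrows_def)
  then obtain X Y h where h: "chain X Y h" "x = kb X Y h" using K_arr by auto
  then have q: "cb X Y h:qis R" using that qis_iff_iso by blast
  show ?thesis
   using natD(4)[OF nat, of "cb X Y h"] q F(2-4)[OF q] h
   by (intro bexI[of _ "FA f (cb X Y h)"]) (auto simp: Hom_def postcomp_exact_def induced_det_def to_Kb_cb)
 qed
 show ?thesis
 proof
  show "det_tri K W g" by fact
  show "triangle K (u, v, w)" if "(u, v, w):Tri K" for u v w using Tri_triangle[OF that] .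
  show "(i, q, ZeroA K Y (ShO K X)):Tri K & (j, p, ZeroA K X (ShO K Y)):Tri K" if "biproduct K X Y S i j p q" for X Y S i j p q
   using biproduct_Tri_both[OF that] .
  show "FO f X:Obj V" if "X:Obj K" for X using F(1)[of X] that by simp
  show "al X:Hom W (FO M (FO f X)) (FO g X)" if "X:Obj K" for X using that by (simp add: Hom_def)
  show "EX a:Hom V (FO f (Dom K x)) (FO f (Cod K x)). al (Cod K x) o[W] FA M a = FA g x o[W] al (Dom K x)"
   if "x:iso_arrows K" for x by (rule lift[OF that])
 next
  fix u v w assume D: "(u, v, w):Tri K"
  obtain X Y Z a b s t rh mu nu where se: "ses X Y Z a b s t"
   and ti: "triangle_iso K (u, v, w) (ses_triangle E (cb X Y a, cb Y Z b)) rh mu nu" using Tri_ses[OF D] by blast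
  note rs = sesD[OF se]
  have S: "(cb X Y a, cb Y Z b):Ses C" unfolding Ses_iff by (intro exI conjI) (rule se refl)+
  let ?c = "connecting E (cb X Y a, cb Y Z b)"
  have st: "ses_triangle E (cb X Y a, cb Y Z b) = (kb X Y a, kb Y Z b, ?c)" by (simp add: ses_triangle_def to_Kb_cb)
  note sT = ses_triangle_Tri[OF se, unfolded st]
  have i: "rh:iso_arrows K" "mu:iso_arrows K" "nu:iso_arrows K" and
   [simp]: "Dom K rh = Dom K u" "Cod K rh = X" "Dom K mu = Cod K u" "Cod K mu = Y" "Dom K nu = Cod K v" "Cod K nu = Z"
   using ti unfolding st by (auto simp: triangle_iso_def Hom_def)
  obtain l where l: "l:Arr V" "Dom V l = FO f (Dom K u)" "Cod V l = FO f X" "al X o[W] FA M l = FA g rh o[W] al (Dom K u)"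
   using lift[OF i(1)] by (auto simp: Hom_def)
  obtain m where m: "m:Arr V" "Dom V m = FO f (Cod K u)" "Cod V m = FO f Y" "al Y o[W] FA M m = FA g mu o[W] al (Cod K u)"
   using lift[OF i(2)] by (auto simp: Hom_def)
  obtain n' where n': "n':Arr V" "Dom V n' = FO f (Cod K v)" "Cod V n' = FO f Z" "al Z o[W] FA M n' = FA g nu o[W] al (Cod K v)"
   using lift[OF i(3)] by (auto simp: Hom_def)
  let ?d = "DS f (cb X Y a, cb Y Z b)"
  have d: "?d:Arr V" "Dom V ?d = FO f Y" "Cod V ?d = FO f X *o[V] FO f Z"
   using det_exactD(2)[OF f S] by (auto simp: Hom_def)
  have o: "cpx (Dom K u)" "cpx (Cod K u)" "cpx (Cod K v)" using Tri_arr[OF D] K.Dom_closed K.Cod_closed by auto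
  note [simp] = l(1-3) m(1-3) n'(1-3) d o rs(5-7) F(1)
  have gi: "FA g rh:Arr W" "FA g mu:Arr W" "FA g nu:Arr W" "Dom W (FA g rh) = FO g (Dom K u)" "Dom W (FA g mu) = FO g (Cod K u)" "Dom W (FA g nu) = FO g (Cod K v)"
    "Cod W (FA g rh) = FO g X" "Cod W (FA g mu) = FO g Y" "Cod W (FA g nu) = FO g Z"
   using G(2-4)[OF i(1)] G(2-4)[OF i(2)] G(2-4)[OF i(3)] by simp_all
  have gd: "DS g (u, v, w):Arr W" "Dom W (DS g (u, v, w)) = FO g (Cod K u)" "Cod W (DS g (u, v, w)) = FO g (Dom K u) *o[W] FO g (Cod K v)"
   "DS g (kb X Y a, kb Y Z b, ?c):Arr W" "Dom W (DS g (kb X Y a, kb Y Z b, ?c)) = FO g Y" "Cod W (DS g (kb X Y a, kb Y Z b, ?c)) = FO g X *o[W] FO g Z"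
   using det_triD(2)[OF g D] det_triD(2)[OF g sT] by (auto simp: Hom_def)
  note [simp] = gi gd
  let ?A = "FO f (Dom K u)" and ?Z = "FO f (Cod K v)"
  let ?e = "ginv V (l *a[V] n') o[V] ?d o[V] m"
  have le: "(l *a[V] n') o[V] ?e = ?d o[V] m" by simp
  have tr': "(al X *a[W] al Z) o[W] MC M (FO f X) (FO f Z) o[W] FA M ?d = DS g (kb X Y a, kb Y Z b, ?c) o[W] al Y"
   using tr S by (fastforce simp: det_exact_trans_def postcomp_exact_def induced_det_def st)
  have mc: "MC M (FO f X) (FO f Z) o[W] FA M (l *a[V] n') = (FA M l *a[W] FA M n') o[W] MC M ?A ?Z"
   using monD(5)[OF mon, of l n'] by simp
  have "(FA g rh *a[W] FA g nu) o[W] (al (Dom K u) *a[W] al (Cod K v)) o[W] MC M ?A ?Z o[W] FA M ?e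
   = ((FA g rh o[W] al (Dom K u)) *a[W] (FA g nu o[W] al (Cod K v))) o[W] MC M ?A ?Z o[W] FA M ?e" by (simp add: W.ten_comp_assoc)
  also have "... = (al X *a[W] al Z) o[W] ((FA M l *a[W] FA M n') o[W] MC M ?A ?Z) o[W] FA M ?e"
   unfolding l(4)[symmetric] n'(4)[symmetric] by (simp add: W.ten_comp_assoc W.assoc)
  also have "... = (al X *a[W] al Z) o[W] MC M (FO f X) (FO f Z) o[W] (FA M (l *a[V] n') o[W] FA M ?e)"
   unfolding mc[symmetric] by (simp add: W.assoc)
  also have "FA M (l *a[V] n') o[W] FA M ?e = FA M (?d o[V] m)" by simp
  also have "(al X *a[W] al Z) o[W] MC M (FO f X) (FO f Z) o[W] FA M (?d o[V] m) =
    ((al X *a[W] al Z) o[W] MC M (FO f X) (FO f Z) o[W] FA M ?d) o[W] FA M m" by (simp add: W.assoc)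
  also have "... = (DS g (kb X Y a, kb Y Z b, ?c) o[W] FA g mu) o[W] al (Cod K u)"
   unfolding tr' using m(4) by (simp add: W.assoc)
  also have "... = (FA g rh *a[W] FA g nu) o[W] DS g (u, v, w) o[W] al (Cod K u)"
   unfolding det_triD(3)[OF g D sT ti[unfolded st], symmetric] by (simp add: W.assoc)
  finally have "(al (Dom K u) *a[W] al (Cod K v)) o[W] MC M ?A ?Z o[W] FA M ?e = DS g (u, v, w) o[W] al (Cod K u)"
   by (rule W.cancel_left) simp_all
  then show "EX a:Hom V (FO f (Cod K u)) (FO f (Dom K u) *o[V] FO f (Cod K v)).
   (al (Dom K u) *a[W] al (Cod K v)) o[W] MC M (FO f (Dom K u)) (FO f (Cod K v)) o[W] FA M a = DS g (u, v, w) o[W] al (Cod K u)"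
   by (intro bexI[of _ ?e]) (simp_all add: Hom_def)
 qed
qed

end

text \<open>Here \<open>J\<close> is a monoidal functor to the image of \<open>M\<close> which turns the
 universal \<open>g\<close> into its lift.\<close>

locale det_section = det_lift V W M T g ob al for V W :: "('u, 'u) picard" and M T g ob al +
 fixes J th
 assumes J: "monoidal_functor W I J" and univ: "universal_det_tri T W g"
  and th: "(postcomp_tri T I J g, th, lft):Arr (det_tri_cat T I)"
begin

lemma J_simps [simp]: "X:Obj W ==> FO J X:Obj V" "x:Arr W ==> FA J x:Arr V"
 "x:Arr W ==> Dom V (FA J x) = FO J (Dom W x)" "x:Arr W ==> Cod V (FA J x) = FO J (Cod W x)"
 "X:Obj W ==> Y:Obj W ==> MC J X Y:Arr V" "X:Obj W ==> Y:Obj W ==> Dom V (MC J X Y) = FO J (X *o[W] Y)"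
 "X:Obj W ==> Y:Obj W ==> Cod V (MC J X Y) = FO J X *o[V] FO J Y"
 using functorD(3,5,6)[OF monD(1)[OF J]] monD(3,4)[OF J] functorD(4)[OF monD(1)[OF J], of x] monD(2)[OF J, of X Y] by auto

lemma th_nat: "is_nat (wide_subcat T (iso_arrows T)) I (postcomp_tri T I J g) lft th" "det_tri_trans T I (postcomp_tri T I J g) th lft"
 using th by (auto simp: det_tri_cat_def nat_cat_def)

lemma th_simps [simp]: "X:Obj T ==> th X:Arr V" "X:Obj T ==> Dom V (th X) = FO J (FO g X)" "X:Obj T ==> Cod V (th X) = ob X"
 using natD(1-3)[OF th_nat(1), of X] by (auto simp: postcomp_tri_def)

text \<open>Composing \<open>J\<close> with \<open>M\<close> gives a monoidal functor \<open>N\<close>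
 for which \<open>N g\<close> and \<open>g\<close> are isomorphic; because \<open>W\<close> is
 universal, the isomorphism is induced by one between \<open>N\<close> and the identity.\<close>

lemma retraction_ex: "EX mu. ALL Z:Obj W. mu Z:Hom W (FO M (FO J Z)) Z &
  (ALL b:Hom W Z Z. mu Z o[W] FA M (FA J b) = b o[W] mu Z)"
proof -
 define N :: "('u, 'u, 'u, 'u) mon_func" where
  "N = \<lparr>FO = FO M \<circ> FO J, FA = FA M \<circ> FA J, MC = (%X Y. MC M (FO J X) (FO J Y) o[W] FA M (MC J X Y))\<rparr>"
 define N' :: "('u, 'u, 'u, 'u) mon_func" where "N' = \<lparr>FO = (%X. X), FA = (%f. f), MC = (%X Y. Ident W (X *o[W] Y))\<rparr>"
 note W = W.picard_category_axioms
 have N: "monoidal_functor W W N" unfolding N_def by (rule comp_monoidal[OF W I_picard W J I_monoidal])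
 have N': "monoidal_functor W W N'" unfolding N'_def by (rule id_monoidal[OF W])
 note eq = universal_triD(3)[OF univ W]
 have eqf: "is_functor (Hom_ten W W) (det_tri_cat T W) \<lparr>FO = (%M. postcomp_tri T W M g), FA = whisker (Obj T) (%M. postcomp_tri T W M g) g\<rparr>"
  using eq by (simp add: is_equivalence_def)
 have o: "N:Obj (Hom_ten W W)" "N':Obj (Hom_ten W W)" using N N' by (simp_all add: Hom_ten_def nat_cat_def)
 have p: "det_tri T W (postcomp_tri T W N g)" "det_tri T W (postcomp_tri T W N' g)"
  using functorD(3)[OF eqf o(1)] functorD(3)[OF eqf o(2)] by (simp_all add: det_tri_cat_def nat_cat_def)
 define ka where "ka = (\<lambda>X\<in>Obj T. al X o[W] FA M (th X))"
 have 1: "is_nat (wide_subcat T (iso_arrows T)) W (postcomp_tri T W N g) (postcomp_tri T W N' g) ka"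
  unfolding is_nat_def
 proof (intro conjI ballI)
  fix x assume "x:Arr (wide_subcat T (iso_arrows T))"
  then have x: "x:iso_arrows T" by simp
  note L = lft_iso[OF x] and i [simp] = iso_obj[OF x]
  have l: "FA lft x:Arr V" "Dom V (FA lft x) = ob (Dom T x)" "Cod V (FA lft x) = ob (Cod T x)" using L by blast+
  have "FA M (th (Cod T x) o[I] FA J (FA g x)) = FA M (FA lft x o[I] th (Dom T x))"
   using natD(4)[OF th_nat(1), of x] x by (simp add: postcomp_tri_def del: I_simps)
  then have e: "FA M (th (Cod T x)) o[W] FA M (FA J (FA g x)) = FA M (FA lft x) o[W] FA M (th (Dom T x))" using l by simp
  have "(al (Cod T x) o[W] FA M (th (Cod T x))) o[W] FA M (FA J (FA g x)) = (al (Cod T x) o[W] FA M (FA lft x)) o[W] FA M (th (Dom T x))"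
   using l e by (simp add: W.assoc)
  also have "... = FA g x o[W] al (Dom T x) o[W] FA M (th (Dom T x))" using L by (simp add: W.assoc)
  finally show "ka (Cod (wide_subcat T (iso_arrows T)) x) o[W] FA (postcomp_tri T W N g) x = FA (postcomp_tri T W N' g) x o[W] ka (Dom (wide_subcat T (iso_arrows T)) x)"
   by (simp add: postcomp_tri_def N_def N'_def ka_def)
 qed (auto simp: ka_def Hom_def postcomp_tri_def N_def N'_def)
 have 2: "det_tri_trans T W (postcomp_tri T W N g) ka (postcomp_tri T W N' g)"
  unfolding det_tri_trans_def
 proof clarify
  fix u v w assume t: "(u, v, w):Tri T"
  note [simp] = tri_obj[OF t]
  let ?X = "Dom T u" and ?Y = "Cod T u" and ?Z = "Cod T v" and ?d = "DS g (u, v, w)" and ?l = "DS lft (u, v, w)"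
  have l: "?l:Arr V" "Dom V ?l = ob ?Y" "Cod V ?l = ob ?X *o[V] ob ?Z"
   "(al ?X *a[W] al ?Z) o[W] MC M (ob ?X) (ob ?Z) o[W] FA M ?l = ?d o[W] al ?Y" using lft_tri[OF t] by blast+
  have "FA M ((th ?X *a[I] th ?Z) o[I] (MC J (FO g ?X) (FO g ?Z) o[I] FA J ?d)) = FA M (?l o[I] th ?Y)"
   using th_nat(2) t unfolding det_tri_trans_def postcomp_tri_def by (fastforce simp del: I_simps)
  then have e: "FA M (th ?X *a[V] th ?Z) o[W] FA M (MC J (FO g ?X) (FO g ?Z)) o[W] FA M (FA J ?d) = FA M ?l o[W] FA M (th ?Y)"
   using l(1-3) by simp
  have "((al ?X o[W] FA M (th ?X)) *a[W] (al ?Z o[W] FA M (th ?Z))) o[W] (MC M (FO J (FO g ?X)) (FO J (FO g ?Z)) o[W] FA M (MC J (FO g ?X) (FO g ?Z))) o[W] FA M (FA J ?d)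
   = (al ?X *a[W] al ?Z) o[W] MC M (ob ?X) (ob ?Z) o[W] (FA M (th ?X *a[V] th ?Z) o[W] FA M (MC J (FO g ?X) (FO g ?Z)) o[W] FA M (FA J ?d))"
   by (simp add: W.assoc W.ten_comp_assoc M_mc)
  also have "... = ((al ?X *a[W] al ?Z) o[W] MC M (ob ?X) (ob ?Z) o[W] FA M ?l) o[W] FA M (th ?Y)" unfolding e using l(1-3) by (simp add: W.assoc)
  also have "... = ?d o[W] al ?Y o[W] FA M (th ?Y)" unfolding l(4) by (simp add: W.assoc)
  finally show "(ka ?X *a[W] ka ?Z) o[W] DS (postcomp_tri T W N g) (u, v, w) = DS (postcomp_tri T W N' g) (u, v, w) o[W] ka ?Y"
   by (simp add: postcomp_tri_def N_def N'_def ka_def)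
 qed
 have "(postcomp_tri T W N g, ka, postcomp_tri T W N' g):Hom (det_tri_cat T W) (postcomp_tri T W N g) (postcomp_tri T W N' g)"
  using p 1 2 by (simp add: Hom_def det_tri_cat_def nat_cat_def)
 then obtain x where "x:Hom (Hom_ten W W) N N'" using equivalence_full[OF eq o] by fastforce
 then obtain mu where mu: "is_nat W W N N' mu" by (auto simp: Hom_def Hom_ten_def nat_cat_def)
 show ?thesis
  using natD[OF mu] by (intro exI[of _ mu]) (force simp: N_def N'_def Hom_def)
qed

text \<open>An automorphism \<open>b\<close> of \<open>Z\<close> is conjugate to \<open>M (J b)\<close>,
 and \<open>\<pi>\<^sub>1\<close> does not see conjugation.\<close>

lemma pi1_surjective: "pi1_map V W M ` carrier (pi1 V) = carrier (pi1 W)"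
proof
 show "pi1_map V W M ` carrier (pi1 V) <= carrier (pi1 W)"
  using pi1_mapD(1)[OF V.picard_category_axioms W.picard_category_axioms mon] by blast
 show "carrier (pi1 W) <= pi1_map V W M ` carrier (pi1 V)"
 proof
  fix b assume b: "b:carrier (pi1 W)"
  obtain mu where mu: "ALL Z:Obj W. mu Z:Hom W (FO M (FO J Z)) Z &
   (ALL b:Hom W Z Z. mu Z o[W] FA M (FA J b) = b o[W] mu Z)" using retraction_ex by blast
  obtain Z where Z [simp]: "Z:Obj W" using W.nonempty by blast
  note [simp] = W.pi1D(1-3)[OF b]
  have m: "mu Z:Arr W" "Dom W (mu Z) = FO M (FO J Z)" "Cod W (mu Z) = Z" "mu Z o[W] FA M (FA J (b Z)) = b Z o[W] mu Z"
   using mu by (auto simp: Hom_def)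
  have "FA J (b Z):Hom V (FO J Z) (FO J Z)" by (simp add: Hom_def)
  from V.pi1_extend[OF _ this] obtain c where c: "c:carrier (pi1 V)" "c (FO J Z) = FA J (b Z)" by auto
  have "mu Z o[W] b (FO M (FO J Z)) = mu Z o[W] FA M (FA J (b Z))"
   using W.pi1_natural[OF b m(1)] m by simp
  then have "b (FO M (FO J Z)) = FA M (c (FO J Z))" unfolding c(2) by (rule W.cancel_left) (use m in simp_all)
  then have "pi1_map V W M c = b"
   by (intro pi1_map_eqI[OF V.picard_category_axioms W.picard_category_axioms mon c(1) b, of "FO J Z"]) simp_all
  then show "b:pi1_map V W M ` carrier (pi1 V)" using c(1) by blast
 qed
qed

end

lemma (in proj_modules) comparison_surjective:
 fixes V W :: "('u, 'u) picard"
 assumes f: "universal_det_exact C (qis R) V f" and gu: "universal_det_tri K W g" and M: "comparison R V f W g M"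
 shows "pi1_map V W M ` carrier (pi1 V) = carrier (pi1 W)"
proof -
 obtain al where al: "(postcomp_exact C W M f, al, induced_det E g):Arr (det_exact_cat C (qis R) W)"
  using comparison_arrow(2)[OF M] by blast
 interpret det_lift V W M K g "FO f" al
  by (rule comparison_lift[OF universal_exactD(1,2)[OF f] universal_triD(1,2)[OF gu] comparison_arrow(1)[OF M] al])
 have "lft:Obj (det_tri_cat K I)" using lft_det by (simp add: det_tri_cat_def nat_cat_def)
 from equivalence_eso[OF universal_triD(3)[OF gu I_picard] this] obtain J th where J: "monoidal_functor W I J"
  and th: "(postcomp_tri K I J g, th, lft):Arr (det_tri_cat K I)"
  by (auto simp: isomorphic_def Hom_ten_def nat_cat_def Hom_def det_tri_cat_def)
 interpret det_section V W M K g "FO f" al J th by unfold_locales (fact J gu th)+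
 show ?thesis by (rule pi1_surjective)
qed

section \<open>A trace form attached to a derivation\<close>

locale derivation = proj_modules R wit for R :: "'r ring" and wit :: "'r list => 'm" +
 fixes D :: "'r => 'r"
 assumes comm: "[|x:carrier R; y:carrier R|] ==> x *[R] y = y *[R] x"
  and D [simp]: "x:carrier R ==> D x:carrier R"
  and D_add: "[|x:carrier R; y:carrier R|] ==> D (x +[R] y) = D x +[R] D y"
  and D_mult: "[|x:carrier R; y:carrier R|] ==> D (x *[R] y) = D x *[R] y +[R] x *[R] D y"
begin

lemma lcomm: "[|x:carrier R; y:carrier R; z:carrier R|] ==> x *[R] (y *[R] z) = y *[R] (x *[R] z)"
 by (metis R.m_assoc comm)

definition mul :: "'r => ('r, 'm) mmap" where
 "mul r = (rg, \<lambda>x\<in>carrier rg. r \<odot>[rg] x, rg)"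

definition rgs :: "('r, 'm) mcpx" where "rgs = \<lparr>cob = (%_. rg), cdif = (%_. undefined)\<rparr>"

text \<open>Elements of \<open>R\<close> act as endomorphisms of the free module of rank one. Storing
 them as such makes sums of ring elements available in a type with addition.\<close>

definition rh :: "'r => ('r, 'm) gop" where "rh r = gm rgs rgs 0 (%_. mul r)"

lemma mul_app [simp]: "x:carrier R ==> fun_of (mul r) (wit [x]) = wit [r *[R] x]"
 by (auto simp: mul_def fun_of_def)

lemma mul_hom: "r:carrier R ==> mul r:Hom E rg rg"
 unfolding Hom_E using rg_fgp
 by (auto simp: mul_def fun_of_def lcomm R.r_distr intro!: mod_homI)

lemma mul_fam: "r:carrier R ==> fam rgs rgs 0 (%_. mul r)"
 using mul_hom by (simp add: fam_def rgs_def)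

lemma rh_add: "[|x:carrier R; y:carrier R|] ==> rh (x +[R] y) = rh x+rh y"
proof -
 assume x: "x:carrier R" and y: "y:carrier R"
 have "mul (x +[R] y) = AddA E (mul x) (mul y)"
  by (rule Hom_E_eqI[OF mul_hom Add_E(1)[OF mul_hom mul_hom]])
   (use x y in \<open>auto simp: Add_E(2)[OF mul_hom mul_hom] R.l_distr\<close>)
 then show ?thesis using gm_add[OF mul_fam mul_fam, OF x y] by (simp add: rh_def)
qed

lemma rh_mult: "[|x:carrier R; y:carrier R|] ==> rh (x *[R] y) = rh x*rh y"
proof -
 assume x: "x:carrier R" and y: "y:carrier R"
 have "mul (x *[R] y) = mul x o[E] mul y"
  by (rule Hom_E_eqI[OF mul_hom Comp_E(1)[OF mul_hom mul_hom]])
   (use x y in \<open>auto simp: Comp_E(2)[OF mul_hom mul_hom] R.m_assoc\<close>)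
 then show ?thesis using gm_comp[OF mul_fam mul_fam, OF y x] by (simp add: rh_def)
qed

lemma rh_inj: "inj_on rh (carrier R)"
proof (rule inj_onI)
 fix x y assume x: "x:carrier R" and y: "y:carrier R" and e: "rh x = rh y"
 have "mul x = mul y" using fun_cong[OF gm_inj[OF mul_fam[OF x] mul_fam[OF y]]] e by (simp add: rh_def)
 then have "fun_of (mul x) (wit [1[R]]) = fun_of (mul y) (wit [1[R]])" by simp
 then show "x = y" using x y by simp
qed

lemma rh_zero [simp]: "rh 0[R] = 0"
 using rh_add[of "0[R]" "0[R]"] by simp

lemma D_zero [simp]: "D 0[R] = 0[R]"
 using D_add[of "0[R]" "0[R]"] R.add.l_cancel_one[of "D 0[R]" "D 0[R]"] by simp

lemma rh_closed: "x:rh ` carrier R ==> y:rh ` carrier R ==> x+y:rh ` carrier R"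
 "0:rh ` carrier R" "x:rh ` carrier R ==> - x:rh ` carrier R"
proof -
 show "x:rh ` carrier R ==> y:rh ` carrier R ==> x+y:rh ` carrier R" by (auto simp: rh_add[symmetric])
 show "0:rh ` carrier R" using imageI[of "0[R]" "carrier R" rh] by simp
 assume "x:rh ` carrier R"
 then obtain r where r: "r:carrier R" "x = rh r" by auto
 have "rh (-[R] r)+rh r = 0" using r by (simp add: rh_add[symmetric] R.l_neg)
 then have "- x = rh (-[R] r)" using r(2) by (metis add.commute minus_unique)
 then show "- x:rh ` carrier R" using r by auto
qed

lemma rh_sum: "(!!i. i:S ==> x i:rh ` carrier R) ==> sum x S:rh ` carrier R"
 by (induction S rule: infinite_finite_induct) (auto intro!: rh_closed simp: rh_closed(2))

text \<open>A chosen dual basis; traces and entrywise derivatives refer to it.\<close>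

definition bas :: "('r, 'm) module => ('m => 'r) list \<times> 'm list" where
 "bas M = (if M = rg then ([inv_into (carrier R) (%r. wit [r])], [wit [1[R]]])
   else SOME p. dual_basis R M (fst p) (snd p))"

abbreviation "nb M \<equiv> length (snd (bas M))"
abbreviation "bx M i \<equiv> snd (bas M) ! i"
abbreviation "bf M i \<equiv> fst (bas M) ! i"

lemma bas: "fgp R M ==> dual_basis R M (fst (bas M)) (snd (bas M))"
proof (cases "M = rg")
 case True
 have i: "inv_into (carrier R) (%r. wit [r]) (wit [x]) = x" if "x:carrier R" for x
  using inv_into_f_f[OF rg_inj that] .
 show ?thesis unfolding True
  by (auto simp: bas_def dual_basis_def linear_form_def i)
next
 case False
 assume "fgp R M"
 then obtain p where "dual_basis R M (fst p) (snd p)" using dual_basis_ex[of M] by fastforce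
 then show ?thesis unfolding bas_def using False by (simp add: someI[of "%p. dual_basis R M (fst p) (snd p)"])
qed

lemma basD:
 assumes "fgp R M" "i < nb M"
 shows "bx M i:carrier M" "linear_form R M (bf M i)" "m:carrier M ==> bf M i m:carrier R"
 using bas[OF assms(1)] assms(2) by (auto simp: dual_basis_def linear_form_def subset_iff)

lemma comb_additive:
 assumes M: "left_module R M" and z: "linear_form R M ze" and s: "!!x y. [|x:carrier R; y:carrier R|] ==> sg (x +[R] y) = (sg x+sg y :: 'z :: ab_group_add)"
 shows "length rs = length xs ==> set rs <= carrier R ==> set xs <= carrier M ==>
  comb M rs xs:carrier M & sg (ze (comb M rs xs)) = (\<Sum>i<length xs. sg (rs ! i *[R] ze (xs ! i)))"
proof (induction rs xs rule: list_induct2)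
 interpret M: left_module R M by fact
 {
  case Nil
  have "sg 0[R] = 0" using s[of "0[R]" "0[R]"] by simp
  then show ?case using linear_form_zero[OF M z] by simp
 next
  case (Cons r rs x xs)
  then have c: "comb M rs xs:carrier M" "x:carrier M" "r:carrier R" "ze x:carrier R" "ze (comb M rs xs):carrier R"
   using z by (auto simp: linear_form_def)
  have "ze (comb M (r # rs) (x # xs)) = r *[R] ze x +[R] ze (comb M rs xs)"
   using z c M.smult_closed by (simp add: linear_form_def)
  then show ?case using c Cons M.smult_closed by (simp add: s sum.lessThan_Suc_shift del: sum.lessThan_Suc)
 }
qed

lemma bas_expand:
 assumes M: "fgp R M" and z: "linear_form R M ze" and m: "m:carrier M"
  and s: "!!x y. [|x:carrier R; y:carrier R|] ==> sg (x +[R] y) = (sg x+sg y :: 'z :: ab_group_add)"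
 shows "sg (ze m) = (\<Sum>i<nb M. sg (bf M i m *[R] ze (bx M i)))"
proof -
 note b = bas[OF M, unfolded dual_basis_def]
 have "m = comb M (map (%xi. xi m) (fst (bas M))) (snd (bas M))" using b m by blast
 moreover have "set (map (%xi. xi m) (fst (bas M))) <= carrier R" using b m by (auto simp: linear_form_def)
 ultimately show ?thesis
  using comb_additive[of M ze sg "map (%xi. xi m) (fst (bas M))" "snd (bas M)", OF fgp_module[OF M] z s] b by simp
qed

text \<open>The matrix of \<open>f\<close> with respect to the dual bases. The modules are only
 projective, so the matrix of an identity is an idempotent and not the unit matrix.\<close>

definition ent :: "('r, 'm) mmap => nat => nat => 'r" where
 "ent f i j = bf (Cod E f) i (fun_of f (bx (Dom E f) j))"

text \<open>This is \<open>tr (a D f)\<close>, computed with the matrices of \<open>a\<close> and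
 \<open>f\<close>.\<close>

definition lam :: "('r, 'm) mmap => ('r, 'm) mmap => ('r, 'm) gop" where
 "lam a f = (\<Sum>i<nb (Dom E f). \<Sum>j<nb (Cod E f). rh (ent a i j)*rh (D (ent f j i)))"

lemma hom_simps: "f:Hom E M N ==> Dom E f = M" "f:Hom E M N ==> Cod E f = N" "f:Hom E M N ==> fgp R M" "f:Hom E M N ==> fgp R N"
 by (auto simp: Hom_def Hom_E) (auto simp: Rproj_def)

lemma ent_closed: "f:Hom E M N ==> i < nb N ==> j < nb M ==> ent f i j:carrier R"
 using hom_simps[of f M N] fun_of_closed basD by (simp add: ent_def)

lemma ent_add: "[|f:Hom E M N; g:Hom E M N; i < nb N; j < nb M|] ==> ent (AddA E f g) i j = ent f i j +[R] ent g i j"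
 using hom_simps[of f M N] hom_simps[of g M N] hom_simps[OF Add_E(1)[of f M N g]] basD[of N i] basD[of M j] fun_of_closed[of f M N] fun_of_closed[of g M N]
 by (simp add: ent_def Add_E(2) linear_form_def)

lemma ent_comp:
 assumes f: "f:Hom E M N" and g: "g:Hom E N L" and ij: "i < nb L" "j < nb M"
  and s: "!!x y. [|x:carrier R; y:carrier R|] ==> sg (x +[R] y) = (sg x+sg y :: 'z :: ab_group_add)"
 shows "sg (ent (g o[E] f) i j) = (\<Sum>k<nb N. sg (ent f k j *[R] ent g i k))"
proof -
 note h [simp] = hom_simps[OF f] hom_simps[OF g] hom_simps[OF Comp_E(1)[OF f g]]
 note l = basD(2)[OF h(8) ij(1), unfolded linear_form_def]
 have x: "bx M j:carrier M" using basD(1)[OF h(3) ij(2)] .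
 have gm: "fun_of g:mod_hom R N L" using g by (simp add: Hom_E)
 have "linear_form R N (%x. bf L i (fun_of g x))"
  using l fun_of_closed[OF g] mod_homD(2,3)[OF gm] by (auto simp: linear_form_def)
 from bas_expand[OF h(4) this fun_of_closed[OF f x] s]
 show ?thesis by (simp add: ent_def Comp_E(2)[OF f g x])
qed

text \<open>The entrywise derivative satisfies the Leibniz rule for matrix products, and the trace is
 cyclic because \<open>R\<close> is commutative.\<close>

lemma lam_cocycle:
 assumes f: "f:Hom E M N" and g: "g:Hom E N L" and a: "a:Hom E L M"
 shows "lam a (g o[E] f) = lam (f o[E] a) g+lam (a o[E] g) f"
proof -
 note [simp] = hom_simps[OF f] hom_simps[OF g] hom_simps[OF Comp_E(1)[OF f g]]
 have c: "ent a i k:carrier R" "ent f j i:carrier R" "ent g k j:carrier R" if "i < nb M" "j < nb N" "k < nb L" for i j k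
  using ent_closed f g a that by blast+
 have "lam a (g o[E] f) = (\<Sum>i<nb M. \<Sum>k<nb L. rh (ent a i k)*rh (D (ent (g o[E] f) k i)))" by (simp add: lam_def)
 also have "... = (\<Sum>i<nb M. \<Sum>k<nb L. \<Sum>j<nb N. rh (ent a i k)*(rh (D (ent f j i))*rh (ent g k j))+rh (ent a i k)*(rh (ent f j i)*rh (D (ent g k j))))"
  using ent_comp[OF f g, of _ _ "%x. rh (D x)"] c by (simp add: D_add rh_add D_mult rh_mult sum_distrib_left distrib_left)
 also have "... = (\<Sum>i<nb M. \<Sum>k<nb L. \<Sum>j<nb N. rh (ent a i k)*(rh (D (ent f j i))*rh (ent g k j))) +
   (\<Sum>i<nb M. \<Sum>k<nb L. \<Sum>j<nb N. rh (ent a i k)*(rh (ent f j i)*rh (D (ent g k j))))"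
  by (simp add: sum.distrib)
 also have "(\<Sum>i<nb M. \<Sum>k<nb L. \<Sum>j<nb N. rh (ent a i k)*(rh (D (ent f j i))*rh (ent g k j))) = lam (a o[E] g) f"
 proof -
  have "lam (a o[E] g) f = (\<Sum>i<nb M. \<Sum>j<nb N. \<Sum>k<nb L. rh (ent g k j)*rh (ent a i k)*rh (D (ent f j i)))"
   using ent_comp[OF g a, of _ _ rh] c by (simp add: lam_def rh_add rh_mult sum_distrib_right)
  also have "... = (\<Sum>i<nb M. \<Sum>j<nb N. \<Sum>k<nb L. rh (ent a i k)*(rh (D (ent f j i))*rh (ent g k j)))"
   using c by (intro sum.cong refl) (simp add: rh_mult[symmetric] comm lcomm R.m_assoc)
  also have "... = (\<Sum>i<nb M. \<Sum>k<nb L. \<Sum>j<nb N. rh (ent a i k)*(rh (D (ent f j i))*rh (ent g k j)))"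
   by (intro sum.cong refl sum.swap)
  finally show ?thesis ..
 qed
 also have "(\<Sum>i<nb M. \<Sum>k<nb L. \<Sum>j<nb N. rh (ent a i k)*(rh (ent f j i)*rh (D (ent g k j)))) = lam (f o[E] a) g"
 proof -
  have "lam (f o[E] a) g = (\<Sum>j<nb N. \<Sum>k<nb L. \<Sum>i<nb M. rh (ent a i k)*(rh (ent f j i)*rh (D (ent g k j))))"
   using ent_comp[OF a f, of _ _ rh] c by (simp add: lam_def rh_add rh_mult sum_distrib_right ma)
  also have "... = (\<Sum>j<nb N. \<Sum>i<nb M. \<Sum>k<nb L. rh (ent a i k)*(rh (ent f j i)*rh (D (ent g k j))))"
   by (intro sum.cong refl sum.swap)
  also have "... = (\<Sum>i<nb M. \<Sum>j<nb N. \<Sum>k<nb L. rh (ent a i k)*(rh (ent f j i)*rh (D (ent g k j))))" by (rule sum.swap)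
  also have "... = (\<Sum>i<nb M. \<Sum>k<nb L. \<Sum>j<nb N. rh (ent a i k)*(rh (ent f j i)*rh (D (ent g k j))))"
   by (intro sum.cong refl sum.swap)
  finally show ?thesis ..
 qed
 finally show ?thesis by (simp add: add.commute)
qed

lemma lam_add:
 assumes "f:Hom E M N" "g:Hom E M N" "a:Hom E N M" "b:Hom E N M"
 shows "lam (AddA E a b) f = lam a f+lam b f" "lam a (AddA E f g) = lam a f+lam a g"
 using assms hom_simps[OF assms(1)] hom_simps[OF assms(2)] hom_simps[OF Add_E(1)[OF assms(1,2)]]
 by (simp_all add: lam_def ent_add ent_closed rh_add D_add alg sum.distrib)

lemma lam_zero:
 assumes f: "f:Hom E M N" and z: "zero_object E M"
 shows "lam a f = 0"
proof -
 note h = hom_simps[OF f]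
 have "ent f j i = 0[R]" if "i < nb M" "j < nb N" for i j
 proof -
  have "bx M i = 0[M]" using basD(1)[OF h(3) that(1)] z by (simp add: zero_object_E)
  moreover have "fun_of f 0[M] = 0[N]" using mod_hom_zero f fgp_group[OF h(3)] fgp_group[OF h(4)] by (auto simp: Hom_E)
  ultimately show ?thesis using linear_form_zero[OF fgp_module[OF h(4)] basD(2)[OF h(4) that(2)]] h by (simp add: ent_def)
 qed
 then show ?thesis by (simp add: lam_def h)
qed

lemma lam_closed: "f:Hom E M N ==> a:Hom E N M ==> lam a f:rh ` carrier R"
 unfolding lam_def using hom_simps[of f M N] ent_closed[of f M N] ent_closed[of a N M]
 by (auto intro!: rh_sum simp: rh_mult[symmetric])

lemma lam_mul: "[|x:carrier R; y:carrier R|] ==> lam (mul x) (mul y) = rh (x *[R] D y)"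
proof -
 assume x: "x:carrier R" and y: "y:carrier R"
 have "ent (mul z) 0 0 = z" if "z:carrier R" for z
  using that hom_simps[OF mul_hom[OF that]] inv_into_f_f[OF rg_inj, of z] by (simp add: ent_def bas_def)
 then show ?thesis using x y hom_simps[OF mul_hom[OF y]] by (simp add: lam_def bas_def rh_mult)
qed

end

section \<open>The trace form on graded maps\<close>

definition alt :: "int => 'z :: ab_group_add => 'z" where
 "alt n x = (if even n then x else - x)"

lemma alt_simps: "alt n (x+y) = alt n x+alt n y" "alt n (- x) = - alt n x" "alt n 0 = 0" "alt 0 x = x" "alt 1 x = - x" "alt (-1) x = - x"
  "alt k (sum h S) = (\<Sum>n\<in>S. alt k (h n))" "alt k (alt n x) = alt (n+k) x"
 by (auto simp: alt_def sum_negf)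

context derivation
begin

abbreviation supp :: "('r, 'm) mcpx => int set" where "supp X \<equiv> {n. ~ zero_object E (cob X n)}"

text \<open>The supertrace version of \<open>lam\<close>; the sum is over the finitely many degrees in
 which \<open>X\<close> is not zero.\<close>

definition Lam :: "('r, 'm) mcpx => ('r, 'm) mcpx => int => ('r, 'm) gop => ('r, 'm) gop => ('r, 'm) gop" where
 "Lam X Y k s f = (\<Sum>n\<in>supp X. alt n (lam (fm Y X (-k) s (n+k)) (fm X Y k f n)))"

lemma fm_hom: "f:H X Y k ==> fm X Y k f n:Hom E (cob X n) (cob Y (n+k))"
 using famD(1)[OF fm(1)] .

lemma fm_hom_back: "s:H Y X (-k) ==> fm Y X (-k) s (n+k):Hom E (cob Y (n+k)) (cob X n)"
 using fm_hom[of s Y X "-k" "n+k"] by simp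

lemma Lam_eq: "[|f:H X Y k; finite S; supp X <= S|] ==> Lam X Y k s f = (\<Sum>n\<in>S. alt n (lam (fm Y X (-k) s (n+k)) (fm X Y k f n)))"
 unfolding Lam_def by (rule sum.mono_neutral_left) (auto simp: lam_zero[OF fm_hom] alt_simps)

lemma Lam_add1: "[|f:H X Y k; s:H Y X (-k); s':H Y X (-k)|] ==> Lam X Y k (s+s') f = Lam X Y k s f+Lam X Y k s' f"
 by (simp add: Lam_def fm_add lam_add(1)[OF fm_hom fm_hom fm_hom_back fm_hom_back] alt_simps sum.distrib)

lemma Lam_add2: "[|f:H X Y k; f':H X Y k; s:H Y X (-k)|] ==> Lam X Y k s (f+f') = Lam X Y k s f+Lam X Y k s f'"
 by (simp add: Lam_def fm_add lam_add(2)[OF fm_hom fm_hom fm_hom_back fm_hom_back] alt_simps sum.distrib)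

lemma Lam_zero: "[|f:H X Y k|] ==> Lam X Y k 0 f = 0" "[|s:H Y X (-k)|] ==> Lam X Y k s 0 = 0"
proof -
 assume f: "f:H X Y k"
 have "0:H Y X (-k)" using H_zero H_gob[OF f] by blast
 then show "Lam X Y k 0 f = 0" using Lam_add1[OF f, of 0 0] by simp
next
 assume s: "s:H Y X (-k)"
 have "0:H X Y k" using H_zero H_gob[OF s] by blast
 then show "Lam X Y k s 0 = 0" using Lam_add2[of 0 X Y k 0 s] s by simp
qed

lemma Lam_neg: "[|f:H X Y k; s:H Y X (-k)|] ==> Lam X Y k (- s) f = - Lam X Y k s f"
 "[|f:H X Y k; s:H Y X (-k)|] ==> Lam X Y k s (- f) = - Lam X Y k s f"
proof -
 assume f: "f:H X Y k" and s: "s:H Y X (-k)"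
 show "Lam X Y k (- s) f = - Lam X Y k s f"
  using Lam_add1[OF f s H_neg[OF s]] Lam_zero(1)[OF f] by (simp add: eq_neg_iff_add_eq_0 add.commute)
 show "Lam X Y k s (- f) = - Lam X Y k s f"
  using Lam_add2[OF f H_neg[OF f] s] Lam_zero(2)[OF s] by (simp add: eq_neg_iff_add_eq_0 add.commute)
qed

lemma Lam_diff1: "[|f:H X Y k; s:H Y X (-k); s':H Y X (-k)|] ==> Lam X Y k (s - s') f = Lam X Y k s f - Lam X Y k s' f"
 using Lam_add1[of f X Y k s "- s'"] H_neg[of s' Y X "-k"] Lam_neg(1) by simp

lemma Lam_cocycle:
 assumes f: "f:H X Y k" and g: "g:H Y Z l" and a: "a:H Z X (-(k+l))" and X: "cpx X" and Y: "cpx Y" and m: "m = k+l"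
 shows "Lam X Z m a (g*f) = alt k (Lam Y Z l (f*a) g)+Lam X Y k (a*g) f"
proof -
 let ?S = "supp X \<union> (%n. n - k) ` supp Y"
 have S: "finite ?S" using cpxD(5)[OF X] cpxD(5)[OF Y] by simp
 have S': "supp Y <= (%n. n+k) ` ?S" by force
 have fa: "fm Z Y (-l) (f*a) (n+k+l) = fm X Y k f n o[E] fm Z X (-(k+l)) a (n+(k+l))" for n
  using fun_cong[OF fm_mult[OF a f], of "n+k+l"] by (simp add: alg)
 have ag: "fm Y X (-k) (a*g) (n+k) = fm Z X (-(k+l)) a (n+(k+l)) o[E] fm Y Z l g (n+k)" for n
  using fun_cong[OF fm_mult[OF g a], of "n+k"] by (simp add: alg)
 have gf: "fm X Z (k+l) (g*f) n = fm Y Z l g (n+k) o[E] fm X Y k f n" for n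
  using fun_cong[OF fm_mult[OF f g], of n] .
 have "Lam X Z m a (g*f) = (\<Sum>n\<in>?S. alt n (lam (fm Z X (-(k+l)) a (n+(k+l))) (fm Y Z l g (n+k) o[E] fm X Y k f n)))"
  unfolding m by (subst Lam_eq[OF H_mult[OF f g refl] S]) (simp_all add: gf)
 also have "... = (\<Sum>n\<in>?S. alt n (lam (fm Z Y (-l) (f*a) (n+k+l)) (fm Y Z l g (n+k)))+alt n (lam (fm Y X (-k) (a*g) (n+k)) (fm X Y k f n)))"
 proof (rule sum.cong[OF refl])
  fix n
  have "fm Y Z l g (n+k):Hom E (cob Y (n+k)) (cob Z (n+(k+l)))" using fm_hom[OF g, of "n+k"] by (simp add: add.assoc)
  from lam_cocycle[OF fm_hom[OF f] this fm_hom_back[OF a]]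
  show "alt n (lam (fm Z X (-(k+l)) a (n+(k+l))) (fm Y Z l g (n+k) o[E] fm X Y k f n)) =
   alt n (lam (fm Z Y (-l) (f*a) (n+k+l)) (fm Y Z l g (n+k)))+alt n (lam (fm Y X (-k) (a*g) (n+k)) (fm X Y k f n))"
   unfolding fa ag by (simp add: alt_simps)
 qed
 also have "... = (\<Sum>n\<in>?S. alt n (lam (fm Z Y (-l) (f*a) (n+k+l)) (fm Y Z l g (n+k))))+Lam X Y k (a*g) f"
  by (subst Lam_eq[OF f S]) (simp_all add: sum.distrib)
 also have "(\<Sum>n\<in>?S. alt n (lam (fm Z Y (-l) (f*a) (n+k+l)) (fm Y Z l g (n+k)))) =
   (\<Sum>n\<in>(%n. n+k) ` ?S. alt k (alt n (lam (fm Z Y (-l) (f*a) (n+l)) (fm Y Z l g n))))"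
  by (subst sum.reindex) (auto simp: alt_def inj_on_def intro!: sum.cong)
 also have "... = alt k (Lam Y Z l (f*a) g)"
  by (subst Lam_eq[OF g finite_imageI[OF S] S']) (simp add: alt_simps)
 finally show ?thesis .
qed

lemma Lam_uno: "a:H X X 0 ==> cpx X ==> Lam X X 0 a (uno X) = 0"
proof -
 assume a: "a:H X X 0" and X: "cpx X"
 note u = H_uno[OF cpxD(1)[OF X]]
 show ?thesis using Lam_cocycle[OF u u _ X X, of a 0] a unl[OF a] unr[OF a] unl[OF u] by (simp add: alt_simps)
qed

lemma Lam_closed: "f:H X Y k ==> s:H Y X (-k) ==> Lam X Y k s f:rh ` carrier R"
 unfolding Lam_def using lam_closed[OF fm_hom fm_hom_back] by (auto intro!: rh_sum rh_closed(3) simp: alt_def)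

end

section \<open>The logarithmic derivative of a quasi-isomorphism\<close>

context derivation
begin

text \<open>The pairing of \<open>a\<close> with \<open>d d = 0\<close> vanishes; expand it by the
 cocycle identity.\<close>

lemma Lam_commutator:
 assumes X: "cpx X" and a: "a:H X X (-2)"
 shows "Lam X X 1 (dd X*a - a*dd X) (dd X) = 0"
proof -
 note d = cpxD(3)[OF X]
 have m: "dd X*a:H X X (-1)" "a*dd X:H X X (-1)" using H_mult[OF a d] H_mult[OF d a] by simp_all
 have "Lam X X 2 a (dd X*dd X) = alt 1 (Lam X X 1 (dd X*a) (dd X))+Lam X X 1 (a*dd X) (dd X)"
  by (rule Lam_cocycle[OF d d _ X X]) (use a in simp_all)
 then show ?thesis
  unfolding cpxD(4)[OF X] Lam_diff1[OF d m] alt_simps(5) using Lam_zero(2)[OF a[folded numeral_One]] by simp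
qed

lemma Lam_homotopy:
 assumes F: "chain X Y F" and a: "a:H Y X (-1)"
 shows "Lam X Y 0 (dd X*a+a*dd Y) F = Lam X X 1 (a*F) (dd X) - Lam Y Y 1 (F*a) (dd Y)"
proof -
 note X = chainD(1)[OF F] and Y = chainD(2)[OF F] and f = chainD(3)[OF F]
 note d = cpxD(3)[OF X] cpxD(3)[OF Y]
 have m: "dd X*a:H Y X 0" "a*dd Y:H Y X 0" using H_mult[OF a d(1)] H_mult[OF d(2) a] by simp_all
 have "Lam X Y 1 a (dd Y*F) = Lam Y Y 1 (F*a) (dd Y)+Lam X Y 0 (a*dd Y) F"
  using Lam_cocycle[OF f d(2) _ X Y, of a 1] a by (simp add: alt_simps(4-6))
 moreover have "Lam X Y 1 a (F*dd X) = - Lam X Y 0 (dd X*a) F+Lam X X 1 (a*F) (dd X)"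
  using Lam_cocycle[OF d(1) f _ X X, of a 1] a by (simp add: alt_simps(4-6))
 ultimately show ?thesis using Lam_add1[of F X Y 0 "dd X*a" "a*dd Y"] m f by (simp add: chainD(4)[OF F] alg)
qed

text \<open>For an isomorphism this is \<open>tr (F\<^sup>-\<^sup>1 D F)\<close>. The homotopies enter
 because \<open>g F\<close> and \<open>F g\<close> are identities only up to \<open>d h + h d\<close>
 and \<open>d h' + h' d\<close>.\<close>

definition tor where
 "tor X Y F g h h' = Lam X Y 0 g F - Lam X X 1 h (dd X) - Lam Y Y 1 h' (dd Y)"

text \<open>For \<open>F = 1 + d k + k d\<close> all terms of the sum can be paired by the cocycle
 identity; the second order homotopy \<open>m\<close> is what makes the remaining terms cancel.\<close>

lemma tor_homotopic_uno:
 assumes hi: "hinv X X F g h h' m" and k: "k:H X X (-1)" and F: "F = uno X+dd X*k+k*dd X"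
 shows "tor X X F g h h' = 0"
proof -
 have g: "chain X X g" and h: "h:H X X (-1)" "h':H X X (-1)" and m: "m:H X X (-2)"
  and e: "g*F = uno X+dd X*h+h*dd X" "F*g = uno X - dd X*h' - h'*dd X" "F*h+h'*F+dd X*m - m*dd X = 0"
  using hi by (auto simp: hinv_def)
 note X = chainD(1)[OF g] and gH = chainD(3)[OF g] and d = cpxD(3)[OF chainD(1)[OF g]]
 note u = unl[OF gH] unr[OF gH] unl[OF h(1)] unr[OF h(2)] unl[OF k] unr[OF k] unl[OF d]
 note cm = chainD(4)[OF g] msub[OF chainD(4)[OF g]]
 define w where "w = m+k*h - h'*k - k*g*k"
 have dk: "dd X*k:H X X 0" "k*dd X:H X X 0" using H_mult[OF k d] H_mult[OF d k] by simp_all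
 have gk: "g*k:H X X (-1)" "k*g:H X X (-1)" using H_mult[OF k gH] H_mult[OF gH k] by simp_all
 have wH: "w:H X X (-2)"
  unfolding w_def using m H_mult[OF h(1) k] H_mult[OF k h(2)] H_mult[OF k gk(2)] by (intro H_add H_diff) simp_all
 let ?p = "g*F - (uno X+dd X*h+h*dd X)" and ?q = "F*g - (uno X - dd X*h' - h'*dd X)"
 have "dd X*w - w*dd X - (g*k - k*g - h - h') = (F*h+h'*F+dd X*m - m*dd X)+k*?p - ?q*k"
  unfolding w_def F by (simp add: alg cm u u[THEN msub])
 then have w: "dd X*w - w*dd X = g*k - k*g - h - h'" unfolding e by simp
 have 1: "Lam X X 0 g (uno X) = 0" by (rule Lam_uno[OF gH X])
 have 2: "Lam X X 0 g (dd X*k) = - Lam X X 1 (k*g) (dd X)+Lam X X (-1) (g*dd X) k"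
  using Lam_cocycle[OF k d _ X X, of g 0] gH by (simp add: alt_simps(4-6))
 have 3: "Lam X X 0 g (k*dd X) = - Lam X X (-1) (g*dd X) k+Lam X X 1 (g*k) (dd X)"
  using Lam_cocycle[OF d k _ X X, of g 0] gH by (simp add: alt_simps(4-6) cm)
 have "Lam X X 0 g F = Lam X X 1 (g*k) (dd X) - Lam X X 1 (k*g) (dd X)"
  unfolding F using Lam_add2[OF H_add[OF cpxD(6)[OF X] dk(1)] dk(2), of g] Lam_add2[OF cpxD(6)[OF X] dk(1), of g] gH 1 2 3 by simp
 also have "... = Lam X X 1 (g*k - k*g) (dd X)" using Lam_diff1[OF d, of "g*k" "k*g"] gk by simp
 finally have "tor X X F g h h' = Lam X X 1 (g*k - k*g - h - h') (dd X)"
  unfolding tor_def using Lam_diff1[OF d, of "g*k - k*g - h" h'] Lam_diff1[OF d, of "g*k - k*g" h] gk h H_diff by simp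
 then show ?thesis using Lam_commutator[OF X wH] w by simp
qed

text \<open>The composite of homotopy inverses carries the composite homotopies. The mixed terms of the
 trace form cancel by the cocycle identity, using the compatibility expressed by \<open>m\<close> and
 \<open>m2\<close>.\<close>

lemma hinv_comp:
 assumes a: "hinv X Y f g h h' m" and b: "hinv Y Z f2 g2 h2 h2' m2"
 shows "hinv X Z (f2*f) (g*g2) (h+g*h2*f) (h2'+f2*h'*g2) (f2*m+m2*f+f2*h'*h2*f)"
  "tor X Z (f2*f) (g*g2) (h+g*h2*f) (h2'+f2*h'*g2) = tor X Y f g h h'+tor Y Z f2 g2 h2 h2'"
proof -
 have f: "chain X Y f" and g: "chain Y X g" and h: "h:H X X (-1)" "h':H Y Y (-1)" and m: "m:H X Y (-2)"
  and e: "g*f = uno X+dd X*h+h*dd X" "f*g = uno Y - dd Y*h' - h'*dd Y" "f*h+h'*f+dd Y*m - m*dd X = 0"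
  using a by (auto simp: hinv_def)
 have f2: "chain Y Z f2" and g2: "chain Z Y g2" and h2: "h2:H Y Y (-1)" "h2':H Z Z (-1)" and m2: "m2:H Y Z (-2)"
  and e2: "g2*f2 = uno Y+dd Y*h2+h2*dd Y" "f2*g2 = uno Z - dd Z*h2' - h2'*dd Z" "f2*h2+h2'*f2+dd Z*m2 - m2*dd Y = 0"
  using b by (auto simp: hinv_def)
 note X = chainD(1)[OF f] and Y = chainD(2)[OF f] and Z = chainD(2)[OF f2]
 note fH = chainD(3)[OF f] and gH = chainD(3)[OF g] and f2H = chainD(3)[OF f2] and g2H = chainD(3)[OF g2]
 note d = cpxD(3)[OF X] cpxD(3)[OF Y] cpxD(3)[OF Z]
 note cm = chainD(4)[OF f] chainD(4)[OF g] chainD(4)[OF f2] chainD(4)[OF g2]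
 note cm' = cm cm[THEN msub]
 note u = unl[OF fH] unl[OF g2H] unl[OF h2(1)] unr[OF h(2)]
 note us = u u[THEN msub]
 have gh2: "g*h2:H Y X (-1)" and h'g2: "h'*g2:H Z Y (-1)" using H_mult[OF h2(1) gH] H_mult[OF g2H h(2)] by simp_all
 have A: "g*h2*f:H X X (-1)" "f2*h'*g2:H Z Z (-1)"
  using H_mult[OF fH gh2] H_mult[OF h'g2 f2H] by (simp_all add: ma)
 have hh: "h'*h2:H Y Y (-2)" using H_mult[OF h2(1) h(2)] by simp
 have M: "f2*m+m2*f+f2*h'*h2*f:H X Z (-2)"
  using H_mult[OF m f2H] H_mult[OF fH m2] H_mult[OF H_mult[OF fH hh refl] f2H] by (intro H_add) (simp_all add: ma)
 have G: "chain Z X (g*g2)" "chain X Z (f2*f)" using chain_mult f g f2 g2 by blast+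
 have 1: "(g*g2)*(f2*f) = g*(g2*f2)*f" "(f2*f)*(g*g2) = f2*(f*g)*g2" by (simp_all add: ma)
 have "f2*f*(h+g*h2*f)+(h2'+f2*h'*g2)*(f2*f)+dd Z*(f2*m+m2*f+f2*h'*h2*f)
   - (f2*m+m2*f+f2*h'*h2*f)*dd X =
  f2*(f*h+h'*f+dd Y*m - m*dd X)+(f2*h2+h2'*f2+dd Z*m2 - m2*dd Y)*f +
  (f2*(f*g - (uno Y - dd Y*h' - h'*dd Y))*h2*f+f2*h'*(g2*f2 - (uno Y+dd Y*h2+h2*dd Y))*f)"
  by (simp add: alg cm' us)
 also have "... = 0" unfolding e e2 by simp
 finally show "hinv X Z (f2*f) (g*g2) (h+g*h2*f) (h2'+f2*h'*g2) (f2*m+m2*f+f2*h'*h2*f)"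
  unfolding hinv_def using G H_add[OF h(1) A(1)] H_add[OF h2(2) A(2)] M
  unfolding 1 e(1,2) e2(1,2) by (simp add: alg cm' us e[simplified alg] e2[simplified alg])
 have p: "Lam X Z 0 (g*g2) (f2*f) = Lam Y Z 0 (f*(g*g2)) f2+Lam X Y 0 (g*g2*f2) f"
  using Lam_cocycle[OF fH f2H _ X Y, of "g*g2" 0] chainD(3)[OF G(1)] by (simp add: alt_simps(4-6))
 have v1: "f*(g*g2) = g2 - (dd Y*(h'*g2)+h'*g2*dd Z)"
  by (simp add: ma[symmetric] e(2)) (simp add: alg cm' us)
 have v2: "g*g2*f2 = g+(dd X*(g*h2)+g*h2*dd Y)"
  by (simp add: ma e2(1)) (simp add: alg cm' unr[OF gH])
 have q: "dd Y*(h'*g2)+h'*g2*dd Z:H Z Y 0" "dd X*(g*h2)+g*h2*dd Y:H Y X 0"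
  using H_mult[OF h'g2 d(2)] H_mult[OF d(3) h'g2] H_mult[OF gh2 d(1)] H_mult[OF d(2) gh2] by (intro H_add; simp)+
 have p1: "Lam Y Z 0 (f*(g*g2)) f2 = Lam Y Z 0 g2 f2 - (Lam Y Y 1 (h'*g2*f2) (dd Y) - Lam Z Z 1 (f2*h'*g2) (dd Z))"
  unfolding v1 using Lam_diff1[OF f2H, of g2 "dd Y*(h'*g2)+h'*g2*dd Z"] g2H q Lam_homotopy[OF f2 h'g2] by (simp add: ma)
 have p2: "Lam X Y 0 (g*g2*f2) f = Lam X Y 0 g f+(Lam X X 1 (g*h2*f) (dd X) - Lam Y Y 1 (f*g*h2) (dd Y))"
  unfolding v2 using Lam_add1[OF fH, of g "dd X*(g*h2)+g*h2*dd Y"] gH q Lam_homotopy[OF f gh2] by (simp add: ma)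
 have B: "h'*g2*f2:H Y Y (-1)" "f*g*h2:H Y Y (-1)"
  using H_mult[OF f2H h'g2] H_mult[OF gh2 fH] by (simp_all add: ma)
 have "h'+h2 - h'*g2*f2 - f*g*h2 = dd Y*(h'*h2) - h'*h2*dd Y"
  by (simp add: ma e2(1)) (simp add: ma[symmetric] e(2), simp add: alg us)
 then have "Lam Y Y 1 (h'+h2 - h'*g2*f2 - f*g*h2) (dd Y) = 0" using Lam_commutator[OF Y hh] by simp
 then have "Lam Y Y 1 h' (dd Y)+Lam Y Y 1 h2 (dd Y) - Lam Y Y 1 (h'*g2*f2) (dd Y) - Lam Y Y 1 (f*g*h2) (dd Y) = 0"
  using Lam_diff1[OF d(2), of "h'+h2 - h'*g2*f2" "f*g*h2"] Lam_diff1[OF d(2), of "h'+h2" "h'*g2*f2"]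
   Lam_add1[OF d(2), of h' h2] B h(2) h2(1) H_add H_diff by simp
 then show "tor X Z (f2*f) (g*g2) (h+g*h2*f) (h2'+f2*h'*g2) = tor X Y f g h h'+tor Y Z f2 g2 h2 h2'"
  unfolding tor_def p p1 p2 using Lam_add1[OF d(1), of h "g*h2*f"] Lam_add1[OF d(3), of h2' "f2*h'*g2"] A h h2
  by (simp add: alg)
qed

lemma hinv_qis:
 assumes "hinv X Y F g h h' m"
 shows "chain X Y F" "cb X Y F:qis R"
proof -
 show F: "chain X Y F" using assms by (simp add: hinv_def)
 have "chain Y X g" using assms by (simp add: hinv_def)
 then show "cb X Y F:qis R" unfolding qis_iff_iso[OF F] kb_iso_iff[OF F] using hinv_heq[OF assms] by blast
qed

lemma hinv_inverse:
 assumes "hinv X Y F g h h' m"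
 shows "EX f k k' l. hinv Y X g f k k' l"
proof (rule qis_hinv)
 show g: "chain Y X g" using assms by (simp add: hinv_def)
 show "cb Y X g:qis R"
  using qis_iff_iso[OF g] kb_iso_iff[OF g] hinv_heq[OF assms] assms by (auto simp: hinv_def)
qed

text \<open>Composing with fixed data for a map in the opposite direction gives a map homotopic to the
 identity, on which the invariant vanishes for every choice; additivity then determines the value.\<close>

lemma tor_unique:
 assumes a: "hinv X Y F g h h' m" and b: "hinv X Y F g2 h2 h2' m2"
 shows "tor X Y F g h h' = tor X Y F g2 h2 h2'"
proof -
 obtain f k k' l where i: "hinv Y X g f k k' l" using hinv_inverse[OF a] by blast
 have h: "h:H X X (-1)" "g*F = uno X+dd X*h+h*dd X" using a by (auto simp: hinv_def)
 show ?thesis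
  using tor_homotopic_uno[OF hinv_comp(1)[OF a i] h] tor_homotopic_uno[OF hinv_comp(1)[OF b i] h]
  unfolding hinv_comp(2)[OF a i] hinv_comp(2)[OF b i] by (metis add_right_cancel)
qed

text \<open>The choice is irrelevant by the preceding lemma.\<close>

definition T where
 "T X Y F = (THE t. EX g h h' m. hinv X Y F g h h' m & t = tor X Y F g h h')"

lemma T_eq: "hinv X Y F g h h' m ==> T X Y F = tor X Y F g h h'"
 unfolding T_def by (rule the_equality) (auto dest: tor_unique)

lemma T_comp:
 assumes "chain X Y F" "cb X Y F:qis R" "chain Y Z G" "cb Y Z G:qis R"
 shows "T X Z (G*F) = T X Y F+T Y Z G"
proof -
 obtain g h h' m g2 h2 h2' m2 where i: "hinv X Y F g h h' m" "hinv Y Z G g2 h2 h2' m2" using qis_hinv assms by metis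
 show ?thesis unfolding T_eq[OF i(1)] T_eq[OF i(2)] T_eq[OF hinv_comp(1)[OF i]] hinv_comp(2)[OF i] ..
qed

lemma T_uno: "cpx X ==> T X X (uno X) = 0"
proof -
 assume X: "cpx X"
 have 0: "0:H X X k" for k using H_zero cpxD(1)[OF X] by blast
 have "hinv X X (uno X) (uno X) 0 0 0" using X chain_uno 0 unl[OF cpxD(6)[OF X]] by (simp add: hinv_def)
 then show ?thesis using T_eq tor_homotopic_uno[OF _ 0] by simp
qed

lemma T_closed: "chain X Y F ==> cb X Y F:qis R ==> T X Y F:rh ` carrier R"
proof -
 assume F: "chain X Y F" "cb X Y F:qis R"
 obtain g h h' m where i: "hinv X Y F g h h' m" using qis_hinv[OF F] by blast
 note X = cpxD(3)[OF chainD(1)[OF F(1)]] and Y = cpxD(3)[OF chainD(2)[OF F(1)]]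
 have "Lam X Y 0 g F:rh ` carrier R" "Lam X X 1 h (dd X):rh ` carrier R" "Lam Y Y 1 h' (dd Y):rh ` carrier R"
  using i chainD(3) by (auto simp: hinv_def intro!: Lam_closed X Y)
 then show ?thesis unfolding T_eq[OF i] tor_def using rh_closed(1)[OF rh_closed(1)[OF _ rh_closed(3)] rh_closed(3)] by simp
qed

end

section \<open>Additivity on short exact sequences\<close>

context derivation
begin

text \<open>The trace form is not additive for block triangular maps because the chosen bases of
 \<open>Y\<close> need not be adapted to the sequence. This term is the logarithmic derivative of the
 change of basis to an adapted one.\<close>

definition dl where "dl X Y Z a b s t = Lam Y Z 0 s b - Lam X Y 0 t a"

text \<open>The failure of additivity for an endomorphism \<open>e\<close> preserving \<open>X\<close>;
 for \<open>e = 1\<close> it is \<open>- dl\<close>.\<close>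

definition defect where "defect X Y Z a b s t e = Lam X Y 0 (t*e) a - Lam Y Z 0 (s*b*e*s) b"

lemma defect_props:
 assumes se: "ses X Y Z a b s t"
 shows "[|e:H Y Y 0; e':H Y Y 0|] ==> defect X Y Z a b s t (e+e') = defect X Y Z a b s t e+defect X Y Z a b s t e'"
  "[|e:H Y Y 0; e':H Y Y 0|] ==> defect X Y Z a b s t (e - e') = defect X Y Z a b s t e - defect X Y Z a b s t e'"
  "defect X Y Z a b s t (uno Y) = - dl X Y Z a b s t"
proof -
 note r = sesD[OF se]
 have m: "t*e:H Y X 0" "s*b*e*s:H Z Y 0" if "e:H Y Y 0" for e
  using H_mult[OF that r(4)] H_mult[OF H_mult[OF r(3) that] H_mult[OF r(9,3)]] by (simp_all add: ma)
 show "[|e:H Y Y 0; e':H Y Y 0|] ==> defect X Y Z a b s t (e+e') = defect X Y Z a b s t e+defect X Y Z a b s t e'"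
  using Lam_add1[OF r(8), of "t*e" "t*e'"] Lam_add1[OF r(9), of "s*b*e*s" "s*b*e'*s"] m[of e] m[of e']
  by (simp add: defect_def distrib_left distrib_right)
 show "[|e:H Y Y 0; e':H Y Y 0|] ==> defect X Y Z a b s t (e - e') = defect X Y Z a b s t e - defect X Y Z a b s t e'"
  using Lam_diff1[OF r(8), of "t*e" "t*e'"] Lam_diff1[OF r(9), of "s*b*e*s" "s*b*e'*s"] m[of e] m[of e']
  by (simp add: defect_def right_diff_distrib left_diff_distrib)
 show "defect X Y Z a b s t (uno Y) = - dl X Y Z a b s t"
  using unr[OF r(4)] unr[OF r(9)] unr[OF r(3)] r(11) by (simp add: defect_def dl_def ma)
qed

text \<open>Write \<open>f\<close> in block form with respect to the splittings and apply the cocycle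
 identity to each block.\<close>

lemma Lam_triangular:
 assumes se: "ses X Y Z a b s t" and se': "ses X' Y' Z' a' b' s' t'"
  and f: "f:H Y Y' k" and g: "g:H Y' Y (-k)"
  and d: "fA:H X X' k" "fC:H Z Z' k" "gA:H X' X (-k)" "gC:H Z' Z (-k)"
  and e: "f*a = a'*fA" "b'*f = fC*b" "g*a' = a*gA" "b*g = gC*b'"
 shows "Lam Y Y' k g f = Lam X X' k gA fA+Lam Z Z' k gC fC
  + alt k (defect X' Y' Z' a' b' s' t' (f*g)) - defect X Y Z a b s t (g*f)"
proof -
 note r = sesD[OF se] and r' = sesD[OF se']
 let ?tg = "t*g" and ?sg = "s*gC" and ?u = "t'*f*s*gC"
 have m: "?tg:H Y' X (-k)" "?sg:H Z' Y (-k)" "?u:H Z' X' 0"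
  using H_mult[OF g r(4)] H_mult[OF d(4) r(3)] H_mult[OF H_mult[OF d(4) r(3) refl] H_mult[OF f r'(4) refl]] by (simp_all add: ma)
 note x = e e[THEN msub] r(10-13) r(10-13)[THEN msub] r'(10-13) r'(10-13)[THEN msub] unl[OF d(3)] unl[OF d(4)] unl[OF d(3), THEN msub] unl[OF d(4), THEN msub]
  unl[OF r(9)] unr[OF d(2)] unr[OF d(2), THEN msub] unl[OF r'(9)] unr[OF d(4)]
 have g': "g = a*?tg+?sg*b'"
  using unl[OF g] unfolding r(14)[symmetric] by (simp add: distrib_right ma e)
 have 1: "Lam X Y' k ?tg (f*a) = Lam Y Y' k (a*?tg) f+Lam X Y 0 (?tg*f) a"
  using Lam_cocycle[OF r(8) f _ r(5,6), of ?tg k] m by (simp add: alt_simps(4))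
 have 2: "Lam X Y' k ?tg (a'*fA) = alt k (Lam X' Y' 0 (fA*?tg) a')+Lam X X' k gA fA"
  using Lam_cocycle[OF d(1) r'(8) _ r(5) r'(5), of ?tg k] m by (simp add: ma x)
 have 3: "Lam Y Z' k ?sg (b'*f) = alt k (Lam Y' Z' 0 (f*?sg) b')+Lam Y Y' k (?sg*b') f"
  using Lam_cocycle[OF f r'(9) _ r(6) r'(6), of ?sg k] m by simp
 have 4: "Lam Y Z' k ?sg (fC*b) = Lam Z Z' k gC fC+Lam Y Z 0 (?sg*fC) b"
  using Lam_cocycle[OF r(9) d(2) _ r(6,7), of ?sg k] m by (simp add: alt_simps(4) x)
 have 5: "Lam Y Y' k g f = Lam Y Y' k (a*?tg) f+Lam Y Y' k (?sg*b') f"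
  by (subst g', rule Lam_add1[OF f]) (use H_mult[OF m(1) r(8)] H_mult[OF r'(9) m(2)] in simp_all)
 have R: "defect X Y Z a b s t (g*f) = Lam X Y 0 (?tg*f) a - Lam Y Z 0 (?sg*fC) b"
  by (simp add: defect_def ma x)
 have 6: "t'*(f*g) = fA*?tg+?u*b'" by (subst g') (simp add: alg x unl[OF d(1)] unl[OF d(1), THEN msub])
 have "f*?sg = (a'*t'+s'*b')*(f*?sg)" unfolding r'(14) using unl[OF H_mult[OF m(2) f refl]] by simp
 also have "... = a'*?u+s'*b'*(f*g)*s'" by (simp add: alg x)
 finally have 7: "f*?sg = a'*?u+s'*b'*(f*g)*s'" .
 have m2: "fA*?tg:H Y' X' 0" "?u*b':H Y' X' 0" "a'*?u:H Z' Y' 0" "s'*b'*(f*g)*s':H Z' Y' 0"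
  using H_mult[OF m(1) d(1)] H_mult[OF r'(9) m(3)] H_mult[OF m(3) r'(8)]
   H_mult[OF H_mult[OF r'(3) H_mult[OF g f refl] refl] H_mult[OF r'(9) r'(3) refl]] by (simp_all add: ma)
 have "Lam X' Z' 0 ?u (b'*a') = Lam Y' Z' 0 (a'*?u) b'+Lam X' Y' 0 (?u*b') a'"
  using Lam_cocycle[OF r'(8,9) _ r'(5,6), of ?u 0] m by (simp add: alt_simps(4))
 then have "Lam Y' Z' 0 (a'*?u) b'+Lam X' Y' 0 (?u*b') a' = 0"
  unfolding r'(13) using Lam_zero(2)[of ?u Z' X' 0] m(3) by simp
 then have 8: "defect X' Y' Z' a' b' s' t' (f*g) = Lam X' Y' 0 (fA*?tg) a' - Lam Y' Z' 0 (f*?sg) b'"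
  unfolding defect_def 6 7 using Lam_add1[OF r'(8), of "fA*?tg" "?u*b'"] Lam_add1[OF r'(9), of "a'*?u" "s'*b'*(f*g)*s'"] m2
  by (simp add: alg)
 have 9: "Lam Y Y' k (a*?tg) f = alt k (Lam X' Y' 0 (fA*?tg) a')+Lam X X' k gA fA - Lam X Y 0 (?tg*f) a"
  using 1 2 unfolding e(1) by (simp add: eq_diff_eq)
 have 10: "Lam Y Y' k (?sg*b') f = Lam Z Z' k gC fC+Lam Y Z 0 (?sg*fC) b - alt k (Lam Y' Z' 0 (f*?sg) b')"
  using 3 4 unfolding e(2) by (simp add: eq_diff_eq add.commute)
 show ?thesis unfolding 5 9 10 R 8 by (simp add: alt_def alg)
qed

text \<open>When the whole homotopy inverse respects the sequences, the defects in the three terms of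
 \<open>T\<close> add up to the defects of the identity.\<close>

lemma T_triangular:
 assumes se: "ses X Y Z a b s t" and se': "ses X' Y' Z' a' b' s' t'"
  and B: "hinv Y Y' be g h h' m" and A: "hinv X X' al gA hA hA' mA" and C: "hinv Z Z' gg gC hC hC' mC"
  and e: "be*a = a'*al" "b'*be = gg*b" "g*a' = a*gA" "b*g = gC*b'"
   "h*a = a*hA" "b*h = hC*b" "h'*a' = a'*hA'" "b'*h' = hC'*b'"
 shows "T Y Y' be+dl X' Y' Z' a' b' s' t' = T X X' al+T Z Z' gg+dl X Y Z a b s t"
proof -
 note r = sesD[OF se] and r' = sesD[OF se']
 have c: "be:H Y Y' 0" "g:H Y' Y 0" "h:H Y Y (-1)" "h':H Y' Y' (-1)" and
  q: "g*be = uno Y+dd Y*h+h*dd Y" "be*g = uno Y' - dd Y'*h' - h'*dd Y'"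
  using B chainD(3) by (auto simp: hinv_def)
 have cA: "al:H X X' 0" "gA:H X' X 0" "hA:H X X (-1)" "hA':H X' X' (-1)" using A chainD(3) by (auto simp: hinv_def)
 have cC: "gg:H Z Z' 0" "gC:H Z' Z 0" "hC:H Z Z (-1)" "hC':H Z' Z' (-1)" using C chainD(3) by (auto simp: hinv_def)
 note d = cpxD(3)[OF r(5)] cpxD(3)[OF r(6)] cpxD(3)[OF r(7)] and d' = cpxD(3)[OF r'(5)] cpxD(3)[OF r'(6)] cpxD(3)[OF r'(7)]
 let ?R = "defect X Y Z a b s t" and ?R' = "defect X' Y' Z' a' b' s' t'"
 have 1: "Lam Y Y' 0 g be = Lam X X' 0 gA al+Lam Z Z' 0 gC gg+?R' (be*g) - ?R (g*be)"
  using Lam_triangular[OF se se' c(1) _ cA(1) cC(1), of g gA gC] c cA cC e by (simp add: alt_simps(4))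
 have 2: "Lam Y Y 1 h (dd Y) = Lam X X 1 hA (dd X)+Lam Z Z 1 hC (dd Z) - ?R (dd Y*h) - ?R (h*dd Y)"
  using Lam_triangular[OF se se d(2) _ d(1,3), of h hA hC] c cA cC e r(15,16) by (simp add: alt_simps(5))
 have 3: "Lam Y' Y' 1 h' (dd Y') = Lam X' X' 1 hA' (dd X')+Lam Z' Z' 1 hC' (dd Z') - ?R' (dd Y'*h') - ?R' (h'*dd Y')"
  using Lam_triangular[OF se' se' d'(2) _ d'(1,3), of h' hA' hC'] c cA cC e r'(15,16) by (simp add: alt_simps(5))
 have hd: "dd Y*h:H Y Y 0" "h*dd Y:H Y Y 0" "dd Y'*h':H Y' Y' 0" "h'*dd Y':H Y' Y' 0"
  using H_mult[OF c(3) d(2)] H_mult[OF d(2) c(3)] H_mult[OF c(4) d'(2)] H_mult[OF d'(2) c(4)] by simp_all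
 have "?R (g*be) = - dl X Y Z a b s t+?R (dd Y*h)+?R (h*dd Y)"
  unfolding q using defect_props[OF se] cpxD(6)[OF r(6)] hd H_add by simp
 moreover have "?R' (be*g) = - dl X' Y' Z' a' b' s' t' - ?R' (dd Y'*h') - ?R' (h'*dd Y')"
  unfolding q using defect_props[OF se'] cpxD(6)[OF r'(6)] hd H_diff by simp
 ultimately show ?thesis unfolding T_eq[OF A] T_eq[OF B] T_eq[OF C] tor_def 1 2 3 by (simp add: alg)
qed

text \<open>Two splittings differ by a map \<open>u : Z \<rightarrow> X\<close>, and \<open>a u b\<close>
 has square zero because \<open>b a = 0\<close>.\<close>

lemma dl_split:
 assumes se: "ses X Y Z a b s t" and se': "ses X Y Z a b s' t'"
 shows "dl X Y Z a b s t = dl X Y Z a b s' t'"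
proof -
 note r = sesD[OF se] and r' = sesD[OF se']
 let ?u = "t*s'"
 have u: "?u:H Z X 0" "a*?u:H Z Y 0" "?u*b:H Y X 0"
  using H_mult[OF r'(3) r(4)] H_mult[OF H_mult[OF r'(3) r(4) refl] r(8)] H_mult[OF r(9) H_mult[OF r'(3) r(4) refl]] by simp_all
 have "(a*t+s*b)*s' = s'" unfolding r(14) by (rule unl[OF r'(3)])
 then have s: "s' = s+a*?u" using r'(11) unr[OF r(3)] by (simp add: distrib_right ma add.commute)
 have "t*(a*t'+s'*b) = t" unfolding r'(14) by (rule unr[OF r(4)])
 then have t: "t = t'+?u*b" using r(10) unl[OF r'(4)] by (simp add: distrib_left ma msub[OF r(10)])
 have "Lam X Z 0 ?u (b*a) = Lam Y Z 0 (a*?u) b+Lam X Y 0 (?u*b) a"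
  using Lam_cocycle[OF r(8,9) _ r(5,6), of ?u 0] u by (simp add: alt_simps(4))
 then have "Lam Y Z 0 (a*?u) b+Lam X Y 0 (?u*b) a = 0" unfolding r(13) using Lam_zero(2)[of ?u Z X 0] u by simp
 moreover have "Lam Y Z 0 s' b = Lam Y Z 0 s b+Lam Y Z 0 (a*?u) b" by (subst s, rule Lam_add1[OF r(9)]) (use r u in simp_all)
 moreover have "Lam X Y 0 t a = Lam X Y 0 t' a+Lam X Y 0 (?u*b) a" by (subst t, rule Lam_add1[OF r(8)]) (use r' u in simp_all)
 ultimately show ?thesis unfolding dl_def by (simp add: alg)
qed

lemma dl_associative:
 assumes s1: "ses X Y U a p sgp pja" and s3: "ses Y Z W b r sgr pjb"
  and s2: "ses X Z V (b*a) q sgq (pja*pjb)" and s4: "ses U V W s t (q*sgr) pjs"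
  and e: "s*p = q*b" "t*q = r" "p*pjb = pjs*q" "sgq = b*sgp*pjs+sgr*t"
 shows "dl X Z V (b*a) q sgq (pja*pjb)+dl U V W s t (q*sgr) pjs = dl X Y U a p sgp pja+dl Y Z W b r sgr pjb"
proof -
 note r1 = sesD[OF s1] and r2 = sesD[OF s2] and r3 = sesD[OF s3] and r4 = sesD[OF s4]
 note M = H_mult[where k = 0 and l = 0 and m = 0, simplified]
 have m: "pja*pjb:H Z X 0" "a*(pja*pjb):H Z Y 0" "sgp*p*pjb:H Z Y 0" "sgp*pjs:H V Y 0" "b*sgp*pjs:H V Z 0" "sgr*t:H V Z 0"
  using M[OF r3(4) r1(4)] M[OF M[OF r3(4) r1(4)] r1(8)] M[OF r3(4) M[OF r1(9) r1(3)]] M[OF r4(4) r1(3)] M[OF M[OF r4(4) r1(3)] r3(8)] M[OF r4(9) r3(3)]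
  by (simp_all add: ma)
 have 1: "Lam X Z 0 (pja*pjb) (b*a) = Lam Y Z 0 (a*(pja*pjb)) b+Lam X Y 0 pja a"
  using Lam_cocycle[OF r1(8) r3(8) _ r1(5,6), of "pja*pjb" 0] m unr[OF r1(4)] by (simp add: alt_simps(4) ma r3(10))
 have 2: "Lam Z W 0 sgr r = Lam V W 0 (q*sgr) t+Lam Z V 0 (sgr*t) q"
  using Lam_cocycle[OF r2(9) r4(9) _ r2(6,7), of sgr 0] r3(3) by (simp add: alt_simps(4) e(2))
 have 3: "Lam Z V 0 sgq q = Lam Z V 0 (b*sgp*pjs) q+Lam Z V 0 (sgr*t) q"
  unfolding e(4) by (rule Lam_add1[OF r2(9)]) (use m in simp_all)
 have "pjb = (a*pja+sgp*p)*pjb" unfolding r1(14) by (rule unl[OF r3(4), symmetric])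
 then have pb: "pjb = a*(pja*pjb)+sgp*p*pjb" by (simp add: alg)
 have 4: "Lam Y Z 0 pjb b = Lam Y Z 0 (a*(pja*pjb)) b+Lam Y Z 0 (sgp*p*pjb) b"
  by (subst pb, rule Lam_add1[OF r3(8)]) (use m in simp_all)
 have 5: "Lam Y V 0 (sgp*pjs) (q*b) = Lam Z V 0 (b*sgp*pjs) q+Lam Y Z 0 (sgp*p*pjb) b"
  using Lam_cocycle[OF r3(8) r2(9) _ r3(5,6), of "sgp*pjs" 0] m by (simp add: alt_simps(4) ma e(3))
 have 6: "Lam Y V 0 (sgp*pjs) (s*p) = Lam U V 0 pjs s+Lam Y U 0 sgp p"
  using Lam_cocycle[OF r1(9) r4(8) _ r1(6,7), of "sgp*pjs" 0] m unl[OF r4(4)] unr[OF r1(3)]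
  by (simp add: alt_simps(4) ma[symmetric] r1(11)) (simp add: ma r4(10))
 show ?thesis unfolding dl_def 1 2 3 4 using 5 6 unfolding e(1) by (simp add: alg)
qed

lemma dl_commutative:
 assumes se: "ses X Y Z a b s t"
 shows "dl X Y Z a b s t = dl Z Y X s t a b"
proof -
 note r = sesD[OF se]
 note u = unl[OF r(3)] unr[OF r(9)] unl[OF r(4)] unr[OF r(8)] unr[OF r(3)] unl[OF r(9)] unr[OF r(4)] unl[OF r(8)]
 have "Lam Z Z 0 (uno Z) (b*s) = Lam Y Z 0 s b+Lam Z Y 0 b s"
  using Lam_cocycle[OF r(3,9) _ r(7,6), of "uno Z" 0] cpxD(6)[OF r(7)] u by (simp add: alt_simps(4))
 moreover have "Lam X X 0 (uno X) (t*a) = Lam Y X 0 a t+Lam X Y 0 t a"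
  using Lam_cocycle[OF r(8,4) _ r(5,6), of "uno X" 0] cpxD(6)[OF r(5)] u by (simp add: alt_simps(4))
 ultimately show ?thesis
  unfolding dl_def r(10,11) using Lam_uno[OF cpxD(6) ] r(5,7) by (simp add: add_eq_0_iff)
qed

lemma dl_closed: "ses X Y Z a b s t ==> dl X Y Z a b s t:rh ` carrier R"
proof -
 assume "ses X Y Z a b s t"
 note r = sesD[OF this]
 show ?thesis unfolding dl_def using rh_closed(1)[OF Lam_closed[OF r(9), of s] rh_closed(3)[OF Lam_closed[OF r(8), of t]]] r(3,4) by simp
qed

text \<open>For a pushout along \<open>al\<close> a homotopy inverse respecting the sequences can
 be written down from one of \<open>al\<close>.\<close>

lemma T_natural_left:
 assumes se: "ses X Y Z a b s t" and se': "ses X' Y' Z a' b' s' t'" and A: "hinv X X' al g h h' m"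
  and c: "t'*dd Y'*s' = al*(t*dd Y*s)"
 defines "be \<equiv> a'*al*t+s'*b"
 shows "EX G k k' l. hinv Y Y' be G k k' l" "T Y Y' be+dl X' Y' Z a' b' s' t' = T X X' al+dl X Y Z a b s t"
proof -
 note r = sesD[OF se] and r' = sesD[OF se']
 note C = ses_connecting[OF se] and C' = ses_connecting[OF se', unfolded c]
 define k where "k = t*dd Y*s"
 have kH: "k:H Z X 1" and dk: "dd X*k = - (k*dd Z)" using C by (auto simp: k_def eq_neg_iff_add_eq_0)
 have al: "chain X X' al" and g: "chain X' X g" and h: "h:H X X (-1)" "h':H X' X' (-1)" and m: "m:H X X' (-2)"
  and e: "g*al = uno X+dd X*h+h*dd X" "al*g = uno X' - dd X'*h' - h'*dd X'" "al*h+h'*al+dd X'*m - m*dd X = 0"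
  using A by (auto simp: hinv_def)
 note aH = chainD(3)[OF al] and gH = chainD(3)[OF g]
 have e3: "al*h = m*dd X - dd X'*m - h'*al" using e(3) by (simp add: alg eq_diff_eq add_eq_0_iff)
 note D = r(15) r'(15) C(3)[folded k_def] C'(3)[folded k_def] C(4)[folded k_def] C'(4)[folded k_def] r(16)[symmetric] r'(16)[symmetric] chainD(4)[OF al] chainD(4)[OF g] dk e(1,2) e3 r(10-13) r'(10-13)
 have D': "t*(dd Y*x) = (dd X*t+k*b)*x" "t'*(dd Y'*x) = (dd X'*t'+al*k*b')*x"
   "dd Y*(s*x) = (a*k+s*dd Z)*x" "dd Y'*(s'*x) = (a'*(al*k)+s'*dd Z)*x" for x
  using C(3)[folded k_def] C'(3)[folded k_def] C(4)[folded k_def] C'(4)[folded k_def] by (simp_all add: ma[symmetric])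
 note D2 = r(15)[THEN msub] r'(15)[THEN msub] r(16)[symmetric, THEN msub] r'(16)[symmetric, THEN msub]
  chainD(4)[OF al, THEN msub] chainD(4)[OF g, THEN msub] dk[THEN msub] e(1,2)[THEN msub] e3[THEN msub] r(10-13)[THEN msub] r'(10-13)[THEN msub]
 note U = unl[OF r(8)] unl[OF r(4)] unr[OF r(8)] unl[OF r'(8)] unl[OF r'(4)] unr[OF r'(8)] unl[OF aH] unl[OF gH] unr[OF aH] unr[OF gH]
   unl[OF h(1)] unr[OF h(1)] unl[OF h(2)] unr[OF h(2)] unl[OF kH] unr[OF kH] unl[OF r(9)] unl[OF r'(9)] unr[OF r(3)] unr[OF r'(3)]
   unl[OF m] unr[OF m] unl[OF cpxD(3)[OF r(7)]] unr[OF cpxD(3)[OF r(7)]] unl[OF cpxD(3)[OF r(5)]] unl[OF cpxD(3)[OF r'(5)]]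
 let ?G = "a*g*t'+s*b'+a*(h*k)*b'" and ?h = "a*h*t" and ?h' = "a'*h'*t'+a'*(m*k)*b'" and ?m = "a'*m*t"
 note H0 = H_mult[where k = 0 and l = 0 and m = 0, simplified]
 have hk: "h*k:H Z X 0" "m*k:H Z X' (-1)" using H_mult[OF kH h(1)] H_mult[OF kH m] by simp_all
 have M: "be:H Y Y' 0" "?G:H Y' Y 0" "?h:H Y Y (-1)" "?h':H Y' Y' (-1)" "?m:H Y Y' (-2)"
  unfolding be_def
  using H0[OF H0[OF r(4) aH] r'(8)] H0[OF r(9) r'(3)] H0[OF H0[OF r'(4) gH] r(8)] H0[OF r'(9) r(3)] H0[OF H0[OF r'(9) hk(1)] r(8)]
   H_mult[OF H_mult[OF r(4) h(1) refl] r(8)] H_mult[OF H_mult[OF r'(4) h(2) refl] r'(8)] H_mult[OF H_mult[OF r'(9) hk(2) refl] r'(8)] H_mult[OF H_mult[OF r(4) m refl] r'(8)]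
  by (simp_all add: ma H_add)
 have "dd Y'*be = be*dd Y" "dd Y*?G = ?G*dd Y'" unfolding be_def by (simp_all add: alg D D' D2 U U[THEN msub])
 moreover have "?G*be = uno Y+dd Y*?h+?h*dd Y" "be*?G = uno Y' - dd Y'*?h' - ?h'*dd Y'"
  unfolding be_def r(14)[symmetric] r'(14)[symmetric] by (simp_all add: alg D D' D2 U U[THEN msub])
 moreover have "be*?h+?h'*be+dd Y'*?m - ?m*dd Y = 0" unfolding be_def by (simp add: alg D D' D2 U U[THEN msub])
 ultimately have B: "hinv Y Y' be ?G ?h ?h' ?m" unfolding hinv_def chain_def using M r r' by simp
 then show "EX G k k' l. hinv Y Y' be G k k' l" by blast
 have Z: "hinv Z Z (uno Z) (uno Z) 0 0 0"
  using chain_uno r(7) H_zero[OF cpxD(1)[OF r(7)] cpxD(1)[OF r(7)]] unl[OF cpxD(6)[OF r(7)]] by (simp add: hinv_def)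
 have "T Y Y' be+dl X' Y' Z a' b' s' t' = T X X' al+T Z Z (uno Z)+dl X Y Z a b s t"
  by (rule T_triangular[OF se se' B A Z]) (simp_all add: be_def alg D D2 U U[THEN msub])
 then show "T Y Y' be+dl X' Y' Z a' b' s' t' = T X X' al+dl X Y Z a b s t" using T_uno[OF r(7)] by simp
qed

text \<open>Here the map is the identity on \<open>X\<close>, and homotopy data for
 \<open>gg\<close> are extended to the middle terms in block form.\<close>

lemma T_natural_right:
 assumes se: "ses X Y Z a b s t" and se': "ses X Y' Z' a' b' s' t'" and C: "hinv Z Z' gg g h h' m"
  and B: "chain Y Y' be" "be*a = a'" "b'*be = gg*b"
 shows "T Y Y' be+dl X Y' Z' a' b' s' t' = T Z Z' gg+dl X Y Z a b s t"
proof -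
 note r = sesD[OF se] and r' = sesD[OF se']
 note c = ses_connecting[OF se] and c' = ses_connecting[OF se']
 define k where "k = t*dd Y*s"
 define k' where "k' = t'*dd Y'*s'"
 define n where "n = t'*be*s"
 note H0 = H_mult[where k = 0 and l = 0 and m = 0, simplified]
 have kH: "k:H Z X 1" "k':H Z' X 1" and dk: "dd X*k' = - (k'*dd Z')" using c c' by (auto simp: k_def k'_def eq_neg_iff_add_eq_0)
 have nH: "n:H Z X 0" unfolding n_def using H0[OF H0[OF r(3) chainD(3)[OF B(1)]] r'(4)] by (simp add: ma)
 have ga: "chain Z Z' gg" and g: "chain Z' Z g" and h: "h:H Z Z (-1)" "h':H Z' Z' (-1)" and m: "m:H Z Z' (-2)"
  and e: "g*gg = uno Z+dd Z*h+h*dd Z" "gg*g = uno Z' - dd Z'*h' - h'*dd Z'" "gg*h+h'*gg+dd Z'*m - m*dd Z = 0"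
  using C by (auto simp: hinv_def)
 note gaH = chainD(3)[OF ga] and gH = chainD(3)[OF g]
 have e3: "gg*h = m*dd Z - dd Z'*m - h'*gg" using e(3) by (simp add: alg eq_diff_eq add_eq_0_iff)
 have "be*(a*t+s*b) = be" unfolding r(14) by (rule unr[OF chainD(3)[OF B(1)]])
 then have "a'*t+be*s*b = be" by (simp only: distrib_left ma[symmetric] B(2))
 then have b1: "be = a'*t+be*s*b" by (rule sym)
 have "(a'*t'+s'*b')*(be*s) = be*s" unfolding r'(14) by (rule unl[OF H0[OF r(3) chainD(3)[OF B(1)]]])
 then have b2: "be*s = a'*n+s'*gg"
  using unr[OF gaH] by (simp add: n_def alg B(3)[THEN msub] r(11))
 have b: "be = a'*t+s'*gg*b+a'*n*b" by (subst b1, subst b2) (simp add: alg)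
 have tb: "t'*be = t+n*b" using b unl[OF r(4)] unl[OF nH] by (simp add: alg r'(10,12)[THEN msub] r'(10,12) unl[OF r(4)] unl[OF nH, THEN msub])
 have "t'*(dd Y'*be)*s = t'*(be*dd Y)*s" unfolding chainD(4)[OF B(1)] ..
 moreover have "t'*(dd Y'*be)*s = (t'*dd Y')*(be*s)" "t'*(be*dd Y)*s = (t'*be)*(dd Y*s)" by (simp_all add: ma)
 ultimately have "(dd X*t'+k'*b')*(a'*n+s'*gg) = (t+n*b)*(a*k+s*dd Z)"
  unfolding tb b2 c'(3)[folded k'_def] c(4)[folded k_def] by simp
 then have kn: "k = k'*gg+dd X*n - n*dd Z"
  using unl[OF nH] unl[OF gaH] unl[OF kH(1)] unl[OF cpxD(3)[OF r(7)]]
  by (simp add: alg r(10-13)[THEN msub] r'(10-13)[THEN msub] eq_diff_eq)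
 note D = r(15) r'(15) c(3)[folded k_def] c'(3)[folded k'_def] c(4)[folded k_def] c'(4)[folded k'_def] r(16)[symmetric] r'(16)[symmetric] chainD(4)[OF ga] chainD(4)[OF g] dk e(1,2) e3 r(10-13) r'(10-13)
 have D': "t*(dd Y*x) = (dd X*t+k*b)*x" "t'*(dd Y'*x) = (dd X*t'+k'*b')*x"
   "dd Y*(s*x) = (a*k+s*dd Z)*x" "dd Y'*(s'*x) = (a'*k'+s'*dd Z')*x" for x
  using c(3)[folded k_def] c'(3)[folded k'_def] c(4)[folded k_def] c'(4)[folded k'_def] by (simp_all add: ma[symmetric])
 note D2 = r(15)[THEN msub] r'(15)[THEN msub] r(16)[symmetric, THEN msub] r'(16)[symmetric, THEN msub]
  chainD(4)[OF ga, THEN msub] chainD(4)[OF g, THEN msub] dk[THEN msub] e(1,2)[THEN msub] e3[THEN msub] r(10-13)[THEN msub] r'(10-13)[THEN msub]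
 note U = unl[OF r(8)] unl[OF r(4)] unr[OF r(8)] unl[OF r'(8)] unl[OF r'(4)] unr[OF r'(8)] unl[OF gaH] unl[OF gH] unr[OF gaH] unr[OF gH]
   unl[OF h(1)] unr[OF h(1)] unl[OF h(2)] unr[OF h(2)] unl[OF kH(2)] unr[OF kH(2)] unl[OF nH] unr[OF nH] unl[OF r(9)] unl[OF r'(9)] unr[OF r(3)] unr[OF r'(3)]
   unl[OF m] unr[OF m] unl[OF cpxD(3)[OF r(7)]] unr[OF cpxD(3)[OF r(7)]] unl[OF cpxD(3)[OF r(5)]] unl[OF cpxD(3)[OF r'(7)]]
 let ?y = "k'*h'+n*g" and ?x = "k'*m+n*h"
 let ?G = "a*t'+s*g*b' - a*?y*b'" and ?h = "s*h*b - a*?x*b" and ?h' = "s'*h'*b'" and ?m = "s'*m*b"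
 have xy: "?y:H Z' X 0" "?x:H Z X (-1)" using H_mult[OF h(2) kH(2)] H0[OF gH nH] H_mult[OF m kH(2)] H_mult[OF h(1) nH] by (simp_all add: H_add)
 have M: "?G:H Y' Y 0" "?h:H Y Y (-1)" "?h':H Y' Y' (-1)" "?m:H Y Y' (-2)"
  using H0[OF r'(4) r(8)] H0[OF H0[OF r'(9) gH] r(3)] H0[OF H0[OF r'(9) xy(1)] r(8)] H_mult[OF H_mult[OF r(9) h(1) refl] r(3)]
   H_mult[OF H_mult[OF r(9) xy(2) refl] r(8)] H_mult[OF H_mult[OF r'(9) h(2) refl] r'(3)] H_mult[OF H_mult[OF r(9) m refl] r'(3)]
  by (simp_all add: ma H_add H_diff)
 have "dd Y*?G = ?G*dd Y'" by (simp add: alg D D' D2 U U[THEN msub] kn)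
 moreover have "?G*be = uno Y+dd Y*?h+?h*dd Y" "be*?G = uno Y' - dd Y'*?h' - ?h'*dd Y'"
  unfolding b r(14)[symmetric] r'(14)[symmetric] by (simp_all add: alg D D' D2 U U[THEN msub] kn)
 moreover have "be*?h+?h'*be+dd Y'*?m - ?m*dd Y = 0" unfolding b by (simp add: alg D D' D2 U U[THEN msub] kn)
 ultimately have hB: "hinv Y Y' be ?G ?h ?h' ?m" unfolding hinv_def chain_def using M B(1)[unfolded chain_def] by simp
 have A: "hinv X X (uno X) (uno X) 0 0 0"
  using chain_uno r(5) H_zero[OF cpxD(1)[OF r(5)] cpxD(1)[OF r(5)]] unl[OF cpxD(6)[OF r(5)]] by (simp add: hinv_def)
 have "T Y Y' be+dl X Y' Z' a' b' s' t' = T X X (uno X)+T Z Z' gg+dl X Y Z a b s t"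
  by (rule T_triangular[OF se se' hB A C]) (simp_all add: B alg D D2 U U[THEN msub])
 then show ?thesis using T_uno[OF r(5)] by simp
qed

text \<open>Any morphism of extensions factors through the extension obtained by pushing out along \<open>al\<close>.\<close>

lemma T_natural:
 assumes se: "ses X Y Z a b s t" and se': "ses X' Y' Z' a' b' s' t'"
  and q: "chain X X' al" "cb X X' al:qis R" "chain Y Y' be" "cb Y Y' be:qis R" "chain Z Z' gg" "cb Z Z' gg:qis R"
  and e: "be*a = a'*al" "gg*b = b'*be"
 shows "T X X' al+T Z Z' gg+dl X Y Z a b s t = dl X' Y' Z' a' b' s' t'+T Y Y' be"
proof -
 note r = sesD[OF se] and r' = sesD[OF se']
 note c = ses_connecting[OF se]
 note H0 = H_mult[where k = 0 and l = 0 and m = 0, simplified]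
 have ac: "al*(t*dd Y*s):H Z X' 1" "dd X'*(al*(t*dd Y*s))+al*(t*dd Y*s)*dd Z = 0"
 proof -
  show "al*(t*dd Y*s):H Z X' 1" using H_mult[OF c(1) chainD(3)[OF q(1)]] by simp
  have "dd X'*(al*(t*dd Y*s))+al*(t*dd Y*s)*dd Z = al*(dd X*(t*dd Y*s)+t*dd Y*s*dd Z)"
   by (simp add: alg chainD(4)[OF q(1), THEN msub])
  then show "dd X'*(al*(t*dd Y*s))+al*(t*dd Y*s)*dd Z = 0" unfolding c(2) by simp
 qed
 obtain Y1 a1 b1 s1 t1 where se1: "ses X' Y1 Z a1 b1 s1 t1" and c1: "t1*dd Y1*s1 = al*(t*dd Y*s)"
  using extension_ex[OF r'(5) r(7) ac] by blast
 note r1 = sesD[OF se1] and d1 = ses_connecting[OF se1, unfolded c1]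
 obtain g h h' m where A: "hinv X X' al g h h' m" using qis_hinv q(1,2) by metis
 obtain g2 h2 h2' m2 where C: "hinv Z Z' gg g2 h2 h2' m2" using qis_hinv q(5,6) by metis
 let ?b1 = "a1*al*t+s1*b" and ?b2 = "a'*t1+be*s*b1"
 note n = T_natural_left[OF se se1 A c1]
 have b: "chain Y Y1 ?b1" "cb Y Y1 ?b1:qis R" using n(1) hinv_qis by blast+
 note bH = chainD(3)[OF q(3)] and aH = chainD(3)[OF q(1)]
 have M: "?b2:H Y1 Y' 0" using H0[OF r1(4) r'(8)] H0[OF H0[OF r1(9) r(3)] bH] by (simp add: H_add ma)
 define k where "k = t*dd Y*s"
 have "dd Y'*?b2 = a'*dd X'*t1+be*(dd Y*s)*b1"
  by (simp add: distrib_left ma[symmetric] r'(15) chainD(4)[OF q(3)])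
 also have "... = a'*(dd X'*t1+al*k*b1)+be*s*(dd Z*b1)"
  unfolding c(4)[folded k_def] by (simp add: alg e(1)[THEN msub])
 also have "... = ?b2*dd Y1" unfolding d1(3)[folded k_def, symmetric] r1(16) by (simp add: distrib_right ma)
 finally have "dd Y'*?b2 = ?b2*dd Y1" .
 then have b2: "chain Y1 Y' ?b2" unfolding chain_def using r1(6) r'(6) M by simp
 have b2': "?b2*a1 = a'" "b'*?b2 = gg*b1"
  using unr[OF r'(8)] unl[OF r1(9)] unr[OF chainD(3)[OF q(5)]]
  by (simp_all add: distrib_right ma r1(10,13) alg r'(13)[THEN msub] r(11)[THEN msub] e(2)[symmetric, THEN msub])
 have "?b2*?b1 = a'*(al*t)+be*(s*b)"
  using unl[OF r(9)] unl[OF H0[OF r(4) aH]] by (simp add: alg r1(10-13)[THEN msub])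
 also have "... = be*(a*t+s*b)" by (simp add: distrib_left ma[symmetric] e(1))
 also have "... = be" unfolding r(14) by (rule unr[OF bH])
 finally have be: "?b2*?b1 = be" .
 have q2: "cb Y1 Y' ?b2:qis R"
 proof -
  obtain G where G: "chain Y1 Y G" "heq Y Y (G*?b1) (uno Y)" "heq Y1 Y1 (?b1*G) (uno Y1)"
   using b qis_iff_iso kb_iso_iff[OF b(1)] by blast
  obtain G' where G': "chain Y' Y G'" "heq Y Y (G'*be) (uno Y)" "heq Y' Y' (be*G') (uno Y')"
   using q(3,4) qis_iff_iso kb_iso_iff[OF q(3)] by blast
  have "heq Y1 Y1 (?b1*(G'*be)*G) (?b1*uno Y*G)"
   by (rule heq_multR[OF heq_multL[OF G'(2) b(1)] G(1)])
  moreover have "?b1*uno Y*G = ?b1*G" using unr[OF chainD(3)[OF b(1)]] by simp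
  moreover have "heq Y1 Y1 (?b1*(G'*be)*G) (?b1*G'*?b2)"
  proof -
   have "heq Y1 Y1 (?b1*G'*?b2*(?b1*G)) (?b1*G'*?b2*uno Y1)"
    by (rule heq_multL[OF G(3)]) (intro chain_mult[OF b2] chain_mult[OF G'(1)] b(1))
   moreover have "?b1*G'*?b2*(?b1*G) = ?b1*(G'*(?b2*?b1))*G" by (simp only: ma)
   moreover have "?b1*G'*?b2*uno Y1 = ?b1*G'*?b2" using unr[OF M] by (simp only: ma)
   ultimately show ?thesis unfolding be by (simp only:)
  qed
  ultimately have "heq Y1 Y1 ((?b1*G')*?b2) (uno Y1)" using G(3) heq_trans heq_sym by metis
  moreover have "heq Y' Y' (?b2*(?b1*G')) (uno Y')" using G'(3) by (simp only: ma[symmetric] be)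
  moreover have "chain Y' Y1 (?b1*G')" using chain_mult[OF G'(1) b(1)] .
  ultimately show ?thesis unfolding qis_iff_iso[OF b2] kb_iso_iff[OF b2] by blast
 qed
 have 1: "T Y Y' be = T Y Y1 ?b1+T Y1 Y' ?b2" using T_comp[OF b b2 q2] unfolding be .
 have 2: "T Y1 Y' ?b2+dl X' Y' Z' a' b' s' t' = T Z Z' gg+dl X' Y1 Z a1 b1 s1 t1"
  by (rule T_natural_right[OF se1 se' C b2 b2'])
 have "T X X' al+T Z Z' gg+dl X Y Z a b s t = (T X X' al+dl X Y Z a b s t)+T Z Z' gg" by (simp only: ac_simps)
 also have "... = T Y Y1 ?b1+(T Z Z' gg+dl X' Y1 Z a1 b1 s1 t1)" unfolding n(2)[symmetric] by (simp only: ac_simps)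
 also have "... = dl X' Y' Z' a' b' s' t'+T Y Y' be" unfolding 1 2[symmetric] by (simp only: ac_simps)
 finally show ?thesis .
qed

end

section \<open>The logarithmic derivative as a determinant functor\<close>

lemma det_exactI:
 assumes "is_functor (wide_subcat T w) P f"
  and "!!a b. (a, b):Ses T ==> DS f (a, b):Hom P (FO f (Cod T a)) (FO f (Dom T a) *o[P] FO f (Cod T b))"
  and "!!a b a' b' al be gg. [|(a, b):Ses T; (a', b'):Ses T; al:w; be:w; gg:w;
    al:Hom T (Dom T a) (Dom T a'); be:Hom T (Cod T a) (Cod T a'); gg:Hom T (Cod T b) (Cod T b');
    be o[T] a = a' o[T] al; gg o[T] b = b' o[T] be|] ==>
    (FA f al *a[P] FA f gg) o[P] DS f (a, b) = DS f (a', b') o[P] FA f be"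
  and "!!a b p q r s t. [|(a, p):Ses T; (b o[T] a, q):Ses T; (b, r):Ses T; (s, t):Ses T;
    Dom T b = Cod T a; Dom T s = Cod T p; Cod T s = Cod T q; Cod T t = Cod T r; s o[T] p = q o[T] b; t o[T] q = r|] ==>
    Phi P (FO f (Dom T a)) (FO f (Cod T p)) (FO f (Cod T r)) o[P]
     (Ident P (FO f (Dom T a)) *a[P] DS f (s, t)) o[P] DS f (b o[T] a, q) =
    (DS f (a, p) *a[P] Ident P (FO f (Cod T r))) o[P] DS f (b, r)"
  and "!!X Y S i j p q. biproduct T X Y S i j p q ==> Psi P (FO f X) (FO f Y) o[P] DS f (i, q) = DS f (j, p)"
 shows "det_exact T w P f"
 unfolding det_exact_def Ball_def split_paired_All prod.case by (intro conjI allI impI; (elim conjE)?; rule assms; assumption)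

context derivation
begin

text \<open>The values of the trace form, as an abelian group.\<close>

definition vals :: "('r, 'm) gop monoid" where "vals = \<lparr>carrier = rh ` carrier R, mult = (+), one = 0\<rparr>"

lemma qisE: "s:qis R ==> (!!X Y F. [|s = cb X Y F; chain X Y F; cb X Y F:qis R|] ==> thesis) ==> thesis"
 using qis_cb by metis

lemma vals_group: "comm_group vals"
proof -
 have "EX y:rh ` carrier R. y+x = 0" if "x:rh ` carrier R" for x
  using rh_closed(3)[OF that] by (intro bexI[of _ "- x"]) simp_all
 then show ?thesis by (intro comm_groupI) (auto simp: vals_def rh_closed ac_simps)
qed

text \<open>The sign convention is that composition adds values, and the second component is
 \<open>dl\<close>.\<close>

definition dlog :: "(('r, 'm) gop => 'u) => (('r, 'm) mcpx, (('r, 'm) module, ('r, 'm) mmap) cmap, 'u, 'u,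
  (('r, 'm) module, ('r, 'm) mmap) cmap \<times> (('r, 'm) module, ('r, 'm) mmap) cmap) det_func" where
 "dlog en = \<lparr>FO = (%_. undefined :: 'u), FA = (%s. en (THE x. EX X Y F. s = cb X Y F & chain X Y F & x = T X Y F)),
   DS = (%d. en (THE x. EX X Y Z a b s t. d = (cb X Y a, cb Y Z b) & ses X Y Z a b s t & x = dl X Y Z a b s t))\<rparr>"

context
 fixes en :: "('r, 'm) gop => 'u"
 assumes en: "inj_on en (rh ` carrier R)"
begin

abbreviation "BG \<equiv> group_picard vals en"

lemma en': "inj_on en (carrier vals)" using en by (simp add: vals_def)

lemmas BG [simp] = comm_group.group_picard_simps[OF vals_group en', unfolded vals_def monoid.simps partial_object.simps, folded vals_def]

lemma dlog_FA: "chain X Y F ==> FA (dlog en) (cb X Y F) = en (T X Y F)"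
proof -
 assume F: "chain X Y F"
 have "(THE x. EX X' Y' F'. cb X Y F = cb X' Y' F' & chain X' Y' F' & x = T X' Y' F') = T X Y F"
 proof (rule the_equality)
  fix x assume "EX X' Y' F'. cb X Y F = cb X' Y' F' & chain X' Y' F' & x = T X' Y' F'"
  then obtain X' Y' F' where e: "cb X Y F = cb X' Y' F'" "chain X' Y' F'" "x = T X' Y' F'" by blast
  then have "X' = X" "Y' = Y" by (simp_all add: cb_def)
  then show "x = T X Y F" using e F cb_eq_iff by blast
 qed (use F in blast)
 then show ?thesis by (simp add: dlog_def)
qed

lemma dlog_DS: "ses X Y Z a b s t ==> DS (dlog en) (cb X Y a, cb Y Z b) = en (dl X Y Z a b s t)"
proof -
 assume se: "ses X Y Z a b s t"
 have "(THE x. EX X' Y' Z' a' b' s' t'. (cb X Y a, cb Y Z b) = (cb X' Y' a', cb Y' Z' b') & ses X' Y' Z' a' b' s' t' & x = dl X' Y' Z' a' b' s' t') = dl X Y Z a b s t"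
 proof (rule the_equality)
  fix x assume "EX X' Y' Z' a' b' s' t'. (cb X Y a, cb Y Z b) = (cb X' Y' a', cb Y' Z' b') & ses X' Y' Z' a' b' s' t' & x = dl X' Y' Z' a' b' s' t'"
  then obtain X' Y' Z' a' b' s' t' where e: "cb X Y a = cb X' Y' a'" "cb Y Z b = cb Y' Z' b'" and se': "ses X' Y' Z' a' b' s' t'"
   and x: "x = dl X' Y' Z' a' b' s' t'" by blast
  have [simp]: "X' = X" "Y' = Y" "Z' = Z" using e by (simp_all add: cb_def)
  have "a' = a" "b' = b" using e cb_eq_iff sesD(1,2)[OF se] sesD(1,2)[OF se'] by simp_all
  then show "x = dl X Y Z a b s t" using x dl_split[OF se] se' by simp
 qed (use se in blast)
 then show ?thesis by (simp add: dlog_def)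
qed

lemma en_comp: "[|x:rh ` carrier R; y:rh ` carrier R|] ==> Comp BG (en x) (en y) = en (x+y)"
 "[|x:rh ` carrier R; y:rh ` carrier R|] ==> TenA BG (en x) (en y) = en (x+y)"
 using BG(9,10) by (simp_all add: vals_def)

lemma BG_picard: "picard_category BG"
 by (rule comm_group.group_picard[OF vals_group en'])

lemma BG_hom: "f:Hom BG X Y \<longleftrightarrow> X = undefined & Y = undefined & f:en ` rh ` carrier R"
 using comm_group.group_picard_hom[OF vals_group en', of f X Y] by (simp add: vals_def)

lemma dlog_FO [simp]: "FO (dlog en) X = undefined" by (simp add: dlog_def)

lemma dlog_det: "det_exact C (qis R) BG (dlog en)"
proof (rule det_exactI)
 interpret B: picard_category BG by (rule BG_picard)
 show "is_functor (wide_subcat C (qis R)) BG (dlog en)"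
  unfolding is_functor_def
 proof (intro conjI ballI impI)
  fix s assume "s:Arr (wide_subcat C (qis R))"
  then obtain X Y F where "s = cb X Y F" "chain X Y F" "cb X Y F:qis R" using qisE by (metis wide_simps(2))
  then show "FA (dlog en) s:Hom BG (FO (dlog en) (Dom (wide_subcat C (qis R)) s)) (FO (dlog en) (Cod (wide_subcat C (qis R)) s))"
   using T_closed by (simp add: BG_hom dlog_FA)
 next
  fix X assume "X:Obj (wide_subcat C (qis R))"
  then have "cpx X" by simp
  then show "FA (dlog en) (Ident (wide_subcat C (qis R)) X) = Ident BG (FO (dlog en) X)"
   by (simp add: cb_ident dlog_FA[OF chain_uno] T_uno)
 next
  fix s u assume "s:Arr (wide_subcat C (qis R))" "u:Arr (wide_subcat C (qis R))" and d: "Dom (wide_subcat C (qis R)) u = Cod (wide_subcat C (qis R)) s"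
  then obtain X Y F Y' Z G where s: "s = cb X Y F" "chain X Y F" "cb X Y F:qis R" and u: "u = cb Y' Z G" "chain Y' Z G" "cb Y' Z G:qis R"
   using qisE by (metis wide_simps(2))
  have [simp]: "Y' = Y" using d s u by simp
  note u' = u[simplified]
  show "FA (dlog en) (Comp (wide_subcat C (qis R)) u s) = Comp BG (FA (dlog en) u) (FA (dlog en) s)"
   using T_comp[OF s(2,3) u'(2,3)] T_closed[OF s(2,3)] T_closed[OF u'(2,3)]
   by (simp add: s(1) u' cb_comp[OF s(2) u'(2)] dlog_FA[OF s(2)] dlog_FA[OF u'(2)] dlog_FA[OF chain_mult[OF s(2) u'(2)]] en_comp add.commute)
 qed (use qis_category B.category_axioms in auto)
next
 fix a b assume "(a, b):Ses C"
 then obtain X Y Z a' b' s t where "ses X Y Z a' b' s t" "a = cb X Y a'" "b = cb Y Z b'" unfolding Ses_iff by blast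
 then show "DS (dlog en) (a, b):Hom BG (FO (dlog en) (Cod C a)) (FO (dlog en) (Dom C a) *o[BG] FO (dlog en) (Cod C b))"
  using dl_closed by (simp add: BG_hom dlog_DS)
next
 fix a b a' b' al be gg
 assume "(a, b):Ses C" "(a', b'):Ses C" "al:qis R" "be:qis R" "gg:qis R"
  "al:Hom C (Dom C a) (Dom C a')" "be:Hom C (Cod C a) (Cod C a')" "gg:Hom C (Cod C b) (Cod C b')"
  "be o[C] a = a' o[C] al" "gg o[C] b = b' o[C] be"
 then show "TenA BG (FA (dlog en) al) (FA (dlog en) gg) o[BG] DS (dlog en) (a, b) = DS (dlog en) (a', b') o[BG] FA (dlog en) be"
 proof (cases rule: ses_morphism)
  case (1 X Y Z x y sg pj X' Y' Z' x' y' sg' pj' al' be' gg')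
  note q = 1(9,12,15)[folded qis_iff_iso[OF 1(8)] qis_iff_iso[OF 1(11)] qis_iff_iso[OF 1(14)]]
  have n: "T X X' al'+T Z Z' gg'+dl X Y Z x y sg pj = dl X' Y' Z' x' y' sg' pj'+T Y Y' be'"
   by (rule T_natural[OF 1(1,4) 1(8) q(1) 1(11) q(2) 1(14) q(3) 1(16,17)])
  note c = T_closed[OF 1(8) q(1)] T_closed[OF 1(11) q(2)] T_closed[OF 1(14) q(3)] dl_closed[OF 1(1)] dl_closed[OF 1(4)]
  show ?thesis
   unfolding 1(2,3,5,6,7,10,13) dlog_FA[OF 1(8)] dlog_FA[OF 1(11)] dlog_FA[OF 1(14)] dlog_DS[OF 1(1)] dlog_DS[OF 1(4)]
   using c n rh_closed(1)[OF c(1,3)] by (simp add: en_comp)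
 qed
next
 fix a b p q r s t
 assume "(a, p):Ses C" "(b o[C] a, q):Ses C" "(b, r):Ses C" "(s, t):Ses C"
  "Dom C b = Cod C a" "Dom C s = Cod C p" "Cod C s = Cod C q" "Cod C t = Cod C r" "s o[C] p = q o[C] b" "t o[C] q = r"
 then show "Phi BG (FO (dlog en) (Dom C a)) (FO (dlog en) (Cod C p)) (FO (dlog en) (Cod C r)) o[BG]
   (TenA BG (Ident BG (FO (dlog en) (Dom C a))) (DS (dlog en) (s, t))) o[BG] DS (dlog en) (b o[C] a, q) =
  TenA BG (DS (dlog en) (a, p)) (Ident BG (FO (dlog en) (Cod C r))) o[BG] DS (dlog en) (b, r)"
 proof (cases rule: ses_configuration)
  case (1 X Y Z U V W a' p' b' r' q' s' t' s1 t1 s2 t2 s3 t3 s4 t4)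
  obtain sg pj where c: "ses X Z V (b'*a') q' sg (t1*t3)" "ses U V W s' t' (q'*s3) pj" "pj*q' = p'*t3" "sg = b'*s1*pj+s3*t'"
   using ses_compatible_splittings[OF 1(1,2,3,4) 1(13,14)] by blast
  note a = dl_associative[OF 1(1,3) c(1,2) 1(13,14) c(3)[symmetric] c(4)]
  note m = dl_closed[OF 1(1)] dl_closed[OF c(1)] dl_closed[OF 1(3)] dl_closed[OF c(2)]
  show ?thesis
   unfolding 1(12) unfolding 1(5-11) dlog_DS[OF 1(1)] dlog_DS[OF c(1)] dlog_DS[OF 1(3)] dlog_DS[OF c(2)]
   using m rh_closed(2) a rh_closed(1)[OF m(4,2)] rh_closed(1)[OF m(1,3)] by (simp add: en_comp add.commute)
 qed
next
 fix X Z Y i j p q assume "biproduct C X Z Y i j p q"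
 then obtain a b s t where e: "i = cb X Y a" "j = cb Z Y s" "p = cb Y X t" "q = cb Y Z b" and se: "ses X Y Z a b s t" "chain Z Y s" "chain Y X t"
  using biproduct_ses by blast
 note r = sesD[OF se(1)]
 have se': "ses Z Y X s t a b" unfolding ses_def using r se by (simp add: chain_def add.commute)
 show "Psi BG (FO (dlog en) X) (FO (dlog en) Z) o[BG] DS (dlog en) (i, q) = DS (dlog en) (j, p)"
  unfolding e dlog_DS[OF se(1)] dlog_DS[OF se'] using dl_commutative[OF se(1)] dl_closed[OF se(1)] rh_closed(2) by (simp add: en_comp)
qed

end

end

section \<open>Dual numbers\<close>

text \<open>The derivation is \<open>D (a + b X) = b X\<close> modulo \<open>X\<^sup>2\<close>, where
 \<open>a\<close> and \<open>b\<close> only depend on the residue class.\<close>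

lemma dual_numbers_derivation:
 fixes R :: "'r ring" and k :: "'k ring"
 assumes R: "ring R" and k: "field k" and iso: "R \<simeq> dual_numbers k"
 shows "EX D e. (ALL x:carrier R. ALL y:carrier R. x *[R] y = y *[R] x) & (ALL x:carrier R. D x:carrier R) &
  (ALL x:carrier R. ALL y:carrier R. D (x +[R] y) = D x +[R] D y) &
  (ALL x:carrier R. ALL y:carrier R. D (x *[R] y) = D x *[R] y +[R] x *[R] D y) &
  e:carrier R & e ~= 0[R] & e *[R] e = 0[R] & D e = e"
proof -
 interpret R: ring R by fact
 interpret k: field k by fact
 define A where "A = (carrier k)[X]\<^bsub>k\<^esub>"
 define X where "X = var k"
 note sub = k.carrier_is_subring
 interpret A: domain A unfolding A_def by (rule k.univ_poly_is_domain[OF sub])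
 have X: "X:carrier A" unfolding A_def X_def by (rule k.var_closed(1)[OF sub])
 have X2: "X [^]\<^bsub>A\<^esub> (2::nat) = X *[A] X" using X by (simp add: numeral_2_eq_2)
 define I where "I = PIdl\<^bsub>A\<^esub> (X *[A] X)"
 have I: "ideal I A" unfolding I_def using X by (intro A.cgenideal_ideal) simp
 interpret I: ideal I A by (rule I)
 have dn: "dual_numbers k = A Quot I" by (simp add: dual_numbers_def Let_def A_def[symmetric] X_def[symmetric] X2 I_def)
 obtain h where h: "h:ring_iso R (A Quot I)" using iso unfolding dn is_ring_iso_def by auto
 have h': "inv_into (carrier R) h:ring_iso (A Quot I) R" by (rule ring_iso_set_sym[OF R h])
 define pi where "pi = inv_into (carrier R) h \<circ> (%a. I +>\<^bsub>A\<^esub> a)"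
 have pi: "pi:ring_hom A R"
  unfolding pi_def by (rule ring_hom_trans[OF I.rcos_ring_hom]) (use h' in \<open>simp add: ring_iso_def\<close>)
 interpret pi: ring_hom_ring A R pi by (rule ring_hom_ringI2[OF A.ring_axioms R pi])
 have surj: "EX p:carrier A. pi p = r" if "r:carrier R" for r
 proof -
  have "h r:carrier (A Quot I)" "inv_into (carrier R) h (h r) = r"
   using h that by (auto simp: ring_iso_def ring_hom_def bij_betw_def)
  then show ?thesis by (auto simp: FactRing_def A_RCOSETS_def' pi_def)
 qed
 have ker: "pi p = 0[R] \<longleftrightarrow> p:I" if p: "p:carrier A" for p
 proof -
  have "I +>\<^bsub>A\<^esub> p:carrier (A Quot I)" "I +>\<^bsub>A\<^esub> 0[A]:carrier (A Quot I)" using p by (auto simp: FactRing_def A_RCOSETS_def')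
  moreover have "inj_on (inv_into (carrier R) h) (carrier (A Quot I))" using h' by (simp add: ring_iso_def bij_betw_def)
  ultimately have "pi p = pi 0[A] \<longleftrightarrow> I +>\<^bsub>A\<^esub> p = I +>\<^bsub>A\<^esub> 0[A]" by (auto simp: pi_def inj_on_def)
  also have "... \<longleftrightarrow> p:I"
   using I.rcos_const_imp_mem[OF p] I.a_rcos_const[of p] I.a_rcos_const[OF I.zero_closed] p by auto
  finally show ?thesis by simp
 qed
 let ?c = "%i p. k.coeff p i"
 have set: "set p <= carrier k" if "p:carrier A" for p
  using that k.polynomial_in_carrier[OF sub, of p] unfolding A_def univ_poly_carrier by simp
 have c [simp]: "?c i p:carrier k" if "p:carrier A" for i p using set[OF that] by simp
 have c_add: "?c i (p +[A] q) = ?c i p +[k] ?c i q" if "p:carrier A" "q:carrier A" for i p q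
  using k.poly_add_coeff[OF set set, OF that] by (simp add: A_def univ_poly_add)
 have c_mult: "?c 0 (p *[A] q) = ?c 0 p *[k] ?c 0 q" "?c 1 (p *[A] q) = ?c 0 p *[k] ?c 1 q +[k] ?c 1 p *[k] ?c 0 q"
  if "p:carrier A" "q:carrier A" for p q
 proof -
  have "{..Suc 0} = {0, Suc 0}" by auto
  then show "?c 0 (p *[A] q) = ?c 0 p *[k] ?c 0 q" "?c 1 (p *[A] q) = ?c 0 p *[k] ?c 1 q +[k] ?c 1 p *[k] ?c 0 q"
   using k.poly_mult_coeff[OF set set, OF that] that c by (simp_all add: A_def univ_poly_mult)
 qed
 have c_X: "?c 0 X = 0[k]" "?c 1 X = 1[k]" by (simp_all add: X_def var_def)
 have I_iff: "p:I \<longleftrightarrow> ?c 0 p = 0[k] & ?c 1 p = 0[k]" if p: "p:carrier A" for p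
 proof
  assume "p:I"
  then obtain q where q: "q:carrier A" "p = q *[A] (X *[A] X)" unfolding I_def cgenideal_def by blast
  then show "?c 0 p = 0[k] & ?c 1 p = 0[k]" using X by (simp add: c_mult c_X del: One_nat_def)
 next
  assume z: "?c 0 p = 0[k] & ?c 1 p = 0[k]"
  have pp: "polynomial\<^bsub>k\<^esub> (carrier k) p" using p by (simp add: A_def univ_poly_carrier)
  show "p:I"
  proof (cases "length p \<le> 2")
   case True
   then consider "p = []" | a where "p = [a]" | a b where "p = [a, b]"
    by (cases p rule: list.exhaust; cases "tl p") auto
   then have "p = []" using z pp by cases (auto simp: polynomial_def)
   then have "p = 0[A]" by (simp add: A_def univ_poly_zero)
   then show ?thesis by simp
  next
   case False
   define q where "q = butlast (butlast p)"
   have ne: "p ~= []" "butlast p ~= []" "q ~= []" using False by (auto simp: q_def simp flip: length_greater_0_conv)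
   have p': "(q @ [last (butlast p)]) @ [last p] = p"
    unfolding q_def append_butlast_last_id[OF ne(2)] by (rule append_butlast_last_id[OF ne(1)])
   have "last p = 0[k]" using z k.coeff_nth[of 0 p] ne(1) by (simp add: last_conv_nth)
   moreover have "last (butlast p) = 0[k]"
    using z k.coeff_nth[of 1 p] False ne(2) by (simp add: last_conv_nth nth_butlast numeral_2_eq_2)
   ultimately have p'': "p = (q @ [0[k]]) @ [0[k]]" using p' by simp
   have "hd p = hd q" by (subst p'') (use ne(3) in simp)
   then have q: "q:carrier A" using pp ne set[OF p] p''
    unfolding A_def univ_poly_carrier[symmetric] polynomial_def by (auto simp: subset_iff)
   have "q *[A] X = q @ [0[k]]" using k.poly_mult_var[OF sub q[unfolded A_def]] ne(3) by (simp add: A_def X_def)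
   moreover have "(q *[A] X) *[A] X = p"
    using k.poly_mult_var[OF sub A.m_closed[OF q X, unfolded A_def]] p'' calculation by (simp add: A_def X_def)
   ultimately show ?thesis unfolding I_def cgenideal_def using q X A.m_assoc[OF q X X] by auto
  qed
 qed
 have pi_eq: "pi p = pi q \<longleftrightarrow> ?c 0 p = ?c 0 q & ?c 1 p = ?c 1 q" if p: "p:carrier A" "q:carrier A" for p q
 proof -
  let ?d = "p \<ominus>\<^bsub>A\<^esub> q"
  have d: "?d:carrier A" "?d +[A] q = p" using p by (simp_all add: A.minus_eq A.a_assoc A.l_neg)
  have 1: "?c i p = ?c i ?d +[k] ?c i q" for i using c_add[OF d(1) p(2)] unfolding d(2) .
  have 2: "pi p = pi ?d +[R] pi q" using pi.hom_add[OF d(1) p(2)] unfolding d(2) .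
  have "pi p = pi q \<longleftrightarrow> pi ?d = 0[R]" unfolding 2 using d p by (simp add: R.add.r_cancel_one)
  also have "... \<longleftrightarrow> ?c 0 p = ?c 0 q & ?c 1 p = ?c 1 q" unfolding ker[OF d(1)] I_iff[OF d(1)] 1 using d p by (simp add: k.add.r_cancel_one)
  finally show ?thesis .
 qed
 define lin where "lin = (%b. if b = 0[k] then [] else [b, 0[k]])"
 have lin: "lin b:carrier A" "?c 0 (lin b) = 0[k]" "?c 1 (lin b) = b" if "b:carrier k" for b
  using that unfolding lin_def A_def univ_poly_carrier[symmetric] by (auto simp: polynomial_def)
 define D where "D = (%r. pi (lin (?c 1 (SOME p. p:carrier A & pi p = r))))"
 have D: "D (pi p) = pi (lin (?c 1 p))" if "p:carrier A" for p
 proof -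
  have "(SOME q. q:carrier A & pi q = pi p):carrier A & pi (SOME q. q:carrier A & pi q = pi p) = pi p"
   by (rule someI[of _ p]) (use that in simp)
  then show ?thesis unfolding D_def using pi_eq that by metis
 qed
 note One_nat_def [simp del]
 show ?thesis
 proof (intro exI[of _ D] exI[of _ "pi X"] conjI ballI)
  fix x y assume "x:carrier R" "y:carrier R"
  then obtain p q where p [simp]: "p:carrier A" "q:carrier A" and e: "x = pi p" "y = pi q" using surj by metis
  show "x *[R] y = y *[R] x" unfolding e using A.m_comm[OF p] by (simp flip: pi.hom_mult)
  show "D x:carrier R" unfolding e by (simp add: D lin)
  show "D (x +[R] y) = D x +[R] D y" unfolding e by (simp add: D lin pi_eq c_add flip: pi.hom_add)
  show "D (x *[R] y) = D x *[R] y +[R] x *[R] D y" unfolding e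
   by (simp add: D lin pi_eq c_add c_mult k.a_comm flip: pi.hom_add pi.hom_mult)
 next
  show "pi X:carrier R" using X by simp
  show "pi X ~= 0[R]" using X by (simp add: ker I_iff c_X)
  show "pi X *[R] pi X = 0[R]" using X by (simp add: ker I_iff c_X c_mult flip: pi.hom_mult)
  show "D (pi X) = pi X" using X by (simp add: D lin pi_eq c_X)
 qed
qed

section \<open>A unit that becomes trivial\<close>

context proj_modules
begin

text \<open>In the triangle \<open>X \<rightarrow> X \<rightarrow> cone(ep)\<close> of an endomorphism with \<open>ep\<^sup>2 = 0\<close>, the automorphism \<open>1 + ep\<close> of the first
 term extends by identities.\<close>

lemma det_tri_unipotent:
 assumes P: "picard_category P" and g: "det_tri K P g" and e: "chain X X ep" "ep*ep = 0"
 shows "cb X X (uno X+ep):qis R" "FA g (kb X X (uno X+ep)) = Ident P (FO g X)"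
proof -
 interpret P: picard_category P by fact
 note X = chainD(1)[OF e(1)]
 note u = unl[OF chainD(3)[OF e(1)]] unr[OF chainD(3)[OF e(1)]] unl[OF cpxD(6)[OF X]]
 have c: "chain X X (uno X+ep)" "chain X X (uno X - ep)" "chain X X (uno X)"
  using chain_add[OF chain_uno[OF X] e(1)] chain_add[OF chain_uno[OF X] chain_neg[OF e(1)]] chain_uno[OF X] by simp_all
 have "(uno X - ep)*(uno X+ep) = uno X" "(uno X+ep)*(uno X - ep) = uno X" by (simp_all add: alg u e(2))
 then have i: "kb X X (uno X+ep):iso_arrows K" using kb_iso_iff[OF c(1)] c heq_refl by metis
 then show "cb X X (uno X+ep):qis R" using qis_iff_iso[OF c(1)] by blast
 obtain Q I J A L where co: "cone X X ep Q I J A L" using cone_ex[OF e(1)] by blast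
 note d = coneD[OF co] and g1 = cpxD(1)[OF X]
 note eh = eta_H[OF g1] eta_inv[OF g1]
 note v = unl[OF d(7)] unr[OF d(7)] unl[OF chainD(3)[OF d(18)]] unr[OF chainD(3)[OF d(18)]] unr[OF eh(1)] unl[OF cpxD(3)[OF X]]
 let ?w = "- (eta X*A)"
 obtain B a b s t be where se: "ses X B Q a b s t"
  and ti: "triangle_iso K (kb X X ep, kb X Q J, kb Q (sh X) ?w) (ses_triangle E (cb X B a, cb B Q b)) (kb X X (uno X)) (kb X B be) (kb Q Q (uno Q))"
  using cone_triangle_ses[OF co] by blast
 have De: "(kb X X ep, kb X Q J, kb Q (sh X) ?w):Tri K"
  using ses_triangle_Tri[OF se] triangle_iso_trans[OF ti] unfolding Tri_iff by blast
 have "chain Q (sh X) (eta X*A)"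
  unfolding chain_def using H_mult[OF d(7) eh(1)] d(4) sh_cpx[OF X] by (simp add: dd_sh[OF X] ma msub[OF eh(3)] d(14) v)
 then have w: "chain Q (sh X) ?w" by (rule chain_neg)
 have w': "heq Q (sh X) (eta X*(uno X+ep)*ate X*?w) (?w*uno Q)"
 proof (rule heqI[of "- (eta X*L)"])
  show "- (eta X*L):H Q (sh X) (-1)" using H_neg[OF H_mult[OF d(8) eh(1) refl]] by simp
  show "eta X*(uno X+ep)*ate X*?w = ?w*uno Q+(dd (sh X)*- (eta X*L)+- (eta X*L)*dd Q)"
   by (simp add: alg dd_sh[OF X] msub[OF eh(3)] v u unl[OF d(8)] d(15) unr[OF chainD(3)[OF e(1)], THEN msub])
 qed
 have "triangle_iso K (kb X X ep, kb X Q J, kb Q (sh X) ?w) (kb X X ep, kb X Q J, kb Q (sh X) ?w)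
   (kb X X (uno X+ep)) (kb X X (uno X)) (kb Q Q (uno Q))"
 proof (rule tri_isoI)
  show "heq X X (uno X*ep) (ep*(uno X+ep))" using heq_refl[OF e(1)] by (simp add: alg u e(2))
  show "heq X Q (uno Q*J) (J*uno X)" using heq_refl[OF d(18)] by (simp add: v)
 qed (use e(1) d(4,18) w w' c chain_uno kb_uno_iso X i in simp_all)
 from det_triD(3)[OF g De De this]
 have n: "(FA g (kb X X (uno X+ep)) *a[P] FA g (kb Q Q (uno Q))) o[P] DS g (kb X X ep, kb X Q J, kb Q (sh X) ?w) =
  DS g (kb X X ep, kb X Q J, kb Q (sh X) ?w) o[P] FA g (kb X X (uno X))" .
 note G = functorD(3-7)[OF det_triD(1)[OF g], simplified]
 have id: "FA g (kb X X (uno X)) = Ident P (FO g X)" "FA g (kb Q Q (uno Q)) = Ident P (FO g Q)"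
  using G(5)[OF X] G(5)[OF d(4)] kb_ident X d(4) by simp_all
 have o: "FO g X:Obj P" "FO g Q:Obj P" using G(1) X d(4) by auto
 have D: "DS g (kb X X ep, kb X Q J, kb Q (sh X) ?w):Arr P" "Dom P (DS g (kb X X ep, kb X Q J, kb Q (sh X) ?w)) = FO g X"
  "Cod P (DS g (kb X X ep, kb X Q J, kb Q (sh X) ?w)) = FO g X *o[P] FO g Q"
  using det_triD(2)[OF g De] by (auto simp: Hom_def)
 note a = G(2-4)[OF i, simplified]
 have "(FA g (kb X X (uno X+ep)) *a[P] Ident P (FO g Q)) o[P] DS g (kb X X ep, kb X Q J, kb Q (sh X) ?w) =
  (Ident P (FO g X) *a[P] Ident P (FO g Q)) o[P] DS g (kb X X ep, kb X Q J, kb Q (sh X) ?w)"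
  using n D o unfolding id by (simp add: P.Ten_Ident)
 then have "FA g (kb X X (uno X+ep)) *a[P] Ident P (FO g Q) = Ident P (FO g X) *a[P] Ident P (FO g Q)"
  by (rule P.cancel_right) (use a D o in simp_all)
 then show "FA g (kb X X (uno X+ep)) = Ident P (FO g X)"
  by (rule P.ten_right_faithful) (use a o in simp_all)
qed

text \<open>By naturality of the isomorphism between \<open>M f\<close> and the functor induced by
 \<open>g\<close>, an automorphism sent to an identity by \<open>g\<close> gives an element of the
 kernel on \<open>\<pi>\<^sub>1\<close>.\<close>

lemma comparison_not_injective:
 fixes V W :: "('u, 'u) picard"
 assumes f: "universal_det_exact C (qis R) V f" and g: "universal_det_tri K W g" and M: "comparison R V f W g M"
  and e: "chain X X ep" "ep*ep = 0" and ne: "FA f (cb X X (uno X+ep)) ~= Ident V (FO f X)"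
 shows "~ inj_on (pi1_map V W M) (carrier (pi1 V))"
proof -
 interpret V: picard_category V by (rule universal_exactD(1)[OF f])
 interpret W: picard_category W by (rule universal_triD(1)[OF g])
 note VW = V.picard_category_axioms W.picard_category_axioms
 obtain al where al: "(postcomp_exact C W M f, al, induced_det E g):Arr (det_exact_cat C (qis R) W)"
  using comparison_arrow(2)[OF M] by blast
 note m = comparison_arrow(1)[OF M]
 have nat: "is_nat (wide_subcat C (qis R)) W (postcomp_exact C W M f) (induced_det E g) al"
  using al by (auto simp: det_exact_cat_def nat_cat_def)
 let ?s = "cb X X (uno X+ep)"
 note X = chainD(1)[OF e(1)]
 note q = det_tri_unipotent[OF W.picard_category_axioms universal_triD(2)[OF g] e]
 note F = functorD(3-6)[OF det_exactD(1)[OF universal_exactD(2)[OF f]], simplified]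
 note Mf = functorD(3-7)[OF monD(1)[OF m]]
 have v: "FA f ?s:Hom V (FO f X) (FO f X)" "FO f X:Obj V" using F(2-4)[OF q(1)] F(1) X by (auto simp: Hom_def)
 note n = natD(1-3)[OF nat, of X, simplified, OF X, unfolded postcomp_exact_def induced_det_def, simplified]
 have "al X o[W] FA M (FA f ?s) = Ident W (FO g X) o[W] al X"
  using natD(4)[OF nat, of ?s] q by (simp add: postcomp_exact_def induced_det_def to_Kb_cb)
 also have "... = al X o[W] Ident W (FO M (FO f X))" using n by simp
 finally have id: "FA M (FA f ?s) = Ident W (FO M (FO f X))"
  by (rule W.cancel_left) (use n v Mf in \<open>auto simp: Hom_def\<close>)
 obtain c where c: "c:carrier (pi1 V)" "c (FO f X) = FA f ?s" using V.pi1_extend[OF v(2,1)] by blast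
 have "pi1_map V W M c = one (pi1 W)"
  by (rule pi1_map_eqI[OF VW m c(1) W.pi1_one v(2)]) (use id v Mf(1) c(2) in \<open>simp add: pi1_def\<close>)
 moreover have "pi1_map V W M (one (pi1 V)) = one (pi1 W)"
  by (rule pi1_map_eqI[OF VW m V.pi1_one W.pi1_one v(2)]) (use v Mf(1,5) in \<open>simp add: pi1_def\<close>)
 moreover have "c ~= one (pi1 V)" using c(2) ne v(2) by (auto simp: pi1_def)
 ultimately show ?thesis using inj_onD[OF _ _ c(1) V.pi1_one, of "pi1_map V W M"] by metis
qed

end

context derivation
begin

text \<open>A universal functor detects every automorphism detected by some determinant functor, here by
 \<open>dlog\<close>, since the latter factors through it.\<close>

lemma universal_detects:
 fixes V :: "('u, 'u) picard" and en :: "('r, 'm) gop => 'u"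
 assumes f: "universal_det_exact C (qis R) V f" and en: "inj_on en (rh ` carrier R)"
  and F: "chain X X F" "cb X X F:qis R" "T X X F ~= 0"
 shows "FA f (cb X X F) ~= Ident V (FO f X)"
proof
 assume id: "FA f (cb X X F) = Ident V (FO f X)"
 let ?B = "group_picard vals en"
 note B = BG_picard[OF en]
 have "dlog en:Obj (det_exact_cat C (qis R) ?B)" using dlog_det[OF en] by (simp add: det_exact_cat_def nat_cat_def)
 from equivalence_eso[OF universal_exactD(3)[OF f B] this] obtain N et where N: "monoidal_functor V ?B N"
  and n: "is_nat (wide_subcat C (qis R)) ?B (postcomp_exact C ?B N f) (dlog en) et"
  by (auto simp: isomorphic_def Hom_ten_def nat_cat_def Hom_def det_exact_cat_def)
 note X = chainD(1)[OF F(1)]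
 have o: "FO f X:Obj V" using functorD(3)[OF det_exactD(1)[OF universal_exactD(2)[OF f]], of X] X by simp
 have "et X:en ` rh ` carrier R" using natD(1)[OF n, of X] X BG[OF en] by (simp add: vals_def)
 then obtain x where x: "et X = en x" "x:rh ` carrier R" by blast
 have "et X o[?B] FA N (FA f (cb X X F)) = FA (dlog en) (cb X X F) o[?B] et X"
  using natD(4)[OF n, of "cb X X F"] F(2) by (simp add: postcomp_exact_def)
 then have "en (x+0) = en (T X X F+x)"
  unfolding id functorD(7)[OF monD(1)[OF N] o] dlog_FA[OF en F(1)] x(1) BG(5)[OF en]
  using en_comp(1)[OF en x(2) rh_closed(2)] en_comp(1)[OF en T_closed[OF F(1,2)] x(2)] by simp
 then have "x+0 = T X X F+x"
  by (rule inj_onD[OF en]) (use x(2) rh_closed(1)[OF T_closed[OF F(1,2)] x(2)] in simp_all)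
 then show False using F(3) by simp
qed

definition pt :: "('r, 'm) mcpx" where
 "pt = \<lparr>cob = (%n. if n = 0 then rg else zmod), cdif = (%n. ZeroA E (if n = 0 then rg else zmod) (if n+1 = 0 then rg else zmod))\<rparr>"

text \<open>Multiplication by \<open>r\<close> on \<open>R\<close>, placed in degree zero.\<close>

definition em :: "'r => ('r, 'm) gop" where
 "em r = gm pt pt 0 (%n. if n = 0 then mul r else ZeroA E zmod zmod)"

lemma pt_cob [simp]: "cob pt n = (if n = 0 then rg else zmod)" by (simp add: pt_def)

lemma pt_gob: "gob pt" by (simp add: gob_def rg_fgp zmod_fgp)

lemma pt_dd: "cdif pt = (%n. ZeroA E (cob pt n) (cob pt (n+1)))" by (simp add: pt_def)

lemma pt_cpx: "cpx pt"
proof -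
 have 0: "gm pt pt 1 (cdif pt) = 0" unfolding pt_dd using gm_zero[OF pt_gob pt_gob, of 1] .
 have z: "zero_object E zmod" unfolding zero_object_E using zmod_fgp by (simp add: zmod_def)
 have "{n. ~ zero_object E (cob pt n)} <= {0}" using z by auto
 then have "finite {n. ~ zero_object E (cob pt n)}" by (rule finite_subset) simp
 moreover have "fam pt pt 1 (cdif pt)" unfolding pt_dd using fam_zero[OF pt_gob pt_gob, of 1] .
 ultimately show ?thesis unfolding cpx_iff dd_def using 0 by simp
qed

lemma zmod_hom_eq: "f:Hom E zmod zmod ==> g:Hom E zmod zmod ==> f = g"
 by (rule Hom_E_eqI) (use fun_of_closed[of f zmod zmod] fun_of_closed[of g zmod zmod] in \<open>auto simp: zmod_def\<close>)

lemma em_fam: "r:carrier R ==> fam pt pt 0 (%n. if n = 0 then mul r else ZeroA E zmod zmod)"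
 using mul_hom Zero_E(1)[OF zmod_fgp zmod_fgp] by (simp add: fam_def)

lemma em_chain: "r:carrier R ==> chain pt pt (em r)"
proof -
 have 0: "dd pt = 0" unfolding dd_def pt_dd using gm_zero[OF pt_gob pt_gob, of 1] .
 show "r:carrier R ==> chain pt pt (em r)"
  unfolding chain_def em_def using pt_cpx gm_H[OF em_fam] by (simp add: 0)
qed

lemma em_add: "[|x:carrier R; y:carrier R|] ==> em (x +[R] y) = em x+em y"
proof -
 assume x: "x:carrier R" and y: "y:carrier R"
 note z = Zero_E(1)[OF zmod_fgp zmod_fgp]
 have "mul (x +[R] y) = AddA E (mul x) (mul y)"
  by (rule Hom_E_eqI[OF mul_hom Add_E(1)[OF mul_hom mul_hom]]) (use x y in \<open>auto simp: Add_E(2)[OF mul_hom mul_hom] R.l_distr\<close>)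
 then have "(%n :: int. if n = 0 then mul (x +[R] y) else ZeroA E zmod zmod) =
   (%n. AddA E (if n = 0 then mul x else ZeroA E zmod zmod) (if n = 0 then mul y else ZeroA E zmod zmod))"
  using zmod_hom_eq[OF z Add_E(1)[OF z z]] by auto
 then show ?thesis using gm_add[OF em_fam[OF x] em_fam[OF y]] by (simp add: em_def)
qed

lemma em_mult: "[|x:carrier R; y:carrier R|] ==> em (x *[R] y) = em x*em y"
proof -
 assume x: "x:carrier R" and y: "y:carrier R"
 note z = Zero_E(1)[OF zmod_fgp zmod_fgp]
 have "mul (x *[R] y) = mul x o[E] mul y"
  by (rule Hom_E_eqI[OF mul_hom Comp_E(1)[OF mul_hom mul_hom]]) (use x y in \<open>auto simp: Comp_E(2)[OF mul_hom mul_hom] R.m_assoc\<close>)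
 then have "(%n :: int. if n = 0 then mul (x *[R] y) else ZeroA E zmod zmod) =
   (%n. (if n+0 = 0 then mul x else ZeroA E zmod zmod) o[E] (if n = 0 then mul y else ZeroA E zmod zmod))"
  using zmod_hom_eq[OF z Comp_E(1)[OF z z]] by auto
 then show ?thesis using gm_comp[OF em_fam[OF y] em_fam[OF x]] by (simp add: em_def)
qed

lemma em_one: "em 1[R] = uno pt"
proof -
 have "mul 1[R] = Ident E rg"
  by (rule Hom_E_eqI[OF mul_hom Ident_E(1)[OF rg_fgp]]) (auto simp: Ident_E(2))
 then have "(%n :: int. if n = 0 then mul 1[R] else ZeroA E zmod zmod) = (%n. Ident E (cob pt n))"
  using zmod_hom_eq[OF Zero_E(1)[OF zmod_fgp zmod_fgp] Ident_E(1)[OF zmod_fgp]] by auto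
 then show ?thesis by (simp only: em_def uno_def)
qed

text \<open>The map \<open>1 + e\<close> is invertible with inverse \<open>1 - e\<close>, so no
 homotopies are needed and \<open>T\<close> reduces to \<open>(1 - e) D e = e - e D e\<close>.\<close>

lemma T_unit:
 assumes e: "e:carrier R" "e *[R] e = 0[R]" "D e = e" "e ~= 0[R]"
 shows "chain pt pt (em e)" "em e*em e = 0" "T pt pt (uno pt+em e) ~= 0"
proof -
 show "chain pt pt (em e)" by (rule em_chain[OF e(1)])
 have 0: "em 0[R] = 0" using em_add[of "0[R]" "0[R]"] by simp
 show "em e*em e = 0" using em_mult[OF e(1) e(1)] 0 by (simp add: e(2))
 let ?a = "1[R] +[R] e" and ?b = "1[R] +[R] (-[R] e)"
 have ab: "?a:carrier R" "?b:carrier R" using e by simp_all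
 have "?b *[R] ?a = 1[R]" "?a *[R] ?b = 1[R]"
  using e by (simp_all add: R.l_distr R.r_distr R.l_minus R.r_minus R.a_assoc R.r_neg R.l_neg)
 then have inv: "em ?b*em ?a = uno pt" "em ?a*em ?b = uno pt" using em_mult[OF ab(2,1)] em_mult[OF ab] em_one by simp_all
 have z: "0:H pt pt k" for k using H_zero[OF pt_gob pt_gob] .
 have hi: "hinv pt pt (em ?a) (em ?b) 0 0 0" unfolding hinv_def using em_chain ab inv z by simp
 have zo: "zero_object E zmod" unfolding zero_object_E using zmod_fgp by (simp add: zmod_def)
 have "T pt pt (em ?a) = Lam pt pt 0 (em ?b) (em ?a)"
  unfolding T_eq[OF hi] tor_def using Lam_zero(1)[of "dd pt" pt pt 1] cpxD(3)[OF pt_cpx] by simp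
 also have "... = (\<Sum>n\<in>{0}. alt n (lam (fm pt pt (-0) (em ?b) (n+0)) (fm pt pt 0 (em ?a) n)))"
  by (rule Lam_eq) (use chainD(3)[OF em_chain[OF ab(1)]] zo in auto)
 also have "... = lam (mul ?b) (mul ?a)"
  using fm_gm[OF em_fam[OF ab(1)]] fm_gm[OF em_fam[OF ab(2)]] by (simp add: em_def alt_simps(4))
 also have "... = rh (?b *[R] D ?a)" by (rule lam_mul[OF ab(2,1)])
 also have "D ?a = e"
 proof -
  have "D 1[R] +[R] D 1[R] = D 1[R]" using D_mult[of "1[R]" "1[R]"] by simp
  then have "D 1[R] = 0[R]" using R.add.l_cancel_one[of "D 1[R]" "D 1[R]"] by simp
  then show ?thesis using D_add[OF R.one_closed e(1)] e by simp
 qed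
 also have "?b *[R] e = e" using e by (simp add: R.l_distr R.l_minus)
 finally have "T pt pt (uno pt+em e) = rh e" using em_add[OF R.one_closed e(1)] em_one by simp
 moreover have "rh e ~= 0" using inj_onD[OF rh_inj, of e "0[R]"] e by auto
 ultimately show "T pt pt (uno pt+em e) ~= 0" by simp
qed

end

theorem lemma4p1:
  fixes R :: "'r ring"
  assumes "ring R"
    and "\<exists>\<iota> :: 'r list \<Rightarrow> 'm. inj_on \<iota> (lists (carrier R))"
    and "\<exists>\<iota> :: 'r list \<Rightarrow> 'u. inj_on \<iota> (lists (carrier R))"
  defines "E \<equiv> (Rproj R :: (('r, 'm) module, ('r, 'm) mmap) exact_cat)"
  shows "(\<forall>P :: ('p, 'b) picard. picard_category P \<longrightarrow>
            is_functor (det_tri_cat (Kb E) P) (det_exact_cat (Cb E) (qis R) P) (induced_func E)) \<and>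
         (\<forall>(V :: ('u, 'u) picard) f (W :: ('u, 'u) picard) g.
            universal_det_exact (Cb E) (qis R) V f \<and> universal_det_tri (Kb E) W g \<longrightarrow>
            (\<exists>h. h \<in> hom (pi1 V) (pi1 W) \<and>
                 (\<exists>M. comparison R V f W g M) \<and>
                 (\<forall>M. comparison R V f W g M \<longrightarrow> pi1_map V W M = h) \<and>
                 h ` carrier (pi1 V) = carrier (pi1 W) \<and>
                 (\<forall>k :: 'k ring. field k \<and> R \<simeq> dual_numbers k \<longrightarrow> \<not> inj_on h (carrier (pi1 V)))))"
proof -
 obtain wit :: "'r list => 'm" where wit: "inj_on wit (lists (carrier R))" using assms(2) by blast
 obtain enc :: "'r list => 'u" where enc: "inj_on enc (lists (carrier R))" using assms(3) by blast
 interpret proj_modules R wit by (rule proj_modules.intro[OF assms(1) wit])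
 let ?E = "Rproj R :: (('r, 'm) module, ('r, 'm) mmap) exact_cat"
 show ?thesis
  unfolding E_def
 proof (intro conjI allI impI)
  fix P :: "('p, 'b) picard" assume "picard_category P"
  then show "is_functor (det_tri_cat (Kb ?E) P) (det_exact_cat (Cb ?E) (qis R) P) (induced_func ?E)"
   by (rule induced_functor)
 next
  fix V W :: "('u, 'u) picard" and f g
  assume "universal_det_exact (Cb ?E) (qis R) V f & universal_det_tri (Kb ?E) W g"
  then have f: "universal_det_exact (Cb ?E) (qis R) V f" and g: "universal_det_tri (Kb ?E) W g" by auto
  obtain M where M: "comparison R V f W g M" using comparison_ex[OF f g] by blast
  note VW = universal_exactD(1)[OF f] universal_triD(1)[OF g]
  show "EX h. h:hom (pi1 V) (pi1 W) & (EX M. comparison R V f W g M) & (ALL M. comparison R V f W g M --> pi1_map V W M = h) &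
    h ` carrier (pi1 V) = carrier (pi1 W) & (ALL k :: 'k ring. field k & R \<simeq> dual_numbers k --> ~ inj_on h (carrier (pi1 V)))"
  proof (intro exI[of _ "pi1_map V W M"] conjI allI impI)
   show "pi1_map V W M:hom (pi1 V) (pi1 W)" by (rule pi1_map_hom[OF VW comparison_arrow(1)[OF M]])
   show "EX M. comparison R V f W g M" using M by blast
   show "pi1_map V W N = pi1_map V W M" if "comparison R V f W g N" for N by (rule comparison_unique[OF f g that M])
   show "pi1_map V W M ` carrier (pi1 V) = carrier (pi1 W)" by (rule comparison_surjective[OF f g M])
   fix k :: "'k ring" assume "field k & R \<simeq> dual_numbers k"
   then obtain D e where D: "ALL x:carrier R. ALL y:carrier R. x *[R] y = y *[R] x" "ALL x:carrier R. D x:carrier R"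
     "ALL x:carrier R. ALL y:carrier R. D (x +[R] y) = D x +[R] D y"
     "ALL x:carrier R. ALL y:carrier R. D (x *[R] y) = D x *[R] y +[R] x *[R] D y"
    and e: "e:carrier R" "e *[R] e = 0[R]" "D e = e" "e ~= 0[R]"
    using dual_numbers_derivation[OF assms(1), of k] by blast
   interpret derivation R wit D
    by (rule derivation.intro[OF proj_modules_axioms derivation_axioms.intro]) (use D in blast)+
   define en where "en = (%x. enc [inv_into (carrier R) rh x])"
   have "inj_on en (rh ` carrier R)"
   proof (rule inj_onI)
    fix x y assume x: "x:rh ` carrier R" and y: "y:rh ` carrier R" and eq: "en x = en y"
    have "inv_into (carrier R) rh x = inv_into (carrier R) rh y"
     using inj_onD[OF enc eq[unfolded en_def]] inv_into_into[OF x] inv_into_into[OF y] by simp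
    then show "x = y" using x y by (rule inv_into_injective)
   qed
   note t = T_unit[OF e]
   have "cb pt pt (uno pt+em e):qis R" by (rule det_tri_unipotent(1)[OF VW(2) universal_triD(2)[OF g] t(1,2)])
   then show "~ inj_on (pi1_map V W M) (carrier (pi1 V))"
    using comparison_not_injective[OF f g M t(1,2)] universal_detects[OF f \<open>inj_on en (rh ` carrier R)\<close> chain_add[OF chain_uno[OF pt_cpx] t(1)]] t(3)
    by blast
  qed
 qed
qed

end
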